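(* Let $\mathbb{K}$ be an algebraically closed field of characteristic $0$, let $n\ge 2$ and $1\le k\le n$. For a general cubic form $[f]$ with $V(f)\subset\mathbb{P}^n$ smooth, if $\mathcal{D}_k(f)\setminus\mathcal{D}_{k-1}(f)$ is non-empty, then $$\operatorname{Sing}(\mathcal{D}_k(f))=\mathcal{D}_{k-1}(f).$$
   Context: Let $S=\mathbb{K}[x_0,\dots,x_n]$ with degree-$3$ part $S^3$. For $f\in S^3$, $H_f=\left(\frac{\partial^2 f}{\partial x_i\partial x_j}\right)_{0\le i,j\le n}$ is the Hessian matrix and, for an integer $k$, $\mathcal{D}_k(f)=\{[x]\in\mathbb{P}^n\mid\operatorname{Rank}(H_f(x))\le k\}$, with its natural structure of closed subscheme of $\mathbb{P}^n$ defined by the $(k+1)\times(k+1)$ minors of $H_f$. "General" means: for all $[f]$ in some nonempty Zariski-open subset of the open set $U\subset\mathbb{P}(S^3)$ parametrizing smooth cubic hypersurfaces. *)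

theory Defs
  imports
    "HOL-Library.Poly_Mapping"
    "HOL-Library.Extended_Nat"
    "HOL-Computational_Algebra.Polynomial"
    "HOL-Computational_Algebra.Fraction_Field"
    "HOL-Algebra.Ring_Divisibility"
    "HOL-Algebra.QuotRing"
    "Jordan_Normal_Form.Determinant"
    "Jordan_Normal_Form.DL_Rank"
    "Jordan_Normal_Form.DL_Submatrix"
begin

section \<open>Polynomials in the variables indexed by a set\<close>

type_synonym ('v, 'a) mpol = "('v \<Rightarrow>\<^sub>0 nat) \<Rightarrow>\<^sub>0 'a"

definition polys :: "'v set \<Rightarrow> ('v, 'a::zero) mpol set" where
  "polys V = {p. \<forall>m \<in> Poly_Mapping.keys p. Poly_Mapping.keys m \<subseteq> V}"

definition mon_deg :: "('v \<Rightarrow>\<^sub>0 nat) \<Rightarrow> nat" where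
  "mon_deg m = (\<Sum>i\<in>Poly_Mapping.keys m. Poly_Mapping.lookup m i)"

definition homogeneous :: "nat \<Rightarrow> ('v, 'a::zero) mpol \<Rightarrow> bool" where
  "homogeneous d p \<longleftrightarrow> (\<forall>m \<in> Poly_Mapping.keys p. mon_deg m = d)"

definition peval :: "('v \<Rightarrow> 'a::comm_semiring_1) \<Rightarrow> ('v, 'a) mpol \<Rightarrow> 'a" where
  "peval x p =
     (\<Sum>m\<in>Poly_Mapping.keys p.
        Poly_Mapping.lookup p m * (\<Prod>i\<in>Poly_Mapping.keys m. x i ^ Poly_Mapping.lookup m i))"

text \<open>Subtraction of exponent vectors is truncated, but a monomial not containing the
  variable \<open>i\<close> contributes with coefficient \<open>0\<close>.\<close>

definition partial_deriv :: "'v \<Rightarrow> ('v, 'a::comm_semiring_1) mpol \<Rightarrow> ('v, 'a) mpol" where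
  "partial_deriv i p =
     (\<Sum>m\<in>Poly_Mapping.keys p.
        Poly_Mapping.single (m - Poly_Mapping.single i 1)
          (of_nat (Poly_Mapping.lookup m i) * Poly_Mapping.lookup p m))"

section \<open>Projective space and its Zariski topology\<close>

text \<open>The projective space with homogeneous coordinates indexed by \<open>V\<close>: its points are the
  sets of nonzero multiples of nonzero vectors supported in \<open>V\<close>.
  Thus \<open>proj_space {..n}\<close> is the projective \<open>n\<close>-space.\<close>

definition pt :: "('v \<Rightarrow> 'a::field) \<Rightarrow> ('v \<Rightarrow> 'a) set" where
  "pt x = {(\<lambda>i. c * x i) | c. c \<noteq> 0}"

definition nonzero_vecs :: "'v set \<Rightarrow> ('v \<Rightarrow> 'a::field) set" where
  "nonzero_vecs V = {x. x \<noteq> (\<lambda>_. 0) \<and> (\<forall>i. i \<notin> V \<longrightarrow> x i = 0)}"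

definition proj_space :: "'v set \<Rightarrow> ('v \<Rightarrow> 'a::field) set set" where
  "proj_space V = pt ` nonzero_vecs V"

definition proj_zeros :: "'v set \<Rightarrow> ('v, 'a::field) mpol set \<Rightarrow> ('v \<Rightarrow> 'a) set set" where
  "proj_zeros V E = {pt x | x. x \<in> nonzero_vecs V \<and> (\<forall>p\<in>E. peval x p = 0)}"

definition zariski_closed :: "'v set \<Rightarrow> ('v \<Rightarrow> 'a::field) set set \<Rightarrow> bool" where
  "zariski_closed V Z \<longleftrightarrow>
     (\<exists>E \<subseteq> polys V. (\<forall>p\<in>E. \<exists>d. homogeneous d p) \<and> Z = proj_zeros V E)"

definition zariski_open :: "'v set \<Rightarrow> ('v \<Rightarrow> 'a::field) set set \<Rightarrow> bool" where
  "zariski_open V W \<longleftrightarrow> W \<subseteq> proj_space V \<and> zariski_closed V (proj_space V - W)"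

section \<open>Regular local rings\<close>

definition subring_of :: "'b::comm_ring_1 set \<Rightarrow> 'b ring" where
  "subring_of A = \<lparr>carrier = A, monoid.mult = (*), one = 1, ring.zero = 0, add = (+)\<rparr>"

definition krull_dim :: "('b, 'm) ring_scheme \<Rightarrow> enat" where
  "krull_dim R = Sup {enat l | l. \<exists>P. (\<forall>i\<le>l. primeideal (P i) R) \<and> (\<forall>i<l. P i \<subset> P (Suc i))}"

text \<open>A Noetherian local ring is regular if its maximal ideal can be generated by
  as many elements as its Krull dimension.\<close>

definition regular_local_ring :: "('b, 'm) ring_scheme \<Rightarrow> bool" where
  "regular_local_ring R \<longleftrightarrow>
     cring R \<and> noetherian_ring R \<and> (\<exists>!M. maximalideal M R) \<and>
     (\<exists>M A. maximalideal M R \<and> A \<subseteq> carrier R \<and> finite A \<and> M = Idl\<^bsub>R\<^esub> A \<and> enat (card A) = krull_dim R)"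

section \<open>Closed subschemes of projective space\<close>

text \<open>The closed subscheme of projective \<open>n\<close>-space defined by a homogeneous ideal \<open>J\<close> of
  \<open>polys {..n}\<close> is represented by \<open>J\<close> itself.  As the ground field will be algebraically
  closed, only closed points are considered; they are the elements of \<open>proj_zeros {..n} J\<close>.\<close>

definition hom_ideal :: "nat \<Rightarrow> (nat, 'a::field) mpol set \<Rightarrow> (nat, 'a) mpol set" where
  "hom_ideal n G = Idl\<^bsub>subring_of (polys {..n})\<^esub> G"

text \<open>The local ring of projective space at \<open>pt x\<close>, inside the field of fractions of the
  polynomial ring.\<close>

definition proj_stalk :: "nat \<Rightarrow> (nat \<Rightarrow> 'a::field) \<Rightarrow> (nat, 'a) mpol fract ring" where
  "proj_stalk n x = subring_of
     {Fract g h | g h d. g \<in> polys {..n} \<and> h \<in> polys {..n} \<and>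
        homogeneous d g \<and> homogeneous d h \<and> peval x h \<noteq> 0}"

text \<open>The stalk at \<open>pt x\<close> of the ideal sheaf associated with \<open>J\<close>.\<close>

definition ideal_stalk ::
  "nat \<Rightarrow> (nat, 'a::field) mpol set \<Rightarrow> (nat \<Rightarrow> 'a) \<Rightarrow> (nat, 'a) mpol fract set" where
  "ideal_stalk n J x = Idl\<^bsub>proj_stalk n x\<^esub>
     {Fract g h | g h d. g \<in> J \<and> h \<in> polys {..n} \<and>
        homogeneous d g \<and> homogeneous d h \<and> peval x h \<noteq> 0}"

definition scheme_stalk ::
  "nat \<Rightarrow> (nat, 'a::field) mpol set \<Rightarrow> (nat \<Rightarrow> 'a) \<Rightarrow> (nat, 'a) mpol fract set ring" where
  "scheme_stalk n J x = proj_stalk n x Quot ideal_stalk n J x"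

definition sing_locus :: "nat \<Rightarrow> (nat, 'a::field) mpol set \<Rightarrow> (nat \<Rightarrow> 'a) set set" where
  "sing_locus n J =
     {pt x | x. x \<in> nonzero_vecs {..n} \<and> pt x \<in> proj_zeros {..n} J \<and>
        \<not> regular_local_ring (scheme_stalk n J x)}"

section \<open>Cubic forms and Hessian loci\<close>

definition cubic_monomials :: "nat \<Rightarrow> (nat \<Rightarrow>\<^sub>0 nat) set" where
  "cubic_monomials n = {m. Poly_Mapping.keys m \<subseteq> {..n} \<and> mon_deg m = 3}"

definition cubic_forms :: "nat \<Rightarrow> (nat, 'a::field) mpol set" where
  "cubic_forms n = {f. f \<in> polys {..n} \<and> homogeneous 3 f}"

text \<open>The point of the projective space of cubic forms given by \<open>f\<close>;
  the homogeneous coordinates are the coefficients of \<open>f\<close>, indexed by \<open>cubic_monomials n\<close>.\<close>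

definition form_pt :: "(nat, 'a::field) mpol \<Rightarrow> ((nat \<Rightarrow>\<^sub>0 nat) \<Rightarrow> 'a) set" where
  "form_pt f = pt (Poly_Mapping.lookup f)"

definition smooth_cubics :: "nat \<Rightarrow> ((nat \<Rightarrow>\<^sub>0 nat) \<Rightarrow> 'a::field) set set" where
  "smooth_cubics n =
     {form_pt f | f. f \<in> cubic_forms n \<and> f \<noteq> 0 \<and> sing_locus n (hom_ideal n {f}) = {}}"

definition hessian :: "nat \<Rightarrow> (nat, 'a::field) mpol \<Rightarrow> (nat, 'a) mpol mat" where
  "hessian n f = mat (n + 1) (n + 1) (\<lambda>(i, j). partial_deriv i (partial_deriv j f))"

definition hessian_locus :: "nat \<Rightarrow> nat \<Rightarrow> (nat, 'a::field) mpol \<Rightarrow> (nat \<Rightarrow> 'a) set set" where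
  "hessian_locus n k f =
     {pt x | x. x \<in> nonzero_vecs {..n} \<and>
        vec_space.rank (n + 1) (map_mat (peval x) (hessian n f)) \<le> k}"

text \<open>The ideal defining the scheme structure of \<open>hessian_locus n k f\<close>.\<close>

definition hessian_minors_ideal :: "nat \<Rightarrow> nat \<Rightarrow> (nat, 'a::field) mpol \<Rightarrow> (nat, 'a) mpol set" where
  "hessian_minors_ideal n k f = hom_ideal n
     {Determinant.det (submatrix (hessian n f) I J) | I J.
        I \<subseteq> {..n} \<and> J \<subseteq> {..n} \<and> card I = k + 1 \<and> card J = k + 1}"

end

theory Submission
  imports Defs
begin

text \<open>Let \<open>F\<close> be the symmetric trilinear form of \<open>f\<close>, so that the Hessian matrix at \<open>x\<close> is \<open>F(x, -, -)\<close>.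
  Call \<open>f\<close> good if, for all nonzero \<open>x\<close> and all vectors \<open>y\<^sub>a\<close>, \<open>z\<^sub>a\<close> in the kernel of the Hessian matrix
  at \<open>x\<close>, the equation \<open>\<Sum>\<^sub>a F(-, y\<^sub>a, z\<^sub>a) = 0\<close> implies that the symmetric tensor \<open>\<Sum>\<^sub>a y\<^sub>a z\<^sub>a\<close> vanishes.
  The general cubic is good: otherwise there would be a generic bad solution \<open>(f, x, y, z)\<close>, along which every
  tangent vector of the space of cubics lifts to a derivation; differentiating
  \<open>\<Sum>\<^sub>a F(x, y\<^sub>a, z\<^sub>a) = 0\<close> in the direction of a cubic \<open>g\<close> kills all terms but the value of the trilinear
  form of \<open>g\<close> at \<open>\<Sum>\<^sub>a x y\<^sub>a z\<^sub>a\<close>, which therefore vanishes for all \<open>g\<close>.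

  Suppose that \<open>f\<close> is good.  At a point \<open>x\<close> where the Hessian matrix has rank \<open>k\<close>, the ideal of minors of
  size \<open>k + 1\<close> is generated by the entries of the Schur complement of an invertible principal block of
  size \<open>k\<close>.  The differentials of these entries at \<open>x\<close> are the forms \<open>F(-, y, z)\<close> with \<open>y\<close>, \<open>z\<close> running
  through a basis of the kernel; goodness says that they are independent, so the local ring is regular.
  At a point where the rank is less than \<open>k\<close>, all minors of size \<open>k + 1\<close> vanish to second order, whereas
  the ideal that they generate is not zero; hence the local ring is not regular.\<close>

section \<open>Ideals of subrings and derivations\<close>

text \<open>Regularity asks for the exact Krull dimension of the quotient of a stalk. Chains of the
  right length are built by differentiation. Conversely, a chain above the ideal is prolonged
  downwards by as many primes as there are independent differentials, and no chain of the stalk is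
  longer than \<open>n\<close>: elements picked from its steps would be algebraically independent,
  against a count of monomials.

  One notion of goodness has to serve all ranks at once. A kernel basis has at most
  \<open>n + 1\<close> vectors, so \<open>(n + 1) * (n + 1)\<close> summands suffice for the tensor,
  and missing ones are zero. The derivations of a stalk see only the \<open>n\<close> directions of
  an affine chart; the remaining direction, that of \<open>x\<close> itself, is supplied by the
  kernel condition. Goodness also yields smoothness: at a singular point \<open>x\<close> of the
  cubic, \<open>x\<close> lies in the kernel of its own Hessian matrix and
  \<open>F(-, x, x) = 0\<close>, although the square of \<open>x\<close> is not zero.\<close>

definition is_subring :: "'b::comm_ring_1 set \<Rightarrow> bool" where
  "is_subring A \<longleftrightarrow> 1 \<in> A \<and> (\<forall>x\<in>A. \<forall>y\<in>A. x - y \<in> A \<and> x * y \<in> A)"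

definition is_ideal :: "'b::comm_ring_1 set \<Rightarrow> 'b set \<Rightarrow> bool" where
  "is_ideal A I \<longleftrightarrow> I \<subseteq> A \<and> 0 \<in> I \<and> (\<forall>x\<in>I. \<forall>y\<in>I. x + y \<in> I) \<and> (\<forall>a\<in>A. \<forall>x\<in>I. a * x \<in> I)"

definition is_prime :: "'b::comm_ring_1 set \<Rightarrow> 'b set \<Rightarrow> bool" where
  "is_prime A P \<longleftrightarrow> is_ideal A P \<and> 1 \<notin> P \<and> (\<forall>x\<in>A. \<forall>y\<in>A. x * y \<in> P \<longrightarrow> x \<in> P \<or> y \<in> P)"

definition derivation :: "('b::comm_ring_1 \<Rightarrow> 'b) \<Rightarrow> bool" where
  "derivation D \<longleftrightarrow> (\<forall>x y. D (x + y) = D x + D y) \<and> (\<forall>x y. D (x * y) = D x * y + x * D y)"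

lemma subring_closed:
  assumes "is_subring A"
  shows "0 \<in> A" "1 \<in> A" "x \<in> A \<Longrightarrow> y \<in> A \<Longrightarrow> x + y \<in> A" "x \<in> A \<Longrightarrow> y \<in> A \<Longrightarrow> x - y \<in> A"
    "x \<in> A \<Longrightarrow> y \<in> A \<Longrightarrow> x * y \<in> A" "x \<in> A \<Longrightarrow> - x \<in> A" "x \<in> A \<Longrightarrow> x ^ k \<in> A" "of_nat k \<in> A"
    "(\<And>i. i \<in> S \<Longrightarrow> f i \<in> A) \<Longrightarrow> sum f S \<in> A" "(\<And>i. i \<in> S \<Longrightarrow> f i \<in> A) \<Longrightarrow> prod f S \<in> A"
proof -
  show 1: "1 \<in> A" and d: "x \<in> A \<Longrightarrow> y \<in> A \<Longrightarrow> x - y \<in> A" and m: "x \<in> A \<Longrightarrow> y \<in> A \<Longrightarrow> x * y \<in> A" for x y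
    using assms by (auto simp: is_subring_def)
  show 0: "0 \<in> A" using d[OF 1 1] by simp
  show u: "x \<in> A \<Longrightarrow> - x \<in> A" for x using d[OF 0, of x] by simp
  show a: "x \<in> A \<Longrightarrow> y \<in> A \<Longrightarrow> x + y \<in> A" for x y using d[of x "- y"] u[of y] by simp
  show "x \<in> A \<Longrightarrow> x ^ k \<in> A" by (induction k) (auto simp: 1 m)
  show "of_nat k \<in> A" by (induction k) (auto simp: 0 1 a)
  show "(\<And>i. i \<in> S \<Longrightarrow> f i \<in> A) \<Longrightarrow> sum f S \<in> A"
    by (induction S rule: infinite_finite_induct) (auto simp: 0 a)
  show "(\<And>i. i \<in> S \<Longrightarrow> f i \<in> A) \<Longrightarrow> prod f S \<in> A"
    by (induction S rule: infinite_finite_induct) (auto simp: 1 m)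
qed

lemma is_subring_UNIV [simp]: "is_subring UNIV"
  by (simp add: is_subring_def)

lemma ideal_closed:
  assumes "is_ideal A I"
  shows "0 \<in> I" "x \<in> I \<Longrightarrow> y \<in> I \<Longrightarrow> x + y \<in> I" "a \<in> A \<Longrightarrow> x \<in> I \<Longrightarrow> a * x \<in> I" "x \<in> I \<Longrightarrow> x \<in> A"
    "(\<And>i. i \<in> S \<Longrightarrow> f i \<in> I) \<Longrightarrow> sum f S \<in> I" "a \<in> A \<Longrightarrow> x \<in> I \<Longrightarrow> x * a \<in> I"
proof -
  show 0: "0 \<in> I" and a: "x \<in> I \<Longrightarrow> y \<in> I \<Longrightarrow> x + y \<in> I" and "a \<in> A \<Longrightarrow> x \<in> I \<Longrightarrow> a * x \<in> I"
    "x \<in> I \<Longrightarrow> x \<in> A" "a \<in> A \<Longrightarrow> x \<in> I \<Longrightarrow> x * a \<in> I" for x y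
    using assms by (auto simp: is_ideal_def mult.commute[of x])
  show "(\<And>i. i \<in> S \<Longrightarrow> f i \<in> I) \<Longrightarrow> sum f S \<in> I"
    by (induction S rule: infinite_finite_induct) (auto simp: 0 a)
qed

lemma ideal_diff:
  assumes "is_subring A" "is_ideal A I"
  shows "x \<in> I \<Longrightarrow> - x \<in> I" "x \<in> I \<Longrightarrow> y \<in> I \<Longrightarrow> x - y \<in> I"
proof -
  show u: "x \<in> I \<Longrightarrow> - x \<in> I" for x
    using ideal_closed(3)[OF assms(2), of "- 1" x] subring_closed[OF assms(1)] by simp
  show "x \<in> I \<Longrightarrow> y \<in> I \<Longrightarrow> x - y \<in> I"
    using ideal_closed(2)[OF assms(2), of x "- y"] u[of y] by simp
qed

lemma primeD:
  assumes "is_prime A P"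
  shows "is_ideal A P" "1 \<notin> P" "x \<in> A \<Longrightarrow> y \<in> A \<Longrightarrow> x * y \<in> P \<Longrightarrow> x \<in> P \<or> y \<in> P"
  using assms by (auto simp: is_prime_def)

lemma prime_power_mem:
  assumes "is_subring A" "is_prime A P" "x \<in> A" "x ^ k \<in> P"
  shows "x \<in> P"
  using assms(4)
proof (induction k)
  case 0
  then show ?case using primeD(2)[OF assms(2)] by simp
next
  case (Suc k)
  then show ?case using primeD(3)[OF assms(2) assms(3), of "x ^ k"] subring_closed(7)[OF assms(1,3)] by auto
qed

section \<open>Elementary calculus of derivations\<close>

lemma derivation_simps:
  assumes "derivation D"
  shows "D (x + y) = D x + D y" "D (x * y) = D x * y + x * D y" "D 0 = 0" "D 1 = 0"
    "D (- x) = - D x" "D (x - y) = D x - D y" "D (sum f S) = (\<Sum>i\<in>S. D (f i))"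
proof -
  show a: "D (x + y) = D x + D y" and m: "D (x * y) = D x * y + x * D y" for x y
    using assms by (auto simp: derivation_def)
  show 0: "D 0 = 0" using a[of 0 0] by simp
  show "D 1 = 0" using m[of 1 1] by simp
  show n: "D (- x) = - D x" for x using a[of x "- x"] 0 by (simp add: eq_neg_iff_add_eq_0 add.commute)
  show "D (x - y) = D x - D y" using a[of x "- y"] n[of y] by simp
  show "D (sum f S) = (\<Sum>i\<in>S. D (f i))"
    by (induction S rule: infinite_finite_induct) (auto simp: 0 a)
qed

lemma derivation_lin:
  assumes "derivation D" "derivation E"
  shows "derivation (\<lambda>x. a * D x + b * E x)"
  using assms unfolding derivation_def by (auto simp: algebra_simps)

lemma derivation_sum:
  assumes "\<And>i. i \<in> S \<Longrightarrow> derivation (D i)"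
  shows "derivation (\<lambda>x. \<Sum>i\<in>S. a i * D i x)"
  using assms unfolding derivation_def
  by (simp add: algebra_simps sum.distrib sum_distrib_left)

lemma derivation_poly:
  assumes D: "derivation D"
  shows "D (poly p x) = poly (map_poly D p) x + poly (pderiv p) x * D x"
proof (induction p)
  case 0
  then show ?case by (simp add: derivation_simps[OF D])
next
  case (pCons a p)
  have "map_poly D (pCons a p) = pCons (D a) (map_poly D p)"
    by (simp add: map_poly_pCons derivation_simps[OF D])
  then show ?case using pCons by (simp add: derivation_simps[OF D] pderiv_pCons algebra_simps)
qed

lemma derivation_funpow_closed:
  "(\<And>x. x \<in> A \<Longrightarrow> D x \<in> A) \<Longrightarrow> x \<in> A \<Longrightarrow> (D ^^ i) x \<in> A"
  by (induction i) auto

lemma derivation_funpow_add: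
  assumes "derivation D"
  shows "(D ^^ i) (x + y) = (D ^^ i) x + (D ^^ i) y" "(D ^^ i) 0 = 0"
  by (induction i) (auto simp: derivation_simps[OF assms])

lemma derivation_Leibniz:
  assumes "derivation D"
  shows "(D ^^ k) (x * y) = (\<Sum>i\<le>k. of_nat (k choose i) * (D ^^ i) x * (D ^^ (k - i)) y)"
proof (induction k)
  case 0
  then show ?case by simp
next
  case (Suc k)
  have Dn: "D (of_nat m) = 0" for m
    by (induction m) (auto simp: derivation_simps[OF assms])
  let ?t = "\<lambda>i j. (D ^^ i) x * (D ^^ j) y"
  have "(D ^^ Suc k) (x * y) = (\<Sum>i\<le>k. of_nat (k choose i) * (?t (Suc i) (k - i) + ?t i (Suc (k - i))))"
    by (simp add: Suc derivation_simps[OF assms] Dn mult.assoc)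
  also have "\<dots> = (\<Sum>i\<le>k. of_nat (k choose i) * ?t (Suc i) (k - i)) + (\<Sum>i\<le>k. of_nat (k choose i) * ?t i (Suc k - i))"
    by (simp add: sum.distrib distrib_left Suc_diff_le)
  also have "(\<Sum>i\<le>k. of_nat (k choose i) * ?t (Suc i) (k - i)) = (\<Sum>i\<le>k. of_nat (k choose i) * ?t (Suc i) (Suc k - Suc i))"
    by simp
  also have "\<dots> = (\<Sum>i\<le>Suc k. of_nat (case i of 0 \<Rightarrow> 0 | Suc i' \<Rightarrow> k choose i') * ?t i (Suc k - i))"
    by (subst sum.atMost_Suc_shift) simp
  also have "(\<Sum>i\<le>k. of_nat (k choose i) * ?t i (Suc k - i)) = (\<Sum>i\<le>Suc k. of_nat (k choose i) * ?t i (Suc k - i))"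
    by (simp add: binomial_eq_0)
  also have "(\<Sum>i\<le>Suc k. of_nat (case i of 0 \<Rightarrow> 0 | Suc i' \<Rightarrow> k choose i') * ?t i (Suc k - i)) + \<dots>
    = (\<Sum>i\<le>Suc k. of_nat (Suc k choose i) * ?t i (Suc k - i))"
    by (subst sum.distrib[symmetric], rule sum.cong) (auto simp: algebra_simps split: nat.split)
  finally show ?case by (simp add: mult.assoc)
qed

text \<open>The prime ideals below are produced from a given one by differentiating: this construction
  replaces the use of power series rings, and of Krull's principal ideal theorem.\<close>

lemma prime_differential:
  assumes A: "is_subring A" and P: "is_prime A P" and D: "derivation D" and DA: "\<And>x. x \<in> A \<Longrightarrow> D x \<in> A"
    and char: "\<And>k. 0 < k \<Longrightarrow> of_nat k \<notin> P"
  shows "is_prime A {u \<in> A. \<forall>i. (D ^^ i) u \<in> P}" (is "is_prime A ?Q")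
proof -
  note sub = subring_closed[OF A] and idl = ideal_closed[OF primeD(1)[OF P]]
  have DiA: "(D ^^ i) x \<in> A" if "x \<in> A" for i x
    using derivation_funpow_closed[of A D, OF DA that] .
  have "is_ideal A ?Q"
    unfolding is_ideal_def
  proof (intro conjI ballI)
    show "a * x \<in> ?Q" if "a \<in> A" "x \<in> ?Q" for a x
      using that by (auto simp: derivation_Leibniz[OF D] intro!: idl(5) idl(3) sub DiA)
  qed (auto simp: derivation_funpow_add[OF D] sub idl)
  moreover have "1 \<notin> ?Q" using primeD(2)[OF P] by (auto intro!: exI[of _ 0])
  moreover have "x \<in> ?Q \<or> y \<in> ?Q" if xy: "x \<in> A" "y \<in> A" "x * y \<in> ?Q" for x y
  proof (rule ccontr)
    assume "\<not> ?thesis"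
    then have ex: "\<exists>i. (D ^^ i) x \<notin> P" "\<exists>i. (D ^^ i) y \<notin> P" using xy by auto
    \<comment> \<open>The argument of Gauss's lemma: with \<open>i\<close> and \<open>j\<close> the
      least orders at which the derivatives of \<open>x\<close> and of \<open>y\<close> leave
      \<open>P\<close>, every Leibniz term of order \<open>i + j\<close> except that of index
      \<open>i\<close> has a factor in \<open>P\<close>. The exceptional term carries a binomial
      coefficient, a positive integer, which \<open>char\<close> keeps out of
      \<open>P\<close>.\<close>
    define i where "i = (LEAST i. (D ^^ i) x \<notin> P)"
    define j where "j = (LEAST i. (D ^^ i) y \<notin> P)"
    have i: "(D ^^ i) x \<notin> P" and j: "(D ^^ j) y \<notin> P"
      unfolding i_def j_def using LeastI_ex[OF ex(1)] LeastI_ex[OF ex(2)] by simp_all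
    have il: "(D ^^ i') x \<in> P" if "i' < i" for i' using not_less_Least[OF that[unfolded i_def]] by simp
    have jl: "(D ^^ i') y \<in> P" if "i' < j" for i' using not_less_Least[OF that[unfolded j_def]] by simp
    let ?f = "\<lambda>l. of_nat (i + j choose l) * (D ^^ l) x * (D ^^ (i + j - l)) y"
    have s1: "(\<Sum>l\<in>{..i + j} - {i}. ?f l) \<in> P"
    proof (rule idl(5))
      fix l assume "l \<in> {..i + j} - {i}"
      then consider "l < i" | "i + j - l < j" by force
      then show "?f l \<in> P"
      proof cases
        case 1
        then show ?thesis by (intro idl(6)[OF _ idl(3)] il DiA xy sub)
      next
        case 2
        then show ?thesis by (intro idl(3) jl DiA xy sub)
      qed
    qed
    have "(D ^^ (i + j)) (x * y) = ?f i + (\<Sum>l\<in>{..i + j} - {i}. ?f l)"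
      by (subst derivation_Leibniz[OF D], subst sum.remove[of _ i]) auto
    then have "?f i = (D ^^ (i + j)) (x * y) - (\<Sum>l\<in>{..i + j} - {i}. ?f l)" by simp
    moreover have "(D ^^ (i + j)) (x * y) \<in> P" using xy by auto
    ultimately have "?f i \<in> P"
      using ideal_diff(2)[OF A primeD(1)[OF P], of "(D ^^ (i + j)) (x * y)" "\<Sum>l\<in>{..i + j} - {i}. ?f l"] s1
      by simp
    then have "of_nat (i + j choose i) * (D ^^ i) x * (D ^^ j) y \<in> P" by simp
    then have "of_nat (i + j choose i) * (D ^^ i) x \<in> P"
      using primeD(3)[OF P _ DiA[OF xy(2)], of "of_nat (i + j choose i) * (D ^^ i) x" j] j DiA[OF xy(1), of i]
      by (simp add: sub)
    then have "of_nat (i + j choose i) \<in> P"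
      using primeD(3)[OF P _ DiA[OF xy(1)], of "of_nat (i + j choose i)" i] i by (simp add: sub)
    then show False using char[of "i + j choose i"] by simp
  qed
  ultimately show ?thesis by (auto simp: is_prime_def)
qed

text \<open>\<open>S (Suc t)\<close> is the largest \<open>D t\<close>-stable ideal inside
  \<open>S t\<close>, hence prime by \<open>prime_differential\<close>. The dual elements make the
  descent strict: \<open>g t\<close> drops out at step \<open>Suc t\<close> because its derivative
  is \<open>1\<close>, whereas the later \<open>g l\<close> are killed by \<open>D t\<close> and
  survive. The last clause is used to tell generators apart in a quotient.\<close>

lemma differential_chain:
  assumes A: "is_subring A" and P: "is_prime A P"
    and char: "\<And>k. 0 < k \<Longrightarrow> of_nat k \<notin> P"
    and D: "\<And>i. i < c \<Longrightarrow> derivation (D i)" "\<And>i x. i < c \<Longrightarrow> x \<in> A \<Longrightarrow> D i x \<in> A"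
    and g: "\<And>i. i < c \<Longrightarrow> g i \<in> P"
    and Dg: "\<And>i j. i < c \<Longrightarrow> j < c \<Longrightarrow> D i (g j) = (if i = j then 1 else 0)"
  shows "\<exists>S. S 0 = P \<and> (\<forall>t\<le>c. is_prime A (S t)) \<and> (\<forall>t<c. S (Suc t) \<subset> S t) \<and>
    (\<forall>t\<le>c. \<forall>l<c. t \<le> l \<longrightarrow> g l \<in> S t) \<and> (\<forall>t\<le>c. \<forall>u\<in>S t. \<forall>l<t. D l u \<in> P)"
proof -
  define S where "S = rec_nat P (\<lambda>t Q. {u \<in> A. \<forall>i. (D t ^^ i) u \<in> Q})"
  have S0: "S 0 = P" and SS: "S (Suc t) = {u \<in> A. \<forall>i. (D t ^^ i) u \<in> S t}" for t
    by (simp_all add: S_def)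
  have sub: "S (Suc t) \<subseteq> S t" for t
    unfolding SS by (auto dest: spec[of _ 0])
  have subP: "S t \<subseteq> P" for t by (induction t) (use S0 sub in auto)
  have anti: "S t' \<subseteq> S t" if "t \<le> t'" for t t'
    using lift_Suc_antimono_le[of S, OF sub that] .
  have pr: "is_prime A (S t)" if "t \<le> c" for t
    using that
  proof (induction t)
    case (Suc t)
    have "of_nat k \<notin> S t" if "0 < k" for k using char[OF that] subP by blast
    then show ?case unfolding SS
      by (intro prime_differential) (use Suc A D in auto)
  qed (use P S0 in simp)
  have gS: "g l \<in> S t" if "t \<le> l" "l < c" for l t
    using that
  proof (induction t)
    case (Suc t)
    have d: "(D t ^^ Suc i) (g l) = 0" for i
      by (induction i) (use Suc Dg D in \<open>auto simp: derivation_simps\<close>)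
    have "(D t ^^ i) (g l) \<in> S t" for i
      using d[of "i - 1"] Suc ideal_closed(1)[OF primeD(1)[OF pr, of t]] by (cases i) auto
    moreover have "g l \<in> A" using g[of l] Suc P by (auto simp: is_prime_def is_ideal_def)
    ultimately show ?case unfolding SS by auto
  qed (use g S0 in simp)
  have "g t \<notin> S (Suc t)" if "t < c" for t
  proof
    assume "g t \<in> S (Suc t)"
    then have "(D t ^^ 1) (g t) \<in> S t" unfolding SS by blast
    then show False using Dg[of t t] that primeD(2)[OF pr, of t] by simp
  qed
  then have "S (Suc t) \<subset> S t" if "t < c" for t using sub[of t] gS[of t t] that by blast
  moreover have "D l u \<in> P" if "t \<le> c" "u \<in> S t" "l < t" for t u l
  proof -
    have "u \<in> S (Suc l)" using anti[of "Suc l" t] that by auto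
    then have "(D l ^^ 1) u \<in> S l" unfolding SS by blast
    then show ?thesis using subP by auto
  qed
  ultimately show ?thesis using S0 pr gS by (intro exI[of _ S]) simp
qed

section \<open>Primes disjoint from a multiplicative set, and extension of derivations modulo a
  prime\<close>

lemma prime_avoiding_exists:
  fixes I :: "'b::comm_ring_1 set"
  assumes I: "is_ideal UNIV I" and S: "1 \<in> S" "\<And>x y. x \<in> S \<Longrightarrow> y \<in> S \<Longrightarrow> x * y \<in> S" and IS: "I \<inter> S = {}"
  shows "\<exists>Q. is_prime UNIV Q \<and> I \<subseteq> Q \<and> Q \<inter> S = {}"
proof -
  define F where "F = {J. is_ideal UNIV J \<and> I \<subseteq> J \<and> J \<inter> S = {}}"
  have "I \<in> F" using I IS by (auto simp: F_def)
  have un: "\<Union>C \<in> F" if C: "subset.chain F C" "C \<noteq> {}" for C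
  proof -
    have CF: "C \<subseteq> F" and lin: "\<And>X Y. X \<in> C \<Longrightarrow> Y \<in> C \<Longrightarrow> X \<subseteq> Y \<or> Y \<subseteq> X"
      using C(1) by (auto simp: subset.chain_def subset_chain_def)
    have id: "is_ideal UNIV X" if "X \<in> C" for X using that CF by (auto simp: F_def)
    have "is_ideal UNIV (\<Union>C)"
      unfolding is_ideal_def
    proof (intro conjI ballI)
      show "x + y \<in> \<Union>C" if xy: "x \<in> \<Union>C" "y \<in> \<Union>C" for x y
      proof -
        obtain X Y where X: "X \<in> C" "x \<in> X" "Y \<in> C" "y \<in> Y" using xy by blast
        then show ?thesis using lin[of X Y] ideal_closed(2)[OF id[of X], of x y] ideal_closed(2)[OF id[of Y], of x y] by blast
      qed
      show "a * x \<in> \<Union>C" if "x \<in> \<Union>C" for x a using that ideal_closed(3)[OF id] by blast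
      show "0 \<in> \<Union>C" using C(2) ideal_closed(1)[OF id] by blast
    qed simp
    then show ?thesis using CF C(2) by (auto simp: F_def)
  qed
  obtain Q where Q: "Q \<in> F" and max: "\<And>X. X \<in> F \<Longrightarrow> Q \<subseteq> X \<Longrightarrow> X = Q"
    using subset_Zorn_nonempty[of F] \<open>I \<in> F\<close> un by blast
  have Qi: "is_ideal UNIV Q" and QI: "I \<subseteq> Q" and QS: "Q \<inter> S = {}" using Q by (auto simp: F_def)
  note idl = ideal_closed[OF Qi]
  have meet: "\<exists>q a. q \<in> Q \<and> q + a * x \<in> S" if "x \<notin> Q" for x
  proof -
    let ?X = "{q + a * x | q a. q \<in> Q}"
    have "is_ideal UNIV ?X"
      unfolding is_ideal_def
    proof (intro conjI ballI)
      show "0 \<in> ?X" using idl(1) by (auto intro!: exI[of _ 0])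
      show "u + v \<in> ?X" if uv: "u \<in> ?X" "v \<in> ?X" for u v
      proof -
        obtain q a q' a' where "u = q + a * x" "v = q' + a' * x" "q \<in> Q" "q' \<in> Q" using uv by auto
        then have "u + v = (q + q') + (a + a') * x" "q + q' \<in> Q" using idl(2) by (auto simp: algebra_simps)
        then show ?thesis by blast
      qed
      show "b * u \<in> ?X" if u: "u \<in> ?X" for b u
      proof -
        obtain q a where "u = q + a * x" "q \<in> Q" using u by auto
        then have "b * u = b * q + (b * a) * x" "b * q \<in> Q" using idl(3) by (auto simp: algebra_simps)
        then show ?thesis by blast
      qed
    qed simp
    moreover have "Q \<subseteq> ?X" by (auto, metis add_0_right mult_zero_left)
    moreover have "x \<in> ?X" using idl(1) by (auto, metis add_0 mult_1)
    ultimately have "?X \<notin> F" using max[of ?X] that by auto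
    then have "?X \<inter> S \<noteq> {}" using \<open>is_ideal UNIV ?X\<close> \<open>Q \<subseteq> ?X\<close> QI by (auto simp: F_def)
    then show ?thesis by auto
  qed
  have "x \<in> Q \<or> y \<in> Q" if xy: "x * y \<in> Q" for x y
  proof (rule ccontr)
    assume "\<not> ?thesis"
    then obtain q a q' a' where *: "q \<in> Q" "q + a * x \<in> S" "q' \<in> Q" "q' + a' * y \<in> S"
      using meet[of x] meet[of y] by auto
    have "(q + a * x) * (q' + a' * y) = (q' + a' * y) * q + a * x * q' + a * a' * (x * y)"
      by (simp add: algebra_simps)
    moreover have "\<dots> \<in> Q" using * xy by (simp add: idl(2) idl(3))
    ultimately show False using S(2)[of "q + a * x" "q' + a' * y"] * QS by auto
  qed
  then have "is_prime UNIV Q" using Qi QS S(1) by (auto simp: is_prime_def)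
  then show ?thesis using QI QS by blast
qed

text \<open>A derivation of the residue field of \<open>L\<close> extends to the field generated by
  the residue of \<open>x\<close>. Denominators are cleared: the extension is
  \<open>t * d + u * e\<close>, where \<open>e\<close> differentiates with respect to
  \<open>x\<close> and treats \<open>L\<close> as constants. If \<open>x\<close> is transcendental
  modulo \<open>Q\<close>, \<open>d\<close> itself will do; otherwise \<open>u\<close> is forced by
  the minimal relation of \<open>x\<close>.\<close>

lemma derivation_extend:
  fixes Q :: "'b::idom set"
  assumes Q: "is_prime UNIV Q" and char: "\<And>k. 0 < k \<Longrightarrow> of_nat k \<notin> Q"
    and L: "is_subring L" and d: "derivation d" "\<And>a. a \<in> L \<Longrightarrow> a \<in> Q \<Longrightarrow> d a \<in> Q"
    and e: "derivation e" "\<And>a. a \<in> L \<Longrightarrow> e a = 0" "e x = 1"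
  shows "\<exists>t u. t \<notin> Q \<and> (\<forall>p. (\<forall>i. coeff p i \<in> L) \<longrightarrow> poly p x \<in> Q \<longrightarrow> t * d (poly p x) + u * e (poly p x) \<in> Q)"
proof -
  note idl = ideal_closed[OF primeD(1)[OF Q], simplified]
  note idm = ideal_diff[OF is_subring_UNIV primeD(1)[OF Q]]
  note subL = subring_closed[OF L]
  have poly_mem: "poly p y \<in> Q" if "\<And>i. coeff p i \<in> Q" for p y
    unfolding poly_altdef using that by (auto intro!: idl)
  have e_poly: "e (poly p x) = poly (pderiv p) x" if "\<And>i. coeff p i \<in> L" for p
  proof -
    have "map_poly e p = 0" using that e(2) by (auto simp: poly_eq_iff coeff_map_poly derivation_simps[OF e(1)])
    then show ?thesis by (simp add: derivation_poly[OF e(1)] e)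
  qed
  have d0: "d 0 = 0" by (simp add: derivation_simps[OF d(1)])
  have triv: "t * d (poly p x) + u * e (poly p x) \<in> Q" if p: "\<And>i. coeff p i \<in> L" "\<And>i. coeff p i \<in> Q" for p t u
  proof -
    have "poly (map_poly d p) x \<in> Q" using p d by (intro poly_mem) (auto simp: coeff_map_poly d0)
    moreover have "poly (pderiv p) x \<in> Q" using p by (intro poly_mem) (auto simp: coeff_pderiv idl)
    ultimately show ?thesis unfolding e_poly[OF p(1)] derivation_poly[OF d(1)] by (intro idl(2,3) idl(6)) auto
  qed
  \<comment> \<open>The algebraic relations of \<open>x\<close> modulo \<open>Q\<close> with not all
    coefficients in \<open>Q\<close>; \<open>B\<close> is empty exactly when \<open>x\<close> is
    transcendental modulo \<open>Q\<close>. Relations with all coefficients in \<open>Q\<close> are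
    harmless by \<open>triv\<close>.\<close>
  define B where "B = {p. (\<forall>i. coeff p i \<in> L) \<and> poly p x \<in> Q \<and> (\<exists>i. coeff p i \<notin> Q)}"
  show ?thesis
  proof (cases "B = {}")
    case True
    then have "1 * d (poly p x) + 0 * e (poly p x) \<in> Q" if "\<forall>i. coeff p i \<in> L" "poly p x \<in> Q" for p
      using that by (intro triv) (auto simp: B_def)
    then show ?thesis using primeD(2)[OF Q] by blast
  next
    case False
    \<comment> \<open>\<open>p0\<close> plays the role of the minimal polynomial of \<open>x\<close> modulo \<open>Q\<close>, which is separable in characteristic \<open>0\<close>.\<close>
    then obtain p0 where p0: "p0 \<in> B" and min: "\<And>p. p \<in> B \<Longrightarrow> degree p0 \<le> degree p"
      using exists_least_iff[of "\<lambda>k. \<exists>p\<in>B. degree p = k"] by (metis ex_in_conv not_less)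
    have p0L: "\<And>i. coeff p0 i \<in> L" and p0x: "poly p0 x \<in> Q" using p0 by (auto simp: B_def)
    define n where "n = degree p0"
    define l where "l = coeff p0 n"
    have lL: "l \<in> L" using p0L l_def by simp
    have lQ: "l \<notin> Q"
    proof
      assume lQ: "l \<in> Q"
      define q where "q = p0 - monom l n"
      obtain i where i: "coeff p0 i \<notin> Q" using p0 by (auto simp: B_def)
      then have "i \<noteq> n" using lQ l_def by auto
      then have i': "coeff q i \<notin> Q" using i by (simp add: q_def)
      have "q \<in> B" unfolding B_def
      proof (safe)
        show "coeff q j \<in> L" for j using p0L lL by (auto simp: q_def subL)
        show "poly q x \<in> Q" using p0x lQ by (auto simp: q_def poly_monom intro!: idl idm)
      qed (use i' in blast)
      then have "n \<le> degree q" using min n_def by auto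
      moreover have "degree q \<le> n" unfolding q_def
        by (intro degree_diff_le) (auto simp: n_def degree_monom_le)
      ultimately have "degree q = n" by simp
      moreover have "coeff q n = 0" by (simp add: q_def l_def)
      ultimately have "q = 0" using leading_coeff_0_iff[of q] by auto
      then show False using i' idl(1) by simp
    qed
    have n0: "n > 0"
    proof (rule ccontr)
      assume "\<not> n > 0"
      then have "p0 = [:l:]" unfolding n_def l_def by (auto elim: degree_eq_zeroE)
      then show False using p0x lQ by simp
    qed
    define t where "t = poly (pderiv p0) x"
    \<comment> \<open>Otherwise \<open>pderiv p0\<close> would be a nontrivial relation of smaller
      degree: its coefficient \<open>of_nat n * l\<close> stays outside \<open>Q\<close> in
      characteristic zero.\<close>
    have tQ: "t \<notin> Q"
    proof
      assume "t \<in> Q"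
      have "pderiv p0 \<in> B" unfolding B_def
      proof (safe)
        show "coeff (pderiv p0) j \<in> L" for j using p0L by (auto simp: coeff_pderiv subL simp del: of_nat_Suc)
        show "poly (pderiv p0) x \<in> Q" using \<open>t \<in> Q\<close> t_def by simp
        have "coeff (pderiv p0) (n - 1) = of_nat n * l" using n0 by (simp add: coeff_pderiv l_def)
        moreover have "of_nat n * l \<notin> Q" using primeD(3)[OF Q, of "of_nat n" l] char[OF n0] lQ by auto
        ultimately show "\<exists>i. coeff (pderiv p0) i \<notin> Q" by metis
      qed
      then have "n \<le> degree (pderiv p0)" using min n_def by auto
      moreover have "degree (pderiv p0) \<le> n - 1"
        by (rule degree_le) (auto simp: n_def coeff_pderiv coeff_eq_0)
      ultimately show False using n0 by simp
    qed
    \<comment> \<open>The choice that makes \<open>D\<close> kill \<open>poly p0 x\<close> exactly,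
      since \<open>e (poly p0 x) = t\<close>.\<close>
    define u where "u = - d (poly p0 x)"
    define D where "D = (\<lambda>a. t * d a + u * e a)"
    have D: "derivation D" unfolding D_def by (rule derivation_lin[OF d(1) e(1)])
    have D0: "D (poly p0 x) = 0"
      unfolding D_def e_poly[OF p0L] u_def t_def by simp
    have "D (poly p x) \<in> Q" if "\<And>i. coeff p i \<in> L" "poly p x \<in> Q" for p
      using that
    proof (induction "degree p" arbitrary: p rule: less_induct)
      case (less p)
      show ?case
      proof (cases "p \<in> B")
        case False
        then show ?thesis using less triv unfolding D_def by (auto simp: B_def)
      next
        case True
        define m where "m = degree p"
        define b where "b = coeff p m"
        have nm: "n \<le> m" using min[OF True] by (simp add: n_def m_def)
        \<comment> \<open>One step of pseudo-division by \<open>p0\<close>: in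
          \<open>l * p - q\<close> the top coefficients cancel, \<open>D (poly q x)\<close> lies in
          \<open>Q\<close> because \<open>D\<close> kills \<open>poly p0 x\<close>, and the factor
          \<open>l\<close> is cancelled at the end since it is not in the prime
          \<open>Q\<close>.\<close>
        define q where "q = monom b (m - n) * p0"
        define r where "r = Polynomial.smult l p - q"
        have bL: "b \<in> L" using less(2) by (simp add: b_def)
        have qL: "coeff q j \<in> L" for j unfolding q_def coeff_monom_mult using p0L bL by (auto simp: subL)
        have rL: "coeff r j \<in> L" for j unfolding r_def using less(2) lL qL by (auto simp: subL)
        have "degree q \<le> m"
          unfolding q_def using degree_mult_le[of "monom b (m - n)" p0] degree_monom_le[of b "m - n"] nm
          by (simp add: n_def)
        then have "degree r \<le> m" unfolding r_def
          by (intro degree_diff_le) (auto simp: m_def degree_smult_le)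
        moreover have "coeff r m = 0" unfolding r_def q_def coeff_diff coeff_monom_mult
          using nm by (simp add: l_def b_def)
        ultimately have deg: "degree r < m" using nm n0
          by (metis le_neq_implies_less leading_coeff_0_iff degree_0 less_le_trans)
        have qx: "poly q x = b * x ^ (m - n) * poly p0 x" by (simp add: q_def poly_monom)
        have rx: "poly r x = l * poly p x - poly q x" by (simp add: r_def)
        have "poly r x \<in> Q" unfolding rx qx using p0x less(3) by (intro idm(2) idl(3)) auto
        then have "D (poly r x) \<in> Q" using less(1)[of r] deg rL m_def by auto
        moreover have "D (poly q x) \<in> Q" unfolding qx derivation_simps(2)[OF D, of _ "poly p0 x"] D0
          using p0x idl(1) by (intro idl(2) idl(3)) auto
        moreover have "l * D (poly p x) = D (poly r x) + D (poly q x) - D l * poly p x"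
          unfolding rx by (simp add: derivation_simps[OF D] algebra_simps)
        ultimately have "l * D (poly p x) \<in> Q" using less(3) by (simp add: idl(2) idl(3) idm(2))
        then show ?thesis using primeD(3)[OF Q, of l] lQ by auto
      qed
    qed
    then show ?thesis using tQ unfolding D_def by blast
  qed
qed

section \<open>Quotients of a local subring\<close>

lemma subring_of_simps [simp]:
  "carrier (subring_of A) = A" "monoid.mult (subring_of A) = (*)" "one (subring_of A) = 1"
  "ring.zero (subring_of A) = 0" "add (subring_of A) = (+)"
  by (simp_all add: subring_of_def)

lemma cring_subring_of:
  assumes "is_subring A"
  shows "cring (subring_of A)"
proof -
  note sub = subring_closed[OF assms]
  have "\<exists>y\<in>A. y + x = 0" if "x \<in> A" for x
    using sub(6)[OF that] by (intro bexI[of _ "- x"]) auto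
  then show ?thesis
    by (intro cringI abelian_groupI comm_monoidI) (auto simp: sub algebra_simps)
qed

lemma a_inv_subring_of:
  assumes "is_subring A" "x \<in> A"
  shows "a_inv (subring_of A) x = - x"
proof -
  interpret cring "subring_of A" by (rule cring_subring_of[OF assms(1)])
  have "- x \<in> A" using subring_closed(6)[OF assms(1,2)] .
  then show ?thesis using minus_equality[of "- x" x] assms by simp
qed

lemma ideal_subring_of:
  assumes "is_subring A"
  shows "ideal I (subring_of A) \<longleftrightarrow> is_ideal A I"
proof
  interpret cring "subring_of A" by (rule cring_subring_of[OF assms])
  {
    assume "ideal I (subring_of A)"
    then interpret ideal I "subring_of A" .
    show "is_ideal A I"
      unfolding is_ideal_def using a_subset zero_closed a_closed I_l_closed by auto
  }
  assume I: "is_ideal A I"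
  have "\<ominus>\<^bsub>subring_of A\<^esub> x \<in> I" if "x \<in> I" for x
    using ideal_diff(1)[OF assms I that] a_inv_subring_of[OF assms] ideal_closed(4)[OF I that] by simp
  then have "subgroup I (add_monoid (subring_of A))"
    using ideal_closed[OF I] by (intro add.subgroupI) (auto simp: a_inv_def)
  then show "ideal I (subring_of A)"
    using ideal_closed[OF I] by (intro idealI ring_axioms) auto
qed

text \<open>Generation of \<open>I\<close> by \<open>B\<close> is phrased as minimality among ideals
  containing \<open>B\<close>, so that no generated ideal has to be constructed.\<close>

definition noetherian_set :: "'b::comm_ring_1 set \<Rightarrow> bool" where
  "noetherian_set A \<longleftrightarrow> (\<forall>I. is_ideal A I \<longrightarrow>
     (\<exists>B. finite B \<and> B \<subseteq> I \<and> (\<forall>J. is_ideal A J \<longrightarrow> B \<subseteq> J \<longrightarrow> I \<subseteq> J)))"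

definition prime_chain :: "'b::comm_ring_1 set \<Rightarrow> 'b set \<Rightarrow> nat \<Rightarrow> (nat \<Rightarrow> 'b set) \<Rightarrow> bool" where
  "prime_chain A I l P \<longleftrightarrow> (\<forall>i\<le>l. is_prime A (P i) \<and> I \<subseteq> P i) \<and> (\<forall>i<l. P i \<subset> P (Suc i))"

text \<open>A dictionary between the quotient ring, whose elements are cosets, and the ideals of
  \<open>A\<close> containing \<open>I\<close>. It translates primes, chains, generators and finally
  regularity, so that later arguments take place inside an ordinary type.\<close>

locale subring_quotient =
  fixes A I :: "'b::comm_ring_1 set"
  assumes A: "is_subring A" and I: "is_ideal A I"
begin

abbreviation "S \<equiv> subring_of A Quot I"
abbreviation "\<pi> \<equiv> a_r_coset (subring_of A) I"

sublocale R: cring "subring_of A" by (rule cring_subring_of[OF A])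
sublocale I: ideal I "subring_of A" using ideal_subring_of[OF A] I by simp

lemma cring_S: "cring S"
  by (rule I.quotient_is_cring[OF R.is_cring])

sublocale Q: cring S by (rule cring_S)

lemma carrier_S: "carrier S = \<pi> ` A"
  by (auto simp: FactRing_def A_RCOSETS_def')

lemma pi_eq_iff: "x \<in> A \<Longrightarrow> y \<in> A \<Longrightarrow> \<pi> x = \<pi> y \<longleftrightarrow> x - y \<in> I"
  using R.quotient_eq_iff_same_a_r_cos[OF I.is_ideal, of x y] a_inv_subring_of[OF A, of y]
  by (simp add: a_minus_def)

lemma Union_pi: "is_ideal A J \<Longrightarrow> I \<subseteq> J \<Longrightarrow> \<Union> (\<pi> ` J) = J"
  using R.ideal_incl_iff[OF I.is_ideal, of J] ideal_subring_of[OF A] by auto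

lemma pi_mem_iff: "is_ideal A J \<Longrightarrow> I \<subseteq> J \<Longrightarrow> x \<in> A \<Longrightarrow> \<pi> x \<in> \<pi> ` J \<longleftrightarrow> x \<in> J"
  using R.canonical_proj_vimage_mem_iff[OF I.is_ideal, of "\<pi> ` J" x] Union_pi[of J] ideal_closed(4)[of A J]
  by (auto simp: carrier_S)

lemma pi_subset_iff: "is_ideal A J \<Longrightarrow> I \<subseteq> J \<Longrightarrow> X \<subseteq> A \<Longrightarrow> \<pi> ` X \<subseteq> \<pi> ` J \<longleftrightarrow> X \<subseteq> J"
  using pi_mem_iff[of J] unfolding image_subset_iff by blast

lemma ideal_quot_iff: "ideal J' S \<longleftrightarrow> (\<exists>J. is_ideal A J \<and> I \<subseteq> J \<and> J' = \<pi> ` J)"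
  using R.quot_ideal_correspondence[OF I.is_ideal] ideal_subring_of[OF A]
  unfolding bij_betw_def by (auto simp: set_eq_iff image_iff)

lemma pi_mult: "x \<in> A \<Longrightarrow> y \<in> A \<Longrightarrow> \<pi> x \<otimes>\<^bsub>S\<^esub> \<pi> y = \<pi> (x * y)"
  using I.rcoset_mult_add[of x y] by (simp add: FactRing_def)

lemma primeideal_quot_iff:
  assumes "is_ideal A J" "I \<subseteq> J"
  shows "primeideal (\<pi> ` J) S \<longleftrightarrow> is_prime A J"
proof
  assume "primeideal (\<pi> ` J) S"
  then interpret J: primeideal "\<pi> ` J" S .
  have JA: "J \<subseteq> A" using assms(1) by (simp add: is_ideal_def)
  have "1 \<notin> J"
  proof
    assume "1 \<in> J"
    then have "A \<subseteq> J" using ideal_closed(3)[OF assms(1), of _ 1] by auto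
    then show False using J.I_notcarr JA carrier_S by (metis subset_antisym)
  qed
  moreover have "x \<in> J \<or> y \<in> J" if "x \<in> A" "y \<in> A" "x * y \<in> J" for x y
    using J.I_prime[of "\<pi> x" "\<pi> y"] that pi_mult[of x y] pi_mem_iff[OF assms] by (auto simp: carrier_S)
  ultimately show "is_prime A J" using assms(1) by (auto simp: is_prime_def)
next
  assume J: "is_prime A J"
  show "primeideal (\<pi> ` J) S"
  proof (rule primeidealI)
    show "ideal (\<pi> ` J) S" using assms ideal_quot_iff by blast
    show "carrier S \<noteq> \<pi> ` J"
      using pi_subset_iff[OF assms, of A] primeD(2)[OF J] subring_closed(2)[OF A] by (auto simp: carrier_S)
    fix a b assume "a \<in> carrier S" "b \<in> carrier S" "a \<otimes>\<^bsub>S\<^esub> b \<in> \<pi> ` J"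
    then obtain x y where xy: "x \<in> A" "y \<in> A" "a = \<pi> x" "b = \<pi> y" "\<pi> (x * y) \<in> \<pi> ` J"
      by (auto simp: carrier_S pi_mult)
    then have "x * y \<in> J" using pi_mem_iff[OF assms, of "x * y"] subring_closed(5)[OF A] by auto
    then show "a \<in> \<pi> ` J \<or> b \<in> \<pi> ` J" using primeD(3)[OF J] xy by auto
  qed (rule cring_S)
qed

lemma krull_dim_quot: "krull_dim S = Sup {enat l | l. \<exists>P. prime_chain A I l P}"
proof -
  have "(\<exists>P'. (\<forall>i\<le>l. primeideal (P' i) S) \<and> (\<forall>i<l. P' i \<subset> P' (Suc i))) \<longleftrightarrow> (\<exists>P. prime_chain A I l P)" for l
  proof
    assume "\<exists>P'. (\<forall>i\<le>l. primeideal (P' i) S) \<and> (\<forall>i<l. P' i \<subset> P' (Suc i))"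
    then obtain P' where P': "\<And>i. i \<le> l \<Longrightarrow> primeideal (P' i) S" "\<And>i. i < l \<Longrightarrow> P' i \<subset> P' (Suc i)" by auto
    have "\<exists>J. is_ideal A J \<and> I \<subseteq> J \<and> P' i = \<pi> ` J" if "i \<le> l" for i
      using P'(1)[OF that] ideal_quot_iff primeideal.axioms(1) by blast
    then obtain P where P: "\<And>i. i \<le> l \<Longrightarrow> is_ideal A (P i) \<and> I \<subseteq> P i \<and> P' i = \<pi> ` P i" by metis
    have "is_prime A (P i)" if "i \<le> l" for i
      using P[OF that] P'(1)[OF that] primeideal_quot_iff by auto
    moreover have "P i \<subset> P (Suc i)" if "i < l" for i
    proof -
      have "P i \<subseteq> P (Suc i)"
        using P'(2)[OF that] P[of i] P[of "Suc i"] that pi_subset_iff[of "P (Suc i)" "P i"] by (auto simp: is_ideal_def)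
      moreover have "P i \<noteq> P (Suc i)" using P'(2)[OF that] P[of i] P[of "Suc i"] that by auto
      ultimately show ?thesis by blast
    qed
    ultimately show "\<exists>P. prime_chain A I l P" using P unfolding prime_chain_def by blast
  next
    assume "\<exists>P. prime_chain A I l P"
    then obtain P where P: "\<And>i. i \<le> l \<Longrightarrow> is_prime A (P i)" "\<And>i. i \<le> l \<Longrightarrow> I \<subseteq> P i" "\<And>i. i < l \<Longrightarrow> P i \<subset> P (Suc i)"
      unfolding prime_chain_def by auto
    have "primeideal (\<pi> ` P i) S" if "i \<le> l" for i
      using primeideal_quot_iff[of "P i"] P(1,2)[OF that] primeD(1) by blast
    moreover have "\<pi> ` P i \<subset> \<pi> ` P (Suc i)" if "i < l" for i
    proof -
      have "is_ideal A (P i)" "is_ideal A (P (Suc i))" using primeD(1)[OF P(1)] that by simp_all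
      then show ?thesis
        using Union_pi[of "P i"] Union_pi[of "P (Suc i)"] P(2,3) that
        by (metis Suc_leI less_imp_le psubset_eq image_mono)
    qed
    ultimately show "\<exists>P'. (\<forall>i\<le>l. primeideal (P' i) S) \<and> (\<forall>i<l. P' i \<subset> P' (Suc i))"
      by (intro exI[of _ "\<lambda>i. \<pi> ` P i"]) blast
  qed
  then show ?thesis unfolding krull_dim_def by simp
qed

lemma genideal_quot:
  assumes J: "is_ideal A J" "I \<subseteq> J" and B: "B \<subseteq> A"
  shows "Idl\<^bsub>S\<^esub> (\<pi> ` B) = \<pi> ` J \<longleftrightarrow> B \<subseteq> J \<and> (\<forall>K. is_ideal A K \<longrightarrow> I \<subseteq> K \<longrightarrow> B \<subseteq> K \<longrightarrow> J \<subseteq> K)"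
proof -
  have JA: "J \<subseteq> A" using J(1) by (simp add: is_ideal_def)
  have BS: "\<pi> ` B \<subseteq> carrier S" using B by (auto simp: carrier_S)
  obtain K where K: "is_ideal A K" "I \<subseteq> K" "Idl\<^bsub>S\<^esub> (\<pi> ` B) = \<pi> ` K"
    using Q.genideal_ideal[OF BS] ideal_quot_iff by blast
  have BK: "B \<subseteq> K" using Q.genideal_self[OF BS] K pi_subset_iff[of K B] B by simp
  have min: "K \<subseteq> K'" if "is_ideal A K'" "I \<subseteq> K'" "B \<subseteq> K'" for K'
  proof -
    have "Idl\<^bsub>S\<^esub> (\<pi> ` B) \<subseteq> \<pi> ` K'"
      using that ideal_quot_iff by (intro Q.genideal_minimal) auto
    then show ?thesis using K that pi_subset_iff[of K' K] by (simp add: is_ideal_def)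
  qed
  have "\<pi> ` K = \<pi> ` J \<longleftrightarrow> K = J" using Union_pi[of K] Union_pi[of J] K J by metis
  then show ?thesis using K BK min J by (metis subset_antisym)
qed

lemma noetherian_quot:
  assumes "noetherian_set A"
  shows "noetherian_ring S"
proof (rule Q.noetherian_ringI)
  fix J' assume "ideal J' S"
  then obtain J where J: "is_ideal A J" "I \<subseteq> J" "J' = \<pi> ` J" using ideal_quot_iff by blast
  obtain B where B: "finite B" "B \<subseteq> J" "\<And>K. is_ideal A K \<Longrightarrow> B \<subseteq> K \<Longrightarrow> J \<subseteq> K"
    using assms J(1) unfolding noetherian_set_def by meson
  have BA: "B \<subseteq> A" using B J by (auto simp: is_ideal_def)
  have "J' = Idl\<^bsub>S\<^esub> (\<pi> ` B)" using genideal_quot[OF J(1,2) BA] B J(3) by auto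
  then show "\<exists>B\<subseteq>carrier S. finite B \<and> J' = Idl\<^bsub>S\<^esub> B"
    using B(1) BA by (intro exI[of _ "\<pi> ` B"]) (auto simp: carrier_S)
qed

text \<open>The hypotheses on \<open>M\<close> say that it is a proper ideal and every element
  outside it is a unit, hence its image is the only maximal ideal of the quotient. Generators are
  lifted to \<open>A\<close>; incongruence modulo \<open>I\<close> ensures that
  \<open>card B\<close> counts their images.\<close>

lemma regular_quot_iff:
  assumes M: "is_ideal A M" "1 \<notin> M" "\<And>u. u \<in> A \<Longrightarrow> u \<notin> M \<Longrightarrow> \<exists>v\<in>A. u * v = 1" and IM: "I \<subseteq> M"
    and noeth: "noetherian_set A"
  shows "regular_local_ring S \<longleftrightarrow>
    (\<exists>B. finite B \<and> B \<subseteq> M \<and> (\<forall>b\<in>B. \<forall>b'\<in>B. b - b' \<in> I \<longrightarrow> b = b') \<and>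
      (\<forall>K. is_ideal A K \<longrightarrow> I \<subseteq> K \<longrightarrow> B \<subseteq> K \<longrightarrow> M \<subseteq> K) \<and> enat (card B) = krull_dim S)"
proof -
  have MA: "M \<subseteq> A" using M(1) by (simp add: is_ideal_def)
  have sub: "J \<subseteq> M" if J: "is_ideal A J" "J \<noteq> A" for J
  proof
    fix u assume u: "u \<in> J"
    show "u \<in> M"
    proof (rule ccontr)
      assume "u \<notin> M"
      then obtain v where "v \<in> A" "u * v = 1" using M(3)[of u] u ideal_closed(4)[OF J(1)] by auto
      then have "1 \<in> J" using ideal_closed(6)[OF J(1), of v u] u by simp
      then have "A \<subseteq> J" using ideal_closed(3)[OF J(1), of _ 1] by auto
      then show False using J by (auto simp: is_ideal_def)
    qed
  qed
  have nM: "carrier S \<noteq> \<pi> ` M"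
    using pi_subset_iff[OF M(1) IM, of A] M(2) subring_closed(2)[OF A] by (auto simp: carrier_S)
  have le: "N \<subseteq> \<pi> ` M" if N: "ideal N S" "N \<noteq> carrier S" for N
  proof -
    obtain J where J: "is_ideal A J" "I \<subseteq> J" "N = \<pi> ` J" using N(1) ideal_quot_iff by blast
    then have "J \<noteq> A" using N(2) by (auto simp: carrier_S)
    then show ?thesis using sub[OF J(1)] J(3) by auto
  qed
  have max: "maximalideal N S \<longleftrightarrow> N = \<pi> ` M" for N
  proof
    assume N: "maximalideal N S"
    then have N': "ideal N S" "carrier S \<noteq> N" by (simp_all add: maximalideal.axioms(1) maximalideal.I_notcarr)
    have iM: "ideal (\<pi> ` M) S" using M(1) IM ideal_quot_iff by blast
    show "N = \<pi> ` M"
      using maximalideal.I_maximal[OF N iM le] N' nM MA by (auto simp: carrier_S)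
  next
    have iM: "ideal (\<pi> ` M) S" using M(1) IM ideal_quot_iff by blast
    assume "N = \<pi> ` M"
    then show "maximalideal N S" using nM iM le by (intro maximalidealI) auto
  qed
  have "regular_local_ring S \<longleftrightarrow> (\<exists>A'. A' \<subseteq> carrier S \<and> finite A' \<and> \<pi> ` M = Idl\<^bsub>S\<^esub> A' \<and> enat (card A') = krull_dim S)"
    unfolding regular_local_ring_def max using cring_S noetherian_quot[OF noeth] by simp
  also have "\<dots> \<longleftrightarrow> (\<exists>B. finite B \<and> B \<subseteq> M \<and> (\<forall>b\<in>B. \<forall>b'\<in>B. b - b' \<in> I \<longrightarrow> b = b') \<and>
      (\<forall>K. is_ideal A K \<longrightarrow> I \<subseteq> K \<longrightarrow> B \<subseteq> K \<longrightarrow> M \<subseteq> K) \<and> enat (card B) = krull_dim S)" (is "?L \<longleftrightarrow> ?R")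
  proof
    assume ?L
    then obtain A' where A': "A' \<subseteq> \<pi> ` A" "finite A'" "\<pi> ` M = Idl\<^bsub>S\<^esub> A'" "enat (card A') = krull_dim S"
      by (auto simp: carrier_S)
    obtain B where B: "B \<subseteq> A" "inj_on \<pi> B" "A' = \<pi> ` B" using A'(1) by (metis subset_image_inj)
    have "finite B" "card B = card A'" using B A'(2) by (auto simp: card_image finite_image_iff)
    moreover have "b = b'" if "b \<in> B" "b' \<in> B" "b - b' \<in> I" for b b'
      using that B pi_eq_iff[of b b'] by (auto dest: inj_onD)
    ultimately show ?R
      using genideal_quot[OF M(1) IM B(1)] A' B(3) by (intro exI[of _ B]) auto
  next
    assume ?R
    then obtain B where B: "finite B" "B \<subseteq> M" "\<And>b b'. b \<in> B \<Longrightarrow> b' \<in> B \<Longrightarrow> b - b' \<in> I \<Longrightarrow> b = b'"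
      "\<And>K. is_ideal A K \<Longrightarrow> I \<subseteq> K \<Longrightarrow> B \<subseteq> K \<Longrightarrow> M \<subseteq> K" "enat (card B) = krull_dim S" by auto
    have BA: "B \<subseteq> A" using B MA by auto
    have "inj_on \<pi> B" using B(3) pi_eq_iff BA by (intro inj_onI) (meson subsetD)
    then have "card (\<pi> ` B) = card B" by (rule card_image)
    then show ?L
      using genideal_quot[OF M(1) IM BA] B BA by (intro exI[of _ "\<pi> ` B"]) (auto simp: carrier_S)
  qed
  finally show ?thesis .
qed

end

section \<open>Underdetermined linear systems\<close>

lemma underdetermined_system:
  fixes f :: "'i \<Rightarrow> 'j \<Rightarrow> 'a::field"
  assumes "finite B" "finite A" "card B < card A"
  shows "\<exists>c. (\<exists>\<alpha>\<in>A. c \<alpha> \<noteq> 0) \<and> (\<forall>\<beta>\<in>B. (\<Sum>\<alpha>\<in>A. c \<alpha> * f \<alpha> \<beta>) = 0)"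
  using assms
proof (induction B arbitrary: A f rule: finite_induct)
  case empty
  then have "A \<noteq> {}" by auto
  then show ?case by (auto intro!: exI[of _ "\<lambda>_. 1"])
next
  case (insert b B)
  show ?case
  proof (cases "\<forall>\<alpha>\<in>A. f \<alpha> b = 0")
    case True
    obtain c where "\<exists>\<alpha>\<in>A. c \<alpha> \<noteq> 0" "\<forall>\<beta>\<in>B. (\<Sum>\<alpha>\<in>A. c \<alpha> * f \<alpha> \<beta>) = 0"
      using insert.IH[of A f] insert.prems insert.hyps by auto
    then show ?thesis using True by (intro exI[of _ c]) simp
  next
    case False
    then obtain a where a: "a \<in> A" "f a b \<noteq> 0" by auto
    let ?A = "A - {a}"
    \<comment> \<open>Gaussian elimination: the equation \<open>b\<close> is solved for the pivot
      unknown \<open>a\<close>, and \<open>f'\<close> is the system that remains for the other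
      unknowns.\<close>
    define f' where "f' = (\<lambda>\<alpha> \<beta>. f \<alpha> \<beta> - f \<alpha> b / f a b * f a \<beta>)"
    have "card B < card ?A" using insert.prems insert.hyps a by simp
    then obtain c where c: "\<exists>\<alpha>\<in>?A. c \<alpha> \<noteq> 0" "\<forall>\<beta>\<in>B. (\<Sum>\<alpha>\<in>?A. c \<alpha> * f' \<alpha> \<beta>) = 0"
      using insert.IH[of ?A f'] insert.prems by auto
    define s where "s = (\<Sum>\<alpha>\<in>?A. c \<alpha> * f \<alpha> b) / f a b"
    define c' where "c' = c(a := - s)"
    have sum: "(\<Sum>\<alpha>\<in>A. c' \<alpha> * f \<alpha> \<beta>) = (\<Sum>\<alpha>\<in>?A. c \<alpha> * f \<alpha> \<beta>) - s * f a \<beta>" for \<beta>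
      using insert.prems a by (simp add: sum.remove[of A a] c'_def)
    have "(\<Sum>\<alpha>\<in>A. c' \<alpha> * f \<alpha> \<beta>) = 0" if "\<beta> \<in> insert b B" for \<beta>
    proof (cases "\<beta> = b")
      case True
      then show ?thesis unfolding sum s_def using a by simp
    next
      case False
      then have "0 = (\<Sum>\<alpha>\<in>?A. c \<alpha> * f' \<alpha> \<beta>)" using c(2) that by simp
      also have "\<dots> = (\<Sum>\<alpha>\<in>?A. c \<alpha> * f \<alpha> \<beta>) - s * f a \<beta>"
        unfolding f'_def s_def by (simp add: right_diff_distrib sum_subtractf sum_distrib_right sum_divide_distrib mult.assoc)
      finally show ?thesis unfolding sum by simp
    qed
    moreover have "\<exists>\<alpha>\<in>A. c' \<alpha> \<noteq> 0" using c(1) by (auto simp: c'_def)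
    ultimately show ?thesis by blast
  qed
qed

section \<open>Regularity through derivations\<close>

text \<open>A model of the local ring of a smooth point of dimension \<open>n\<close>:
  \<open>ev\<close> is the residue map, \<open>c\<close> embeds the residue field, \<open>T\<close>
  generates the maximal ideal, and the derivations \<open>E\<close> are dual to \<open>T\<close>.
  Finite generation of ideals and the bound on chains of primes are the only further properties of
  the ring.\<close>

locale local_system =
  fixes A :: "'b::field set" and ev :: "'b \<Rightarrow> 'a::field_char_0" and c :: "'a \<Rightarrow> 'b" and n :: nat
    and T :: "nat \<Rightarrow> 'b" and E :: "nat \<Rightarrow> 'b \<Rightarrow> 'b"
  assumes A: "is_subring A"
    and ev_add: "x \<in> A \<Longrightarrow> y \<in> A \<Longrightarrow> ev (x + y) = ev x + ev y"
    and ev_mult: "x \<in> A \<Longrightarrow> y \<in> A \<Longrightarrow> ev (x * y) = ev x * ev y"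
    and c_add: "c (a + b) = c a + c b" and c_1: "c 1 = 1" and c_A: "c a \<in> A" and ev_c: "ev (c a) = a"
    and unit: "u \<in> A \<Longrightarrow> ev u \<noteq> 0 \<Longrightarrow> inverse u \<in> A"
    and T_A: "i < n \<Longrightarrow> T i \<in> A" and ev_T: "i < n \<Longrightarrow> ev (T i) = 0"
    and E_der: "i < n \<Longrightarrow> derivation (E i)" and E_A: "i < n \<Longrightarrow> x \<in> A \<Longrightarrow> E i x \<in> A"
    and E_c: "i < n \<Longrightarrow> E i (c a) = 0"
    and E_T: "i < n \<Longrightarrow> j < n \<Longrightarrow> E i (T j) = (if i = j then 1 else 0)"
    and T_gen: "u \<in> A \<Longrightarrow> ev u = 0 \<Longrightarrow> \<exists>a. (\<forall>i<n. a i \<in> A) \<and> u = (\<Sum>i<n. a i * T i)"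
    and dim: "prime_chain A {} l P \<Longrightarrow> l \<le> n"
    and noeth: "noetherian_set A"
begin

definition M :: "'b set" where "M = {u \<in> A. ev u = 0}"

definition der :: "('b \<Rightarrow> 'b) \<Rightarrow> bool" where
  "der D \<longleftrightarrow> derivation D \<and> (\<forall>x\<in>A. D x \<in> A) \<and> (\<forall>a. D (c a) = 0)"

text \<open>Regular parameters together with dual derivations. Carrying the derivations along makes
  it possible to test linear independence of differentials and to produce primes from any such
  system.\<close>

definition system :: "(nat \<Rightarrow> 'b) \<Rightarrow> (nat \<Rightarrow> 'b \<Rightarrow> 'b) \<Rightarrow> bool" where
  "system g D \<longleftrightarrow> (\<forall>i<n. g i \<in> M \<and> der (D i)) \<and> (\<forall>i<n. \<forall>j<n. D i (g j) = (if i = j then 1 else 0)) \<and>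
     (\<forall>u\<in>M. \<exists>a. (\<forall>i<n. a i \<in> A) \<and> u = (\<Sum>i<n. a i * g i))"

lemmas sub = subring_closed[OF A]

lemma ev_simps:
  "ev 0 = 0" "ev 1 = 1" "x \<in> A \<Longrightarrow> ev (- x) = - ev x" "x \<in> A \<Longrightarrow> y \<in> A \<Longrightarrow> ev (x - y) = ev x - ev y"
  "(\<And>i. i \<in> S \<Longrightarrow> f i \<in> A) \<Longrightarrow> ev (sum f S) = (\<Sum>i\<in>S. ev (f i))"
proof -
  show 0: "ev 0 = 0" using ev_add[of 0 0] sub by simp
  show "ev 1 = 1" using ev_c[of 1] c_1 by simp
  show n: "ev (- x) = - ev x" if "x \<in> A" for x
    using ev_add[of x "- x"] that sub 0 by (simp add: eq_neg_iff_add_eq_0 add.commute)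
  show "ev (x - y) = ev x - ev y" if "x \<in> A" "y \<in> A"
    using ev_add[of x "- y"] n[of y] that sub(6) by simp
  show "(\<And>i. i \<in> S \<Longrightarrow> f i \<in> A) \<Longrightarrow> ev (sum f S) = (\<Sum>i\<in>S. ev (f i))"
    by (induction S rule: infinite_finite_induct) (auto simp: 0 ev_add sub(9))
qed

lemma c_of_nat: "c (of_nat k) = of_nat k"
proof (induction k)
  case 0
  show ?case using c_add[of 0 0] by (metis add.right_neutral add_left_cancel of_nat_0)
qed (simp add: c_add c_1)

lemma M_ideal: "is_ideal A M"
  unfolding is_ideal_def M_def by (auto simp: sub ev_simps ev_add ev_mult)

lemma M_prime: "is_prime A M"
  unfolding is_prime_def using M_ideal by (auto simp: M_def ev_simps ev_mult)

lemma prime_subset_M: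
  assumes "is_prime A P"
  shows "P \<subseteq> M"
proof
  fix u assume u: "u \<in> P"
  have uA: "u \<in> A" using u primeD(1)[OF assms] by (auto simp: is_ideal_def)
  have "ev u = 0"
  proof (rule ccontr)
    assume "ev u \<noteq> 0"
    moreover from this have "u \<noteq> 0" using ev_simps by auto
    ultimately have "1 \<in> P" using ideal_closed(3)[OF primeD(1)[OF assms] unit[of u] u] uA by simp
    then show False using primeD(2)[OF assms] by simp
  qed
  then show "u \<in> M" using uA by (simp add: M_def)
qed

lemma unit_M:
  assumes "u \<in> A" "u \<notin> M"
  shows "\<exists>v\<in>A. u * v = 1"
proof -
  have "ev u \<noteq> 0" using assms by (simp add: M_def)
  then have "inverse u \<in> A" "u \<noteq> 0" using unit assms ev_simps by auto
  then show ?thesis by (intro bexI[of _ "inverse u"]) auto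
qed

lemma of_nat_not_in_prime:
  assumes "is_prime A P" "0 < k"
  shows "of_nat k \<notin> P"
proof
  assume "of_nat k \<in> P"
  then have "ev (c (of_nat k)) = 0" using prime_subset_M[OF assms(1)] by (auto simp: M_def c_of_nat)
  then show False using assms(2) by (simp add: ev_c)
qed

lemma zero_prime: "is_prime A {0}"
  using sub by (auto simp: is_prime_def is_ideal_def)

lemma system_T: "system T E"
  unfolding system_def der_def M_def using T_A ev_T E_der E_A E_c E_T T_gen by auto

text \<open>At the point, \<open>D k\<close> reads off the coefficient of \<open>g k\<close>: the
  terms in which a coefficient is differentiated keep a factor \<open>g i\<close>, which vanishes
  there.\<close>

lemma ev_system_deriv:
  assumes g: "system g D" and k: "k < n" and a: "\<And>i. i < n \<Longrightarrow> a i \<in> A"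
  shows "ev (D k (\<Sum>i<n. a i * g i)) = ev (a k)"
proof -
  have dk: "derivation (D k)" "\<And>x. x \<in> A \<Longrightarrow> D k x \<in> A" using g k by (auto simp: system_def der_def)
  have gA: "g i \<in> A" "ev (g i) = 0" if "i < n" for i using g that by (auto simp: system_def M_def)
  have sk: "(\<Sum>i<n. a i * (if k = i then 1 else 0)) = a k"
    using k by (simp add: if_distrib cong: if_cong)
  have "D k (\<Sum>i<n. a i * g i) = (\<Sum>i<n. D k (a i) * g i + a i * (if k = i then 1 else 0))"
    unfolding derivation_simps(7)[OF dk(1)] derivation_simps(2)[OF dk(1)]
    using g k by (intro sum.cong) (auto simp: system_def)
  also have "\<dots> = (\<Sum>i<n. D k (a i) * g i) + a k"
    using sk by (simp add: sum.distrib)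
  finally have "ev (D k (\<Sum>i<n. a i * g i)) = ev ((\<Sum>i<n. D k (a i) * g i) + a k)" by simp
  also have "\<dots> = ev (\<Sum>i<n. D k (a i) * g i) + ev (a k)"
    using k a gA dk by (intro ev_add sub) auto
  also have "ev (\<Sum>i<n. D k (a i) * g i) = (\<Sum>i<n. ev (D k (a i) * g i))"
    using a gA dk by (intro ev_simps sub) auto
  also have "\<dots> = 0" using a gA dk by (intro sum.neutral) (auto simp: ev_mult)
  finally show ?thesis by simp
qed

lemma system_permute:
  assumes g: "system g D" and t: "bij_betw t {..<n} {..<n}"
  shows "system (g \<circ> t) (D \<circ> t)"
proof -
  have tn: "t i < n" if "i < n" for i using t that by (auto simp: bij_betw_def)
  have tinj: "t i = t j \<longleftrightarrow> i = j" if "i < n" "j < n" for i j using t that by (auto simp: bij_betw_def inj_on_def)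
  have "\<exists>a. (\<forall>i<n. a i \<in> A) \<and> u = (\<Sum>i<n. a i * (g \<circ> t) i)" if u: "u \<in> M" for u
  proof -
    obtain a where a: "\<forall>i<n. a i \<in> A" "u = (\<Sum>i<n. a i * g i)" using g u by (auto simp: system_def)
    have "u = (\<Sum>i<n. a (t i) * g (t i))" unfolding a(2)
      using sum.reindex_bij_betw[OF t, of "\<lambda>i. a i * g i"] by simp
    then show ?thesis using a(1) tn by (intro exI[of _ "a \<circ> t"]) auto
  qed
  then show ?thesis using g tn tinj unfolding system_def by auto
qed

text \<open>Steinitz exchange. By \<open>ev_system_deriv\<close> the condition on
  \<open>D k u\<close> says that \<open>u\<close> has a unit coefficient at \<open>g k\<close>. The
  dual derivations follow suit: \<open>D k\<close> is rescaled to take the value \<open>1\<close> on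
  \<open>u\<close>, and the others are corrected by multiples of \<open>D k\<close> so as to kill
  \<open>u\<close>.\<close>

lemma system_exchange:
  assumes g: "system g D" and k: "k < n" and u: "u \<in> M" and Du: "ev (D k u) \<noteq> 0"
  shows "\<exists>D'. system (g(k := u)) D'"
proof -
  have d: "derivation (D i)" "\<And>x. x \<in> A \<Longrightarrow> D i x \<in> A" "D i (c a) = 0" if "i < n" for i a
    using g that by (auto simp: system_def der_def)
  have uA: "u \<in> A" using u by (simp add: M_def)
  define w where "w = inverse (D k u)"
  have wA: "w \<in> A" unfolding w_def using unit d(2)[OF k uA] Du by simp
  have "D k u \<noteq> 0" using Du ev_simps by auto
  then have w1: "w * D k u = 1" by (simp add: w_def)
  define D' where "D' = (\<lambda>i. if i = k then (\<lambda>x. w * D k x) else (\<lambda>x. D i x + (- D i u * w) * D k x))"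
  have "der (D' i)" if "i < n" for i
  proof -
    have "derivation (\<lambda>x. w * D k x)" using derivation_lin[of "D k" "D k" w 0] d[OF k] by simp
    moreover have "derivation (\<lambda>x. D i x + (- D i u * w) * D k x)"
      using derivation_lin[of "D i" "D k" 1 "- D i u * w"] d[OF k] d[OF that] by simp
    ultimately show ?thesis
      unfolding der_def D'_def using d[OF that] d[OF k] wA uA
      by (simp add: sub del: mult_minus_left)
  qed
  moreover have "D' i ((g(k := u)) j) = (if i = j then 1 else 0)" if "i < n" "j < n" for i j
    using g w1 that k by (auto simp: D'_def system_def mult.assoc)
  moreover have "\<exists>b. (\<forall>i<n. b i \<in> A) \<and> v = (\<Sum>i<n. b i * (g(k := u)) i)" if v: "v \<in> M" for v
  proof -
    obtain a where a: "\<forall>i<n. a i \<in> A" "u = (\<Sum>i<n. a i * g i)" using g u by (auto simp: system_def)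
    obtain b where b: "\<forall>i<n. b i \<in> A" "v = (\<Sum>i<n. b i * g i)" using g v by (auto simp: system_def)
    have ak: "ev (a k) \<noteq> 0" using ev_system_deriv[OF g k, of a] a Du by auto
    have akA: "inverse (a k) \<in> A" "a k \<noteq> 0" using unit[of "a k"] ak a(1) k ev_simps(1) by auto
    \<comment> \<open>Solving \<open>u = (\<Sum>i<n. a i * g i)\<close> for \<open>g k\<close> and
      substituting into \<open>v\<close> gives \<open>u\<close> the coefficient
      \<open>z\<close>.\<close>
    define z where "z = b k * inverse (a k)"
    define b' where "b' = (\<lambda>i. if i = k then z else b i - z * a i)"
    have "\<forall>i<n. b' i \<in> A" using a(1) b(1) akA k by (auto simp: b'_def z_def intro!: sub)
    moreover have "v = (\<Sum>i<n. b' i * (g(k := u)) i)"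
    proof -
      have "(\<Sum>i<n. b' i * (g(k := u)) i) = z * u + (\<Sum>i\<in>{..<n} - {k}. (b i - z * a i) * g i)"
        using k by (subst sum.remove[of _ k]) (auto simp: b'_def)
      also have "(\<Sum>i\<in>{..<n} - {k}. (b i - z * a i) * g i) = (\<Sum>i<n. (b i - z * a i) * g i)"
        using k akA by (subst (2) sum.remove[of _ k]) (auto simp: z_def)
      also have "\<dots> = v - z * u" unfolding a(2) b(2)
        by (simp add: left_diff_distrib sum_subtractf sum_distrib_left mult.assoc)
      finally show ?thesis by simp
    qed
    ultimately show ?thesis by blast
  qed
  ultimately show ?thesis using g u unfolding system_def by (intro exI[of _ D']) auto
qed

text \<open>Elements of \<open>M\<close> whose differentials at the point are linearly independent
  start a system. They are exchanged in one at a time; the exchange can only get stuck if the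
  differential of \<open>h k\<close> depends on those of the earlier elements.\<close>

lemma system_extend:
  fixes m :: nat and h :: "nat \<Rightarrow> 'b"
  assumes h: "\<And>l. l < m \<Longrightarrow> h l \<in> M"
    and indep: "\<And>s. (\<And>i. i < n \<Longrightarrow> ev (E i (\<Sum>l<m. c (s l) * h l)) = 0) \<Longrightarrow> \<forall>l<m. s l = 0"
  shows "m \<le> n \<and> (\<exists>g D. system g D \<and> (\<forall>l<m. g l = h l))"
proof -
  have "k \<le> m \<Longrightarrow> k \<le> n \<and> (\<exists>g D. system g D \<and> (\<forall>l<k. g l = h l))" for k
  proof (induction k)
    case 0
    then show ?case using system_T by auto
  next
    case (Suc k)
    then obtain g D where g: "system g D" "\<forall>l<k. g l = h l" and k: "k \<le> n" "k < m" by auto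
    have d: "derivation (D i)" "\<And>x. x \<in> A \<Longrightarrow> D i x \<in> A" "\<And>a. D i (c a) = 0" if "i < n" for i
      using g that by (auto simp: system_def der_def)
    have hA: "h l \<in> A" "ev (h l) = 0" if "l < m" for l using h[OF that] by (auto simp: M_def)
    have "\<exists>j. k \<le> j \<and> j < n \<and> ev (D j (h k)) \<noteq> 0"
    proof (rule ccontr)
      assume "\<not> ?thesis"
      then have no: "\<And>j. k \<le> j \<Longrightarrow> j < n \<Longrightarrow> ev (D j (h k)) = 0" by auto
      \<comment> \<open>Suppose that no position from \<open>k\<close> on can receive
        \<open>h k\<close>. Then \<open>h k\<close>, corrected by its coefficients along the earlier
        elements, is killed at the point by all \<open>D j\<close>; its own coefficient
        \<open>1\<close> contradicts independence.\<close>
      define s where "s = (\<lambda>l. if l < k then - ev (D l (h k)) else if l = k then 1 else 0)"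
      define w where "w = (\<Sum>l<m. c (s l) * h l)"
      have wM: "w \<in> M" unfolding w_def using h
        by (intro ideal_closed(5)[OF M_ideal] ideal_closed(3)[OF M_ideal] c_A) auto
      have Djw: "ev (D j w) = 0" if j: "j < n" for j
      proof -
        have "D j w = (\<Sum>l<m. c (s l) * D j (h l))"
          unfolding w_def derivation_simps(7)[OF d(1)[OF j]] derivation_simps(2)[OF d(1)[OF j]] d(3)[OF j] by simp
        then have "ev (D j w) = ev (\<Sum>l<m. c (s l) * D j (h l))" by simp
        also have "\<dots> = (\<Sum>l<m. ev (c (s l) * D j (h l)))"
          using hA d(2)[OF j] by (intro ev_simps(5) sub(5) c_A) auto
        also have "\<dots> = (\<Sum>l<m. s l * ev (D j (h l)))"
          using hA d(2)[OF j] by (intro sum.cong) (auto simp: ev_mult c_A ev_c)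
        also have "\<dots> = (\<Sum>l\<in>{..<Suc k}. s l * ev (D j (h l)))"
          using k by (intro sum.mono_neutral_right) (auto simp: s_def)
        also have "\<dots> = (\<Sum>l<k. s l * (if j = l then 1 else 0)) + ev (D j (h k))"
        proof -
          have "ev (D j (h l)) = (if j = l then 1 else 0)" if "l < k" for l
          proof -
            have "D j (g l) = (if j = l then 1 else 0)" using g(1) j k that by (simp add: system_def)
            then show ?thesis using g(2) that ev_simps(1,2) by simp
          qed
          then show ?thesis by (simp add: s_def)
        qed
        also have "\<dots> = 0" using no[of j] j by (cases "j < k") (simp_all add: s_def sum.delta' if_distrib[of "\<lambda>x. _ * x"] cong: if_cong)
        finally show ?thesis .
      qed
      obtain a where a: "\<forall>i<n. a i \<in> A" "w = (\<Sum>i<n. a i * g i)" using g wM by (auto simp: system_def)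
      have ea: "ev (a j) = 0" if "j < n" for j using ev_system_deriv[OF g(1) that, of a] Djw[OF that] a by auto
      \<comment> \<open>Independence is stated for the derivations \<open>E\<close>, not for
        \<open>D\<close>. Now all \<open>a j\<close> and all \<open>g j\<close> lie in
        \<open>M\<close>, so \<open>w\<close> is in the square of \<open>M\<close>, and every
        derivation of \<open>A\<close> sends it into \<open>M\<close>.\<close>
      have "ev (E i w) = 0" if i: "i < n" for i
      proof -
        have gA: "g j \<in> A" "ev (g j) = 0" if "j < n" for j using g that by (auto simp: system_def M_def)
        have "E i w = (\<Sum>j<n. E i (a j) * g j + a j * E i (g j))"
          unfolding a(2) derivation_simps(7)[OF E_der[OF i]] derivation_simps(2)[OF E_der[OF i]] ..
        also have "ev \<dots> = (\<Sum>j<n. ev (E i (a j) * g j + a j * E i (g j)))"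
          using a(1) gA E_A[OF i] by (intro ev_simps sub) auto
        also have "\<dots> = 0" using a(1) gA E_A[OF i] ea by (intro sum.neutral) (simp add: ev_add ev_mult sub)
        finally show ?thesis .
      qed
      then have "\<forall>l<m. s l = 0" by (intro indep[of s, folded w_def])
      then have "s k = 0" using k by blast
      then show False by (simp add: s_def)
    qed
    then obtain j where j: "k \<le> j" "j < n" "ev (D j (h k)) \<noteq> 0" by blast
    \<comment> \<open>Brings the replaceable element to position \<open>k\<close>; since
      \<open>k \<le> j\<close>, the positions below \<open>k\<close>, already occupied by
      \<open>h\<close>, do not move.\<close>
    define t where "t = Transposition.transpose k j"
    have t: "bij_betw t {..<n} {..<n}" unfolding t_def bij_betw_def
      using j by (auto simp: inj_on_def image_iff Transposition.transpose_def
          dest: leD split: if_splits)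
    have "system (g \<circ> t) (D \<circ> t)" by (rule system_permute[OF g(1) t])
    moreover have "ev ((D \<circ> t) k (h k)) \<noteq> 0" using j by (simp add: t_def)
    ultimately obtain D' where D': "system ((g \<circ> t)(k := h k)) D'"
      using system_exchange[of "g \<circ> t" "D \<circ> t" k "h k"] h k j by auto
    moreover have "((g \<circ> t)(k := h k)) l = h l" if "l < Suc k" for l
      using that g(2) j by (auto simp: t_def Transposition.transpose_def less_Suc_eq)
    ultimately show ?case using j by fastforce
  qed
  from this[of m] show ?thesis by simp
qed

text \<open>After completing \<open>h\<close> to a system \<open>g\<close>, the quotient has
  dimension \<open>n - m\<close>, and its maximal ideal is generated by the remaining
  \<open>n - m\<close> members of \<open>g\<close>. It is enough that every prime containing
  \<open>h\<close> contains \<open>I\<close>: dimension depends only on primes, and the generators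
  need only \<open>h\<close> to lie in \<open>I\<close>.\<close>

lemma regularI:
  fixes m :: nat and h :: "nat \<Rightarrow> 'b"
  assumes idI: "is_ideal A I" "I \<subseteq> M" and h: "\<And>l. l < m \<Longrightarrow> h l \<in> I"
    and indep: "\<And>s. (\<And>i. i < n \<Longrightarrow> ev (E i (\<Sum>l<m. c (s l) * h l)) = 0) \<Longrightarrow> \<forall>l<m. s l = 0"
    and prime: "\<And>P. is_prime A P \<Longrightarrow> (\<And>l. l < m \<Longrightarrow> h l \<in> P) \<Longrightarrow> I \<subseteq> P"
  shows "regular_local_ring (subring_of A Quot I)"
proof -
  interpret subring_quotient A I using A idI(1) by unfold_locales
  have "m \<le> n \<and> (\<exists>g D. system g D \<and> (\<forall>l<m. g l = h l))"
    using h idI(2) indep by (intro system_extend) auto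
  then obtain g D where mn: "m \<le> n" and g: "system g D" and gh: "\<And>l. l < m \<Longrightarrow> g l = h l" by auto
  have d: "derivation (D i)" "\<And>x. x \<in> A \<Longrightarrow> D i x \<in> A" if "i < n" for i
    using g that by (auto simp: system_def der_def)
  have Dg: "D i (g j) = (if i = j then 1 else 0)" if "i < n" "j < n" for i j using g that by (auto simp: system_def)
  have gM: "g i \<in> M" if "i < n" for i using g that by (auto simp: system_def)
  define d' where "d' = n - m"
  \<comment> \<open>The order is reversed so that differentiation removes \<open>g (n - 1)\<close>,
    ..., \<open>g m\<close> first: after \<open>d'\<close> steps the prime still contains
    \<open>g 0\<close>, ..., \<open>g (m - 1)\<close>, that is \<open>h\<close>, and therefore
    \<open>I\<close>.\<close>
  define r where "r i = n - Suc i" for i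
  have r: "r i < n" "i < n \<Longrightarrow> r (r i) = i" if "0 < n" for i using that by (auto simp: r_def)
  have "\<exists>S. S 0 = M \<and> (\<forall>t\<le>n. is_prime A (S t)) \<and> (\<forall>t<n. S (Suc t) \<subset> S t) \<and>
    (\<forall>t\<le>n. \<forall>l<n. t \<le> l \<longrightarrow> g (r l) \<in> S t) \<and> (\<forall>t\<le>n. \<forall>u\<in>S t. \<forall>l<t. D (r l) u \<in> M)"
    using d gM Dg of_nat_not_in_prime[OF M_prime]
    by (intro differential_chain[OF A M_prime]) (auto simp: r_def)
  then obtain S where S': "S 0 = M \<and> (\<forall>t\<le>n. is_prime A (S t)) \<and> (\<forall>t<n. S (Suc t) \<subset> S t) \<and>
    (\<forall>t\<le>n. \<forall>l<n. t \<le> l \<longrightarrow> g (r l) \<in> S t) \<and> (\<forall>t\<le>n. \<forall>u\<in>S t. \<forall>l<t. D (r l) u \<in> M)"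
    by (rule exE)
  then have S: "S 0 = M" "\<And>t. t \<le> n \<Longrightarrow> is_prime A (S t)" "\<And>t. t < n \<Longrightarrow> S (Suc t) \<subset> S t"
    "\<And>t l. t \<le> n \<Longrightarrow> l < n \<Longrightarrow> t \<le> l \<Longrightarrow> g (r l) \<in> S t" "\<And>t u l. t \<le> n \<Longrightarrow> u \<in> S t \<Longrightarrow> l < t \<Longrightarrow> D (r l) u \<in> M"
    by simp_all
  have IS: "I \<subseteq> S d'"
  proof (rule prime)
    show "is_prime A (S d')" using S(2) by (simp add: d'_def)
    show "h l \<in> S d'" if "l < m" for l
      using S(4)[of d' "r l"] mn that r[of l] gh[OF that] by (auto simp: d'_def r_def)
  qed
  have S_anti: "S t' \<subseteq> S t" if "t \<le> t'" "t' \<le> n" for t t'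
    using that(1,2)
  proof (induction t' rule: dec_induct)
    case (step k)
    then show ?case using S(3)[of k] by auto
  qed simp
  have chain: "prime_chain A I d' (\<lambda>i. S (d' - i))"
    unfolding prime_chain_def
  proof (intro conjI allI impI)
    show "is_prime A (S (d' - i))" for i using S(2) by (simp add: d'_def)
    show "I \<subseteq> S (d' - i)" for i using IS S_anti[of "d' - i" d'] by (simp add: d'_def subset_trans)
    show "S (d' - i) \<subset> S (d' - Suc i)" if "i < d'" for i
      using S(3)[of "d' - Suc i"] that by (simp add: d'_def Suc_diff_Suc)
  qed
  \<comment> \<open>The smallest prime of the chain contains \<open>h\<close>, so differentiating it
    along \<open>D 0\<close>, ..., \<open>D (m - 1)\<close> yields \<open>m\<close> further primes
    below it, and the whole chain of length \<open>m + l\<close> is bounded by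
    \<open>n\<close>.\<close>
  have upper: "l \<le> d'" if P: "prime_chain A I l P" for l P
  proof -
    have P0: "is_prime A (P 0)" "I \<subseteq> P 0" using P by (auto simp: prime_chain_def)
    have gP: "g l \<in> P 0" if "l < m" for l using gh h P0(2) that by auto
    have "\<exists>R. R 0 = P 0 \<and> (\<forall>t\<le>m. is_prime A (R t)) \<and> (\<forall>t<m. R (Suc t) \<subset> R t) \<and>
      (\<forall>t\<le>m. \<forall>l<m. t \<le> l \<longrightarrow> g l \<in> R t) \<and> (\<forall>t\<le>m. \<forall>u\<in>R t. \<forall>l<t. D l u \<in> P 0)"
      using d mn gP Dg of_nat_not_in_prime[OF P0(1)]
      by (intro differential_chain[OF A P0(1)]) auto
    then obtain R where R: "R 0 = P 0" "\<And>t. t \<le> m \<Longrightarrow> is_prime A (R t)" "\<And>t. t < m \<Longrightarrow> R (Suc t) \<subset> R t"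
      by metis
    have "prime_chain A {} (m + l) (\<lambda>i. if i < m then R (m - i) else P (i - m))"
      unfolding prime_chain_def
    proof (intro conjI allI impI)
      fix i
      assume "i \<le> m + l"
      then show "is_prime A (if i < m then R (m - i) else P (i - m))"
        using R(2)[of "m - i"] P by (auto simp: prime_chain_def)
    next
      fix i
      assume i: "i < m + l"
      consider "Suc i < m" | "Suc i = m" | "m \<le> i" by linarith
      then show "(if i < m then R (m - i) else P (i - m)) \<subset> (if Suc i < m then R (m - Suc i) else P (Suc i - m))"
      proof cases
        case 1
        then show ?thesis using R(3)[of "m - Suc i"] by (simp add: Suc_diff_Suc)
      next
        case 2
        then show ?thesis using R(3)[of 0] R(1) by auto
      next
        case 3
        then show ?thesis using P i by (auto simp: prime_chain_def Suc_diff_le)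
      qed
    qed simp
    then have "m + l \<le> n" by (rule dim)
    then show ?thesis by (simp add: d'_def)
  qed
  have kd: "krull_dim (subring_of A Quot I) = enat d'"
    unfolding krull_dim_quot using chain upper
    by (intro antisym Sup_least Sup_upper) auto
  define B where "B = g ` {m..<n}"
  \<comment> \<open>First derivatives of elements of \<open>I\<close> in the directions from
    \<open>m\<close> on lie in \<open>M\<close>, because \<open>I\<close> is contained in
    \<open>S d'\<close>; the derivative of \<open>g i - g j\<close> in direction \<open>i\<close> is
    \<open>1\<close>.\<close>
  have diff: "i = j" if ij: "m \<le> i" "i < n" "m \<le> j" "j < n" "g i - g j \<in> I" for i j
  proof (rule ccontr)
    assume "i \<noteq> j"
    then have "D i (g i - g j) = 1" using Dg ij d by (simp add: derivation_simps)
    moreover have "D (r (r i)) (g i - g j) \<in> M"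
      using S(5)[of d' "g i - g j" "r i"] ij IS by (auto simp: d'_def r_def)
    ultimately show False using ij r(2)[of i] primeD(2)[OF M_prime] by auto
  qed
  have "inj_on g {m..<n}"
    using diff ideal_closed(1)[OF idI(1)] by (intro inj_onI) (metis atLeastLessThan_iff diff_self)
  then have "card B = d'" by (simp add: B_def card_image d'_def)
  moreover have "M \<subseteq> K" if K: "is_ideal A K" "I \<subseteq> K" "B \<subseteq> K" for K
  proof
    fix u assume "u \<in> M"
    then obtain a where a: "\<forall>i<n. a i \<in> A" "u = (\<Sum>i<n. a i * g i)" using g by (auto simp: system_def)
    have "g i \<in> K" if "i < n" for i
      using that K h gh by (cases "i < m") (auto simp: B_def)
    then show "u \<in> K" unfolding a(2) using a(1)
      by (intro ideal_closed(5)[OF K(1)] ideal_closed(3)[OF K(1)]) auto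
  qed
  moreover have "B \<subseteq> M" using gM by (auto simp: B_def)
  moreover have "b = b'" if bb: "b \<in> B" "b' \<in> B" "b - b' \<in> I" for b b'
  proof -
    obtain i j where ij: "b = g i" "b' = g j" "m \<le> i" "i < n" "m \<le> j" "j < n"
      using bb(1,2) unfolding B_def by auto
    then show ?thesis using diff[of i j] bb(3) by simp
  qed
  moreover have "finite B" by (simp add: B_def)
  ultimately show ?thesis
    using kd by (intro iffD2[OF regular_quot_iff[OF M_ideal primeD(2)[OF M_prime] unit_M idI(2) noeth]] exI[of _ B]
      conjI ballI allI impI) (blast | simp)+
qed

text \<open>An ideal with zero differentials at the point leaves the cotangent space unchanged, so
  the maximal ideal of the quotient still needs \<open>n\<close> generators. Yet its dimension is
  below \<open>n\<close>: as \<open>A\<close> lies in a field, \<open>{0}\<close> is a prime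
  strictly below every prime containing the nonzero ideal \<open>I\<close>.\<close>

lemma not_regularI:
  assumes idI: "is_ideal A I" "I \<subseteq> M" "I \<noteq> {0}" and EI: "\<And>i u. i < n \<Longrightarrow> u \<in> I \<Longrightarrow> ev (E i u) = 0"
  shows "\<not> regular_local_ring (subring_of A Quot I)"
proof
  interpret subring_quotient A I using A idI(1) by unfold_locales
  assume reg: "regular_local_ring (subring_of A Quot I)"
  from iffD1[OF regular_quot_iff[OF M_ideal primeD(2)[OF M_prime] unit_M idI(2) noeth] reg]
  obtain B where "finite B \<and> B \<subseteq> M \<and> (\<forall>b\<in>B. \<forall>b'\<in>B. b - b' \<in> I \<longrightarrow> b = b') \<and>
      (\<forall>K. is_ideal A K \<longrightarrow> I \<subseteq> K \<longrightarrow> B \<subseteq> K \<longrightarrow> M \<subseteq> K) \<and> enat (card B) = krull_dim (subring_of A Quot I)"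
    by (rule exE)
  then have B: "finite B" "B \<subseteq> M" "\<And>K. is_ideal A K \<Longrightarrow> I \<subseteq> K \<Longrightarrow> B \<subseteq> K \<Longrightarrow> M \<subseteq> K"
    "enat (card B) = krull_dim (subring_of A Quot I)"
    by simp_all
  have cardB: "n \<le> card B"
  proof (rule ccontr)
    assume "\<not> ?thesis"
    then obtain s where s: "\<exists>i\<in>{..<n}. s i \<noteq> 0" "\<forall>b\<in>B. (\<Sum>i<n. s i * ev (E i b)) = 0"
      using underdetermined_system[of B "{..<n}" "\<lambda>i b. ev (E i b)"] B(1) by auto
    \<comment> \<open>Fewer than \<open>n\<close> generators leave a nonzero direction
      \<open>s\<close> along which all their differentials vanish. The elements of \<open>M\<close>
      with this property form an ideal containing \<open>I\<close> and \<open>B\<close>, but not all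
      the \<open>T j\<close>.\<close>
    define K where "K = {u \<in> M. (\<Sum>i<n. s i * ev (E i u)) = 0}"
    have MA: "u \<in> A" "ev u = 0" if "u \<in> M" for u using that by (auto simp: M_def)
    have "is_ideal A K"
      unfolding is_ideal_def
    proof (intro conjI ballI)
      show "K \<subseteq> A" using MA by (auto simp: K_def)
      show "0 \<in> K" using ideal_closed(1)[OF M_ideal] by (simp add: K_def derivation_simps[OF E_der] ev_simps)
      show "x + y \<in> K" if "x \<in> K" "y \<in> K" for x y
        using that ideal_closed(2)[OF M_ideal, of x y] MA E_A
        by (auto simp: K_def derivation_simps[OF E_der] ev_add distrib_left sum.distrib)
      show "a * x \<in> K" if ax: "a \<in> A" "x \<in> K" for a x
      proof -
        have "x \<in> M" using ax by (simp add: K_def)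
        have "ev (E i (a * x)) = ev a * ev (E i x)" if "i < n" for i
          using MA[OF \<open>x \<in> M\<close>] ax E_A[OF that] by (simp add: derivation_simps[OF E_der[OF that]] ev_add ev_mult sub)
        then have "(\<Sum>i<n. s i * ev (E i (a * x))) = ev a * (\<Sum>i<n. s i * ev (E i x))"
          by (simp add: sum_distrib_left mult.left_commute)
        then show ?thesis using ax ideal_closed(3)[OF M_ideal, of a x] by (simp add: K_def)
      qed
    qed
    moreover have "I \<subseteq> K" using idI(2) EI by (auto simp: K_def)
    moreover have "B \<subseteq> K" using B(2) s(2) by (auto simp: K_def)
    ultimately have "M \<subseteq> K" by (rule B(3))
    have "s j = 0" if "j < n" for j
    proof -
      have "T j \<in> K" using \<open>M \<subseteq> K\<close> T_A ev_T that by (auto simp: M_def)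
      then have "(\<Sum>i<n. s i * ev (if i = j then 1 else 0)) = 0"
        using E_T that by (simp add: K_def)
      moreover have "(\<Sum>i<n. s i * ev (if i = j then 1 else 0)) = (\<Sum>i<n. if i = j then s i else 0)"
        by (intro sum.cong) (auto simp: ev_simps)
      ultimately show ?thesis using that by simp
    qed
    then show False using s(1) by auto
  qed
  \<comment> \<open>Otherwise all chains have length at most \<open>n - 1\<close>, less than
    \<open>card B\<close>. The case \<open>n = 0\<close> is excluded beforehand by the one-term
    chain \<open>M\<close>.\<close>
  have "\<exists>l P. n \<le> l \<and> prime_chain A I l P"
  proof (rule ccontr)
    assume no: "\<not> ?thesis"
    have "prime_chain A I 0 (\<lambda>_. M)" using M_prime idI(2) by (simp add: prime_chain_def)
    then have "n > 0" using no by auto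
    have "l \<le> n - 1" if "prime_chain A I l P" for l P
    proof -
      have "\<not> n \<le> l" using no that by blast
      then show ?thesis by simp
    qed
    then have "krull_dim (subring_of A Quot I) \<le> enat (n - 1)"
      unfolding krull_dim_quot by (intro Sup_least) auto
    then have "card B \<le> n - 1" using B(4) by (metis enat_ord_simps(1))
    then show False using cardB \<open>n > 0\<close> by simp
  qed
  then obtain l P where l: "n \<le> l" and P: "prime_chain A I l P" by blast
  have "prime_chain A {} (Suc l) (\<lambda>i. case i of 0 \<Rightarrow> {0} | Suc j \<Rightarrow> P j)"
    unfolding prime_chain_def
  proof (intro conjI allI impI)
    fix i assume "i \<le> Suc l"
    then show "is_prime A (case i of 0 \<Rightarrow> {0} | Suc j \<Rightarrow> P j)"
      using P zero_prime by (auto simp: prime_chain_def split: nat.split)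
  next
    fix i assume i: "i < Suc l"
    obtain x where "x \<in> I" "x \<noteq> 0" using idI(3) ideal_closed(1)[OF idI(1)] by blast
    moreover have "I \<subseteq> P 0" using P by (auto simp: prime_chain_def)
    ultimately have "{0} \<subset> P 0" using ideal_closed(1)[OF idI(1)] by blast
    then show "(case i of 0 \<Rightarrow> {0} | Suc j \<Rightarrow> P j) \<subset> (case Suc i of 0 \<Rightarrow> {0} | Suc j \<Rightarrow> P j)"
      using P i by (auto simp: prime_chain_def split: nat.split)
  qed simp
  then have "Suc l \<le> n" by (rule dim)
  then show False using l by simp
qed

end

section \<open>The Hilbert basis theorem\<close>

text \<open>The ascending chain condition: the ideal of all terms is the union of the increasing
  ideals \<open>G N\<close>, and finitely many generators already lie in one of them.\<close>

lemma noetherian_sequence: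
  assumes A: "is_subring A" and N: "noetherian_set A" and a: "\<And>i::nat. a i \<in> A"
  shows "\<exists>N u. (\<forall>i. u i \<in> A) \<and> a N = (\<Sum>i<N. u i * a i)"
proof -
  note sub = subring_closed[OF A]
  define G where "G = (\<lambda>N. {\<Sum>i<N. u i * a i | u. \<forall>i. u i \<in> A})"
  have mono: "G N \<subseteq> G N'" if "N \<le> N'" for N N'
  proof
    fix x assume "x \<in> G N"
    then obtain u where u: "\<forall>i. u i \<in> A" "x = (\<Sum>i<N. u i * a i)" by (auto simp: G_def)
    have "x = (\<Sum>i<N'. (if i < N then u i else 0) * a i)"
      unfolding u(2) using that by (intro sum.mono_neutral_cong_left) auto
    then show "x \<in> G N'" using u(1) sub(1) unfolding G_def
      by (intro CollectI exI[of _ "\<lambda>i. if i < N then u i else 0"]) auto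
  qed
  have id: "is_ideal A (G N)" for N
    unfolding is_ideal_def
  proof (intro conjI ballI)
    show "G N \<subseteq> A" using a by (auto simp: G_def intro!: sub)
    show "0 \<in> G N" using sub(1) by (auto simp: G_def intro!: exI[of _ "\<lambda>_. 0"])
    show "x + y \<in> G N" if xy: "x \<in> G N" "y \<in> G N" for x y
    proof -
      obtain u v where "\<forall>i. u i \<in> A" "x = (\<Sum>i<N. u i * a i)" "\<forall>i. v i \<in> A" "y = (\<Sum>i<N. v i * a i)"
        using xy by (auto simp: G_def)
      then show ?thesis using sub(3) unfolding G_def
        by (intro CollectI exI[of _ "\<lambda>i. u i + v i"]) (auto simp: distrib_right sum.distrib)
    qed
    show "b * x \<in> G N" if bx: "b \<in> A" "x \<in> G N" for b x
    proof -
      obtain u where "\<forall>i. u i \<in> A" "x = (\<Sum>i<N. u i * a i)" using bx by (auto simp: G_def)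
      then show ?thesis using sub(5) bx unfolding G_def
        by (intro CollectI exI[of _ "\<lambda>i. b * u i"]) (auto simp: sum_distrib_left mult.assoc)
    qed
  qed
  define I where "I = (\<Union>N. G N)"
  have "is_ideal A I"
    unfolding is_ideal_def
  proof (intro conjI ballI)
    show "I \<subseteq> A" using ideal_closed(4)[OF id] by (auto simp: I_def)
    show "0 \<in> I" using ideal_closed(1)[OF id] by (auto simp: I_def)
    show "b * x \<in> I" if "b \<in> A" "x \<in> I" for b x
      using that ideal_closed(3)[OF id] by (auto simp: I_def)
    show "x + y \<in> I" if xy: "x \<in> I" "y \<in> I" for x y
    proof -
      obtain N N' where "x \<in> G N" "y \<in> G N'" using xy by (auto simp: I_def)
      then have "x \<in> G (max N N')" "y \<in> G (max N N')" using mono[of N "max N N'"] mono[of N' "max N N'"] by auto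
      then show ?thesis using ideal_closed(2)[OF id] by (auto simp: I_def)
    qed
  qed
  then obtain B where B: "finite B" "B \<subseteq> I" "\<And>J. is_ideal A J \<Longrightarrow> B \<subseteq> J \<Longrightarrow> I \<subseteq> J"
    using N unfolding noetherian_set_def by meson
  have "\<exists>N. B \<subseteq> G N" using B(1,2)
  proof (induction B rule: finite_induct)
    case (insert b B)
    then obtain N N' where "B \<subseteq> G N" "b \<in> G N'" by (auto simp: I_def)
    then have "insert b B \<subseteq> G (max N N')" using mono[of N "max N N'"] mono[of N' "max N N'"] by auto
    then show ?case by blast
  qed simp
  then obtain N where "B \<subseteq> G N" by blast
  then have "I \<subseteq> G N" using B(3) id by blast
  moreover have "(\<Sum>i<N. (if i = N then 1 else 0) * a i) = 0" by (rule sum.neutral) auto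
  then have "a N = (\<Sum>i<Suc N. (if i = N then 1 else 0) * a i)" by simp
  then have "a N \<in> G (Suc N)" using sub(1,2) unfolding G_def
    by (intro CollectI exI[of _ "\<lambda>i. if i = N then 1 else 0"]) auto
  then have "a N \<in> I" by (auto simp: I_def)
  ultimately have "a N \<in> G N" by blast
  then show ?thesis by (auto simp: G_def)
qed

text \<open>Values of polynomials at \<open>x\<close> instead of a polynomial ring: this treats
  transcendental and algebraic elements alike, so that adjunctions can be iterated inside one
  type.\<close>

definition adjoin :: "'b::comm_ring_1 set \<Rightarrow> 'b \<Rightarrow> 'b set" where
  "adjoin A x = {poly p x | p. \<forall>i. coeff p i \<in> A}"

lemma coeff_mult_closed:
  assumes "is_subring A" "\<forall>i. coeff p i \<in> A" "\<forall>i. coeff q i \<in> A"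
  shows "coeff (p * q) i \<in> A"
  unfolding coeff_mult using assms(2,3) by (intro subring_closed[OF assms(1)]) auto

lemma adjoin_subring:
  assumes "is_subring A"
  shows "is_subring (adjoin A x)"
  unfolding is_subring_def
proof (intro conjI ballI)
  note sub = subring_closed[OF assms]
  show "1 \<in> adjoin A x" unfolding adjoin_def using sub(1,2)
    by (intro CollectI exI[of _ 1]) (auto simp: coeff_1)
  fix u v assume "u \<in> adjoin A x" "v \<in> adjoin A x"
  then obtain p q where pq: "\<forall>i. coeff p i \<in> A" "u = poly p x" "\<forall>i. coeff q i \<in> A" "v = poly q x"
    by (auto simp: adjoin_def)
  then show "u - v \<in> adjoin A x" unfolding adjoin_def using sub(4)
    by (intro CollectI exI[of _ "p - q"]) auto
  show "u * v \<in> adjoin A x" unfolding adjoin_def using pq coeff_mult_closed[OF assms]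
    by (intro CollectI exI[of _ "p * q"]) auto
qed

lemma adjoin_memI:
  assumes "is_subring A"
  shows "a \<in> A \<Longrightarrow> a \<in> adjoin A x" "x \<in> adjoin A x"
proof -
  note sub = subring_closed[OF assms]
  show "a \<in> A \<Longrightarrow> a \<in> adjoin A x" unfolding adjoin_def using sub(1)
    by (intro CollectI exI[of _ "[:a:]"]) (auto simp: coeff_pCons split: nat.split)
  show "x \<in> adjoin A x" unfolding adjoin_def using sub(1,2)
    by (intro CollectI exI[of _ "[:0, 1:]"]) (auto simp: coeff_pCons split: nat.split)
qed

text \<open>The classical proof by leading coefficients. A value at \<open>x\<close> has no degree,
  so degrees are minimized over the polynomials that represent elements of \<open>I\<close>.\<close>

theorem hilbert_basis:
  fixes A :: "'b::comm_ring_1 set"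
  assumes A: "is_subring A" and N: "noetherian_set A"
  shows "noetherian_set (adjoin A x)"
  unfolding noetherian_set_def
proof (intro allI impI)
  note sub = subring_closed[OF A]
  fix I assume I: "is_ideal (adjoin A x) I"
  define AX where "AX = {p. \<forall>i. coeff p i \<in> A}"
  define G where "G = (\<lambda>(p :: nat \<Rightarrow> 'b poly) N. {\<Sum>i<N. u i * poly (p i) x | u. \<forall>i. u i \<in> adjoin A x})"
  show "\<exists>B. finite B \<and> B \<subseteq> I \<and> (\<forall>J. is_ideal (adjoin A x) J \<longrightarrow> B \<subseteq> J \<longrightarrow> I \<subseteq> J)"
  proof (rule ccontr)
    assume no: "\<not> ?thesis"
    define C where "C = (\<lambda>p N. {q \<in> AX. poly q x \<in> I \<and> poly q x \<notin> G p N})"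
    have ne: "C p N \<noteq> {}" if p: "\<And>i. i < N \<Longrightarrow> p i \<in> AX \<and> poly (p i) x \<in> I" for p N
    proof
      assume "C p N = {}"
      then have sub': "I \<subseteq> G p N" using I unfolding C_def AX_def adjoin_def is_ideal_def by blast
      have "I \<subseteq> J" if J: "is_ideal (adjoin A x) J" "(\<lambda>i. poly (p i) x) ` {..<N} \<subseteq> J" for J
      proof -
        have "G p N \<subseteq> J" unfolding G_def using J(2)
          by (auto intro!: ideal_closed(5)[OF J(1)] ideal_closed(3)[OF J(1)])
        then show ?thesis using sub' by blast
      qed
      moreover have "(\<lambda>i. poly (p i) x) ` {..<N} \<subseteq> I" using p by auto
      ultimately show False using no by (meson finite_imageI finite_lessThan)
    qed
    \<comment> \<open>Well-founded dependent choice: \<open>p N\<close> has least degree among the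
      polynomials whose value lies in \<open>I\<close> but not in the ideal generated by the earlier
      values.\<close>
    have "\<exists>p. \<forall>N. (\<forall>i<N. p i \<in> AX \<and> poly (p i) x \<in> I) \<longrightarrow> p N \<in> C p N \<and> (\<forall>q\<in>C p N. degree (p N) \<le> degree q)"
    proof (rule dependent_wf_choice[OF wf_less])
      fix p q :: "nat \<Rightarrow> 'b poly" and N :: nat and r
      assume eq: "\<And>z. (z, N) \<in> {(x, y). x < y} \<Longrightarrow> p z = q z"
      have "G p N = G q N" unfolding G_def using eq by (intro Collect_cong ex_cong1) (auto intro!: sum.cong)
      then have "C p N = C q N" by (simp add: C_def)
      then show "((\<forall>i<N. p i \<in> AX \<and> poly (p i) x \<in> I) \<longrightarrow> r \<in> C p N \<and> (\<forall>q\<in>C p N. degree r \<le> degree q)) =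
        ((\<forall>i<N. q i \<in> AX \<and> poly (q i) x \<in> I) \<longrightarrow> r \<in> C q N \<and> (\<forall>s\<in>C q N. degree r \<le> degree s))"
        using eq by simp
    next
      fix N :: nat and p :: "nat \<Rightarrow> 'b poly"
      show "\<exists>r. (\<forall>i<N. p i \<in> AX \<and> poly (p i) x \<in> I) \<longrightarrow> r \<in> C p N \<and> (\<forall>q\<in>C p N. degree r \<le> degree q)"
      proof (cases "\<forall>i<N. p i \<in> AX \<and> poly (p i) x \<in> I")
        case True
        then obtain q0 where "q0 \<in> C p N" using ne[of N p] by auto
        then show ?thesis using ex_has_least_nat[of "\<lambda>q. q \<in> C p N" q0 degree] by blast
      qed blast
    qed
    then obtain p where p: "\<And>N. (\<And>i. i < N \<Longrightarrow> p i \<in> AX \<and> poly (p i) x \<in> I) \<Longrightarrow>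
      p N \<in> C p N \<and> (\<forall>q\<in>C p N. degree (p N) \<le> degree q)" by blast
    have pI: "p N \<in> AX \<and> poly (p N) x \<in> I" for N
    proof (induction N rule: less_induct)
      case (less N)
      then show ?case using p[of N] by (auto simp: C_def)
    qed
    then have pC: "p N \<in> C p N" and min: "q \<in> C p N \<Longrightarrow> degree (p N) \<le> degree q" for N q
      using p by auto
    have zero: "0 \<in> adjoin A x" using adjoin_memI(1)[OF A sub(1)] .
    have Gmono: "G p i \<subseteq> G p N" if "i \<le> N" for i N
    proof
      fix y assume "y \<in> G p i"
      then obtain u where u: "\<forall>i. u i \<in> adjoin A x" "y = (\<Sum>j<i. u j * poly (p j) x)" by (auto simp: G_def)
      have "y = (\<Sum>j<N. (if j < i then u j else 0) * poly (p j) x)"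
        unfolding u(2) using that by (intro sum.mono_neutral_cong_left) auto
      then show "y \<in> G p N" using u(1) zero unfolding G_def
        by (intro CollectI exI[of _ "\<lambda>j. if j < i then u j else 0"]) auto
    qed
    have mono: "degree (p i) \<le> degree (p N)" if "i \<le> N" for i N
      using min[of "p N" i] pC[of N] Gmono[OF that] by (auto simp: C_def)
    define a where "a = (\<lambda>i. lead_coeff (p i))"
    have aA: "a i \<in> A" for i using pI[of i] by (auto simp: a_def AX_def)
    obtain N u where u: "\<forall>i. u i \<in> A" "a N = (\<Sum>i<N. u i * a i)"
      using noetherian_sequence[OF A N, of a] aA by blast
    define d where "d = degree (p N)"
    \<comment> \<open>The earlier polynomials, shifted to degree \<open>d\<close> and combined so
      that the coefficient of \<open>s\<close> in degree \<open>d\<close> is the leading coefficient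
      of \<open>p N\<close>.\<close>
    define s where "s = (\<Sum>i<N. monom (u i) (d - degree (p i)) * p i)"
    define q where "q = p N - s"
    have sA: "coeff s j \<in> A" for j
      unfolding s_def coeff_sum coeff_monom_mult using u(1) pI sub by (auto simp: AX_def intro!: sub(9))
    have mA: "poly (monom (u i) k) x \<in> adjoin A x" for i k
      unfolding adjoin_def using u(1) sub(1) by (intro CollectI exI[of _ "monom (u i) k"]) (auto simp: coeff_monom)
    have sG: "poly s x \<in> G p N" unfolding G_def s_def poly_sum poly_mult
      using mA by (intro CollectI exI[of _ "\<lambda>i. poly (monom (u i) (d - degree (p i))) x"]) auto
    have "poly q x \<notin> G p N"
    proof
      assume qG: "poly q x \<in> G p N"
      obtain v where v: "\<forall>i. v i \<in> adjoin A x" "poly q x = (\<Sum>i<N. v i * poly (p i) x)" using qG by (auto simp: G_def)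
      obtain w where w: "\<forall>i. w i \<in> adjoin A x" "poly s x = (\<Sum>i<N. w i * poly (p i) x)" using sG by (auto simp: G_def)
      have "poly (p N) x = (\<Sum>i<N. (v i + w i) * poly (p i) x)"
      proof -
        have "poly (p N) x = poly q x + poly s x" by (simp add: q_def)
        then show ?thesis unfolding v(2) w(2) by (simp add: distrib_right sum.distrib)
      qed
      then have "poly (p N) x \<in> G p N" unfolding G_def using v(1) w(1) subring_closed(3)[OF adjoin_subring[OF A]]
        by (intro CollectI exI[of _ "\<lambda>i. v i + w i"]) auto
      then show False using pC[of N] by (simp add: C_def)
    qed
    moreover have "poly q x \<in> I"
    proof -
      have "poly s x \<in> I" unfolding s_def poly_sum poly_mult
        using pI mA by (intro ideal_closed(5)[OF I] ideal_closed(3)[OF I]) auto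
      then show ?thesis using ideal_diff(2)[OF adjoin_subring[OF A] I] pI by (simp add: q_def)
    qed
    moreover have "q \<in> AX" using pI[of N] sA sub(4) by (auto simp: AX_def q_def)
    ultimately have qC: "q \<in> C p N" by (simp add: C_def)
    have degs: "degree s \<le> d" unfolding s_def
    proof (rule degree_sum_le)
      fix i assume "i \<in> {..<N}"
      then have "degree (p i) \<le> d" using mono by (simp add: d_def)
      then show "degree (monom (u i) (d - degree (p i)) * p i) \<le> d"
        using degree_mult_le[of "monom (u i) (d - degree (p i))" "p i"] degree_monom_le[of "u i" "d - degree (p i)"] by simp
    qed simp
    have "coeff s d = (\<Sum>i<N. u i * a i)" unfolding s_def coeff_sum coeff_monom_mult a_def
    proof (rule sum.cong)
      fix i assume "i \<in> {..<N}"
      then have "degree (p i) \<le> d" using mono by (simp add: d_def)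
      then show "(if d < d - degree (p i) then 0 else u i * coeff (p i) (d - (d - degree (p i)))) = u i * lead_coeff (p i)"
        by simp
    qed simp
    \<comment> \<open>Minimality forces \<open>degree q = d\<close> although the coefficient there
      is zero. Hence \<open>q\<close> is the zero polynomial, which is impossible since its value is
      outside \<open>G p N\<close>; this covers \<open>d = 0\<close> as well.\<close>
    then have "coeff q d = 0" using u(2) by (simp add: q_def a_def d_def)
    moreover have "degree q \<le> d" unfolding q_def using degs by (intro degree_diff_le) (auto simp: d_def)
    moreover have "d \<le> degree q" using min[OF qC] by (simp add: d_def)
    ultimately have "q = 0" using leading_coeff_0_iff[of q] by simp
    then have "poly q x \<in> G p N" unfolding G_def using zero by (auto intro!: exI[of _ "\<lambda>_. 0"])
    then show False using qC by (simp add: C_def)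
  qed
qed

section \<open>Localization, and algebraic independence along chains of primes\<close>

lemma ideal_contraction:
  assumes "is_subring B" "B \<subseteq> A" "is_ideal A I"
  shows "is_ideal B (I \<inter> B)"
  unfolding is_ideal_def
proof (intro conjI ballI)
  note sub = subring_closed[OF assms(1)] and idl = ideal_closed[OF assms(3)]
  show "0 \<in> I \<inter> B" using sub(1) idl(1) by simp
  show "x + y \<in> I \<inter> B" if "x \<in> I \<inter> B" "y \<in> I \<inter> B" for x y using that sub(3) idl(2) by simp
  show "a * x \<in> I \<inter> B" if "a \<in> B" "x \<in> I \<inter> B" for a x using that sub(5) idl(3)[of a x] assms(2) by auto
qed simp

text \<open>By \<open>frac\<close> every element of \<open>A\<close> is an element of
  \<open>B\<close> divided by a unit of \<open>A\<close> taken from \<open>B\<close>. An ideal of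
  \<open>A\<close> is therefore generated by its intersection with \<open>B\<close>.\<close>

lemma noetherian_localization:
  assumes B: "is_subring B" "noetherian_set B" and A: "is_subring A" "B \<subseteq> A"
    and frac: "\<And>u. u \<in> A \<Longrightarrow> \<exists>s\<in>B. \<exists>t\<in>A. s * t = 1 \<and> s * u \<in> B"
  shows "noetherian_set A"
  unfolding noetherian_set_def
proof (intro allI impI)
  fix I assume I: "is_ideal A I"
  have "is_ideal B (I \<inter> B)" by (rule ideal_contraction[OF B(1) A(2) I])
  then obtain C where C: "finite C" "C \<subseteq> I \<inter> B" "\<And>J. is_ideal B J \<Longrightarrow> C \<subseteq> J \<Longrightarrow> I \<inter> B \<subseteq> J"
    using B(2) unfolding noetherian_set_def by meson
  have "I \<subseteq> J" if J: "is_ideal A J" "C \<subseteq> J" for J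
  proof
    fix u assume u: "u \<in> I"
    then obtain s t where st: "s \<in> B" "t \<in> A" "s * t = 1" "s * u \<in> B" using frac[of u] ideal_closed(4)[OF I] by blast
    have "is_ideal B (J \<inter> B)" by (rule ideal_contraction[OF B(1) A(2) J(1)])
    then have "I \<inter> B \<subseteq> J" using C(3)[of "J \<inter> B"] C(2) J(2) by blast
    moreover have "s * u \<in> I" using ideal_closed(3)[OF I] st(1) A(2) u by blast
    ultimately have "t * (s * u) \<in> J" using ideal_closed(3)[OF J(1) st(2)] st(4) by blast
    moreover have "t * (s * u) = u" using st(3) by (simp add: mult.assoc[symmetric] mult.commute)
    ultimately show "u \<in> J" by simp
  qed
  then show "\<exists>B. finite B \<and> B \<subseteq> I \<and> (\<forall>J. is_ideal A J \<longrightarrow> B \<subseteq> J \<longrightarrow> I \<subseteq> J)" using C by blast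
qed

text \<open>Elements taken from the successive steps of a chain satisfy no polynomial relation
  modulo the bottom prime. The least power of \<open>u 0\<close> can be divided out since
  \<open>u 0\<close> is not in \<open>P 0\<close>. Modulo the next prime only the terms with that
  least exponent survive, which is a relation in one variable fewer along the chain without
  \<open>P 0\<close>.\<close>

lemma prime_chain_independent:
  fixes c :: "'a::field \<Rightarrow> 'b::comm_ring_1" and P :: "nat \<Rightarrow> 'b set"
  assumes A: "is_subring A" and c: "\<And>a b. c (a * b) = c a * c b" "c 1 = 1" "\<And>a. c a \<in> A" "c 0 = 0"
    and P: "\<And>i. i \<le> l \<Longrightarrow> is_prime A (P i)" "\<And>i. i < l \<Longrightarrow> P i \<subseteq> P (Suc i)"
    and u: "\<And>i. i < l \<Longrightarrow> u i \<in> P (Suc i) - P i"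
    and S: "finite S" "\<And>\<alpha> i. \<alpha> \<in> S \<Longrightarrow> l \<le> i \<Longrightarrow> \<alpha> i = 0"
    and rel: "(\<Sum>\<alpha>\<in>S. c (k \<alpha>) * (\<Prod>i<l. u i ^ \<alpha> i)) \<in> P 0"
    and \<alpha>: "\<alpha> \<in> S"
  shows "k \<alpha> = (0::'a)"
  using P u S rel \<alpha>
proof (induction l arbitrary: P u S k \<alpha>)
  case 0
  have z: "\<beta> = (\<lambda>_. 0)" if "\<beta> \<in> S" for \<beta> using 0 that by (intro ext) auto
  then have "S = {\<lambda>_. 0}" using z[of \<alpha>] 0(7) by blast
  then have "c (k \<alpha>) \<in> P 0" using 0 by auto
  then have "k \<alpha> \<noteq> 0 \<Longrightarrow> c (inverse (k \<alpha>) * k \<alpha>) \<in> P 0"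
    unfolding c(1) using 0(1)[of 0] c(3) by (intro ideal_closed(3)[OF primeD(1)]) auto
  then show ?case using primeD(2)[OF 0(1)[of 0]] c(2) by auto
next
  case (Suc l)
  note P = Suc.prems(1,2) and u = Suc.prems(3) and S = Suc.prems(4,5) and rel = Suc.prems(6)
  note sub = subring_closed[OF A]
  have Pid: "is_ideal A (P i)" if "i \<le> Suc l" for i using primeD(1)[OF P(1)[OF that]] .
  have uA: "u i \<in> A" if "i < Suc l" for i using u[OF that] ideal_closed(4)[OF Pid[of "Suc i"]] that by auto
  define S' where "S' = {\<alpha> \<in> S. k \<alpha> \<noteq> 0}"
  show ?case
  proof (rule ccontr)
    assume k0: "k \<alpha> \<noteq> 0"
    have "\<alpha> \<in> S'" using Suc.prems(7) k0 by (simp add: S'_def)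
    have "finite S'" using S by (simp add: S'_def)
    define a where "a = Min ((\<lambda>\<alpha>. \<alpha> 0) ` S')"
    have "a \<in> (\<lambda>\<alpha>. \<alpha> 0) ` S'" unfolding a_def using \<open>\<alpha> \<in> S'\<close> \<open>finite S'\<close> by (intro Min_in) auto
    then obtain \<beta> where \<beta>: "\<beta> \<in> S'" "\<beta> 0 = a" by auto
    have amin: "a \<le> \<gamma> 0" if "\<gamma> \<in> S'" for \<gamma> unfolding a_def using that \<open>finite S'\<close> by auto
    define m where "m = (\<lambda>\<gamma> :: nat \<Rightarrow> nat. \<Prod>i<l. u (Suc i) ^ \<gamma> (Suc i))"
    have mA: "m \<gamma> \<in> A" for \<gamma> unfolding m_def using uA by (intro sub) auto
    define r where "r = (\<lambda>\<gamma>. c (k \<gamma>) * (u 0 ^ (\<gamma> 0 - a) * m \<gamma>))"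
    have rA: "r \<gamma> \<in> A" for \<gamma> unfolding r_def using mA uA[of 0] c(3) by (intro sub) auto
    have "(\<Sum>\<gamma>\<in>S. c (k \<gamma>) * (\<Prod>i<Suc l. u i ^ \<gamma> i)) = (\<Sum>\<gamma>\<in>S'. u 0 ^ a * r \<gamma>)"
    proof (rule sum.mono_neutral_cong_right)
      fix \<gamma> assume "\<gamma> \<in> S'"
      then have "u 0 ^ \<gamma> 0 = u 0 ^ a * u 0 ^ (\<gamma> 0 - a)" using amin by (simp flip: power_add)
      then show "c (k \<gamma>) * (\<Prod>i<Suc l. u i ^ \<gamma> i) = u 0 ^ a * r \<gamma>"
        by (simp add: prod.lessThan_Suc_shift r_def m_def ac_simps del: prod.lessThan_Suc)
    qed (use S c(4) in \<open>auto simp: S'_def\<close>)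
    then have "u 0 ^ a * (\<Sum>\<gamma>\<in>S'. r \<gamma>) \<in> P 0" using rel by (simp add: sum_distrib_left)
    moreover have "u 0 ^ a \<notin> P 0" using prime_power_mem[OF A P(1) uA, of 0 0 a] u[of 0] by auto
    ultimately have "(\<Sum>\<gamma>\<in>S'. r \<gamma>) \<in> P 0"
      using primeD(3)[OF P(1)[of 0], of "u 0 ^ a" "\<Sum>\<gamma>\<in>S'. r \<gamma>"] rA uA[of 0] by (auto simp: sub)
    then have r1: "(\<Sum>\<gamma>\<in>S'. r \<gamma>) \<in> P 1" using P(2)[of 0] by auto
    define S2 where "S2 = {\<gamma> \<in> S'. \<gamma> 0 = a}"
    have "(\<Sum>\<gamma>\<in>S' - S2. r \<gamma>) \<in> P 1"
    proof (rule ideal_closed(5)[OF Pid])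
      fix \<gamma> assume "\<gamma> \<in> S' - S2"
      then have "a < \<gamma> 0" using amin[of \<gamma>] by (auto simp: S2_def)
      then obtain j where "\<gamma> 0 - a = Suc j" by (metis Suc_diff_Suc)
      then have "r \<gamma> = (c (k \<gamma>) * (u 0 ^ j * m \<gamma>)) * u 0" by (simp add: r_def ac_simps)
      then show "r \<gamma> \<in> P 1" using ideal_closed(3)[OF Pid[of 1]] u[of 0] uA[of 0] mA c(3) by (simp add: sub)
    qed simp
    moreover have "(\<Sum>\<gamma>\<in>S'. r \<gamma>) = (\<Sum>\<gamma>\<in>S' - S2. r \<gamma>) + (\<Sum>\<gamma>\<in>S2. r \<gamma>)"
      using \<open>finite S'\<close> by (intro sum.subset_diff) (auto simp: S2_def)
    ultimately have "(\<Sum>\<gamma>\<in>S2. r \<gamma>) \<in> P 1"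
      using ideal_diff(2)[OF A Pid[of 1] r1] by (metis add_diff_cancel_left' One_nat_def le_add1 plus_1_eq_Suc)
    moreover have "(\<Sum>\<gamma>\<in>S2. r \<gamma>) = (\<Sum>\<gamma>\<in>S2. c (k \<gamma>) * m \<gamma>)"
      by (intro sum.cong) (auto simp: r_def S2_def)
    ultimately have m1: "(\<Sum>\<gamma>\<in>S2. c (k \<gamma>) * m \<gamma>) \<in> P (Suc 0)" by simp
    \<comment> \<open>All surviving exponent vectors begin with \<open>a\<close>, so deleting the
      first entry is injective and no coefficients get merged.\<close>
    have unshift: "case_nat a (\<gamma> \<circ> Suc) = \<gamma>" if "\<gamma> \<in> S2" for \<gamma>
      using that by (auto simp: S2_def split: nat.split)
    have inj: "inj_on (\<lambda>\<gamma>. \<gamma> \<circ> Suc) S2" by (rule inj_on_inverseI[of _ "case_nat a"]) (rule unshift)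
    have "(k \<circ> case_nat a) (\<beta> \<circ> Suc) = 0"
    proof (rule Suc.IH[of "P \<circ> Suc" "u \<circ> Suc" "(\<lambda>\<gamma>. \<gamma> \<circ> Suc) ` S2" "k \<circ> case_nat a" "\<beta> \<circ> Suc"])
      have "(\<Sum>\<alpha>\<in>(\<lambda>\<gamma>. \<gamma> \<circ> Suc) ` S2. c ((k \<circ> case_nat a) \<alpha>) * (\<Prod>i<l. (u \<circ> Suc) i ^ \<alpha> i)) = (\<Sum>\<gamma>\<in>S2. c (k \<gamma>) * m \<gamma>)"
        unfolding sum.reindex[OF inj] by (intro sum.cong) (auto simp: m_def unshift)
      then show "(\<Sum>\<alpha>\<in>(\<lambda>\<gamma>. \<gamma> \<circ> Suc) ` S2. c ((k \<circ> case_nat a) \<alpha>) * (\<Prod>i<l. (u \<circ> Suc) i ^ \<alpha> i)) \<in> (P \<circ> Suc) 0"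
        using m1 by simp
      show "finite ((\<lambda>\<gamma>. \<gamma> \<circ> Suc) ` S2)" using \<open>finite S'\<close> by (simp add: S2_def)
      show "\<alpha> i = 0" if "\<alpha> \<in> (\<lambda>\<gamma>. \<gamma> \<circ> Suc) ` S2" "l \<le> i" for \<alpha> i
        using that S(2) by (auto simp: S2_def S'_def)
      show "\<beta> \<circ> Suc \<in> (\<lambda>\<gamma>. \<gamma> \<circ> Suc) ` S2" using \<beta> by (auto simp: S2_def)
    qed (use P u in auto)
    then have "k \<beta> = 0" using unshift[of \<beta>] \<beta> by (simp add: S2_def)
    then show False using \<beta> by (simp add: S'_def)
  qed
qed

section \<open>Multivariate polynomials\<close>

abbreviation Cst :: "'a::zero \<Rightarrow> ('v, 'a) mpol" where "Cst a \<equiv> Poly_Mapping.single 0 a"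
abbreviation Vr :: "'v \<Rightarrow> ('v, 'a::zero_neq_one) mpol" where
  "Vr i \<equiv> Poly_Mapping.single (Poly_Mapping.single i (Suc 0)) 1"

definition mmono :: "('v \<Rightarrow> 'r::comm_semiring_1) \<Rightarrow> ('v \<Rightarrow>\<^sub>0 nat) \<Rightarrow> 'r" where
  "mmono t m = (\<Prod>i\<in>Poly_Mapping.keys m. t i ^ Poly_Mapping.lookup m i)"

text \<open>Evaluation with values in another ring, the coefficients being sent through
  \<open>c\<close>. Besides \<open>peval\<close>, it covers dehomogenization, with values in the
  fraction field.\<close>

definition mev :: "('a::zero \<Rightarrow> 'r::comm_semiring_1) \<Rightarrow> ('v \<Rightarrow> 'r) \<Rightarrow> ('v, 'a) mpol \<Rightarrow> 'r" where
  "mev c t p = (\<Sum>m\<in>Poly_Mapping.keys p. c (Poly_Mapping.lookup p m) * mmono t m)"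

definition rhom :: "('a::comm_ring_1 \<Rightarrow> 'r::comm_ring_1) \<Rightarrow> bool" where
  "rhom c \<longleftrightarrow> (\<forall>a b. c (a + b) = c a + c b \<and> c (a * b) = c a * c b) \<and> c 1 = 1"

lemma rhomD:
  assumes "rhom c"
  shows "c (a + b) = c a + c b" "c (a * b) = c a * c b" "c 1 = 1" "c 0 = 0" "c (- a) = - c a" "c (a - b) = c a - c b"
    "c (sum f S) = (\<Sum>i\<in>S. c (f i))" "c (of_nat k) = of_nat k" "c (prod f S) = (\<Prod>i\<in>S. c (f i))"
proof -
  show a: "c (a + b) = c a + c b" and m: "c (a * b) = c a * c b" and o: "c 1 = 1" for a b
    using assms by (auto simp: rhom_def)
  show z: "c 0 = 0" using a[of 0 0] by (metis add.right_neutral add_left_cancel)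
  show n: "c (- a) = - c a" for a using a[of a "- a"] z by (simp add: eq_neg_iff_add_eq_0 add.commute)
  show "c (a - b) = c a - c b" using a[of a "- b"] n[of b] by simp
  show "c (sum f S) = (\<Sum>i\<in>S. c (f i))" by (induction S rule: infinite_finite_induct) (auto simp: a z)
  show "c (of_nat k) = of_nat k" by (induction k) (auto simp: a z o)
  show "c (prod f S) = (\<Prod>i\<in>S. c (f i))" by (induction S rule: infinite_finite_induct) (auto simp: m o)
qed

lemma rhom_id: "rhom (\<lambda>x. x)" by (simp add: rhom_def)

lemma rhom_Cst: "rhom (Cst :: 'a::comm_ring_1 \<Rightarrow> ('v, 'a) mpol)"
  by (simp add: rhom_def single_add mult_single)

lemma peval_eq_mev: "peval = mev (\<lambda>a. a)"
  by (simp add: fun_eq_iff peval_def mev_def mmono_def)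

lemma mmono_superset:
  assumes "finite S" "Poly_Mapping.keys m \<subseteq> S"
  shows "mmono t m = (\<Prod>i\<in>S. t i ^ Poly_Mapping.lookup m i)"
  unfolding mmono_def using assms by (intro prod.mono_neutral_left) (auto simp: in_keys_iff)

lemma mmono_add: "mmono t (m + m') = mmono t m * mmono t m'"
proof -
  let ?S = "Poly_Mapping.keys m \<union> Poly_Mapping.keys m'"
  have "Poly_Mapping.keys (m + m') \<subseteq> ?S" by (rule Poly_Mapping.keys_add)
  then show ?thesis
    by (simp add: mmono_superset[of ?S] lookup_add power_add prod.distrib)
qed

lemma mmono_simps [simp]: "mmono t 0 = 1" "mmono t (Poly_Mapping.single i k) = t i ^ k"
  by (auto simp: mmono_def)

lemma sum_of_singles: "p = (\<Sum>m\<in>Poly_Mapping.keys p. Poly_Mapping.single m (Poly_Mapping.lookup p m))"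
proof (rule poly_mapping_eqI)
  fix k
  show "Poly_Mapping.lookup p k = Poly_Mapping.lookup (\<Sum>m\<in>Poly_Mapping.keys p. Poly_Mapping.single m (Poly_Mapping.lookup p m)) k"
    by (cases "k \<in> Poly_Mapping.keys p")
      (auto simp: lookup_sum lookup_single when_def sum.delta in_keys_iff)
qed

lemma mev_superset:
  assumes "rhom c" "finite S" "Poly_Mapping.keys p \<subseteq> S"
  shows "mev c t p = (\<Sum>m\<in>S. c (Poly_Mapping.lookup p m) * mmono t m)"
  unfolding mev_def using assms rhomD(4)[OF assms(1)] by (intro sum.mono_neutral_left) (auto simp: in_keys_iff)

lemma mev_add:
  assumes "rhom c"
  shows "mev c t (p + q) = mev c t p + mev c t q"
proof -
  let ?S = "Poly_Mapping.keys p \<union> Poly_Mapping.keys q"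
  have "Poly_Mapping.keys (p + q) \<subseteq> ?S" by (rule Poly_Mapping.keys_add)
  then show ?thesis
    by (simp add: mev_superset[OF assms, of ?S] lookup_add rhomD[OF assms] distrib_right sum.distrib)
qed

lemma mev_single:
  assumes "rhom c"
  shows "mev c t (Poly_Mapping.single m a) = c a * mmono t m"
  by (cases "a = 0") (auto simp: mev_def rhomD[OF assms])

lemma mev_0 [simp]: "mev c t 0 = 0"
  by (simp add: mev_def)

lemma mev_sum:
  assumes "rhom c"
  shows "mev c t (sum f S) = (\<Sum>i\<in>S. mev c t (f i))"
  by (induction S rule: infinite_finite_induct) (auto simp: mev_add[OF assms])

lemma mev_mult:
  assumes c: "rhom c"
  shows "mev c t (p * q) = mev c t p * mev c t q"
proof -
  let ?s = "\<lambda>p m. Poly_Mapping.single m (Poly_Mapping.lookup p m)"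
  have "p * q = (\<Sum>m\<in>Poly_Mapping.keys p. \<Sum>m'\<in>Poly_Mapping.keys q. ?s p m * ?s q m')"
    by (subst sum_of_singles[of p], subst sum_of_singles[of q]) (simp add: sum_product)
  then have "mev c t (p * q) = (\<Sum>m\<in>Poly_Mapping.keys p. \<Sum>m'\<in>Poly_Mapping.keys q.
      (c (Poly_Mapping.lookup p m) * mmono t m) * (c (Poly_Mapping.lookup q m') * mmono t m'))"
    by (simp add: mev_sum[OF c] mult_single mev_single[OF c] rhomD[OF c] mmono_add ac_simps)
  then show ?thesis by (simp add: mev_def sum_product)
qed

lemma mev_Cst_Vr:
  assumes "rhom c"
  shows "mev c t (Cst a) = c a" "mev c t (Vr i) = t i" "mev c t 1 = 1"
  using mev_single[OF assms, of t 0 1] by (auto simp: mev_single[OF assms] rhomD[OF assms])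

lemma rhom_mev: "rhom c \<Longrightarrow> rhom (mev c t)"
  unfolding rhom_def[of "mev c t"] by (simp add: mev_add mev_mult mev_Cst_Vr)

lemma rhom_peval: "rhom (peval x)"
  using rhom_mev[OF rhom_id, of x] by (simp add: peval_eq_mev)

lemmas mev_rhom = rhomD[OF rhom_mev]
lemmas peval_rhom = rhomD[OF rhom_peval]

lemma peval_Cst_Vr [simp]: "peval x (Cst a) = (a :: 'a::comm_ring_1)" "peval x (Vr i) = (x i :: 'a)"
  by (simp_all add: peval_eq_mev mev_Cst_Vr[OF rhom_id])

lemma peval_single: "peval x (Poly_Mapping.single m a) = (a :: 'a::comm_ring_1) * mmono x m"
  by (simp add: peval_eq_mev mev_single[OF rhom_id])

lemma rhom_power: "rhom c \<Longrightarrow> c (a ^ k) = c a ^ k"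
  by (induction k) (auto simp: rhomD)

lemma Vr_power: "Vr i ^ k = (Poly_Mapping.single (Poly_Mapping.single i k) 1 :: ('v, 'a::comm_ring_1) mpol)"
  by (induction k) (auto simp: mult_single simp flip: single_add)

lemma single_as_product: "Poly_Mapping.single m a = Cst a * (mmono Vr m :: ('v, 'a::comm_ring_1) mpol)"
proof -
  have "finite S \<Longrightarrow> (\<Prod>i\<in>S. Vr i ^ k i) = (Poly_Mapping.single (\<Sum>i\<in>S. Poly_Mapping.single i (k i)) 1 :: ('v, 'a) mpol)" for S k
    by (induction S rule: finite_induct) (auto simp: Vr_power mult_single)
  then have "mmono Vr m = (Poly_Mapping.single m 1 :: ('v, 'a) mpol)"
    unfolding mmono_def using sum_of_singles[of m] by simp
  then show ?thesis by (simp add: mult_single)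
qed

lemma polys_Cst [intro, simp]: "Cst a \<in> polys V"
  by (cases "a = 0") (auto simp: polys_def)

lemma polys_Vr [intro, simp]: "i \<in> V \<Longrightarrow> (Vr i :: ('v, 'a::comm_ring_1) mpol) \<in> polys V"
  by (auto simp: polys_def)

lemma polys_subring: "is_subring (polys V :: ('v, 'a::comm_ring_1) mpol set)"
proof -
  have "(1 :: ('v, 'a) mpol) \<in> polys V" by (metis polys_Cst single_one)
  moreover have "x - y \<in> polys V" if "x \<in> polys V" "y \<in> polys V" for x y :: "('v, 'a) mpol"
  proof -
    have "Poly_Mapping.keys (x - y) \<subseteq> Poly_Mapping.keys x \<union> Poly_Mapping.keys y"
      by (auto simp: in_keys_iff lookup_minus)
    then show ?thesis using that by (fastforce simp: polys_def)
  qed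
  moreover have "x * y \<in> polys V" if "x \<in> polys V" "y \<in> polys V" for x y :: "('v, 'a) mpol"
    unfolding polys_def
  proof (intro CollectI ballI)
    fix m assume "m \<in> Poly_Mapping.keys (x * y)"
    then obtain a b where ab: "m = a + b" "a \<in> Poly_Mapping.keys x" "b \<in> Poly_Mapping.keys y"
      using keys_mult[of x y] by auto
    then show "Poly_Mapping.keys m \<subseteq> V" using that Poly_Mapping.keys_add[of a b] by (fastforce simp: polys_def)
  qed
  ultimately show ?thesis by (auto simp: is_subring_def)
qed

lemmas polys_closed = subring_closed[OF polys_subring]

lemma polys_mono: "V \<subseteq> W \<Longrightarrow> polys V \<subseteq> polys W"
  by (auto simp: polys_def)

lemma polys_induct [consumes 1, case_names Cst Vr add mult]:
  fixes p :: "('v, 'a::comm_ring_1) mpol"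
  assumes p: "p \<in> polys V" and C: "\<And>a. P (Cst a)" and X: "\<And>i. i \<in> V \<Longrightarrow> P (Vr i)"
    and add: "\<And>p q. p \<in> polys V \<Longrightarrow> q \<in> polys V \<Longrightarrow> P p \<Longrightarrow> P q \<Longrightarrow> P (p + q)"
    and mult: "\<And>p q. p \<in> polys V \<Longrightarrow> q \<in> polys V \<Longrightarrow> P p \<Longrightarrow> P q \<Longrightarrow> P (p * q)"
  shows "P p"
proof -
  have pow: "P (Vr i ^ k) \<and> (Vr i :: ('v, 'a) mpol) ^ k \<in> polys V" if "i \<in> V" for i k
    by (induction k) (use that X mult C[of 1] in \<open>auto intro!: polys_closed\<close>)
  have prod: "P (\<Prod>i\<in>S. Vr i ^ k i) \<and> (\<Prod>i\<in>S. (Vr i :: ('v, 'a) mpol) ^ k i) \<in> polys V" if "finite S" "S \<subseteq> V" for S k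
    using that
    by (induction S rule: finite_induct) (use pow mult C[of 1] in \<open>auto intro!: polys_closed\<close>)
  have single: "P (Poly_Mapping.single m a) \<and> Poly_Mapping.single m a \<in> polys V" if "Poly_Mapping.keys m \<subseteq> V" for m a
  proof -
    have "P (mmono Vr m) \<and> (mmono Vr m :: ('v, 'a) mpol) \<in> polys V"
      unfolding mmono_def by (rule prod[OF finite_keys that])
    then show ?thesis
      unfolding single_as_product[of m a] using mult[OF polys_Cst _ C] polys_closed(5)[OF polys_Cst] by blast
  qed
  have "P (\<Sum>m\<in>S. Poly_Mapping.single m (Poly_Mapping.lookup p m)) \<and> (\<Sum>m\<in>S. Poly_Mapping.single m (Poly_Mapping.lookup p m)) \<in> polys V"
    if "finite S" "S \<subseteq> Poly_Mapping.keys p" for S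
    using that
  proof (induction S rule: finite_induct)
    case empty
    then show ?case using C[of 0] polys_closed(1) by simp
  next
    case (insert m S)
    then have "Poly_Mapping.keys m \<subseteq> V" using p by (auto simp: polys_def)
    then show ?case using insert add single by (auto intro!: polys_closed)
  qed
  then show ?thesis using sum_of_singles[of p] by (metis finite_keys order_refl)
qed

section \<open>Formal partial derivatives\<close>

lemma lookup_partial_deriv:
  "Poly_Mapping.lookup (partial_deriv i p) m =
     of_nat (Poly_Mapping.lookup m i + 1) * Poly_Mapping.lookup p (m + Poly_Mapping.single i 1)"
proof -
  let ?e = "Poly_Mapping.single i (1::nat)"
  have eq: "m' = m + ?e" if "m' - ?e = m" "Poly_Mapping.lookup m' i \<noteq> 0" for m'
  proof (rule poly_mapping_eqI)
    fix k
    show "Poly_Mapping.lookup m' k = Poly_Mapping.lookup (m + ?e) k"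
      using that(2) by (auto simp: that(1)[symmetric] lookup_add lookup_minus lookup_single when_def)
  qed
  have t: "Poly_Mapping.lookup (Poly_Mapping.single (m' - ?e) (of_nat (Poly_Mapping.lookup m' i) * Poly_Mapping.lookup p m')) m
    = (if m' = m + ?e then of_nat (Poly_Mapping.lookup m i + 1) * Poly_Mapping.lookup p (m + ?e) else 0)" for m'
  proof (cases "m' = m + ?e")
    case True
    have "m + ?e - ?e = m" by simp
    then show ?thesis unfolding True by (simp add: lookup_add)
  next
    case False
    then have "Poly_Mapping.lookup m' i = 0 \<or> m' - ?e \<noteq> m" using eq by blast
    then show ?thesis using False by (auto simp: lookup_single when_def)
  qed
  show ?thesis
    unfolding partial_deriv_def lookup_sum t by (auto simp: sum.delta in_keys_iff)
qed

lemma partial_deriv_add: "partial_deriv i (p + q) = partial_deriv i p + partial_deriv i q"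
  by (rule poly_mapping_eqI) (simp add: lookup_partial_deriv lookup_add distrib_left)

lemma partial_deriv_0 [simp]: "partial_deriv i 0 = 0"
  by (simp add: partial_deriv_def)

lemma partial_deriv_sum: "partial_deriv i (sum f S) = (\<Sum>j\<in>S. partial_deriv i (f j))"
  by (induction S rule: infinite_finite_induct) (auto simp: partial_deriv_add)

lemma partial_deriv_single:
  "partial_deriv i (Poly_Mapping.single m a) =
     Poly_Mapping.single (m - Poly_Mapping.single i 1) (of_nat (Poly_Mapping.lookup m i) * a)"
  by (cases "a = 0") (auto simp: partial_deriv_def)

lemma partial_deriv_mult:
  fixes p q :: "('v, 'a::comm_ring_1) mpol"
  shows "partial_deriv i (p * q) = partial_deriv i p * q + p * partial_deriv i q"
proof -
  let ?e = "Poly_Mapping.single i (1::nat)"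
  let ?s = "\<lambda>p :: ('v, 'a) mpol. \<lambda>m. Poly_Mapping.single m (Poly_Mapping.lookup p m)"
  \<comment> \<open>If \<open>i\<close> does not occur in \<open>m\<close>, truncated subtraction
    may make the two exponents differ, but then both coefficients are zero.\<close>
  have shift: "Poly_Mapping.single (m + m' - ?e) (of_nat (Poly_Mapping.lookup m i) * a) =
      (Poly_Mapping.single (m - ?e + m') (of_nat (Poly_Mapping.lookup m i) * a) :: ('v, 'a) mpol)" for m m' a
  proof (cases "Poly_Mapping.lookup m i = 0")
    case False
    then have "m + m' - ?e = m - ?e + m'"
      by (intro poly_mapping_eqI) (auto simp: lookup_add lookup_minus lookup_single when_def)
    then show ?thesis by simp
  qed simp
  have *: "partial_deriv i (?s p m * ?s q m') = partial_deriv i (?s p m) * ?s q m' + ?s p m * partial_deriv i (?s q m')" for m m'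
  proof -
    let ?a = "Poly_Mapping.lookup p m" and ?b = "Poly_Mapping.lookup q m'"
    have "partial_deriv i (?s p m * ?s q m') =
        Poly_Mapping.single (m + m' - ?e) (of_nat (Poly_Mapping.lookup m i) * (?a * ?b)) +
        Poly_Mapping.single (m' + m - ?e) (of_nat (Poly_Mapping.lookup m' i) * (?a * ?b))"
      by (simp add: mult_single partial_deriv_single lookup_add distrib_right single_add add.commute)
    then show ?thesis unfolding shift by (simp add: mult_single partial_deriv_single ac_simps)
  qed
  have "partial_deriv i (p * q) = (\<Sum>m\<in>Poly_Mapping.keys p. \<Sum>m'\<in>Poly_Mapping.keys q. partial_deriv i (?s p m * ?s q m'))"
    by (subst sum_of_singles[of p], subst sum_of_singles[of q]) (simp add: sum_product partial_deriv_sum)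
  also have "\<dots> = partial_deriv i (\<Sum>m\<in>Poly_Mapping.keys p. ?s p m) * (\<Sum>m'\<in>Poly_Mapping.keys q. ?s q m') +
      (\<Sum>m\<in>Poly_Mapping.keys p. ?s p m) * partial_deriv i (\<Sum>m'\<in>Poly_Mapping.keys q. ?s q m')"
    unfolding * by (simp add: sum_product partial_deriv_sum sum.distrib)
  finally show ?thesis by (simp flip: sum_of_singles)
qed

lemma derivation_partial_deriv: "derivation (partial_deriv i :: ('v, 'a::comm_ring_1) mpol \<Rightarrow> _)"
  by (simp add: derivation_def partial_deriv_add partial_deriv_mult)

lemma partial_deriv_Cst_Vr [simp]:
  "partial_deriv i (Cst a) = 0" "partial_deriv i (Vr j :: ('v, 'a::comm_ring_1) mpol) = (if i = j then 1 else 0)"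
  by (auto simp: partial_deriv_single lookup_single when_def)

lemma partial_deriv_polys:
  fixes p :: "('v, 'a::comm_ring_1) mpol"
  assumes "p \<in> polys V"
  shows "partial_deriv i p \<in> polys V"
  using assms
  by (induction rule: polys_induct) (auto simp: partial_deriv_add partial_deriv_mult intro!: polys_closed)

lemma partial_deriv_eq_0:
  fixes p :: "('v, 'a::comm_ring_1) mpol"
  assumes "p \<in> polys V" "i \<notin> V"
  shows "partial_deriv i p = 0"
  using assms
  by (induction rule: polys_induct) (auto simp: partial_deriv_add partial_deriv_mult)

section \<open>Derivations, congruences and nonvanishing of values of polynomials\<close>

lemma derivation_mev:
  fixes p :: "('v, 'a::comm_ring_1) mpol"
  assumes p: "p \<in> polys V" and V: "finite V" and c: "rhom c" and D: "derivation D" and Dc: "\<And>a. D (c a) = 0"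
  shows "D (mev c t p) = (\<Sum>i\<in>V. mev c t (partial_deriv i p) * D (t i))"
  using p
proof (induction rule: polys_induct)
  case (Cst a)
  then show ?case by (simp add: mev_Cst_Vr[OF c] Dc)
next
  case (Vr j)
  then have "(\<Sum>i\<in>V. mev c t (if i = j then 1 else 0) * D (t i)) = (\<Sum>i\<in>V. if i = j then D (t i) else 0)"
    by (intro sum.cong) (auto simp: mev_Cst_Vr[OF c])
  then show ?case using Vr V by (simp add: mev_Cst_Vr[OF c])
next
  case (add p q)
  then show ?case by (simp add: partial_deriv_add mev_add[OF c] derivation_simps[OF D] distrib_right sum.distrib)
next
  case (mult p q)
  then show ?case
    by (simp add: partial_deriv_mult mev_add[OF c] mev_mult[OF c] derivation_simps[OF D] sum.distrib
        sum_distrib_left sum_distrib_right algebra_simps)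
qed

text \<open>With the whole ring as ideal this is closure of \<open>A\<close> under evaluation. With
  the ideal generated by coordinates centred at a point it compares a polynomial with its value
  there.\<close>

lemma mev_cong_ideal:
  fixes p :: "('v, 'a::comm_ring_1) mpol"
  assumes A: "is_subring A" and I: "is_ideal A I" and c: "rhom c" "\<And>a. c a \<in> A"
    and t: "\<And>i. i \<in> V \<Longrightarrow> t i \<in> A" "\<And>i. i \<in> V \<Longrightarrow> s i \<in> A" "\<And>i. i \<in> V \<Longrightarrow> t i - s i \<in> I"
    and p: "p \<in> polys V"
  shows "mev c t p \<in> A \<and> mev c s p \<in> A \<and> mev c t p - mev c s p \<in> I"
  using p
proof (induction rule: polys_induct)
  case (mult p q)
  note sub = subring_closed[OF A] and idl = ideal_closed[OF I]
  have eq: "mev c t p * mev c t q - mev c s p * mev c s q =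
    mev c t q * (mev c t p - mev c s p) + mev c s p * (mev c t q - mev c s q)" by (simp add: algebra_simps)
  then show ?case using mult sub(5) idl(2,3) unfolding mev_mult[OF c(1)] eq by blast
next
  case (add p q)
  note sub = subring_closed[OF A] and idl = ideal_closed[OF I]
  have eq: "mev c t p + mev c t q - (mev c s p + mev c s q) =
    (mev c t p - mev c s p) + (mev c t q - mev c s q)" by (simp add: algebra_simps)
  then show ?case using add sub(3) idl(2) unfolding mev_add[OF c(1)] eq by blast
qed (use c t ideal_closed(1)[OF I] in \<open>auto simp: mev_Cst_Vr[OF c(1)]\<close>)

lemma mev_closed:
  fixes p :: "('v, 'a::comm_ring_1) mpol"
  assumes "is_subring A" "rhom c" "\<And>a. c a \<in> A" "\<And>i. i \<in> V \<Longrightarrow> t i \<in> A" "p \<in> polys V"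
  shows "mev c t p \<in> A"
  using mev_cong_ideal[of A "A" c V t t p] assms subring_closed[OF assms(1)] by (auto simp: is_ideal_def)

lemma mev_cong:
  assumes "p \<in> polys V" "\<And>i. i \<in> V \<Longrightarrow> t i = s i"
  shows "mev c t p = mev c s p"
  unfolding mev_def mmono_def using assms by (intro sum.cong prod.cong arg_cong2[of _ _ _ _ "(*)"]) (auto simp: polys_def subset_iff)

lemma mev_comp:
  assumes "rhom c" "rhom d"
  shows "d (mev c t p) = mev (d \<circ> c) (d \<circ> t) p"
  unfolding mev_def mmono_def by (simp add: rhomD[OF assms(2)] rhom_power[OF assms(2)])

lemma polys_insert_as_poly:
  fixes p :: "('v, 'a::comm_ring_1) mpol"
  assumes "p \<in> polys (insert v V)"
  shows "\<exists>q. (\<forall>i. coeff q i \<in> polys V) \<and> poly q (Vr v) = p"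
  using assms
proof (induction rule: polys_induct)
  case (Cst a)
  show ?case by (intro exI[of _ "[:Cst a:]"]) (auto simp: coeff_pCons polys_closed(1) split: nat.split)
next
  case (Vr i)
  show ?case
  proof (cases "i = v")
    case True
    then show ?thesis by (intro exI[of _ "[:0, 1:]"]) (auto simp: coeff_pCons polys_closed(1,2) split: nat.split)
  next
    case False
    then show ?thesis using Vr by (intro exI[of _ "[:Vr i:]"]) (auto simp: coeff_pCons polys_closed(1) split: nat.split)
  qed
next
  case (add p q)
  then obtain p' q' where "\<forall>i. coeff p' i \<in> polys V" "poly p' (Vr v) = p" "\<forall>i. coeff q' i \<in> polys V" "poly q' (Vr v) = q" by auto
  then show ?case by (intro exI[of _ "p' + q'"]) (auto intro: polys_closed(3))
next
  case (mult p q)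
  then obtain p' q' where "\<forall>i. coeff p' i \<in> polys V" "poly p' (Vr v) = p" "\<forall>i. coeff q' i \<in> polys V" "poly q' (Vr v) = q" by auto
  then show ?case by (intro exI[of _ "p' * q'"]) (auto intro: coeff_mult_closed[OF polys_subring])
qed

lemma nonzero_value_exists:
  fixes p :: "('v, 'a::field_char_0) mpol"
  assumes "finite V" "p \<in> polys V" "p \<noteq> 0"
  shows "\<exists>x. (\<forall>i. i \<notin> V \<longrightarrow> x i = 0) \<and> peval x p \<noteq> 0"
  using assms
proof (induction V arbitrary: p rule: finite_induct)
  case empty
  then have "Poly_Mapping.keys p \<subseteq> {0}" by (auto simp: polys_def)
  then have "p = Cst (Poly_Mapping.lookup p 0)"
    by (intro poly_mapping_eqI) (auto simp: lookup_single when_def in_keys_iff)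
  then have "peval (\<lambda>_. 0) p = Poly_Mapping.lookup p 0" "Poly_Mapping.lookup p 0 \<noteq> 0"
    using empty(2) peval_Cst_Vr(1) by (metis, metis single_zero)
  then show ?case by (intro exI[of _ "\<lambda>_. 0"]) auto
next
  case (insert v V)
  obtain q where q: "\<forall>i. coeff q i \<in> polys V" "poly q (Vr v) = p" using polys_insert_as_poly[OF insert.prems(1)] by auto
  have "q \<noteq> 0" using q(2) insert.prems(2) by auto
  then have "lead_coeff q \<noteq> 0" by simp
  then obtain x where x: "\<forall>i. i \<notin> V \<longrightarrow> x i = 0" "peval x (lead_coeff q) \<noteq> 0" using insert.IH[of "lead_coeff q"] q(1) by auto
  define r where "r = map_poly (peval x) q"
  have cr: "coeff r i = peval x (coeff q i)" for i by (simp add: r_def coeff_map_poly peval_rhom)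
  have "r \<noteq> 0" using x(2) cr[of "degree q"] by auto
  then have "finite {a. poly r a = 0}" by (rule poly_roots_finite)
  then obtain a where a: "poly r a \<noteq> 0" using infinite_UNIV_char_0[where 'a='a] by (metis (mono_tags) UNIV_eq_I mem_Collect_eq)
  let ?x = "x(v := a)"
  have "peval ?x (coeff q i) = coeff r i" for i
    unfolding cr peval_eq_mev using q(1) insert.hyps by (intro mev_cong[of _ V]) auto
  moreover have "degree r \<le> degree q" by (rule degree_le) (auto simp: cr coeff_eq_0 peval_rhom)
  ultimately have "peval ?x p = poly r a"
    unfolding q(2)[symmetric] poly_altdef
    by (simp add: peval_rhom rhom_power[OF rhom_peval])
      (rule sum.mono_neutral_right, auto simp: coeff_eq_0)
  then have "peval ?x p \<noteq> 0" using a by simp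
  moreover have "\<forall>i. i \<notin> insert v V \<longrightarrow> ?x i = 0" using x(1) by auto
  ultimately show ?case by blast
qed

section \<open>Homogeneous polynomials\<close>

lemma mon_deg_superset:
  assumes "finite S" "Poly_Mapping.keys m \<subseteq> S"
  shows "mon_deg m = (\<Sum>i\<in>S. Poly_Mapping.lookup m i)"
  unfolding mon_deg_def using assms by (intro sum.mono_neutral_left) (auto simp: in_keys_iff)

lemma mon_deg_add: "mon_deg (m + m') = mon_deg m + mon_deg m'"
proof -
  let ?S = "Poly_Mapping.keys m \<union> Poly_Mapping.keys m'"
  have "Poly_Mapping.keys (m + m') \<subseteq> ?S" by (rule Poly_Mapping.keys_add)
  then show ?thesis by (simp add: mon_deg_superset[of ?S] lookup_add sum.distrib)
qed

lemma mon_deg_simps [simp]: "mon_deg 0 = 0" "mon_deg (Poly_Mapping.single i k) = k"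
  by (auto simp: mon_deg_def)

lemma mon_deg_0_iff: "mon_deg m = 0 \<longleftrightarrow> m = 0"
  unfolding mon_deg_def by (auto simp: in_keys_iff intro: poly_mapping_eqI)

lemma homogeneous_simps:
  fixes p q :: "('v, 'a::comm_ring_1) mpol"
  shows "homogeneous d p \<Longrightarrow> homogeneous d q \<Longrightarrow> homogeneous d (p + q)"
    "homogeneous d p \<Longrightarrow> homogeneous e q \<Longrightarrow> homogeneous (d + e) (p * q)"
    "homogeneous d (0 :: ('v, 'a) mpol)" "homogeneous 0 (1 :: ('v, 'a) mpol)"
    "homogeneous 0 (Cst a)" "homogeneous 1 (Vr i :: ('v, 'a) mpol)"
    "homogeneous d p \<Longrightarrow> homogeneous d (- p)"
proof -
  show "homogeneous d (p + q)" if "homogeneous d p" "homogeneous d q"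
    using that Poly_Mapping.keys_add[of p q] by (auto simp: homogeneous_def)
  show "homogeneous (d + e) (p * q)" if "homogeneous d p" "homogeneous e q"
    using that keys_mult[of p q] by (fastforce simp: homogeneous_def mon_deg_add)
  show "homogeneous d (- p)" if "homogeneous d p"
    using that by (auto simp: homogeneous_def in_keys_iff)
  show "homogeneous 0 (Cst a)" by (cases "a = 0") (auto simp: homogeneous_def)
qed (auto simp: homogeneous_def)

lemma homogeneous_sum:
  fixes f :: "'i \<Rightarrow> ('v, 'a::comm_ring_1) mpol"
  shows "(\<And>i. i \<in> S \<Longrightarrow> homogeneous d (f i)) \<Longrightarrow> homogeneous d (sum f S)"
  by (induction S rule: infinite_finite_induct) (auto simp: homogeneous_simps)

lemma homogeneous_prod:
  fixes f :: "'i \<Rightarrow> ('v, 'a::comm_ring_1) mpol"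
  shows "(\<And>i. i \<in> S \<Longrightarrow> homogeneous (d i) (f i)) \<Longrightarrow> homogeneous (sum d S) (prod f S)"
  by (induction S rule: infinite_finite_induct) (auto simp: homogeneous_simps)

lemma homogeneous_power:
  fixes p :: "('v, 'a::comm_ring_1) mpol"
  shows "homogeneous d p \<Longrightarrow> homogeneous (k * d) (p ^ k)"
  by (induction k) (auto simp: homogeneous_simps)

lemma homogeneous_partial_deriv:
  fixes p :: "('v, 'a::comm_ring_1) mpol"
  assumes "homogeneous (Suc d) p"
  shows "homogeneous d (partial_deriv i p)"
  unfolding homogeneous_def
proof
  fix m assume "m \<in> Poly_Mapping.keys (partial_deriv i p)"
  then have "m + Poly_Mapping.single i 1 \<in> Poly_Mapping.keys p"
    by (auto simp: in_keys_iff lookup_partial_deriv)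
  then have "mon_deg (m + Poly_Mapping.single i 1) = Suc d" using assms unfolding homogeneous_def by blast
  then show "mon_deg m = d" by (simp add: mon_deg_add)
qed

lemma mmono_scale: "mmono (\<lambda>i. s * t i) m = s ^ mon_deg m * mmono t m"
  by (simp add: mmono_def mon_deg_def power_mult_distrib prod.distrib power_sum)

lemma mev_scale:
  assumes "homogeneous d p"
  shows "mev c (\<lambda>i. s * t i) p = s ^ d * mev c t p"
  unfolding mev_def sum_distrib_left mmono_scale
  using assms by (intro sum.cong) (auto simp: homogeneous_def ac_simps)

lemma peval_scale: "homogeneous d p \<Longrightarrow> peval (\<lambda>i. s * x i) p = s ^ d * peval x p"
  by (simp add: peval_eq_mev mev_scale)

lemma single_sum: "Poly_Mapping.single m (sum f S) = (\<Sum>i\<in>S. Poly_Mapping.single m (f i))"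
  by (induction S rule: infinite_finite_induct) (auto simp: single_add)

lemma euler_identity:
  fixes p :: "('v, 'a::comm_ring_1) mpol"
  assumes p: "p \<in> polys V" "homogeneous d p" and V: "finite V"
  shows "(\<Sum>i\<in>V. Vr i * partial_deriv i p) = of_nat d * p"
proof -
  let ?s = "\<lambda>m. Poly_Mapping.single m (Poly_Mapping.lookup p m)"
  have "(\<Sum>i\<in>V. Vr i * partial_deriv i (?s m)) = of_nat d * ?s m" if m: "m \<in> Poly_Mapping.keys p" for m
  proof -
    have mV: "Poly_Mapping.keys m \<subseteq> V" and d: "mon_deg m = d" using p m by (auto simp: polys_def homogeneous_def)
    have "Vr i * partial_deriv i (?s m) = Poly_Mapping.single m (of_nat (Poly_Mapping.lookup m i) * Poly_Mapping.lookup p m)" for i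
    proof (cases "Poly_Mapping.lookup m i = 0")
      case False
      then have "Poly_Mapping.single i 1 + (m - Poly_Mapping.single i 1) = m"
        by (intro poly_mapping_eqI) (auto simp: lookup_add lookup_minus lookup_single when_def)
      then show ?thesis by (simp add: partial_deriv_single mult_single)
    qed (simp add: partial_deriv_single)
    then have "(\<Sum>i\<in>V. Vr i * partial_deriv i (?s m)) = Poly_Mapping.single m (of_nat (mon_deg m) * Poly_Mapping.lookup p m)"
      using mon_deg_superset[OF V mV] by (simp add: sum_distrib_right single_sum)
    then show ?thesis unfolding d by (simp add: mult_single flip: single_of_nat)
  qed
  then have "(\<Sum>m\<in>Poly_Mapping.keys p. \<Sum>i\<in>V. Vr i * partial_deriv i (?s m)) = of_nat d * (\<Sum>m\<in>Poly_Mapping.keys p. ?s m)"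
    by (simp add: sum_distrib_left)
  moreover have "(\<Sum>m\<in>Poly_Mapping.keys p. \<Sum>i\<in>V. Vr i * partial_deriv i (?s m)) = (\<Sum>i\<in>V. Vr i * partial_deriv i (\<Sum>m\<in>Poly_Mapping.keys p. ?s m))"
    by (subst sum.swap) (simp add: partial_deriv_sum sum_distrib_left)
  ultimately show ?thesis by (simp flip: sum_of_singles)
qed

lemma linear_form_expand:
  fixes p :: "('v, 'a::comm_ring_1) mpol"
  assumes p: "p \<in> polys V" "homogeneous 1 p" and V: "finite V"
  shows "p = (\<Sum>l\<in>V. Cst (Poly_Mapping.lookup (partial_deriv l p) 0) * Vr l)"
proof -
  have "partial_deriv l p = Cst (Poly_Mapping.lookup (partial_deriv l p) 0)" for l
  proof (rule poly_mapping_eqI)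
    fix m
    have "homogeneous 0 (partial_deriv l p)" using homogeneous_partial_deriv[of 0 p l] p(2) by simp
    then have "m \<in> Poly_Mapping.keys (partial_deriv l p) \<Longrightarrow> m = 0" by (auto simp: homogeneous_def mon_deg_0_iff)
    then show "Poly_Mapping.lookup (partial_deriv l p) m = Poly_Mapping.lookup (Cst (Poly_Mapping.lookup (partial_deriv l p) 0)) m"
      by (auto simp: lookup_single when_def in_keys_iff)
  qed
  then show ?thesis using euler_identity[OF p V] by (simp add: mult.commute)
qed

section \<open>Generic points and tangent vectors\<close>

text \<open>The condition on \<open>Q\<close> makes the coordinates in \<open>V\<close>
  algebraically independent modulo \<open>Q\<close>, so their derivatives can be prescribed freely.
  The directional derivative along \<open>w\<close> is then extended through \<open>Y\<close> one
  variable at a time; \<open>s\<close> collects the denominators cleared on the way.\<close>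

lemma derivation_lift:
  fixes Q :: "('u::linorder, 'a::field_char_0) mpol set"
  assumes Q: "is_prime UNIV Q" and V: "finite V" "Q \<inter> polys V \<subseteq> {0}" and Y: "finite Y" "Y \<inter> V = {}"
  shows "\<exists>d s. derivation d \<and> s \<notin> Q \<and> (\<forall>p\<in>Q \<inter> polys (V \<union> Y). d p \<in> Q) \<and>
    (\<forall>v\<in>V. d (Vr v) = s * Cst (w v)) \<and> (\<forall>a. d (Cst a) = 0)"
  using Y
proof (induction Y rule: finite_induct)
  case empty
  define d where "d = (\<lambda>p. \<Sum>v\<in>V. Cst (w v) * partial_deriv v p)"
  have "derivation d" unfolding d_def by (intro derivation_sum derivation_partial_deriv)
  moreover have "d (Vr v) = Cst (w v)" if "v \<in> V" for v
  proof -
    have "d (Vr v) = (\<Sum>u\<in>V. if u = v then Cst (w u) else 0)" unfolding d_def by (intro sum.cong) auto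
    then show ?thesis using V that by simp
  qed
  moreover have "d p \<in> Q" if "p \<in> Q \<inter> polys V" for p
  proof -
    have "p = 0" using V(2) that by blast
    then show ?thesis using ideal_closed(1)[OF primeD(1)[OF Q]] by (simp add: d_def)
  qed
  moreover have "d (Cst a) = 0" for a by (simp add: d_def)
  ultimately show ?case using primeD(2)[OF Q] by (intro exI[of _ d] exI[of _ 1]) simp
next
  case (insert y Y)
  then obtain d s where d: "derivation d" "s \<notin> Q" "\<And>p. p \<in> polys (V \<union> Y) \<Longrightarrow> p \<in> Q \<Longrightarrow> d p \<in> Q"
    "\<And>v. v \<in> V \<Longrightarrow> d (Vr v) = s * Cst (w v)" "\<And>a. d (Cst a) = 0" by auto
  have char: "(of_nat k :: ('u, 'a) mpol) \<notin> Q" if "0 < k" for k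
  proof
    assume "(of_nat k :: ('u, 'a) mpol) \<in> Q"
    then have "Cst (of_nat k :: 'a) \<in> Q \<inter> polys V" by (simp add: polys_closed(8))
    then have "Cst (of_nat k :: 'a) = (0 :: ('u, 'a) mpol)" using V(2) by blast
    then have "(of_nat k :: 'a) = 0" by (metis lookup_single_eq lookup_zero)
    then show False using that by simp
  qed
  have "\<exists>t u. t \<notin> Q \<and> (\<forall>p. (\<forall>i. coeff p i \<in> polys (V \<union> Y)) \<longrightarrow> poly p (Vr y) \<in> Q \<longrightarrow>
      t * d (poly p (Vr y)) + u * partial_deriv y (poly p (Vr y)) \<in> Q)"
  proof (rule derivation_extend[OF Q char polys_subring d(1) d(3) derivation_partial_deriv])
    show "partial_deriv y a = 0" if "a \<in> polys (V \<union> Y)" for a :: "('u, 'a) mpol"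
      using partial_deriv_eq_0[OF that] insert by auto
  qed auto
  then obtain t u where tu: "t \<notin> Q" "\<And>p. (\<forall>i. coeff p i \<in> polys (V \<union> Y)) \<Longrightarrow> poly p (Vr y) \<in> Q \<Longrightarrow>
      t * d (poly p (Vr y)) + u * partial_deriv y (poly p (Vr y)) \<in> Q" by blast
  define d' where "d' = (\<lambda>p. t * d p + u * partial_deriv y p)"
  have "derivation d'" unfolding d'_def by (rule derivation_lin[OF d(1) derivation_partial_deriv])
  moreover have "t * s \<notin> Q" using primeD(3)[OF Q, of t s] tu(1) d(2) by auto
  moreover have "d' p \<in> Q" if p: "p \<in> Q \<inter> polys (V \<union> insert y Y)" for p
  proof -
    obtain q where q: "\<forall>i. coeff q i \<in> polys (V \<union> Y)" "poly q (Vr y) = p"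
      using polys_insert_as_poly[of p y "V \<union> Y"] p by auto
    then show ?thesis using tu(2)[OF q(1)] p by (simp add: d'_def)
  qed
  moreover have "d' (Vr v) = t * s * Cst (w v)" if "v \<in> V" for v
    using insert that d(4) by (auto simp: d'_def mult.assoc)
  moreover have "d' (Cst a) = 0" for a using d(5) by (simp add: d'_def)
  ultimately show ?case by blast
qed

text \<open>Suppose that the \<open>V\<close>-coordinates of the solutions of the system \<open>E = 0\<close>, \<open>h \<noteq> 0\<close> are Zariski
  dense.  Then there is a generic solution, with values in the residue field of a prime \<open>Q\<close>, and every
  tangent vector \<open>w\<close> of the \<open>V\<close>-space lifts to a derivation \<open>d\<close> there.\<close>

lemma generic_solution:
  fixes E :: "('u::linorder, 'a::field_char_0) mpol set"
  assumes V: "finite V" and Y: "finite Y" "Y \<inter> V = {}"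
    and main: "\<And>Q d s. is_prime UNIV Q \<Longrightarrow> E \<subseteq> Q \<Longrightarrow> derivation d \<Longrightarrow> s \<notin> Q \<Longrightarrow>
      (\<And>p. p \<in> Q \<Longrightarrow> p \<in> polys (V \<union> Y) \<Longrightarrow> d p \<in> Q) \<Longrightarrow> (\<And>v. v \<in> V \<Longrightarrow> d (Vr v) = s * Cst (w v)) \<Longrightarrow>
      (\<And>a. d (Cst a) = 0) \<Longrightarrow> h \<in> Q"
  shows "\<exists>G\<in>polys V. G \<noteq> 0 \<and> (\<forall>b. (\<forall>p\<in>E. peval b p = 0) \<longrightarrow> peval b h \<noteq> 0 \<longrightarrow> peval b G = 0)"
proof (rule ccontr)
  assume no: "\<not> ?thesis"
  define B where "B = {b. (\<forall>p\<in>E. peval b p = 0) \<and> peval b h \<noteq> 0}"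
  define I where "I = {p. \<forall>b\<in>B. peval b p = 0}"
  \<comment> \<open>A prime that contains \<open>I\<close> and misses \<open>S\<close> is a generic
    solution: the coordinates in \<open>V\<close> satisfy no relation modulo \<open>Q\<close>, and
    \<open>h\<close> is nonzero there. If \<open>I\<close> met \<open>S\<close>, the factor
    \<open>G\<close> would vanish at all solutions in \<open>B\<close>, which was excluded.\<close>
  define S where "S = {G * h ^ e | G e. G \<in> polys V \<and> G \<noteq> 0}"
  have one: "(1 :: ('u, 'a) mpol) \<in> polys V" by (rule polys_closed(2))
  have "is_ideal UNIV I" by (auto simp: is_ideal_def I_def peval_rhom)
  moreover have "1 \<in> S" unfolding S_def using one by (intro CollectI exI[of _ 1] exI[of _ 0]) auto
  moreover have "x * y \<in> S" if xy: "x \<in> S" "y \<in> S" for x y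
  proof -
    obtain G e G' e' where "x = G * h ^ e" "y = G' * h ^ e'" "G \<in> polys V" "G' \<in> polys V" "G \<noteq> 0" "G' \<noteq> 0"
      using xy by (auto simp: S_def)
    then show ?thesis unfolding S_def using polys_closed(5)[of G V G']
      by (intro CollectI exI[of _ "G * G'"] exI[of _ "e + e'"]) (auto simp: power_add)
  qed
  moreover have "I \<inter> S = {}"
  proof (rule ccontr)
    assume "I \<inter> S \<noteq> {}"
    then obtain G e where G: "G \<in> polys V" "G \<noteq> 0" "\<forall>b\<in>B. peval b (G * h ^ e) = 0" by (auto simp: I_def S_def)
    then have "\<forall>b\<in>B. peval b G = 0" by (auto simp: B_def peval_rhom rhom_power[OF rhom_peval])
    then show False using no G by (auto simp: B_def)
  qed
  ultimately obtain Q where Q: "is_prime UNIV Q" "I \<subseteq> Q" "Q \<inter> S = {}" using prime_avoiding_exists[of I S] by blast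
  have "Q \<inter> polys V \<subseteq> {0}"
  proof
    fix G assume G: "G \<in> Q \<inter> polys V"
    show "G \<in> {0}"
    proof (rule ccontr)
      assume "G \<notin> {0}"
      then have "G \<in> S" unfolding S_def using G by (intro CollectI exI[of _ G] exI[of _ 0]) auto
      then show False using G Q(3) by blast
    qed
  qed
  then obtain d s where d: "derivation d" "s \<notin> Q" "\<forall>p\<in>Q \<inter> polys (V \<union> Y). d p \<in> Q"
    "\<forall>v\<in>V. d (Vr v) = s * Cst (w v)" "\<forall>a. d (Cst a) = 0"
    using derivation_lift[OF Q(1) V _ Y, of w] by blast
  have "E \<subseteq> I" by (auto simp: I_def B_def)
  then have "h \<in> Q" using main[OF Q(1) _ d(1,2)] d(3-5) Q(2) by blast
  moreover have "h \<in> S" unfolding S_def using one by (intro CollectI exI[of _ 1] exI[of _ 1]) auto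
  ultimately show False using Q(3) by blast
qed

section \<open>The trilinear form of a cubic\<close>

text \<open>The exponent of the variable \<open>0\<close> is determined by the degree and the other
  \<open>n\<close> exponents. The power \<open>n\<close>, and not \<open>n + 1\<close>, is what
  makes the later dimension count work.\<close>

lemma monomials_finite_card:
  "finite {m :: nat \<Rightarrow>\<^sub>0 nat. Poly_Mapping.keys m \<subseteq> {..n} \<and> mon_deg m = d}" (is "finite ?S")
  "card {m :: nat \<Rightarrow>\<^sub>0 nat. Poly_Mapping.keys m \<subseteq> {..n} \<and> mon_deg m = d} \<le> (d + 1) ^ n"
proof -
  define F where "F = ({1..n} \<rightarrow>\<^sub>E {..d})"
  define f where "f = (\<lambda>m :: nat \<Rightarrow>\<^sub>0 nat. restrict (Poly_Mapping.lookup m) {1..n})"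
  have deg: "mon_deg m = Poly_Mapping.lookup m 0 + (\<Sum>i\<in>{1..n}. Poly_Mapping.lookup m i)"
    if "Poly_Mapping.keys m \<subseteq> {..n}" for m :: "nat \<Rightarrow>\<^sub>0 nat"
  proof -
    have "{..n} = insert 0 {1..n}" by auto
    then show ?thesis using mon_deg_superset[OF _ that] by simp
  qed
  have inj: "inj_on f ?S"
  proof (rule inj_onI)
    fix m m' assume m: "m \<in> ?S" "m' \<in> ?S" "f m = f m'"
    have eq: "Poly_Mapping.lookup m i = Poly_Mapping.lookup m' i" if "i \<in> {1..n}" for i
      using fun_cong[OF m(3), of i] that by (simp add: f_def)
    then have "(\<Sum>i\<in>{1..n}. Poly_Mapping.lookup m i) = (\<Sum>i\<in>{1..n}. Poly_Mapping.lookup m' i)" by (rule sum.cong[OF refl])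
    then have "Poly_Mapping.lookup m 0 = Poly_Mapping.lookup m' 0" using m deg[of m] deg[of m'] by auto
    then have "Poly_Mapping.lookup m i = Poly_Mapping.lookup m' i" if "i \<le> n" for i
      using eq[of i] that by (cases "i = 0") auto
    moreover have "Poly_Mapping.lookup m i = Poly_Mapping.lookup m' i" if "\<not> i \<le> n" for i
    proof -
      have "i \<notin> Poly_Mapping.keys m" "i \<notin> Poly_Mapping.keys m'" using m that by auto
      then show ?thesis by (simp add: in_keys_iff)
    qed
    ultimately show "m = m'" by (intro poly_mapping_eqI) blast
  qed
  have "f m \<in> F" if m: "m \<in> ?S" for m
  proof -
    have "Poly_Mapping.lookup m i \<le> d" if "i \<in> {1..n}" for i
    proof -
      have "Poly_Mapping.lookup m i \<le> (\<Sum>i\<in>{1..n}. Poly_Mapping.lookup m i)" using that by (intro member_le_sum) auto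
      then show ?thesis using deg[of m] m by auto
    qed
    then show ?thesis by (auto simp: f_def F_def)
  qed
  then have img: "f ` ?S \<subseteq> F" by blast
  have F: "finite F" "card F = (d + 1) ^ n" unfolding F_def by (auto intro!: finite_PiE simp: card_PiE)
  show "finite ?S" using inj img F(1) by (rule inj_on_finite)
  show "card ?S \<le> (d + 1) ^ n" using card_inj_on_le[OF inj img F(1)] F(2) by simp
qed

lemma finite_cubic_monomials: "finite (cubic_monomials n)"
  unfolding cubic_monomials_def by (rule monomials_finite_card)

lemma sum_rotate3:
  "(\<Sum>a\<in>A. \<Sum>i\<in>I. \<Sum>j\<in>J. f a i j) = (\<Sum>i\<in>I. \<Sum>j\<in>J. \<Sum>a\<in>A. f a i j)"
  by (subst sum.swap, rule sum.cong[OF refl], rule sum.swap)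

lemma sum_rotate4:
  "(\<Sum>l\<in>L. \<Sum>a\<in>A. \<Sum>i\<in>I. \<Sum>j\<in>J. f l a i j) = (\<Sum>a\<in>A. \<Sum>i\<in>I. \<Sum>j\<in>J. \<Sum>l\<in>L. f l a i j)"
  by (subst sum.swap, rule sum.cong[OF refl], rule sum_rotate3)

definition mon3 :: "nat \<Rightarrow> nat \<Rightarrow> nat \<Rightarrow> (nat \<Rightarrow>\<^sub>0 nat)" where
  "mon3 i j l = Poly_Mapping.single i 1 + Poly_Mapping.single j 1 + Poly_Mapping.single l 1"

definition mfact :: "(nat \<Rightarrow>\<^sub>0 nat) \<Rightarrow> nat" where
  "mfact m = (\<Prod>i\<in>Poly_Mapping.keys m. fact (Poly_Mapping.lookup m i))"

text \<open>For a cubic form this is the third partial derivative in the directions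
  \<open>i\<close>, \<open>j\<close>, \<open>l\<close>. Written through a coefficient, it is visibly
  symmetric and linear in \<open>f\<close>.\<close>

definition tens :: "(nat, 'a::comm_ring_1) mpol \<Rightarrow> nat \<Rightarrow> nat \<Rightarrow> nat \<Rightarrow> 'a" where
  "tens f i j l = of_nat (mfact (mon3 i j l)) * Poly_Mapping.lookup f (mon3 i j l)"

lemma mon3_sym: "mon3 i j l = mon3 j i l" "mon3 i j l = mon3 i l j" "mon3 i j l = mon3 l j i"
  by (simp_all add: mon3_def ac_simps)

lemma tens_sym: "tens f i j l = tens f j i l" "tens f i j l = tens f i l j" "tens f i j l = tens f l j i"
  unfolding tens_def using mon3_sym by metis+

lemma mon3_cubic: "i \<le> n \<Longrightarrow> j \<le> n \<Longrightarrow> l \<le> n \<Longrightarrow> mon3 i j l \<in> cubic_monomials n"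
  unfolding cubic_monomials_def mon3_def
  using Poly_Mapping.keys_add[of "Poly_Mapping.single i 1 + Poly_Mapping.single j 1" "Poly_Mapping.single l (1::nat)"]
    Poly_Mapping.keys_add[of "Poly_Mapping.single i 1" "Poly_Mapping.single j (1::nat)"]
  by (auto simp: mon_deg_add subset_iff)

lemma lookup_deriv3:
  "Poly_Mapping.lookup (partial_deriv l (partial_deriv i (partial_deriv j f))) 0 = tens f i j l"
proof -
  have k: "Poly_Mapping.keys (mon3 i j l) = {i, j, l}"
    by (auto simp: in_keys_iff mon3_def lookup_add lookup_single when_def split: if_splits)
  have [simp]: "{a, b, a} = {a, b}" for a b :: nat by auto
  have "mfact (mon3 i j l) = (if i = l then 2 else 1) * (1 + of_bool (l = j) + of_bool (i = j))"
    unfolding mfact_def k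
    by (cases "i = j"; cases "j = l"; cases "i = l")
      (auto simp: mon3_def lookup_add lookup_single when_def fact_2 fact_numeral numeral_2_eq_2 numeral_3_eq_3)
  moreover have "Poly_Mapping.single l 1 + Poly_Mapping.single i 1 + Poly_Mapping.single j 1 = mon3 i j l"
    by (simp add: mon3_def ac_simps)
  ultimately show ?thesis
    by (simp add: lookup_partial_deriv tens_def lookup_add lookup_single when_def add.assoc)
qed

lemma cubic_formsD:
  assumes "f \<in> cubic_forms n"
  shows "f \<in> polys {..n}" "homogeneous 3 f" "partial_deriv i f \<in> polys {..n}" "homogeneous 2 (partial_deriv i f)"
    "partial_deriv i (partial_deriv j f) \<in> polys {..n}" "homogeneous 1 (partial_deriv i (partial_deriv j f))"
proof -
  show f: "f \<in> polys {..n}" "homogeneous 3 f" using assms by (auto simp: cubic_forms_def)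
  show p: "partial_deriv i f \<in> polys {..n}" for i by (rule partial_deriv_polys[OF f(1)])
  show h: "homogeneous 2 (partial_deriv i f)" for i
    using homogeneous_partial_deriv[of 2 f i] f(2) by (simp add: numeral_3_eq_3 numeral_2_eq_2)
  show "partial_deriv i (partial_deriv j f) \<in> polys {..n}" by (rule partial_deriv_polys[OF p])
  show "homogeneous 1 (partial_deriv i (partial_deriv j f))"
    using homogeneous_partial_deriv[of 1 "partial_deriv j f" i] h by (simp add: numeral_2_eq_2)
qed

lemma second_deriv_expand:
  assumes "f \<in> cubic_forms n"
  shows "partial_deriv i (partial_deriv j f) = (\<Sum>l\<le>n. Cst (tens f i j l) * Vr l)"
  using linear_form_expand[OF cubic_formsD(5,6)[OF assms]] by (simp add: lookup_deriv3)

text \<open>\<open>R\<close> is the number of summands of the tensor, and shorter tensors are padded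
  with zero vectors. The conclusion concerns the symmetrization, as a symmetric form cannot detect
  more.\<close>

definition good :: "nat \<Rightarrow> nat \<Rightarrow> (nat, 'a::comm_ring_1) mpol \<Rightarrow> bool" where
  "good n R f \<longleftrightarrow> (\<forall>x y z. (\<exists>i\<le>n. x i \<noteq> 0) \<longrightarrow>
     (\<forall>a<R. \<forall>j\<le>n. (\<Sum>i\<le>n. \<Sum>l\<le>n. tens f i j l * x l * y a i) = 0) \<longrightarrow>
     (\<forall>a<R. \<forall>i\<le>n. (\<Sum>j\<le>n. \<Sum>l\<le>n. tens f i j l * x l * z a j) = 0) \<longrightarrow>
     (\<forall>l\<le>n. (\<Sum>a<R. \<Sum>i\<le>n. \<Sum>j\<le>n. tens f i j l * y a i * z a j) = 0) \<longrightarrow>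
     (\<forall>i\<le>n. \<forall>j\<le>n. (\<Sum>a<R. y a i * z a j + y a j * z a i) = 0))"

text \<open>The unknowns \<open>x\<close>, \<open>y\<close>, \<open>z\<close> share an index type
  with the coefficients of the cubic, whose indices are exponent vectors. An exponent of at least
  \<open>4\<close> keeps the new names apart from the cubic monomials.\<close>

definition extra_var :: "nat \<Rightarrow> nat \<Rightarrow> (nat \<Rightarrow>\<^sub>0 nat)" where
  "extra_var k i = Poly_Mapping.single 0 (4 + prod_encode (k, i))"

lemma extra_var_not_cubic: "extra_var k i \<notin> cubic_monomials n"
  by (simp add: extra_var_def cubic_monomials_def)

text \<open>The tangent vector is the direction of a single monomial \<open>m\<close>, and
  \<open>h\<close> is the trilinear form of that monomial at the tensor
  \<open>\<Sum>\<^sub>a x y\<^sub>a z\<^sub>a\<close>. At a generic solution of the kernel and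
  tensor equations \<open>E\<close>, \<open>h\<close> must vanish; so the solutions with
  \<open>h\<close> nonzero have special coefficients.\<close>

lemma generic_good_monomial:
  fixes n R :: nat and m :: "nat \<Rightarrow>\<^sub>0 nat"
  defines "V \<equiv> cubic_monomials n"
  defines "X \<equiv> \<lambda>i. Vr (extra_var 0 i) :: (nat \<Rightarrow>\<^sub>0 nat, 'a::field_char_0) mpol"
  defines "Y \<equiv> \<lambda>a i. Vr (extra_var (1 + 2 * a) i) :: (nat \<Rightarrow>\<^sub>0 nat, 'a) mpol"
  defines "Z \<equiv> \<lambda>a i. Vr (extra_var (2 + 2 * a) i) :: (nat \<Rightarrow>\<^sub>0 nat, 'a) mpol"
  defines "T \<equiv> \<lambda>i j l. Cst (of_nat (mfact (mon3 i j l))) * Vr (mon3 i j l) :: (nat \<Rightarrow>\<^sub>0 nat, 'a) mpol"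
  defines "E \<equiv> {\<Sum>i\<le>n. \<Sum>l\<le>n. T i j l * X l * Y a i | a j. a < R \<and> j \<le> n} \<union>
    {\<Sum>j\<le>n. \<Sum>l\<le>n. T i j l * X l * Z a j | a i. a < R \<and> i \<le> n} \<union>
    {\<Sum>a<R. \<Sum>i\<le>n. \<Sum>j\<le>n. T i j l * Y a i * Z a j | l. l \<le> n}"
  defines "h \<equiv> (\<Sum>l\<le>n. \<Sum>a<R. \<Sum>i\<le>n. \<Sum>j\<le>n. (if mon3 i j l = m then Cst (of_nat (mfact m)) else 0) * X l * Y a i * Z a j)"
  shows "\<exists>G\<in>polys V. G \<noteq> 0 \<and> (\<forall>b. (\<forall>p\<in>E. peval b p = 0) \<longrightarrow> peval b h \<noteq> 0 \<longrightarrow> peval b G = 0)"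
proof -
  \<comment> \<open>Index \<open>0\<close> is used for \<open>x\<close>, odd indices for the
    \<open>y\<^sub>a\<close> and positive even ones for the \<open>z\<^sub>a\<close>; the largest
    index for \<open>a < R\<close> is \<open>2 * R\<close>.\<close>
  define W where "W = case_prod extra_var ` ({..2 * R} \<times> {..n})"
  have W: "finite W" "W \<inter> V = {}" using extra_var_not_cubic by (auto simp: W_def V_def)
  have memW: "extra_var k i \<in> W" if "k \<le> 2 * R" "i \<le> n" for k i using that by (auto simp: W_def)
  have pX: "X i \<in> polys (V \<union> W)" if "i \<le> n" for i using memW[of 0 i] that by (auto simp: X_def)
  have pY: "Y a i \<in> polys (V \<union> W)" if "a < R" "i \<le> n" for a i using memW[of "1 + 2 * a" i] that by (auto simp: Y_def)
  have pZ: "Z a i \<in> polys (V \<union> W)" if "a < R" "i \<le> n" for a i using memW[of "2 + 2 * a" i] that by (auto simp: Z_def)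
  have pT: "T i j l \<in> polys (V \<union> W)" if "i \<le> n" "j \<le> n" "l \<le> n" for i j l
    using mon3_cubic[OF that] unfolding T_def V_def by (intro polys_closed(5) polys_Cst polys_Vr) auto
  show ?thesis
  proof (rule generic_solution[OF _ W, where w = "\<lambda>v. if v = m then 1 else 0"])
    show "finite V" by (simp add: V_def finite_cubic_monomials)
    fix Q :: "(nat \<Rightarrow>\<^sub>0 nat, 'a) mpol set" and d s
    assume Q: "is_prime UNIV Q" and EQ: "E \<subseteq> Q" and d: "derivation d" and s: "s \<notin> Q"
      and dQ: "\<And>p. p \<in> Q \<Longrightarrow> p \<in> polys (V \<union> W) \<Longrightarrow> d p \<in> Q"
      and dV: "\<And>v. v \<in> V \<Longrightarrow> d (Vr v) = s * Cst (if v = m then 1 else 0)"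
      and dC: "\<And>a. d (Cst a) = 0"
    note idl = ideal_closed[OF primeD(1)[OF Q], simplified]
    have eY: "(\<Sum>i\<le>n. \<Sum>l\<le>n. T i j l * X l * Y a i) \<in> Q" if "a < R" "j \<le> n" for a j using EQ that by (auto simp: E_def)
    have eZ: "(\<Sum>j\<le>n. \<Sum>l\<le>n. T i j l * X l * Z a j) \<in> Q" if "a < R" "i \<le> n" for a i using EQ that by (auto simp: E_def)
    have eL: "(\<Sum>a<R. \<Sum>i\<le>n. \<Sum>j\<le>n. T i j l * Y a i * Z a j) \<in> Q" if "l \<le> n" for l using EQ that by (auto simp: E_def)
    have dT: "d (T i j l) = s * (if mon3 i j l = m then Cst (of_nat (mfact m)) else 0)" if "i \<le> n" "j \<le> n" "l \<le> n" for i j l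
      using dV[of "mon3 i j l"] mon3_cubic[OF that] by (auto simp: T_def V_def derivation_simps(2)[OF d] dC simp del: single_of_nat)
    let ?S = "\<lambda>f. \<Sum>l\<le>n. \<Sum>a<R. \<Sum>i\<le>n. \<Sum>j\<le>n. f l a i j"
    define P where "P = ?S (\<lambda>l a i j. T i j l * X l * Y a i * Z a j)"
    have P: "P = (\<Sum>l\<le>n. X l * (\<Sum>a<R. \<Sum>i\<le>n. \<Sum>j\<le>n. T i j l * Y a i * Z a j))"
      unfolding P_def sum_distrib_left by (intro sum.cong refl) (simp add: ac_simps)
    have "P \<in> Q" unfolding P by (rule idl(5), rule idl(3), rule eL) simp
    moreover have "P \<in> polys (V \<union> W)" unfolding P_def using pX pY pZ pT
      by (intro polys_closed(9) polys_closed(5)) auto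
    ultimately have dP: "d P \<in> Q" by (rule dQ)
    \<comment> \<open>The Leibniz rule for the four factors. Differentiating the coefficients gives
      \<open>s * h\<close>. Each other sum is a combination of equations in \<open>E\<close>: a
      derivative of \<open>x\<close> meets the tensor equation, a derivative of \<open>Y\<close> the
      kernel equation of \<open>Z\<close>, and a derivative of \<open>Z\<close> that of
      \<open>Y\<close>.\<close>
    have e0: "d P = ?S (\<lambda>l a i j. d (T i j l) * X l * Y a i * Z a j) + ?S (\<lambda>l a i j. T i j l * d (X l) * Y a i * Z a j)
      + ?S (\<lambda>l a i j. T i j l * X l * d (Y a i) * Z a j) + ?S (\<lambda>l a i j. T i j l * X l * Y a i * d (Z a j))"
      unfolding P_def derivation_simps(7)[OF d] derivation_simps(2)[OF d]
      by (simp add: sum.distrib algebra_simps)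
    have e1: "?S (\<lambda>l a i j. d (T i j l) * X l * Y a i * Z a j) = s * h"
      unfolding h_def sum_distrib_left by (intro sum.cong refl) (simp add: dT ac_simps)
    have e2: "?S (\<lambda>l a i j. T i j l * d (X l) * Y a i * Z a j) =
        (\<Sum>l\<le>n. d (X l) * (\<Sum>a<R. \<Sum>i\<le>n. \<Sum>j\<le>n. T i j l * Y a i * Z a j))"
      unfolding sum_distrib_left by (intro sum.cong refl) (simp add: ac_simps)
    have m2: "(\<Sum>l\<le>n. d (X l) * (\<Sum>a<R. \<Sum>i\<le>n. \<Sum>j\<le>n. T i j l * Y a i * Z a j)) \<in> Q" by (rule idl(5), rule idl(3), rule eL) simp
    have e3: "?S (\<lambda>l a i j. T i j l * X l * d (Y a i) * Z a j) =
        (\<Sum>a<R. \<Sum>i\<le>n. d (Y a i) * (\<Sum>j\<le>n. \<Sum>l\<le>n. T i j l * X l * Z a j))"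
    proof -
      have "?S (\<lambda>l a i j. T i j l * X l * d (Y a i) * Z a j) =
        (\<Sum>a<R. \<Sum>i\<le>n. \<Sum>j\<le>n. \<Sum>l\<le>n. T i j l * X l * d (Y a i) * Z a j)"
        by (rule sum_rotate4)
      then show ?thesis unfolding sum_distrib_left by (simp add: ac_simps)
    qed
    have m3: "(\<Sum>a<R. \<Sum>i\<le>n. d (Y a i) * (\<Sum>j\<le>n. \<Sum>l\<le>n. T i j l * X l * Z a j)) \<in> Q" by (rule idl(5), rule idl(5), rule idl(3), rule eZ) simp_all
    have e4: "?S (\<lambda>l a i j. T i j l * X l * Y a i * d (Z a j)) =
        (\<Sum>a<R. \<Sum>j\<le>n. d (Z a j) * (\<Sum>i\<le>n. \<Sum>l\<le>n. T i j l * X l * Y a i))"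
    proof -
      have "?S (\<lambda>l a i j. T i j l * X l * Y a i * d (Z a j)) =
        (\<Sum>a<R. \<Sum>j\<le>n. \<Sum>i\<le>n. \<Sum>l\<le>n. T i j l * X l * Y a i * d (Z a j))"
        by (subst sum_rotate4, rule sum.cong[OF refl], rule sum.swap)
      then show ?thesis unfolding sum_distrib_left by (simp add: ac_simps)
    qed
    have m4: "(\<Sum>a<R. \<Sum>j\<le>n. d (Z a j) * (\<Sum>i\<le>n. \<Sum>l\<le>n. T i j l * X l * Y a i)) \<in> Q" by (rule idl(5), rule idl(5), rule idl(3), rule eY) simp_all
    have "s * h = d P - ((\<Sum>l\<le>n. d (X l) * (\<Sum>a<R. \<Sum>i\<le>n. \<Sum>j\<le>n. T i j l * Y a i * Z a j)) +
        (\<Sum>a<R. \<Sum>i\<le>n. d (Y a i) * (\<Sum>j\<le>n. \<Sum>l\<le>n. T i j l * X l * Z a j)) +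
        (\<Sum>a<R. \<Sum>j\<le>n. d (Z a j) * (\<Sum>i\<le>n. \<Sum>l\<le>n. T i j l * X l * Y a i)))"
      unfolding e0 e1 e2 e3 e4 by simp
    then have "s * h \<in> Q"
      using ideal_diff(2)[OF is_subring_UNIV primeD(1)[OF Q] dP idl(2)[OF idl(2)[OF m2 m3] m4]] by simp
    then show "h \<in> Q" using primeD(3)[OF Q, of s h] s by auto
  qed
qed

text \<open>A bad solution makes the product of a nonzero linear form and a nonzero quadratic form,
  so it has a nonzero coefficient at some monomial \<open>m\<close>, and \<open>h m\<close> does not
  vanish there. Multiplying the equations for all cubic monomials covers every case.\<close>

lemma generic_good:
  "\<exists>G\<in>polys (cubic_monomials n). G \<noteq> 0 \<and>
     (\<forall>f\<in>cubic_forms n. \<not> good n R (f :: (nat, 'a::field_char_0) mpol) \<longrightarrow> peval (Poly_Mapping.lookup f) G = 0)"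
proof -
  let ?V = "cubic_monomials n"
  define X where "X = (\<lambda>i. Vr (extra_var 0 i) :: (nat \<Rightarrow>\<^sub>0 nat, 'a) mpol)"
  define Y where "Y = (\<lambda>a i. Vr (extra_var (1 + 2 * a) i) :: (nat \<Rightarrow>\<^sub>0 nat, 'a) mpol)"
  define Z where "Z = (\<lambda>a i. Vr (extra_var (2 + 2 * a) i) :: (nat \<Rightarrow>\<^sub>0 nat, 'a) mpol)"
  define T where "T = (\<lambda>i j l. Cst (of_nat (mfact (mon3 i j l))) * Vr (mon3 i j l) :: (nat \<Rightarrow>\<^sub>0 nat, 'a) mpol)"
  define E where "E = {\<Sum>i\<le>n. \<Sum>l\<le>n. T i j l * X l * Y a i | a j. a < R \<and> j \<le> n} \<union>
    {\<Sum>j\<le>n. \<Sum>l\<le>n. T i j l * X l * Z a j | a i. a < R \<and> i \<le> n} \<union>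
    {\<Sum>a<R. \<Sum>i\<le>n. \<Sum>j\<le>n. T i j l * Y a i * Z a j | l. l \<le> n}"
  define h where "h = (\<lambda>m. \<Sum>l\<le>n. \<Sum>a<R. \<Sum>i\<le>n. \<Sum>j\<le>n. (if mon3 i j l = m then Cst (of_nat (mfact m)) else 0) * X l * Y a i * Z a j)"
  have "\<exists>G\<in>polys ?V. G \<noteq> 0 \<and> (\<forall>b. (\<forall>p\<in>E. peval b p = 0) \<longrightarrow> peval b (h m) \<noteq> 0 \<longrightarrow> peval b G = 0)" for m
    unfolding E_def h_def X_def Y_def Z_def T_def by (rule generic_good_monomial)
  then obtain G where G: "\<And>m. G m \<in> polys ?V" "\<And>m. G m \<noteq> 0"
    "\<And>m b. (\<forall>p\<in>E. peval b p = 0) \<Longrightarrow> peval b (h m) \<noteq> 0 \<Longrightarrow> peval b (G m) = 0" by metis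
  have "peval (Poly_Mapping.lookup f) (\<Prod>m\<in>?V. G m) = 0" if f: "f \<in> cubic_forms n" "\<not> good n R f" for f
  proof -
    obtain x y z i0 j0 where bad: "\<exists>i\<le>n. x i \<noteq> 0"
      "\<forall>a<R. \<forall>j\<le>n. (\<Sum>i\<le>n. \<Sum>l\<le>n. tens f i j l * x l * y a i) = 0"
      "\<forall>a<R. \<forall>i\<le>n. (\<Sum>j\<le>n. \<Sum>l\<le>n. tens f i j l * x l * z a j) = 0"
      "\<forall>l\<le>n. (\<Sum>a<R. \<Sum>i\<le>n. \<Sum>j\<le>n. tens f i j l * y a i * z a j) = 0"
      and ij: "i0 \<le> n" "j0 \<le> n" "(\<Sum>a<R. y a i0 * z a j0 + y a j0 * z a i0) \<noteq> 0"
      using f(2) unfolding good_def by blast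
    \<comment> \<open>The point at which everything is evaluated: the coefficients of
      \<open>f\<close> at the cubic monomials, and elsewhere the vectors \<open>x\<close>,
      \<open>y\<close>, \<open>z\<close>, recovered by decoding the names of the extra
      variables.\<close>
    define b where "b = (\<lambda>v. if v \<in> ?V then Poly_Mapping.lookup f v else
      (case prod_decode (Poly_Mapping.lookup v 0 - 4) of (k, i) \<Rightarrow>
        if k = 0 then x i else if odd k then y ((k - 1) div 2) i else z ((k - 2) div 2) i))"
    have bX: "peval b (X i) = x i" and bY: "peval b (Y a i) = y a i" and bZ: "peval b (Z a i) = z a i" for i a
      using extra_var_not_cubic[of _ _ n] by (simp_all add: X_def Y_def Z_def b_def) (simp_all add: extra_var_def)
    have bT: "peval b (T i j l) = tens f i j l" if "i \<le> n" "j \<le> n" "l \<le> n" for i j l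
      using mon3_cubic[OF that] unfolding T_def tens_def peval_rhom(2) peval_Cst_Vr by (simp add: b_def)
    have bE: "\<forall>p\<in>E. peval b p = 0"
      unfolding E_def using bad(2-4) by (auto simp: peval_rhom bX bY bZ bT)
    define Q where "Q = (\<lambda>i j. \<Sum>a<R. y a i * z a j)"
    \<comment> \<open>\<open>L\<close> is the linear form of \<open>x\<close> and \<open>P\<close>
      the quadratic form \<open>\<Sum>\<^sub>a y\<^sub>a z\<^sub>a\<close>. Second partial
      derivatives of \<open>P\<close> recover the symmetrized tensor, so \<open>P\<close> is nonzero
      by badness.\<close>
    define L where "L = (\<Sum>l\<le>n. Cst (x l) * Vr l :: (nat, 'a) mpol)"
    define P where "P = (\<Sum>i\<le>n. \<Sum>j\<le>n. Cst (Q i j) * (Vr i * Vr j) :: (nat, 'a) mpol)"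
    have "L \<noteq> 0"
    proof
      assume "L = 0"
      obtain i where i: "i \<le> n" "x i \<noteq> 0" using bad(1) by blast
      have "partial_deriv i L = (\<Sum>l\<le>n. if i = l then Cst (x l) else 0)"
        unfolding L_def partial_deriv_sum partial_deriv_mult by (intro sum.cong) auto
      also have "\<dots> = Cst (x i)" using i by simp
      finally have "Cst (x i) = (0 :: (nat, 'a) mpol)" using \<open>L = 0\<close> by simp
      then show False using i by (metis lookup_single_eq lookup_zero)
    qed
    moreover have "P \<noteq> 0"
    proof
      assume "P = 0"
      have "partial_deriv j0 P = (\<Sum>i\<le>n. \<Sum>j\<le>n. (if j0 = i then Cst (Q i j) * Vr j else 0) + (if j0 = j then Cst (Q i j) * Vr i else 0))"
        unfolding P_def partial_deriv_sum partial_deriv_mult by (intro sum.cong) auto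
      also have "\<dots> = (\<Sum>j\<le>n. \<Sum>i\<le>n. if j0 = i then Cst (Q i j) * Vr j else 0) + (\<Sum>i\<le>n. \<Sum>j\<le>n. if j0 = j then Cst (Q i j) * Vr i else 0)"
        unfolding sum.distrib by (subst sum.swap) simp
      also have "\<dots> = (\<Sum>j\<le>n. Cst (Q j0 j) * Vr j) + (\<Sum>i\<le>n. Cst (Q i j0) * Vr i)"
        using ij by simp
      finally have d: "partial_deriv j0 P = \<dots>" .
      have "partial_deriv i0 (partial_deriv j0 P) = (\<Sum>j\<le>n. if i0 = j then Cst (Q j0 j) else 0) + (\<Sum>i\<le>n. if i0 = i then Cst (Q i j0) else 0)"
        unfolding d partial_deriv_add partial_deriv_sum partial_deriv_mult
        by (intro arg_cong2[of _ _ _ _ "(+)"] sum.cong) auto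
      also have "\<dots> = Cst (Q j0 i0 + Q i0 j0)" using ij by (simp add: single_add)
      finally have "Cst (Q j0 i0 + Q i0 j0) = (0 :: (nat, 'a) mpol)" using \<open>P = 0\<close> by simp
      then have "Q j0 i0 + Q i0 j0 = 0" by (metis lookup_single_eq lookup_zero)
      then show False using ij by (simp add: Q_def sum.distrib add.commute)
    qed
    ultimately have "L * P \<noteq> 0" by simp
    then obtain m where m: "Poly_Mapping.lookup (L * P) m \<noteq> 0" by (metis lookup_zero poly_mapping_eqI)
    have LP: "L * P = (\<Sum>l\<le>n. \<Sum>i\<le>n. \<Sum>j\<le>n. Poly_Mapping.single (mon3 i j l) (x l * Q i j))"
      unfolding L_def P_def sum_distrib_right unfolding sum_distrib_left
      by (intro sum.cong refl) (simp add: mult_single mon3_def ac_simps)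
    have lk: "Poly_Mapping.lookup (L * P) m = (\<Sum>l\<le>n. \<Sum>i\<le>n. \<Sum>j\<le>n. if mon3 i j l = m then x l * Q i j else 0)"
      unfolding LP lookup_sum by (intro sum.cong refl) (simp add: lookup_single when_def)
    have hm: "peval b (h m) = of_nat (mfact m) * Poly_Mapping.lookup (L * P) m"
    proof -
      have "peval b (h m) = (\<Sum>l\<le>n. \<Sum>a<R. \<Sum>i\<le>n. \<Sum>j\<le>n. (if mon3 i j l = m then of_nat (mfact m) else 0) * x l * y a i * z a j)"
        unfolding h_def peval_rhom(2,7) bX bY bZ
        by (intro sum.cong refl) (auto simp: peval_rhom(4,8))
      also have "\<dots> = (\<Sum>l\<le>n. \<Sum>i\<le>n. \<Sum>j\<le>n. \<Sum>a<R. (if mon3 i j l = m then of_nat (mfact m) else 0) * x l * y a i * z a j)"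
        by (rule sum.cong[OF refl], rule sum_rotate3)
      also have "\<dots> = of_nat (mfact m) * Poly_Mapping.lookup (L * P) m"
        unfolding lk sum_distrib_left by (intro sum.cong refl) (simp add: Q_def sum_distrib_left mult.assoc)
      finally show ?thesis .
    qed
    have "m \<in> ?V"
    proof (rule ccontr)
      assume "m \<notin> ?V"
      then have "mon3 i j l \<noteq> m" if "i \<le> n" "j \<le> n" "l \<le> n" for i j l using mon3_cubic[OF that] by auto
      then have "Poly_Mapping.lookup (L * P) m = 0" unfolding lk by (intro sum.neutral ballI) auto
      then show False using m by simp
    qed
    moreover have "mfact m \<noteq> 0" by (simp add: mfact_def)
    ultimately have "peval b (G m) = 0" using G(3)[OF bE, of m] hm m by simp
    moreover have "peval b (G m) = peval (Poly_Mapping.lookup f) (G m)"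
      unfolding peval_eq_mev using G(1) by (intro mev_cong[of _ ?V]) (auto simp: b_def)
    ultimately show ?thesis using \<open>m \<in> ?V\<close> finite_cubic_monomials[of n]
      unfolding peval_rhom(9) by (auto intro: prod_zero)
  qed
  moreover have "(\<Prod>m\<in>?V. G m) \<in> polys ?V" using G(1) by (intro polys_closed(10))
  moreover have "(\<Prod>m\<in>?V. G m) \<noteq> 0" using G(2) finite_cubic_monomials[of n] by simp
  ultimately show ?thesis by blast
qed

section \<open>The local ring of a point of projective space\<close>

text \<open>The quotient rule on a chosen representation as a fraction; the next lemma shows that
  the choice is immaterial.\<close>

definition fract_deriv :: "('r::idom \<Rightarrow> 'r) \<Rightarrow> 'r fract \<Rightarrow> 'r fract" where
  "fract_deriv d q = (SOME r. \<exists>a b. b \<noteq> 0 \<and> q = Fract a b \<and> r = Fract (d a * b - a * d b) (b * b))"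

lemma fract_deriv_Fract:
  assumes d: "derivation d" and b: "b \<noteq> 0"
  shows "fract_deriv d (Fract a b) = Fract (d a * b - a * d b) (b * b)"
  unfolding fract_deriv_def
proof (rule some_equality)
  show "\<exists>a' b'. b' \<noteq> 0 \<and> Fract a b = Fract a' b' \<and>
      Fract (d a * b - a * d b) (b * b) = Fract (d a' * b' - a' * d b') (b' * b')" using b by blast
  fix r assume "\<exists>a' b'. b' \<noteq> 0 \<and> Fract a b = Fract a' b' \<and> r = Fract (d a' * b' - a' * d b') (b' * b')"
  then obtain a' b' where r: "b' \<noteq> 0" "Fract a b = Fract a' b'" "r = Fract (d a' * b' - a' * d b') (b' * b')" by blast
  have e: "a * b' = a' * b" using r b by (simp add: eq_fract)
  have "d (a * b') = d (a' * b)" using e by simp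
  then have de: "d a * b' + a * d b' = d a' * b + a' * d b" by (simp add: derivation_simps[OF d])
  \<comment> \<open>The difference of the two cross products is a combination of the relation
    \<open>e\<close> and its derivative \<open>de\<close>.\<close>
  have "(d a' * b' - a' * d b') * (b * b) - (d a * b - a * d b) * (b' * b') =
      (b * b') * (d a' * b + a' * d b - (d a * b' + a * d b')) + (a * b' - a' * b) * (b * d b' + b' * d b)"
    by (simp add: algebra_simps)
  then have "(d a' * b' - a' * d b') * (b * b) = (d a * b - a * d b) * (b' * b')" unfolding de e by simp
  then show "r = Fract (d a * b - a * d b) (b * b)" using r b by (simp add: eq_fract)
qed

lemma derivation_fract_deriv:
  fixes d :: "'b::idom \<Rightarrow> 'b"
  assumes d: "derivation d"
  shows "derivation (fract_deriv d)"
  unfolding derivation_def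
proof (intro conjI allI)
  note ds = derivation_simps[OF d]
  fix q r :: "'b fract"
  obtain a b where q: "q = Fract a b" "b \<noteq> 0" by (cases q)
  obtain a' b' where r: "r = Fract a' b'" "b' \<noteq> 0" by (cases r)
  note fd = fract_deriv_Fract[OF d]
  show "fract_deriv d (q + r) = fract_deriv d q + fract_deriv d r"
    using q r by (simp add: fd eq_fract ds algebra_simps)
  show "fract_deriv d (q * r) = fract_deriv d q * r + q * fract_deriv d r"
    using q r by (simp add: fd eq_fract ds algebra_simps)
qed

lemma rhom_to_fract: "rhom (\<lambda>a. Fract a 1)"
  by (simp add: rhom_def One_fract_def)

lemma homogeneous_Vr [simp]: "homogeneous (Suc 0) (Vr i :: ('v, 'a::comm_ring_1) mpol)"
  using homogeneous_simps(6) by simp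

lemma mev_Cst_Vr_id: "mev Cst Vr p = (p :: ('v, 'a::comm_ring_1) mpol)"
proof -
  have "mev Cst Vr p = (\<Sum>m\<in>Poly_Mapping.keys p. Poly_Mapping.single m (Poly_Mapping.lookup p m))"
    unfolding mev_def by (simp flip: single_as_product)
  then show ?thesis by (simp flip: sum_of_singles)
qed

text \<open>The index \<open>p\<close> selects an affine chart around the point, the one where the
  coordinate \<open>p\<close> is invertible.\<close>

locale proj_point =
  fixes n :: nat and x :: "nat \<Rightarrow> 'a::field_char_0" and p :: nat
  assumes xn: "x \<in> nonzero_vecs {..n}" and pn: "p \<le> n" and xp: "x p \<noteq> 0"
begin

definition stalk :: "(nat, 'a) mpol fract set" where
  "stalk = {Fract g h | g h d. g \<in> polys {..n} \<and> h \<in> polys {..n} \<and>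
     homogeneous d g \<and> homogeneous d h \<and> peval x h \<noteq> 0}"

definition ev :: "(nat, 'a) mpol fract \<Rightarrow> 'a" where
  "ev u = (SOME r. \<exists>g h d. u = Fract g h \<and> g \<in> polys {..n} \<and> h \<in> polys {..n} \<and>
     homogeneous d g \<and> homogeneous d h \<and> peval x h \<noteq> 0 \<and> r = peval x g / peval x h)"

definition const :: "'a \<Rightarrow> (nat, 'a) mpol fract" where "const a = Fract (Cst a) 1"

definition coord :: "nat \<Rightarrow> (nat, 'a) mpol fract" where "coord j = Fract (Vr j) (Vr p)"

abbreviation dehom :: "(nat, 'a) mpol \<Rightarrow> (nat, 'a) mpol fract" where "dehom \<equiv> mev const coord"

text \<open>Multiplying by the coordinate \<open>p\<close> restores degree \<open>0\<close>. For
  \<open>j\<close> other than \<open>p\<close> this is the partial derivative with respect to the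
  affine coordinate \<open>coord j\<close> of the chart.\<close>

definition pder :: "nat \<Rightarrow> (nat, 'a) mpol fract \<Rightarrow> (nat, 'a) mpol fract" where
  "pder j u = Fract (Vr p) 1 * fract_deriv (partial_deriv j) u"

definition skip :: "nat \<Rightarrow> nat" where "skip i = (if i < p then i else Suc i)"

definition T :: "nat \<Rightarrow> (nat, 'a) mpol fract" where "T i = coord (skip i) - const (x (skip i) / x p)"

abbreviation E :: "nat \<Rightarrow> (nat, 'a) mpol fract \<Rightarrow> (nat, 'a) mpol fract" where "E i \<equiv> pder (skip i)"

lemma proj_stalk_eq: "proj_stalk n x = subring_of stalk"
  by (simp add: proj_stalk_def stalk_def)

lemma peval_nonzero: "peval x h \<noteq> 0 \<Longrightarrow> h \<noteq> 0"
  by (auto simp: peval_rhom)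

lemma Vp_nonzero: "(Vr p :: (nat, 'a) mpol) \<noteq> 0"
  using peval_nonzero[of "Vr p"] xp by simp

lemma stalkI:
  "g \<in> polys {..n} \<Longrightarrow> h \<in> polys {..n} \<Longrightarrow> homogeneous d g \<Longrightarrow> homogeneous d h \<Longrightarrow> peval x h \<noteq> 0 \<Longrightarrow>
   Fract g h \<in> stalk"
  by (auto simp: stalk_def)

lemma stalkE:
  assumes "u \<in> stalk"
  obtains g h d where "u = Fract g h" "g \<in> polys {..n}" "h \<in> polys {..n}" "homogeneous d g" "homogeneous d h"
    "peval x h \<noteq> 0" "h \<noteq> 0"
  using assms peval_nonzero unfolding stalk_def by blast

lemma ev_Fract:
  assumes "g \<in> polys {..n}" "h \<in> polys {..n}" "homogeneous d g" "homogeneous d h" "peval x h \<noteq> 0"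
  shows "ev (Fract g h) = peval x g / peval x h"
  unfolding ev_def
proof (rule some_equality)
  show "\<exists>g' h' d. Fract g h = Fract g' h' \<and> g' \<in> polys {..n} \<and> h' \<in> polys {..n} \<and>
     homogeneous d g' \<and> homogeneous d h' \<and> peval x h' \<noteq> 0 \<and> peval x g / peval x h = peval x g' / peval x h'"
    using assms by blast
  fix r assume "\<exists>g' h' d. Fract g h = Fract g' h' \<and> g' \<in> polys {..n} \<and> h' \<in> polys {..n} \<and>
     homogeneous d g' \<and> homogeneous d h' \<and> peval x h' \<noteq> 0 \<and> r = peval x g' / peval x h'"
  then obtain g' h' where r: "Fract g h = Fract g' h'" "peval x h' \<noteq> 0" "r = peval x g' / peval x h'" by blast
  have "g * h' = g' * h" using r assms(5) peval_nonzero by (simp add: eq_fract)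
  then have "peval x (g * h') = peval x (g' * h)" by simp
  then have "peval x g * peval x h' = peval x g' * peval x h" unfolding peval_rhom .
  then show "r = peval x g / peval x h" unfolding r(3) using r(2) assms(5) by (simp add: frac_eq_eq)
qed

lemma stalk_add_mult:
  assumes "u \<in> stalk" "v \<in> stalk"
  shows "u + v \<in> stalk" "u * v \<in> stalk" "ev (u + v) = ev u + ev v" "ev (u * v) = ev u * ev v"
proof -
  obtain g h d where u: "u = Fract g h" "g \<in> polys {..n}" "h \<in> polys {..n}" "homogeneous d g" "homogeneous d h"
    "peval x h \<noteq> 0" "h \<noteq> 0" using assms(1) by (rule stalkE)
  obtain g' h' d' where v: "v = Fract g' h'" "g' \<in> polys {..n}" "h' \<in> polys {..n}" "homogeneous d' g'" "homogeneous d' h'"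
    "peval x h' \<noteq> 0" "h' \<noteq> 0" using assms(2) by (rule stalkE)
  have s: "u + v = Fract (g * h' + g' * h) (h * h')" and m: "u * v = Fract (g * g') (h * h')"
    using u v by simp_all
  have hh: "h * h' \<in> polys {..n}" "homogeneous (d + d') (h * h')" "peval x (h * h') \<noteq> 0"
    using u v by (auto simp: polys_closed homogeneous_simps peval_rhom)
  have gg: "g * g' \<in> polys {..n}" "homogeneous (d + d') (g * g')"
    using u v by (auto simp: polys_closed homogeneous_simps)
  have "homogeneous (d + d') (g' * h)" using homogeneous_simps(2)[of d' g' d h] u v by (simp add: add.commute)
  then have gs: "g * h' + g' * h \<in> polys {..n}" "homogeneous (d + d') (g * h' + g' * h)"
    using u v by (auto simp: polys_closed homogeneous_simps)
  show "u + v \<in> stalk" unfolding s by (rule stalkI[OF gs(1) hh(1) gs(2) hh(2,3)])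
  show "u * v \<in> stalk" unfolding m by (rule stalkI[OF gg(1) hh(1) gg(2) hh(2,3)])
  have eu: "ev u = peval x g / peval x h" unfolding u(1) by (rule ev_Fract[OF u(2-6)])
  have ev': "ev v = peval x g' / peval x h'" unfolding v(1) by (rule ev_Fract[OF v(2-6)])
  have "ev (u + v) = peval x (g * h' + g' * h) / peval x (h * h')"
    unfolding s by (rule ev_Fract[OF gs(1) hh(1) gs(2) hh(2,3)])
  then show "ev (u + v) = ev u + ev v" unfolding eu ev' using u(6) v(6) by (simp add: peval_rhom field_simps)
  have "ev (u * v) = peval x (g * g') / peval x (h * h')"
    unfolding m by (rule ev_Fract[OF gg(1) hh(1) gg(2) hh(2,3)])
  then show "ev (u * v) = ev u * ev v" unfolding eu ev' by (simp add: peval_rhom)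
qed

lemma const_stalk: "const a \<in> stalk" "ev (const a) = a"
proof -
  have c: "Cst a \<in> polys {..n}" "(1 :: (nat, 'a) mpol) \<in> polys {..n}" "homogeneous 0 (Cst a)"
    "homogeneous 0 (1 :: (nat, 'a) mpol)" "peval x 1 \<noteq> 0"
    by (auto simp: polys_closed homogeneous_simps peval_rhom)
  show "const a \<in> stalk" unfolding const_def by (rule stalkI[OF c])
  show "ev (const a) = a" unfolding const_def ev_Fract[OF c] by (simp add: peval_rhom)
qed

lemma rhom_const: "rhom const"
  by (simp add: rhom_def const_def single_add mult_single One_fract_def)

lemma stalk_subring: "is_subring stalk"
proof -
  have "const 1 = 1" using rhomD[OF rhom_const] by simp
  then have "1 \<in> stalk" using const_stalk[of 1] by simp
  moreover have "u - v \<in> stalk" if "u \<in> stalk" "v \<in> stalk" for u v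
  proof -
    have eq: "u - v = u + const (- 1) * v" using rhomD(3,5)[OF rhom_const] by simp
    show ?thesis unfolding eq by (intro stalk_add_mult(1,2) const_stalk that)
  qed
  ultimately show ?thesis using stalk_add_mult by (auto simp: is_subring_def)
qed

lemma coord_stalk: "j \<le> n \<Longrightarrow> coord j \<in> stalk" "j \<le> n \<Longrightarrow> ev (coord j) = x j / x p"
  unfolding coord_def using pn xp by (auto intro!: stalkI[of _ _ "Suc 0"] simp: ev_Fract[of _ _ "Suc 0"])

lemma coord_p: "coord p = 1"
  using Vp_nonzero by (simp add: coord_def One_fract_def eq_fract)

lemma stalk_inverse:
  assumes "u \<in> stalk" "ev u \<noteq> 0"
  shows "inverse u \<in> stalk"
proof -
  obtain g h d where u: "u = Fract g h" "g \<in> polys {..n}" "h \<in> polys {..n}" "homogeneous d g" "homogeneous d h"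
    "peval x h \<noteq> 0" "h \<noteq> 0" using assms(1) by (rule stalkE)
  have "peval x g \<noteq> 0" using assms(2) u ev_Fract[OF u(2-6)] by auto
  then show ?thesis using u by (auto intro!: stalkI)
qed

lemma dehom_stalk: "g \<in> polys {..n} \<Longrightarrow> dehom g \<in> stalk"
  by (rule mev_closed[OF stalk_subring rhom_const const_stalk(1) coord_stalk(1)]) auto

lemma dehom_eq:
  assumes "homogeneous d g"
  shows "dehom g = Fract g (Vr p ^ d)"
proof -
  have "Fract g 1 = Fract (mev Cst Vr g) 1" by (simp add: mev_Cst_Vr_id)
  also have "\<dots> = mev ((\<lambda>a. Fract a 1) \<circ> Cst) ((\<lambda>a. Fract a 1) \<circ> Vr) g"
    by (rule mev_comp[OF rhom_Cst rhom_to_fract])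
  also have "(\<lambda>a. Fract a 1) \<circ> Cst = const" by (simp add: fun_eq_iff const_def)
  also have "(\<lambda>a. Fract a 1) \<circ> Vr = (\<lambda>j. Fract (Vr p) 1 * coord j)"
    using Vp_nonzero by (simp add: fun_eq_iff coord_def eq_fract)
  finally have "Fract g 1 = Fract (Vr p) 1 ^ d * dehom g" unfolding mev_scale[OF assms] .
  then have "Fract g 1 = Fract (Vr p ^ d) 1 * dehom g" by (simp flip: rhom_power[OF rhom_to_fract])
  moreover have "Fract 1 (Vr p ^ d) * Fract ((Vr p :: (nat, 'a) mpol) ^ d) 1 = 1"
    unfolding mult_fract One_fract_def by (subst eq_fract(1)) (simp_all add: Vp_nonzero)
  moreover have "Fract 1 (Vr p ^ d) * (Fract (Vr p ^ d) 1 * dehom g) = (Fract 1 (Vr p ^ d) * Fract (Vr p ^ d) 1) * dehom g"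
    by (simp only: mult.assoc)
  ultimately have "dehom g = Fract 1 (Vr p ^ d) * Fract g 1" by (simp only: mult_1)
  then show ?thesis by simp
qed

lemma Vp_power:
  "(Vr p :: (nat, 'a) mpol) ^ d \<in> polys {..n}" "homogeneous d ((Vr p :: (nat, 'a) mpol) ^ d)"
  "peval x (Vr p ^ d) = x p ^ d" "peval x (Vr p ^ d) \<noteq> 0"
proof -
  show "(Vr p :: (nat, 'a) mpol) ^ d \<in> polys {..n}" using pn by (intro polys_closed(7)) auto
  show "homogeneous d ((Vr p :: (nat, 'a) mpol) ^ d)"
    using homogeneous_power[OF homogeneous_simps(6), of d p] by simp
  show e: "peval x (Vr p ^ d) = x p ^ d" by (simp add: rhom_power[OF rhom_peval])
  show "peval x (Vr p ^ d) \<noteq> 0" unfolding e using xp by simp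
qed

lemma ev_dehom: "g \<in> polys {..n} \<Longrightarrow> homogeneous d g \<Longrightarrow> ev (dehom g) = peval x g / x p ^ d"
  using ev_Fract[OF _ Vp_power(1) _ Vp_power(2,4), of g d] by (simp add: dehom_eq Vp_power(3))

lemma Fract_eq_dehom:
  assumes "homogeneous d g" "homogeneous d h" "h \<noteq> 0"
  shows "Fract g h = dehom g * inverse (dehom h)"
  unfolding dehom_eq[OF assms(1)] dehom_eq[OF assms(2)] using assms(3) Vp_nonzero by (simp add: eq_fract)

text \<open>In degree \<open>0\<close> the derivative is zero, which is homogeneous of every degree;
  this case falls outside the shift of degrees by one.\<close>

lemma homogeneous_Vr_partial_deriv:
  assumes "homogeneous d g"
  shows "homogeneous d (Vr q * partial_deriv j (g :: (nat, 'a) mpol))"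
proof (cases d)
  case 0
  have "partial_deriv j g = 0"
  proof (rule poly_mapping_eqI)
    fix m
    have "m + Poly_Mapping.single j 1 \<notin> Poly_Mapping.keys g"
      using assms 0 by (auto simp: homogeneous_def mon_deg_add)
    then show "Poly_Mapping.lookup (partial_deriv j g) m = Poly_Mapping.lookup 0 m"
      by (simp add: lookup_partial_deriv in_keys_iff)
  qed
  then show ?thesis by (simp add: homogeneous_simps)
next
  case (Suc e)
  then show ?thesis using homogeneous_simps(2)[OF homogeneous_simps(6) homogeneous_partial_deriv] assms by fastforce
qed

lemma pder_derivation: "derivation (pder j)"
  using derivation_lin[OF derivation_fract_deriv[OF derivation_partial_deriv[of j]] derivation_fract_deriv[OF derivation_partial_deriv[of j]],
      of "Fract (Vr p) 1" 0]
  unfolding pder_def[abs_def] by simp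

lemma pder_Fract: "b \<noteq> 0 \<Longrightarrow> pder j (Fract a b) = Fract (Vr p * (partial_deriv j a * b - a * partial_deriv j b)) (b * b)"
  by (simp add: pder_def fract_deriv_Fract[OF derivation_partial_deriv])

lemma pder_stalk:
  assumes "u \<in> stalk"
  shows "pder j u \<in> stalk"
proof -
  obtain g h d where u: "u = Fract g h" "g \<in> polys {..n}" "h \<in> polys {..n}" "homogeneous d g" "homogeneous d h"
    "peval x h \<noteq> 0" "h \<noteq> 0" using assms(1) by (rule stalkE)
  have pp: "partial_deriv j g \<in> polys {..n}" "partial_deriv j h \<in> polys {..n}" "(Vr p :: (nat, 'a) mpol) \<in> polys {..n}"
    using u(2,3) pn by (simp_all add: partial_deriv_polys)
  have "homogeneous (d + d) ((Vr p * partial_deriv j g) * h + - (g * (Vr p * partial_deriv j h)))"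
    using u by (intro homogeneous_simps homogeneous_Vr_partial_deriv)
  moreover have "(Vr p * partial_deriv j g) * h + - (g * (Vr p * partial_deriv j h)) =
      Vr p * (partial_deriv j g * h - g * partial_deriv j h)" by (simp add: algebra_simps)
  ultimately have "homogeneous (d + d) (Vr p * (partial_deriv j g * h - g * partial_deriv j h))" by simp
  moreover have "homogeneous (d + d) (h * h)" using u by (intro homogeneous_simps)
  moreover have "Vr p * (partial_deriv j g * h - g * partial_deriv j h) \<in> polys {..n}"
    using u pp by (intro polys_closed)
  moreover have "h * h \<in> polys {..n}" using u by (intro polys_closed)
  ultimately show ?thesis unfolding u(1) pder_Fract[OF u(7)] using u(6)
    by (intro stalkI) (auto simp: peval_rhom)
qed

lemma pder_const: "pder j (const a) = 0"
  unfolding const_def by (subst pder_Fract) (auto simp: Zero_fract_def eq_fract derivation_simps(4)[OF derivation_partial_deriv])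

lemma pder_coord: "j \<noteq> p \<Longrightarrow> pder j (coord i) = (if i = j then 1 else 0)"
  unfolding coord_def using Vp_nonzero by (subst pder_Fract) (auto simp: Zero_fract_def One_fract_def eq_fract)

lemma pder_dehom:
  assumes "g \<in> polys {..n}" "j \<noteq> p" "j \<le> n"
  shows "pder j (dehom g) = dehom (partial_deriv j g)"
proof -
  have "pder j (dehom g) = (\<Sum>i\<le>n. dehom (partial_deriv i g) * pder j (coord i))"
    using assms(1) by (intro derivation_mev rhom_const pder_derivation pder_const) auto
  also have "\<dots> = (\<Sum>i\<le>n. if i = j then dehom (partial_deriv i g) else 0)"
    using assms(2) by (intro sum.cong) (auto simp: pder_coord)
  finally show ?thesis using assms(3) by simp
qed

lemma skip_simps: "i < n \<Longrightarrow> skip i \<le> n" "skip i \<noteq> p" "skip i = skip j \<longleftrightarrow> i = j"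
  by (auto simp: skip_def)

lemma skip_surj: "j \<le> n \<Longrightarrow> j \<noteq> p \<Longrightarrow> \<exists>i<n. skip i = j"
  using pn by (intro exI[of _ "if j < p then j else j - 1"]) (auto simp: skip_def)

lemma T_stalk: "i < n \<Longrightarrow> T i \<in> stalk" "i < n \<Longrightarrow> ev (T i) = 0"
proof -
  assume i: "i < n"
  have eq: "T i = coord (skip i) + const (- (x (skip i) / x p))"
    unfolding T_def rhomD(5)[OF rhom_const] by simp
  show "T i \<in> stalk" "ev (T i) = 0" unfolding eq
    using coord_stalk[OF skip_simps(1)[OF i]] const_stalk by (simp_all add: stalk_add_mult)
qed

text \<open>Modulo the ideal generated by the \<open>T i\<close>, every affine coordinate is
  congruent to its value at the point, hence so is every dehomogenized polynomial. A numerator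
  vanishing at the point thus belongs to this ideal, and denominators are units.\<close>

lemma T_generate:
  assumes u: "u \<in> stalk" "ev u = 0"
  shows "\<exists>a. (\<forall>i<n. a i \<in> stalk) \<and> u = (\<Sum>i<n. a i * T i)"
proof -
  note sub = subring_closed[OF stalk_subring]
  define K where "K = {\<Sum>i<n. a i * T i | a. \<forall>i<n. a i \<in> stalk}"
  have K: "is_ideal stalk K"
    unfolding is_ideal_def
  proof (intro conjI ballI)
    show "K \<subseteq> stalk" using T_stalk(1) by (auto simp: K_def intro!: sub(9) sub(5))
    show "0 \<in> K" unfolding K_def using sub(1) by (intro CollectI exI[of _ "\<lambda>_. 0"]) auto
    fix u v assume "u \<in> K" "v \<in> K"
    then obtain a b where "\<forall>i<n. a i \<in> stalk" "u = (\<Sum>i<n. a i * T i)" "\<forall>i<n. b i \<in> stalk" "v = (\<Sum>i<n. b i * T i)"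
      by (auto simp: K_def)
    then show "u + v \<in> K" unfolding K_def
      by (intro CollectI exI[of _ "\<lambda>i. a i + b i"]) (auto simp: sub(3) distrib_right sum.distrib)
  next
    fix s u assume s: "s \<in> stalk" "u \<in> K"
    then obtain a where "\<forall>i<n. a i \<in> stalk" "u = (\<Sum>i<n. a i * T i)" by (auto simp: K_def)
    then show "s * u \<in> K" unfolding K_def using s
      by (intro CollectI exI[of _ "\<lambda>i. s * a i"]) (auto simp: sub(5) sum_distrib_left mult.assoc)
  qed
  have TK: "T i \<in> K" if "i < n" for i
  proof -
    have "T i = (\<Sum>j<n. (if j = i then 1 else 0) * T j)" using that by (simp add: if_distrib[of "\<lambda>y. y * _"] cong: if_cong)
    then show ?thesis unfolding K_def using sub(1,2) by (intro CollectI exI[of _ "\<lambda>j. if j = i then 1 else 0"]) auto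
  qed
  have diff: "coord j - const (x j / x p) \<in> K" if jn: "j \<le> n" for j
  proof (cases "j = p")
    case True
    then show ?thesis using xp ideal_closed(1)[OF K] rhomD(3)[OF rhom_const] by (simp add: coord_p)
  next
    case False
    then obtain i where "i < n" "skip i = j" using skip_surj[OF jn] by blast
    then show ?thesis using TK[of i] by (simp add: T_def)
  qed
  obtain g h d where gh: "u = Fract g h" "g \<in> polys {..n}" "h \<in> polys {..n}" "homogeneous d g" "homogeneous d h"
    "peval x h \<noteq> 0" "h \<noteq> 0" using u(1) by (rule stalkE)
  have g0: "peval x g = 0" using u(2) gh ev_Fract[OF gh(2-6)] by simp
  have "dehom g - mev const (\<lambda>j. const (x j / x p)) g \<in> K"
    using mev_cong_ideal[OF stalk_subring K rhom_const const_stalk(1), of "{..n}" coord "\<lambda>j. const (x j / x p)" g]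
      coord_stalk(1) const_stalk(1) diff gh(2) by auto
  moreover have "mev const (\<lambda>j. const (x j / x p)) g = const (peval (\<lambda>j. x j / x p) g)"
    using mev_comp[OF rhom_id rhom_const, of "\<lambda>j. x j / x p" g] by (simp add: peval_eq_mev comp_def)
  moreover have "peval (\<lambda>j. x j / x p) g = 0"
    using peval_scale[OF gh(4), of "inverse (x p)" x] g0 by (simp add: divide_inverse mult.commute)
  ultimately have "dehom g \<in> K" using rhomD(4)[OF rhom_const] by simp
  moreover have "inverse (dehom h) \<in> stalk"
    using stalk_inverse[OF dehom_stalk[OF gh(3)]] ev_dehom[OF gh(3,5)] gh(6) xp by simp
  ultimately have "u \<in> K" unfolding gh(1) Fract_eq_dehom[OF gh(4,5,7)] using ideal_closed(6)[OF K] by simp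
  then show ?thesis by (auto simp: K_def)
qed

section \<open>Noetherianity and dimension of the stalk\<close>

lemma noetherian_polys_image:
  fixes c :: "'b::field \<Rightarrow> 'r::comm_ring_1"
  assumes c: "rhom c"
  shows "is_subring (mev c t ` polys {..<k}) \<and> noetherian_set (mev c t ` polys {..<k :: nat})"
proof (induction k)
  case 0
  have "polys {..<0 :: nat} = range (Cst :: 'b \<Rightarrow> _)"
  proof (intro equalityI subsetI)
    fix q :: "(nat, 'b) mpol" assume "q \<in> polys {..<0}"
    then have "Poly_Mapping.keys q \<subseteq> {0}" by (auto simp: polys_def)
    then have "q = Cst (Poly_Mapping.lookup q 0)"
      by (intro poly_mapping_eqI) (auto simp: lookup_single when_def in_keys_iff)
    then show "q \<in> range Cst" by blast
  qed auto
  then have img: "mev c t ` polys {..<0} = range c" by (auto simp: mev_Cst_Vr[OF c] image_image)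
  have sub: "is_subring (range c)" unfolding is_subring_def
    using rhomD(2,3,6)[OF c] by (auto simp: image_iff) metis+
  have "noetherian_set (range c)"
    unfolding noetherian_set_def
  proof (intro allI impI)
    fix I assume I: "is_ideal (range c) I"
    show "\<exists>B. finite B \<and> B \<subseteq> I \<and> (\<forall>J. is_ideal (range c) J \<longrightarrow> B \<subseteq> J \<longrightarrow> I \<subseteq> J)"
    proof (cases "I \<subseteq> {0}")
      case True
      then show ?thesis using ideal_closed(1) by (intro exI[of _ "{}"]) blast
    next
      case False
      then obtain u where u: "u \<in> I" "u \<noteq> 0" by blast
      then obtain a where a: "u = c a" using ideal_closed(4)[OF I] by blast
      then have "a \<noteq> 0" using u rhomD(4)[OF c] by auto
      have "I \<subseteq> J" if J: "is_ideal (range c) J" "{u} \<subseteq> J" for J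
      proof
        fix v assume "v \<in> I"
        then obtain b where b: "v = c b" using ideal_closed(4)[OF I] by blast
        have "v = c (b / a) * u" unfolding a b rhomD(2)[OF c, symmetric] using \<open>a \<noteq> 0\<close> by simp
        then show "v \<in> J" using ideal_closed(3)[OF J(1), of "c (b / a)" u] J(2) by simp
      qed
      then show ?thesis using u by (intro exI[of _ "{u}"]) auto
    qed
  qed
  then show ?case using sub img by simp
next
  case (Suc k)
  let ?B = "mev c t ` polys {..<k}"
  have B: "is_subring ?B" "noetherian_set ?B" using Suc by auto
  have ins: "{..<Suc k} = insert k {..<k}" by auto
  \<comment> \<open>One more variable adjoins one more value, with no assumption on relations among
    the values. The induction therefore runs over images of polynomial rings, starting from the
    image of a field.\<close>
  have "mev c t ` polys {..<Suc k} = adjoin ?B (t k)"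
  proof (intro equalityI subsetI)
    fix u assume "u \<in> mev c t ` polys {..<Suc k}"
    then obtain q where q: "q \<in> polys (insert k {..<k})" "u = mev c t q" unfolding ins by blast
    obtain r where r: "\<forall>i. coeff r i \<in> polys {..<k}" "poly r (Vr k) = q" using polys_insert_as_poly[OF q(1)] by blast
    have z: "mev c t 0 = 0" by simp
    have "u = poly (map_poly (mev c t) r) (t k)"
      unfolding q(2) r(2)[symmetric] by (induction r) (simp_all add: map_poly_pCons[where f = "mev c t", OF z] mev_add[OF c] mev_mult[OF c] mev_Cst_Vr[OF c])
    then show "u \<in> adjoin ?B (t k)" using r(1) unfolding adjoin_def
      by (intro CollectI exI[of _ "map_poly (mev c t) r"]) (auto simp: coeff_map_poly)
  next
    fix u assume "u \<in> adjoin ?B (t k)"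
    then obtain r where r: "\<forall>i. coeff r i \<in> ?B" "u = poly r (t k)" by (auto simp: adjoin_def)
    have C: "is_subring (mev c t ` polys {..<Suc k})"
      unfolding is_subring_def
    proof (intro conjI ballI)
      show "1 \<in> mev c t ` polys {..<Suc k}" using polys_closed(2) mev_Cst_Vr(3)[OF c, of t] by (metis imageI)
      fix a b assume "a \<in> mev c t ` polys {..<Suc k}" "b \<in> mev c t ` polys {..<Suc k}"
      then obtain a' b' where ab: "a = mev c t a'" "b = mev c t b'" "a' \<in> polys {..<Suc k}" "b' \<in> polys {..<Suc k}" by auto
      have "a - b = mev c t (a' - b')" "a * b = mev c t (a' * b')"
        unfolding ab by (simp_all add: mev_mult[OF c] mev_rhom(6)[OF c])
      then show "a - b \<in> mev c t ` polys {..<Suc k}" "a * b \<in> mev c t ` polys {..<Suc k}"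
        using ab(3,4) by (auto intro!: imageI polys_closed)
    qed
    have "polys {..<k} \<subseteq> (polys {..<Suc k} :: (nat, 'b) mpol set)" by (rule polys_mono) auto
    then have "coeff r i \<in> mev c t ` polys {..<Suc k}" for i using r(1) by blast
    moreover have "t k \<in> mev c t ` polys {..<Suc k}"
      using imageI[OF polys_Vr[of k "{..<Suc k}"], of "mev c t"] by (simp add: mev_Cst_Vr[OF c])
    ultimately show "u \<in> mev c t ` polys {..<Suc k}"
      unfolding r(2) poly_altdef by (intro subring_closed[OF C])
  qed
  then show ?case using adjoin_subring[OF B(1)] hilbert_basis[OF B] by simp
qed

lemma noetherian_stalk: "noetherian_set stalk"
proof (rule noetherian_localization)
  let ?B = "dehom ` polys {..<Suc n}"
  show "is_subring ?B" "noetherian_set ?B" using noetherian_polys_image[OF rhom_const] by blast+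
  show "is_subring stalk" by (rule stalk_subring)
  have n: "{..<Suc n} = {..n}" by auto
  show "?B \<subseteq> stalk" unfolding n using dehom_stalk by blast
  fix u assume "u \<in> stalk"
  then obtain g h d where gh: "u = Fract g h" "g \<in> polys {..n}" "h \<in> polys {..n}" "homogeneous d g" "homogeneous d h"
    "peval x h \<noteq> 0" "h \<noteq> 0" by (rule stalkE)
  have nz: "dehom h \<noteq> 0" unfolding dehom_eq[OF gh(5)] using gh(7) Vp_nonzero by (simp add: Zero_fract_def eq_fract)
  have "inverse (dehom h) \<in> stalk"
    using stalk_inverse[OF dehom_stalk[OF gh(3)]] ev_dehom[OF gh(3,5)] gh(6) xp by simp
  moreover have "dehom h * u = dehom g" unfolding gh(1) Fract_eq_dehom[OF gh(4,5,7)] using nz by simp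
  ultimately show "\<exists>s\<in>?B. \<exists>t\<in>stalk. s * t = 1 \<and> s * u \<in> ?B"
    unfolding n using nz gh by (intro bexI[of _ "dehom h"] bexI[of _ "inverse (dehom h)"]) auto
qed

text \<open>Counting monomials shows that \<open>n + 1\<close> elements of the stalk are algebraically dependent.\<close>

lemma stalk_dim:
  assumes P: "prime_chain stalk {} l P"
  shows "l \<le> n"
proof (rule ccontr)
  assume "\<not> l \<le> n"
  then have ln: "Suc n \<le> l" by simp
  have Pp: "is_prime stalk (P i)" if "i \<le> Suc n" for i using P ln that by (auto simp: prime_chain_def)
  have Ps: "P i \<subset> P (Suc i)" if "i < Suc n" for i using P ln that by (auto simp: prime_chain_def)
  have "\<exists>u. u \<in> P (Suc i) - P i" if "i < Suc n" for i using Ps[OF that] by blast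
  then obtain u where u: "\<And>i. i < Suc n \<Longrightarrow> u i \<in> P (Suc i) - P i" by metis
  have "u i \<in> stalk" if "i < Suc n" for i using u[OF that] ideal_closed(4)[OF primeD(1)[OF Pp[of "Suc i"]]] that by auto
  then have "\<exists>g h d. u i = Fract g h \<and> g \<in> polys {..n} \<and> h \<in> polys {..n} \<and> homogeneous d g \<and> homogeneous d h \<and> h \<noteq> 0"
    if "i < Suc n" for i using that by (metis stalkE)
  then obtain g h d where gh': "\<forall>i<Suc n. u i = Fract (g i) (h i) \<and> g i \<in> polys {..n} \<and> h i \<in> polys {..n} \<and>
      homogeneous (d i) (g i) \<and> homogeneous (d i) (h i) \<and> h i \<noteq> 0" by metis
  then have gh: "\<And>i. i < Suc n \<Longrightarrow> u i = Fract (g i) (h i)" "\<And>i. i < Suc n \<Longrightarrow> g i \<in> polys {..n}"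
    "\<And>i. i < Suc n \<Longrightarrow> h i \<in> polys {..n}" "\<And>i. i < Suc n \<Longrightarrow> homogeneous (d i) (g i)"
    "\<And>i. i < Suc n \<Longrightarrow> homogeneous (d i) (h i)" "\<And>i. i < Suc n \<Longrightarrow> h i \<noteq> 0" by blast+
  \<comment> \<open>With exponents up to \<open>D\<close> there are \<open>(D + 1) ^ Suc n\<close>
    products of the \<open>u i\<close>. Over a common denominator their numerators have degree
    \<open>D * N\<close>, which leaves at most \<open>(D * N + 1) ^ n\<close> monomials. This is at
    most \<open>(D + 1) ^ n * (N + 1) ^ n\<close>, and \<open>D\<close> is chosen to be the second
    factor.\<close>
  define N where "N = (\<Sum>i<Suc n. d i)"
  define D where "D = (N + 1) ^ n"
  define F where "F = ({..<Suc n} \<rightarrow>\<^sub>E {..D})"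
  define S where "S = (\<lambda>\<alpha> i. if i < Suc n then \<alpha> i else 0) ` F"
  have F: "finite F" "card F = (D + 1) ^ Suc n" unfolding F_def by (auto intro!: finite_PiE simp: card_PiE)
  have "inj_on (\<lambda>\<alpha> i. if i < Suc n then \<alpha> i else 0) F"
  proof (rule inj_onI)
    fix \<alpha> \<beta> :: "nat \<Rightarrow> nat"
    assume ab: "\<alpha> \<in> F" "\<beta> \<in> F" "(\<lambda>i. if i < Suc n then \<alpha> i else 0) = (\<lambda>i. if i < Suc n then \<beta> i else 0)"
    have "\<alpha> i = \<beta> i" if "i < Suc n" for i using fun_cong[OF ab(3), of i] that by simp
    then show "\<alpha> = \<beta>" using ab(1,2) unfolding F_def by (intro PiE_ext) auto
  qed
  then have S: "finite S" "card S = (D + 1) ^ Suc n" using F by (simp_all add: S_def card_image)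
  have SD: "\<alpha> i \<le> D" "Suc n \<le> i \<Longrightarrow> \<alpha> i = 0" if \<alpha>: "\<alpha> \<in> S" for \<alpha> i
  proof -
    obtain \<beta> where \<beta>: "\<beta> \<in> F" "\<alpha> = (\<lambda>i. if i < Suc n then \<beta> i else 0)" using \<alpha> unfolding S_def by blast
    have "\<beta> i \<in> {..D}" if "i < Suc n" using PiE_mem[OF \<beta>(1)[unfolded F_def], of i] that by simp
    then show "\<alpha> i \<le> D" "Suc n \<le> i \<Longrightarrow> \<alpha> i = 0" unfolding \<beta>(2) by simp_all
  qed
  let ?M = "{m :: nat \<Rightarrow>\<^sub>0 nat. Poly_Mapping.keys m \<subseteq> {..n} \<and> mon_deg m = D * N}"
  have "card ?M < card S"
  proof -
    have "card ?M \<le> (D * N + 1) ^ n" by (rule monomials_finite_card)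
    also have "\<dots> \<le> ((D + 1) * (N + 1)) ^ n" by (intro power_mono) (auto simp: algebra_simps)
    also have "\<dots> = (D + 1) ^ n * D" unfolding power_mult_distrib by (simp add: D_def)
    also have "\<dots> < card S" unfolding S(2) by simp
    finally show ?thesis .
  qed
  \<comment> \<open>The numerator of the product of the \<open>u i ^ \<alpha> i\<close> after
    multiplication by the common denominator, the product of the \<open>h i ^ D\<close>.\<close>
  define G where "G = (\<lambda>\<alpha>. \<Prod>i<Suc n. g i ^ \<alpha> i * h i ^ (D - \<alpha> i))"
  obtain k where k: "\<exists>\<alpha>\<in>S. k \<alpha> \<noteq> 0" "\<forall>m\<in>?M. (\<Sum>\<alpha>\<in>S. k \<alpha> * Poly_Mapping.lookup (G \<alpha>) m) = 0"
    using underdetermined_system[OF monomials_finite_card(1) S(1) \<open>card ?M < card S\<close>, of "\<lambda>\<alpha>. Poly_Mapping.lookup (G \<alpha>)"] by blast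
  have GM: "Poly_Mapping.lookup (G \<alpha>) m = 0" if "\<alpha> \<in> S" "m \<notin> ?M" for \<alpha> m
  proof -
    have "G \<alpha> \<in> polys {..n}" unfolding G_def using gh by (intro polys_closed) auto
    moreover have "homogeneous (\<Sum>i<Suc n. D * d i) (G \<alpha>)" unfolding G_def
    proof (rule homogeneous_prod)
      fix i assume "i \<in> {..<Suc n}"
      then have "homogeneous (\<alpha> i * d i + (D - \<alpha> i) * d i) (g i ^ \<alpha> i * h i ^ (D - \<alpha> i))"
        using gh by (intro homogeneous_simps homogeneous_power) auto
      then show "homogeneous (D * d i) (g i ^ \<alpha> i * h i ^ (D - \<alpha> i))"
        using SD(1)[OF that(1), of i] by (simp flip: distrib_right)
    qed
    moreover have "(\<Sum>i<Suc n. D * d i) = D * N" by (simp only: N_def sum_distrib_left)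
    ultimately have "m \<notin> Poly_Mapping.keys (G \<alpha>)" using that(2) by (auto simp: polys_def homogeneous_def)
    then show ?thesis by (simp add: in_keys_iff)
  qed
  have "(\<Sum>\<alpha>\<in>S. Cst (k \<alpha>) * G \<alpha>) = 0"
  proof (rule poly_mapping_eqI)
    fix m
    have "Poly_Mapping.lookup (Cst (k \<alpha>) * G \<alpha>) m = k \<alpha> * Poly_Mapping.lookup (G \<alpha>) m" for \<alpha>
      by (simp add: Poly_Mapping.map.rep_eq when_def flip: Poly_Mapping.mult_map_scale_conv_mult)
    then have "Poly_Mapping.lookup (\<Sum>\<alpha>\<in>S. Cst (k \<alpha>) * G \<alpha>) m = (\<Sum>\<alpha>\<in>S. k \<alpha> * Poly_Mapping.lookup (G \<alpha>) m)"
      by (simp add: lookup_sum)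
    also have "\<dots> = 0" using k(2) GM by (cases "m \<in> ?M") auto
    finally show "Poly_Mapping.lookup (\<Sum>\<alpha>\<in>S. Cst (k \<alpha>) * G \<alpha>) m = Poly_Mapping.lookup 0 m" by simp
  qed
  have rt: "rhom (\<lambda>a :: (nat, 'a) mpol. Fract a 1)" by (rule rhom_to_fract)
  note rf = rhomD[OF rt] rhom_power[OF rt]
  define H where "H = (\<Prod>i<Suc n. Fract (h i) 1 ^ D)"
  have hF: "Fract (h i) 1 \<noteq> 0" if "i < Suc n" for i using gh(6)[OF that] by (simp add: Zero_fract_def eq_fract)
  then have "H \<noteq> 0" unfolding H_def by (simp add: prod_zero_iff del: prod.lessThan_Suc)
  have mono: "(\<Prod>i<Suc n. u i ^ \<alpha> i) * H = Fract (G \<alpha>) 1" if "\<alpha> \<in> S" for \<alpha>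
  proof -
    have "u i ^ \<alpha> i * Fract (h i) 1 ^ D = Fract (g i ^ \<alpha> i * h i ^ (D - \<alpha> i)) 1" if i: "i < Suc n" for i
    proof -
      have "u i * Fract (h i) 1 = Fract (g i) 1" using gh(1,6)[OF i] by (simp add: eq_fract)
      moreover have "u i ^ \<alpha> i * (Fract (h i) 1 ^ \<alpha> i * Fract (h i) 1 ^ (D - \<alpha> i)) =
          (u i * Fract (h i) 1) ^ \<alpha> i * Fract (h i) 1 ^ (D - \<alpha> i)"
        by (simp only: power_mult_distrib mult.assoc)
      moreover have "Fract (h i) 1 ^ D = Fract (h i) 1 ^ \<alpha> i * Fract (h i) 1 ^ (D - \<alpha> i)"
        using SD(1)[OF \<open>\<alpha> \<in> S\<close>, of i] by (simp flip: power_add)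
      ultimately have "u i ^ \<alpha> i * Fract (h i) 1 ^ D = Fract (g i) 1 ^ \<alpha> i * Fract (h i) 1 ^ (D - \<alpha> i)"
        by simp
      then show ?thesis by (simp only: rf)
    qed
    then show ?thesis unfolding H_def G_def rf(9) prod.distrib[symmetric] by (intro prod.cong) auto
  qed
  have "(\<Sum>\<alpha>\<in>S. const (k \<alpha>) * (\<Prod>i<Suc n. u i ^ \<alpha> i)) * H = (\<Sum>\<alpha>\<in>S. const (k \<alpha>) * Fract (G \<alpha>) 1)"
    unfolding sum_distrib_right by (intro sum.cong) (simp_all add: mult.assoc mono del: prod.lessThan_Suc)
  also have "\<dots> = Fract (\<Sum>\<alpha>\<in>S. Cst (k \<alpha>) * G \<alpha>) 1" unfolding rf(7) rf(2) const_def ..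
  also have "\<dots> = 0" unfolding \<open>(\<Sum>\<alpha>\<in>S. Cst (k \<alpha>) * G \<alpha>) = 0\<close> by (simp add: Zero_fract_def)
  finally have rel: "(\<Sum>\<alpha>\<in>S. const (k \<alpha>) * (\<Prod>i<Suc n. u i ^ \<alpha> i)) = 0" using \<open>H \<noteq> 0\<close> by simp
  have rel0: "(\<Sum>\<alpha>\<in>S. const (k \<alpha>) * (\<Prod>i<Suc n. u i ^ \<alpha> i)) \<in> P 0"
    unfolding rel using ideal_closed(1)[OF primeD(1)[OF Pp[of 0]]] by simp
  have "k \<alpha> = 0" if "\<alpha> \<in> S" for \<alpha>
    by (rule prime_chain_independent[where c = const and l = "Suc n" and P = P and u = u and S = S and k = k and \<alpha> = \<alpha>,
      OF stalk_subring rhomD(2)[OF rhom_const] rhomD(3)[OF rhom_const] const_stalk(1)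
      rhomD(4)[OF rhom_const] Pp psubset_imp_subset[OF Ps] u S(1) _ rel0 that]) (assumption | rule SD(2))+
  then show False using k(1) by blast
qed

sublocale local_system stalk ev const n T E
proof
  show "is_subring stalk" by (rule stalk_subring)
  show "noetherian_set stalk" by (rule noetherian_stalk)
  show "l \<le> n" if "prime_chain stalk {} l P" for l P using stalk_dim[OF that] .
  show "\<exists>a. (\<forall>i<n. a i \<in> stalk) \<and> u = (\<Sum>i<n. a i * T i)" if "u \<in> stalk" "ev u = 0" for u by (rule T_generate[OF that])
  show "E i (T j) = (if i = j then 1 else 0)" if "i < n" "j < n" for i j
    unfolding T_def derivation_simps(6)[OF pder_derivation] pder_const using skip_simps by (simp add: pder_coord)
qed (use stalk_add_mult rhomD[OF rhom_const] const_stalk stalk_inverse T_stalk pder_derivation pder_stalk pder_const in auto)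

subsection \<open>Stalks of homogeneous ideals\<close>

lemma ideal_stalk_ideal:
  assumes "J \<subseteq> polys {..n}"
  shows "is_ideal stalk (ideal_stalk n J x)"
proof -
  interpret R: cring "subring_of stalk" by (rule cring_subring_of[OF stalk_subring])
  have "{Fract g h | g h d. g \<in> J \<and> h \<in> polys {..n} \<and> homogeneous d g \<and> homogeneous d h \<and> peval x h \<noteq> 0} \<subseteq> carrier (subring_of stalk)"
    using assms by (auto simp: stalk_def)
  from R.genideal_ideal[OF this] show ?thesis
    unfolding ideal_stalk_def proj_stalk_eq ideal_subring_of[OF stalk_subring] .
qed

lemma hom_ideal_sub:
  assumes "G \<subseteq> polys {..n}"
  shows "G \<subseteq> hom_ideal n G" "is_ideal (polys {..n}) (hom_ideal n (G :: (nat, 'a) mpol set))"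
    "\<And>K. is_ideal (polys {..n}) K \<Longrightarrow> G \<subseteq> K \<Longrightarrow> hom_ideal n G \<subseteq> K"
proof -
  interpret R: cring "subring_of (polys {..n} :: (nat, 'a) mpol set)" by (rule cring_subring_of[OF polys_subring])
  have G: "G \<subseteq> carrier (subring_of (polys {..n}))" using assms by simp
  show "G \<subseteq> hom_ideal n G" unfolding hom_ideal_def by (rule R.genideal_self[OF G])
  show "is_ideal (polys {..n}) (hom_ideal n G)"
    using R.genideal_ideal[OF G] unfolding hom_ideal_def ideal_subring_of[OF polys_subring] .
  show "hom_ideal n G \<subseteq> K" if "is_ideal (polys {..n}) K" "G \<subseteq> K" for K
    unfolding hom_ideal_def using that ideal_subring_of[OF polys_subring] by (intro R.genideal_minimal) auto
qed

text \<open>The polynomials whose dehomogenization lies in \<open>K\<close> form an ideal, so the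
  condition passes from \<open>G\<close> to everything it generates. A fraction differs from its
  dehomogenized numerator by a unit of the stalk.\<close>

lemma ideal_stalk_subset:
  assumes G: "G \<subseteq> polys {..n}" and K: "is_ideal stalk K" and GK: "\<And>g. g \<in> G \<Longrightarrow> dehom g \<in> K"
  shows "ideal_stalk n (hom_ideal n G) x \<subseteq> K"
proof -
  interpret R: cring "subring_of stalk" by (rule cring_subring_of[OF stalk_subring])
  define L where "L = {g \<in> polys {..n}. dehom g \<in> K}"
  have "is_ideal (polys {..n}) L" unfolding is_ideal_def L_def
    using ideal_closed[OF K] dehom_stalk by (auto simp: polys_closed mev_add[OF rhom_const] mev_mult[OF rhom_const])
  moreover have "G \<subseteq> L" using G GK by (auto simp: L_def)
  ultimately have JL: "hom_ideal n G \<subseteq> L" by (rule hom_ideal_sub(3)[OF G])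
  have "Fract g h \<in> K" if gh: "g \<in> hom_ideal n G" "h \<in> polys {..n}" "homogeneous d g" "homogeneous d h" "peval x h \<noteq> 0" for g h d
  proof -
    have "inverse (dehom h) \<in> stalk"
      using stalk_inverse[OF dehom_stalk[OF gh(2)]] ev_dehom[OF gh(2,4)] gh(5) xp by simp
    then show ?thesis unfolding Fract_eq_dehom[OF gh(3,4) peval_nonzero[OF gh(5)]]
      using JL gh(1) ideal_closed(6)[OF K] by (auto simp: L_def)
  qed
  then show ?thesis unfolding ideal_stalk_def proj_stalk_eq
    using K by (intro R.genideal_minimal) (auto simp: ideal_subring_of[OF stalk_subring])
qed

lemma ideal_stalk_mem:
  assumes G: "G \<subseteq> polys {..n}" and g: "g \<in> G" "homogeneous d g"
  shows "dehom g \<in> ideal_stalk n (hom_ideal n G) x"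
proof -
  interpret R: cring "subring_of stalk" by (rule cring_subring_of[OF stalk_subring])
  let ?H = "{Fract g h | g h d. g \<in> hom_ideal n G \<and> h \<in> polys {..n} \<and> homogeneous d g \<and> homogeneous d h \<and> peval x h \<noteq> 0}"
  have "hom_ideal n G \<subseteq> polys {..n}" using hom_ideal_sub(2)[OF G] by (simp add: is_ideal_def)
  then have "?H \<subseteq> carrier (subring_of stalk)" by (auto simp: stalk_def)
  moreover have "dehom g \<in> ?H" unfolding dehom_eq[OF g(2)] using hom_ideal_sub(1)[OF G] g Vp_power by blast
  ultimately show ?thesis unfolding ideal_stalk_def proj_stalk_eq using R.genideal_self by blast
qed

end

section \<open>Determinants and minors\<close>

lemma bij_betw_pick:
  assumes "finite I"
  shows "bij_betw (pick I) {..<card I} I"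
proof -
  have "inj_on (pick I) {..<card I}"
  proof (rule inj_onI)
    fix a b assume ab: "a \<in> {..<card I}" "b \<in> {..<card I}" "pick I a = pick I b"
    show "a = b" using pick_mono_le[of a I b] pick_mono_le[of b I a] ab by (metis lessThan_iff less_irrefl linorder_neqE_nat)
  qed
  moreover have "pick I ` {..<card I} \<subseteq> I" using pick_in_set_le by auto
  ultimately show ?thesis
    using card_image[of "pick I" "{..<card I}"] card_subset_eq[OF assms] by (auto simp: bij_betw_def)
qed

lemma mat_mult_vec_index:
  "i < m \<Longrightarrow> dim_vec v = k \<Longrightarrow> (mat m k f *\<^sub>v v) $ i = (\<Sum>b<k. f (i, b) * v $ b)"
  by (simp add: scalar_prod_def lessThan_atLeast0)

text \<open>Invertibility as injectivity, expressed on index sets: the enumerations \<open>r\<close>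
  and \<open>c\<close> of rows and columns disappear from the right-hand side.\<close>

lemma det_nonzero_iff:
  fixes A :: "nat \<Rightarrow> nat \<Rightarrow> 'a::field"
  assumes r: "bij_betw r {..<m} I" and c: "bij_betw c {..<m} J"
  shows "Determinant.det (mat m m (\<lambda>(a, b). A (r a) (c b))) \<noteq> 0 \<longleftrightarrow>
    (\<forall>w. (\<forall>a\<in>I. (\<Sum>b\<in>J. A a b * w b) = 0) \<longrightarrow> (\<forall>b\<in>J. w b = 0))"
proof -
  let ?M = "mat m m (\<lambda>(a, b). A (r a) (c b))"
  have prod: "(?M *\<^sub>v vec m (w \<circ> c)) $ i = (\<Sum>b\<in>J. A (r i) b * w b)" if "i < m" for i w
  proof -
    have "(?M *\<^sub>v vec m (w \<circ> c)) $ i = (\<Sum>b<m. A (r i) (c b) * w (c b))"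
      using that by (subst mat_mult_vec_index) auto
    also have "\<dots> = (\<Sum>b\<in>J. A (r i) b * w b)" by (rule sum.reindex_bij_betw[OF c])
    finally show ?thesis .
  qed
  have "Determinant.det ?M = 0 \<longleftrightarrow> (\<exists>w. (\<forall>a\<in>I. (\<Sum>b\<in>J. A a b * w b) = 0) \<and> (\<exists>b\<in>J. w b \<noteq> 0))"
  proof
    assume "Determinant.det ?M = 0"
    then obtain v where v: "v \<in> carrier_vec m" "v \<noteq> 0\<^sub>v m" "?M *\<^sub>v v = 0\<^sub>v m"
      using det_0_iff_vec_prod_zero_field[of ?M m] by auto
    define w where "w = (\<lambda>b. v $ (inv_into {..<m} c b))"
    have wc: "w (c b) = v $ b" if "b < m" for b
      using c that by (simp add: w_def bij_betw_inv_into_left)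
    have vw: "v = vec m (w \<circ> c)" using v(1) wc by (intro eq_vecI) auto
    have "(\<Sum>b\<in>J. A a b * w b) = 0" if aI: "a \<in> I" for a
    proof -
      obtain i where "i < m" "a = r i" using r aI by (auto simp: bij_betw_def)
      moreover from this have "(?M *\<^sub>v v) $ i = 0" using v(3) by simp
      ultimately show ?thesis using prod[of i w] vw by simp
    qed
    moreover have "\<exists>b\<in>J. w b \<noteq> 0"
    proof (rule ccontr)
      assume "\<not> ?thesis"
      then have "w (c b) = 0" if "b < m" for b using c that by (auto simp: bij_betw_def)
      then have "v = 0\<^sub>v m" unfolding vw by (intro eq_vecI) auto
      then show False using v(2) by simp
    qed
    ultimately show "\<exists>w. (\<forall>a\<in>I. (\<Sum>b\<in>J. A a b * w b) = 0) \<and> (\<exists>b\<in>J. w b \<noteq> 0)" by blast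
  next
    assume "\<exists>w. (\<forall>a\<in>I. (\<Sum>b\<in>J. A a b * w b) = 0) \<and> (\<exists>b\<in>J. w b \<noteq> 0)"
    then obtain w b where w: "\<forall>a\<in>I. (\<Sum>b\<in>J. A a b * w b) = 0" "b \<in> J" "w b \<noteq> 0" by blast
    let ?v = "vec m (w \<circ> c)"
    obtain i where i: "i < m" "b = c i" using c w(2) by (auto simp: bij_betw_def)
    have "?v \<noteq> 0\<^sub>v m"
    proof
      assume "?v = 0\<^sub>v m"
      then have "?v $ i = 0" using i by simp
      then show False using i w(3) by simp
    qed
    moreover have "?M *\<^sub>v ?v = 0\<^sub>v m"
    proof (rule eq_vecI)
      fix i assume "i < dim_vec (0\<^sub>v m :: 'a vec)"
      then have i: "i < m" by simp
      then have "r i \<in> I" using r by (auto simp: bij_betw_def)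
      then show "(?M *\<^sub>v ?v) $ i = 0\<^sub>v m $ i" using prod[OF i] w(1) i by simp
    qed simp
    ultimately show "Determinant.det ?M = 0"
      by (intro iffD2[OF det_0_iff_vec_prod_zero_field[of ?M m]] exI[of _ ?v] conjI) simp_all
  qed
  then show ?thesis by blast
qed

text \<open>\<open>I0\<close> is a smallest set of rows that determines the kernel. Minimality makes
  these rows independent. A vector killed by the block on \<open>I0\<close>, extended by zero, is
  killed by all rows; by symmetry it is then a relation among the rows in \<open>I0\<close>, hence
  zero.\<close>

lemma symmetric_rank_basis:
  fixes A :: "nat \<Rightarrow> nat \<Rightarrow> 'a::field"
  assumes sym: "\<And>i j. i \<le> n \<Longrightarrow> j \<le> n \<Longrightarrow> A i j = A j i"
  shows "\<exists>I0\<subseteq>{..n}. card I0 = vec_space.rank (n + 1) (mat (n + 1) (n + 1) (\<lambda>(i, j). A i j)) \<and>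
    (\<forall>w. (\<forall>a\<in>I0. (\<Sum>b\<in>I0. A a b * w b) = 0) \<longrightarrow> (\<forall>b\<in>I0. w b = 0)) \<and>
    (\<forall>w. (\<forall>a\<in>I0. (\<Sum>b\<le>n. A a b * w b) = 0) \<longrightarrow> (\<forall>a\<le>n. (\<Sum>b\<le>n. A a b * w b) = 0))"
proof -
  interpret vec_space "TYPE('a)" "n + 1" .
  let ?M = "mat (n + 1) (n + 1) (\<lambda>(i, j). A i j)"
  have M: "?M \<in> carrier_mat (n + 1) (n + 1)" by simp
  define K where "K = (\<lambda>I. \<forall>w. (\<forall>a\<in>I. (\<Sum>b\<le>n. A a b * w b) = 0) \<longrightarrow> (\<forall>a\<le>n. (\<Sum>b\<le>n. A a b * w b) = 0))"
  have "{..n} \<subseteq> {..n} \<and> K {..n}" by (simp add: K_def)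
  from ex_has_least_nat[of "\<lambda>I. I \<subseteq> {..n} \<and> K I" "{..n}" card, OF this]
  obtain I where I: "I \<subseteq> {..n}" "K I" and min: "\<And>J. J \<subseteq> {..n} \<Longrightarrow> K J \<Longrightarrow> card I \<le> card J" by blast
  have finI: "finite I" using I(1) finite_subset by blast
  have indep: "\<forall>a\<in>I. c a = 0" if c: "\<And>b. b \<le> n \<Longrightarrow> (\<Sum>a\<in>I. c a * A a b) = 0" for c
  proof (rule ccontr)
    assume "\<not> ?thesis"
    then obtain a where a: "a \<in> I" "c a \<noteq> 0" by blast
    have "K (I - {a})"
      unfolding K_def
    proof (intro allI impI)
      fix w a' assume w: "\<forall>a\<in>I - {a}. (\<Sum>b\<le>n. A a b * w b) = 0" and a': "a' \<le> n"
      have "0 = (\<Sum>b\<le>n. (\<Sum>a\<in>I. c a * A a b) * w b)" using c by simp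
      also have "\<dots> = (\<Sum>a\<in>I. c a * (\<Sum>b\<le>n. A a b * w b))"
        unfolding sum_distrib_right sum_distrib_left by (subst sum.swap) (simp add: mult.assoc)
      also have "\<dots> = c a * (\<Sum>b\<le>n. A a b * w b)"
        using w by (subst sum.remove[OF finI a(1)]) simp
      finally have "(\<Sum>b\<le>n. A a b * w b) = 0" using a(2) by simp
      then have "\<forall>a\<in>I. (\<Sum>b\<le>n. A a b * w b) = 0" using w by auto
      then have "\<forall>a\<le>n. (\<Sum>b\<le>n. A a b * w b) = 0" by (rule mp[OF spec[OF I(2)[unfolded K_def]]])
      then show "(\<Sum>b\<le>n. A a' b * w b) = 0" using a' by blast
    qed
    then have "card I \<le> card (I - {a})" using I(1) by (intro min) auto
    then show False using a(1) finI card_Diff1_less[OF finI a(1)] by simp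
  qed
  have restrict: "(\<Sum>b\<le>n. A a b * (if b \<in> J then w b else 0)) = (\<Sum>b\<in>J. A a b * w b)" if "J \<subseteq> {..n}" for J a w
    using that by (intro sum.mono_neutral_cong_right) auto
  have nonsing: "\<forall>b\<in>I. w b = 0" if w: "\<forall>a\<in>I. (\<Sum>b\<in>I. A a b * w b) = 0" for w
  proof (rule indep)
    fix b assume b: "b \<le> n"
    have "\<forall>a\<in>I. (\<Sum>b\<le>n. A a b * (if b \<in> I then w b else 0)) = 0"
      unfolding restrict[OF I(1)] by (rule w)
    then have "\<forall>a\<le>n. (\<Sum>b\<le>n. A a b * (if b \<in> I then w b else 0)) = 0" by (rule mp[OF spec[OF I(2)[unfolded K_def]]])
    then have "(\<Sum>a\<in>I. A b a * w a) = 0" unfolding restrict[OF I(1)] using b by blast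
    moreover have "(\<Sum>a\<in>I. A b a * w a) = (\<Sum>a\<in>I. w a * A a b)"
      using I(1) b by (intro sum.cong refl) (auto simp: sym[of b] mult.commute)
    ultimately show "(\<Sum>a\<in>I. w a * A a b) = 0" by simp
  qed
  have col: "col ?M j $ i = A i j" if "i \<le> n" "j \<le> n" for i j using that by simp
  have inj: "inj_on (col ?M) I"
  proof (rule inj_onI, rule ccontr)
    fix i j assume ij: "i \<in> I" "j \<in> I" "col ?M i = col ?M j" "i \<noteq> j"
    have "\<forall>b\<in>I. (if b = i then 1 else if b = j then - 1 else (0::'a)) = 0"
    proof (rule nonsing, rule ballI)
      fix a assume a: "a \<in> I"
      have le: "a \<le> n" "i \<le> n" "j \<le> n" using a ij(1,2) I(1) by auto
      have "A a i = A a j" using col[OF le(1,2)] col[OF le(1,3)] unfolding ij(3) by (simp only:)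
      moreover have "(\<Sum>b\<in>I. A a b * (if b = i then 1 else if b = j then - 1 else 0)) =
        (\<Sum>b\<in>{i, j}. A a b * (if b = i then 1 else if b = j then - 1 else 0))"
        using ij(1,2) finI by (intro sum.mono_neutral_right) auto
      moreover have "\<dots> = A a i - A a j" using ij(4) by auto
      ultimately show "(\<Sum>b\<in>I. A a b * (if b = i then 1 else if b = j then - 1 else 0)) = 0" by (simp only: diff_self)
    qed
    from bspec[OF this ij(1)] show False by simp
  qed
  have colc: "col ?M i \<in> carrier_vec (n + 1)" for i by (rule carrier_vecI) simp
  have colsM: "set (cols ?M) = col ?M ` {..n}"
    unfolding cols_def set_map set_upt by (rule arg_cong[of _ _ "image (col ?M)"]) auto
  have lin: "lincomb a (col ?M ` J) $ i = (\<Sum>b\<in>J. A i b * a (col ?M b))" if "inj_on (col ?M) J" "J \<subseteq> {..n}" "i \<le> n" for a J i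
  proof -
    have "lincomb a (col ?M ` J) $ i = (\<Sum>x\<in>col ?M ` J. a x * x $ i)"
      using that by (intro lincomb_index) auto
    also have "\<dots> = (\<Sum>b\<in>J. A i b * a (col ?M b))"
      unfolding sum.reindex[OF that(1)] using that by (intro sum.cong refl) (auto simp: mult.commute)
    finally show ?thesis .
  qed
  have "card I \<le> rank ?M"
  proof -
    have "lin_indpt (col ?M ` I)"
    proof
      assume dep: "lin_dep (col ?M ` I)"
      then obtain a v where a: "lincomb a (col ?M ` I) = 0\<^sub>v (n + 1)" "v \<in> col ?M ` I" "a v \<noteq> 0"
      proof -
        have "col ?M ` I \<subseteq> carrier_vec (n + 1)" "finite (col ?M ` I)" using finI by (auto intro!: carrier_vecI)
        then show ?thesis using finite_lin_dep[of "col ?M ` I"] dep that by blast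
      qed
      have "\<forall>b\<in>I. a (col ?M b) = 0"
      proof (rule nonsing, rule ballI)
        fix i assume i: "i \<in> I"
        then show "(\<Sum>b\<in>I. A i b * a (col ?M b)) = 0" using lin[OF inj I(1), of i a] a(1) I(1) by auto
      qed
      then show False using a by auto
    qed
    moreover have "col ?M ` I \<subseteq> set (cols ?M)" unfolding colsM using I(1) by blast
    ultimately have "card (col ?M ` I) \<le> rank ?M" by (intro rank_ge_card_indpt[OF M])
    then show ?thesis using card_image[OF inj] by simp
  qed
  \<comment> \<open>More than \<open>card I\<close> columns satisfy a common relation on the rows in
    \<open>I\<close>. The kernel property of \<open>I\<close> extends it to all rows, so the columns
    are dependent.\<close>
  moreover have "rank ?M \<le> card I"
  proof -
    have "\<exists>B. finite B \<and> maximal B (\<lambda>T. T \<subseteq> set (cols ?M) \<and> lin_indpt T) \<and> {} \<subseteq> B"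
    proof (rule maximal_exists_superset[of "set (cols ?M)"])
      have "\<not> lin_dep {}" by (metis empty_subsetI fin_dim finite_basis_exists subset_li_is_li vec_vs vectorspace.basis_def)
      then show "{} \<subseteq> set (cols ?M) \<and> lin_indpt {}" by simp
    qed auto
    then obtain B where B: "maximal B (\<lambda>T. T \<subseteq> set (cols ?M) \<and> lin_indpt T)" by blast
    then have B': "B \<subseteq> col ?M ` {..n}" "lin_indpt B" unfolding maximal_def colsM by auto
    obtain J where J: "J \<subseteq> {..n}" "inj_on (col ?M) J" "B = col ?M ` J" using B'(1) by (metis subset_image_inj)
    have finJ: "finite J" using J(1) finite_subset by blast
    have "card J \<le> card I"
    proof (rule ccontr)
      assume "\<not> card J \<le> card I"
      then obtain c where c: "\<exists>j\<in>J. c j \<noteq> 0" "\<forall>a\<in>I. (\<Sum>j\<in>J. c j * A a j) = 0"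
        using underdetermined_system[OF finI finJ, of "\<lambda>j a. A a j"] by auto
      have "\<forall>a\<in>I. (\<Sum>b\<le>n. A a b * (if b \<in> J then c b else 0)) = 0"
        unfolding restrict[OF J(1)] using c(2) by (simp add: mult.commute)
      then have "\<forall>a\<le>n. (\<Sum>b\<le>n. A a b * (if b \<in> J then c b else 0)) = 0" by (rule mp[OF spec[OF I(2)[unfolded K_def]]])
      then have z: "(\<Sum>b\<in>J. A a b * c b) = 0" if "a \<le> n" for a unfolding restrict[OF J(1)] using that by blast
      define a where "a = (\<lambda>v. c (inv_into J (col ?M) v))"
      have ac: "a (col ?M b) = c b" if "b \<in> J" for b using J(2) that by (simp add: a_def)
      have "lincomb a B = 0\<^sub>v (n + 1)"
      proof (rule eq_vecI)
        have "B \<subseteq> carrier_vec (n + 1)" using colc J(3) by blast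
        then show "dim_vec (lincomb a B) = dim_vec (0\<^sub>v (n + 1))"
          using finJ J(3) lincomb_dim[of B a] by simp
        fix i assume "i < dim_vec (0\<^sub>v (n + 1) :: 'a vec)"
        then have i: "i \<le> n" by simp
        have "lincomb a B $ i = (\<Sum>b\<in>J. A i b * c b)"
          unfolding J(3) lin[OF J(2,1) i] using ac by (intro sum.cong) auto
        then show "lincomb a B $ i = 0\<^sub>v (n + 1) $ i" using z i by simp
      qed
      moreover obtain j where "j \<in> J" "c j \<noteq> 0" using c(1) by blast
      moreover have "B \<subseteq> carrier_vec (n + 1)" "finite B" using colc J(3) finJ by blast+
      ultimately have "lin_dep B" using J(3) ac unfolding lin_dep_def by (intro exI[of _ B] exI[of _ a] exI[of _ "col ?M j"]) auto
      then show False using B'(2) by simp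
    qed
    then show ?thesis using rank_card_indpt[OF M B] J(3) card_image[OF J(2)] by simp
  qed
  ultimately have "card I = rank ?M" by simp
  moreover have "\<forall>w. (\<forall>a\<in>I. (\<Sum>b\<in>I. A a b * w b) = 0) \<longrightarrow> (\<forall>b\<in>I. w b = 0)" using nonsing by (intro allI impI)
  ultimately show ?thesis using I(1) I(2)[unfolded K_def] by (intro exI[of _ I] conjI)
qed

text \<open>The rows in \<open>X\<close> are arbitrary: \<open>X\<close> is empty for a minor itself
  and a singleton for a row-wise derivative of a minor. Annihilating the rows in \<open>I0\<close>
  and in \<open>X\<close> imposes fewer than \<open>m\<close> conditions on \<open>m\<close>
  unknowns, and the kernel property takes care of all other rows.\<close>

lemma minor_vanishes:
  fixes A :: "nat \<Rightarrow> nat \<Rightarrow> 'a::field"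
  assumes K: "\<forall>w. (\<forall>a\<in>I0. (\<Sum>b\<le>n. A a b * w b) = 0) \<longrightarrow> (\<forall>a\<le>n. (\<Sum>b\<le>n. A a b * w b) = 0)"
    and J: "J \<subseteq> {..n}" and c: "bij_betw c {..<m} J" and I0: "finite I0" "card I0 + card X < m" "finite X"
    and B: "\<And>a b. a < m \<Longrightarrow> b < m \<Longrightarrow> a \<notin> X \<Longrightarrow> B a b = A (r a) (c b)" "\<And>a. a < m \<Longrightarrow> a \<notin> X \<Longrightarrow> r a \<le> n"
  shows "Determinant.det (mat m m (\<lambda>(a, b). B a b)) = 0"
proof -
  have "card J = m" using bij_betw_same_card[OF c] by simp
  define f where "f = (\<lambda>j q. case q of Inl a \<Rightarrow> A a j | Inr a \<Rightarrow> B a (inv_into {..<m} c j))"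
  have "finite J" using J finite_subset by blast
  moreover have "card (I0 <+> X) < card J" using I0 \<open>card J = m\<close> by (simp add: card_Plus)
  ultimately obtain w where w: "\<exists>j\<in>J. w j \<noteq> 0" "\<forall>q\<in>I0 <+> X. (\<Sum>j\<in>J. w j * f j q) = 0"
    using underdetermined_system[of "I0 <+> X" J f] I0 by auto
  have restrict: "(\<Sum>b\<le>n. A a b * (if b \<in> J then w b else 0)) = (\<Sum>b\<in>J. A a b * w b)" for a
    using J by (intro sum.mono_neutral_cong_right) auto
  have "(\<Sum>b\<in>J. A a b * w b) = 0" if "a \<in> I0" for a
    using w(2)[rule_format, OF InlI[OF that]] by (simp add: f_def mult.commute)
  then have Az: "(\<Sum>b\<in>J. A a b * w b) = 0" if "a \<le> n" for a
    using K[rule_format, of "\<lambda>b. if b \<in> J then w b else 0"] that unfolding restrict by blast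
  have "\<not> (\<forall>w. (\<forall>a\<in>{..<m}. (\<Sum>b\<in>J. B a (inv_into {..<m} c b) * w b) = 0) \<longrightarrow> (\<forall>b\<in>J. w b = 0))"
  proof
    assume *: "\<forall>w. (\<forall>a\<in>{..<m}. (\<Sum>b\<in>J. B a (inv_into {..<m} c b) * w b) = 0) \<longrightarrow> (\<forall>b\<in>J. w b = 0)"
    have "(\<Sum>b\<in>J. B a (inv_into {..<m} c b) * w b) = 0" if a: "a < m" for a
    proof (cases "a \<in> X")
      case True
      then show ?thesis using w(2)[rule_format, OF InrI[OF True]] by (simp add: f_def mult.commute)
    next
      case False
      have "(\<Sum>b\<in>J. B a (inv_into {..<m} c b) * w b) = (\<Sum>b\<in>J. A (r a) b * w b)"
      proof (intro sum.cong refl arg_cong2[of _ _ _ _ "(*)"])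
        fix b assume b: "b \<in> J"
        then have "inv_into {..<m} c b < m" "c (inv_into {..<m} c b) = b"
          using c by (auto simp: bij_betw_def inv_into_into f_inv_into_f dest: inv_into_into[of b c "{..<m}"])
        then show "B a (inv_into {..<m} c b) = A (r a) b" using B(1)[OF a _ False] by simp
      qed
      then show ?thesis using Az B(2)[OF a False] by simp
    qed
    then show False using * w(1) by blast
  qed
  then have "\<not> Determinant.det (mat m m (\<lambda>(a, b). B (id a) (inv_into {..<m} c (c b)))) \<noteq> 0"
    unfolding det_nonzero_iff[OF bij_betw_id c, of "\<lambda>a b. B a (inv_into {..<m} c b)"] .
  then have "Determinant.det (mat m m (\<lambda>(a, b). B (id a) (inv_into {..<m} c (c b)))) = 0" by blast
  moreover have "mat m m (\<lambda>(a, b). B (id a) (inv_into {..<m} c (c b))) = mat m m (\<lambda>(a, b). B a b)"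
    using c by (intro eq_matI) (auto simp: bij_betw_inv_into_left)
  ultimately show ?thesis by simp
qed

text \<open>Take any \<open>m\<close> columns \<open>J\<close> of the nonsingular block and a
  smallest set of rows on which they remain independent. Fewer than \<open>m\<close> rows would
  admit a relation of the columns, and among more than \<open>m\<close> rows one would be
  redundant.\<close>

lemma minor_exists:
  fixes A :: "nat \<Rightarrow> nat \<Rightarrow> 'a::field"
  assumes I0: "finite I0" "\<forall>w. (\<forall>a\<in>I0. (\<Sum>b\<in>I0. A a b * w b) = 0) \<longrightarrow> (\<forall>b\<in>I0. w b = 0)" and m: "m \<le> card I0"
  shows "\<exists>I\<subseteq>I0. \<exists>J\<subseteq>I0. card I = m \<and> card J = m \<and>
    Determinant.det (mat m m (\<lambda>(a, b). A (pick I a) (pick J b))) \<noteq> 0"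
proof -
  obtain J where J: "J \<subseteq> I0" "card J = m" using obtain_subset_with_card_n[OF m] by blast
  have finJ: "finite J" using J I0 finite_subset by blast
  define N where "N = (\<lambda>I. \<forall>w. (\<forall>a\<in>I. (\<Sum>b\<in>J. A a b * w b) = 0) \<longrightarrow> (\<forall>b\<in>J. w b = 0))"
  have "N I0"
    unfolding N_def
  proof (intro allI impI)
    fix w assume w: "\<forall>a\<in>I0. (\<Sum>b\<in>J. A a b * w b) = 0"
    have "(\<Sum>b\<in>I0. A a b * (if b \<in> J then w b else 0)) = (\<Sum>b\<in>J. A a b * w b)" for a
      using J(1) I0(1) by (intro sum.mono_neutral_cong_right) auto
    then have "\<forall>a\<in>I0. (\<Sum>b\<in>I0. A a b * (if b \<in> J then w b else 0)) = 0" using w by simp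
    then have "\<forall>b\<in>I0. (if b \<in> J then w b else 0) = 0" by (rule mp[OF spec[OF I0(2)]])
    then have "w b = 0" if "b \<in> J" for b
      using bspec[of I0 "\<lambda>b. (if b \<in> J then w b else 0) = 0" b] that J(1) by auto
    then show "\<forall>b\<in>J. w b = 0" by blast
  qed
  then have "I0 \<subseteq> I0 \<and> N I0" by simp
  from ex_has_least_nat[of "\<lambda>I. I \<subseteq> I0 \<and> N I" I0 card, OF this]
  obtain I where I: "I \<subseteq> I0" "N I" and min: "\<And>I'. I' \<subseteq> I0 \<Longrightarrow> N I' \<Longrightarrow> card I \<le> card I'" by blast
  have finI: "finite I" using I I0 finite_subset by blast
  have "\<not> card I < card J"
  proof
    assume "card I < card J"
    then obtain c where c: "\<exists>j\<in>J. c j \<noteq> 0" "\<forall>a\<in>I. (\<Sum>j\<in>J. c j * A a j) = 0"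
      using underdetermined_system[OF finI finJ, of "\<lambda>j a. A a j"] by auto
    have "\<forall>a\<in>I. (\<Sum>j\<in>J. A a j * c j) = 0" using c(2) by (simp add: mult.commute)
    then have "\<forall>j\<in>J. c j = 0" by (rule mp[OF spec[OF I(2)[unfolded N_def]]])
    then show False using c(1) by blast
  qed
  moreover have "\<not> card J < card I"
  proof
    assume "card J < card I"
    then obtain c where c: "\<exists>a\<in>I. c a \<noteq> 0" "\<forall>b\<in>J. (\<Sum>a\<in>I. c a * A a b) = 0"
      using underdetermined_system[OF finJ finI, of A] by auto
    then obtain a where a: "a \<in> I" "c a \<noteq> 0" by blast
    have "N (I - {a})"
      unfolding N_def
    proof (intro allI impI)
      fix w assume w: "\<forall>a\<in>I - {a}. (\<Sum>b\<in>J. A a b * w b) = 0"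
      have "0 = (\<Sum>b\<in>J. (\<Sum>a\<in>I. c a * A a b) * w b)" using c(2) by simp
      also have "\<dots> = (\<Sum>a\<in>I. c a * (\<Sum>b\<in>J. A a b * w b))"
        unfolding sum_distrib_right sum_distrib_left by (subst sum.swap) (simp add: mult.assoc)
      also have "\<dots> = c a * (\<Sum>b\<in>J. A a b * w b)"
        using w by (subst sum.remove[OF finI a(1)]) simp
      finally have "(\<Sum>b\<in>J. A a b * w b) = 0" using a(2) by simp
      then have "\<forall>a\<in>I. (\<Sum>b\<in>J. A a b * w b) = 0" using w by auto
      then show "\<forall>b\<in>J. w b = 0" by (rule mp[OF spec[OF I(2)[unfolded N_def]]])
    qed
    then have "card I \<le> card (I - {a})" using I(1) by (intro min) auto
    then show False using card_Diff1_less[OF finI a(1)] by simp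
  qed
  ultimately have cI: "card I = m" using J(2) by simp
  have "bij_betw (pick I) {..<m} I" "bij_betw (pick J) {..<m} J"
    using bij_betw_pick[OF finI] bij_betw_pick[OF finJ] cI J(2) by simp_all
  from iffD2[OF det_nonzero_iff[OF this, of A]]
  have "Determinant.det (mat m m (\<lambda>(a, b). A (pick I a) (pick J b))) \<noteq> 0"
    using I(2) unfolding N_def by blast
  then show ?thesis using I(1) J cI by blast
qed

section \<open>Determinants under homomorphisms, derivations and congruences; bordered
  determinants\<close>

lemma rhom_det:
  assumes "rhom c"
  shows "c (Determinant.det N) = Determinant.det (map_mat c N)"
proof -
  interpret comm_ring_hom c using rhomD[OF assms] by unfold_locales auto
  show ?thesis by simp
qed

lemma derivation_det:
  assumes D: "derivation D" and N: "N \<in> carrier_mat m m"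
  shows "D (Determinant.det N) = (\<Sum>i<m. Determinant.det (mat m m (\<lambda>(a, b). if a = i then D (N $$ (a, b)) else N $$ (a, b))))"
proof -
  have D_prod: "finite S \<Longrightarrow> D (prod f S) = (\<Sum>i\<in>S. \<Prod>j\<in>S. if j = i then D (f j) else f j)" for f and S :: "nat set"
  proof (induction S rule: finite_induct)
    case (insert x S)
    have "(\<Prod>j\<in>insert x S. if j = x then D (f j) else f j) = D (f x) * prod f S"
    proof -
      have "(\<Prod>j\<in>S. if j = x then D (f j) else f j) = prod f S"
        using insert by (intro prod.cong) auto
      then show ?thesis using insert by simp
    qed
    moreover have "(\<Prod>j\<in>insert x S. if j = i then D (f j) else f j) = f x * (\<Prod>j\<in>S. if j = i then D (f j) else f j)"
      if "i \<in> S" for i using insert that by auto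
    ultimately show ?case using insert by (simp add: derivation_simps[OF D] sum_distrib_left)
  qed (simp add: derivation_simps[OF D])
  have sg: "D (signof p * y) = signof p * D y" for p y by (simp add: sign_def derivation_simps[OF D])
  let ?N = "\<lambda>i. mat m m (\<lambda>(a, b). if a = i then D (N $$ (a, b)) else N $$ (a, b))"
  have "D (Determinant.det N) = (\<Sum>p\<in>{p. p permutes {0..<m}}. \<Sum>i\<in>{0..<m}. signof p * (\<Prod>j = 0..<m. if j = i then D (N $$ (j, p j)) else N $$ (j, p j)))"
    unfolding det_def'[OF N] derivation_simps(7)[OF D] sg by (simp add: D_prod sum_distrib_left)
  also have "\<dots> = (\<Sum>i\<in>{0..<m}. \<Sum>p\<in>{p. p permutes {0..<m}}. signof p * (\<Prod>j = 0..<m. ?N i $$ (j, p j)))"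
    by (subst sum.swap, intro sum.cong refl arg_cong2[of _ _ _ _ "(*)"] prod.cong) (auto dest: permutes_in_image)
  also have "\<dots> = (\<Sum>i\<in>{0..<m}. Determinant.det (?N i))"
    by (intro sum.cong refl) (simp add: det_def'[of _ m])
  finally show ?thesis by (simp add: lessThan_atLeast0)
qed

lemma det_cong_ideal:
  assumes A: "is_subring A" and K: "is_ideal A K" and N: "N \<in> carrier_mat m m" "N' \<in> carrier_mat m m"
    and e: "\<And>a b. a < m \<Longrightarrow> b < m \<Longrightarrow> N $$ (a, b) \<in> A \<and> N' $$ (a, b) \<in> A \<and> N $$ (a, b) - N' $$ (a, b) \<in> K"
  shows "Determinant.det N \<in> A \<and> Determinant.det N' \<in> A \<and> Determinant.det N - Determinant.det N' \<in> K"
proof -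
  note sub = subring_closed[OF A] and idl = ideal_closed[OF K]
  have prod: "(\<Prod>i\<in>S. f i) - (\<Prod>i\<in>S. g i) \<in> K"
    if fg: "finite S" "\<And>i. i \<in> S \<Longrightarrow> f i \<in> A \<and> g i \<in> A \<and> f i - g i \<in> K" for S :: "nat set" and f g
    using fg
  proof (induction S rule: finite_induct)
    case (insert x S)
    have "(\<Prod>i\<in>S. g i) \<in> A" using insert by (intro sub) auto
    moreover have "f x * (\<Prod>i\<in>S. f i) - g x * (\<Prod>i\<in>S. g i) =
      f x * ((\<Prod>i\<in>S. f i) - (\<Prod>i\<in>S. g i)) + (\<Prod>i\<in>S. g i) * (f x - g x)" by (simp add: algebra_simps)
    ultimately show ?case using insert idl(2,3) by simp
  qed (simp add: idl)
  have sg: "signof p \<in> A" for p using sub(2) sub(6)[OF sub(2)] by (simp add: sign_def)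
  have p: "p i < m" if "p permutes {0..<m}" "i < m" for p i using permutes_in_image[OF that(1), of i] that(2) by simp
  have "Determinant.det N \<in> A" "Determinant.det N' \<in> A"
    unfolding det_def'[OF N(1)] det_def'[OF N(2)] using e p sg by (intro sub(9) sub(5) sub(10); auto)+
  moreover have "Determinant.det N - Determinant.det N' = (\<Sum>p\<in>{p. p permutes {0..<m}}.
      signof p * ((\<Prod>i = 0..<m. N $$ (i, p i)) - (\<Prod>i = 0..<m. N' $$ (i, p i))))"
    unfolding det_def'[OF N(1)] det_def'[OF N(2)] by (simp add: sum_subtractf right_diff_distrib)
  moreover have "\<dots> \<in> K"
    by (rule idl(5), rule idl(3)[OF sg], rule prod) (use e p in auto)
  ultimately show ?thesis by simp
qed

text \<open>As in Cramer's rule, replacing column \<open>b0\<close> by \<open>N *\<^sub>v w\<close>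
  multiplies the determinant by \<open>w $ b0 = 1\<close>. The new column has a single entry that
  can be nonzero, and the cofactor there does not involve the replaced column.\<close>

lemma det_single_entry_column:
  fixes N :: "'r::comm_ring_1 mat"
  assumes N: "N \<in> carrier_mat m m" and w: "w \<in> carrier_vec m" "w $ b0 = 1" and b0: "a0 < m" "b0 < m"
    and Nw: "\<And>a. a < m \<Longrightarrow> (N *\<^sub>v w) $ a = (if a = a0 then s else 0)"
  shows "Determinant.det N = s * cofactor N a0 b0"
proof -
  let ?R = "replace_col N (N *\<^sub>v w) b0"
  have R: "?R \<in> carrier_mat m m" using N by (simp add: replace_col_def)
  have "Determinant.det ?R = Determinant.det N" using cramer_lemma_mat[OF N w(1) b0(2)] w(2) by simp
  moreover have "Determinant.det ?R = (\<Sum>i<m. ?R $$ (i, b0) * cofactor ?R i b0)" by (rule laplace_expansion_column[OF R b0(2)])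
  moreover have "\<dots> = (\<Sum>i<m. if i = a0 then s * cofactor ?R i b0 else 0)"
    using N b0 Nw by (intro sum.cong) (auto simp: replace_col_def)
  moreover have "mat_delete ?R a0 b0 = mat_delete N a0 b0"
    using N by (intro eq_matI) (auto simp: mat_delete_def replace_col_def)
  then have "cofactor ?R a0 b0 = cofactor N a0 b0" by (simp add: cofactor_def)
  ultimately show ?thesis using b0 by simp
qed

text \<open>The perturbed entry makes the second determinant independent of \<open>s\<close>.\<close>

lemma det_bordered:
  fixes N :: "'r::comm_ring_1 mat"
  assumes N: "N \<in> carrier_mat m m" and w: "w \<in> carrier_vec m" "w $ b0 = 1" and b0: "a0 < m" "b0 < m"
    and Nw: "\<And>a. a < m \<Longrightarrow> (N *\<^sub>v w) $ a = (if a = a0 then s else 0)"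
  shows "Determinant.det N = s * Determinant.det (mat m m (\<lambda>(a, b). if a = a0 \<and> b = b0 then N $$ (a, b) - s + 1 else N $$ (a, b)))"
proof -
  let ?N = "mat m m (\<lambda>(a, b). if a = a0 \<and> b = b0 then N $$ (a, b) - s + 1 else N $$ (a, b))"
  \<comment> \<open>Raising the entry by \<open>1 - s\<close> turns the value \<open>s\<close> of
    the product with \<open>w\<close> into \<open>1\<close>, since \<open>w $ b0 = 1\<close>; the
    cofactor at that entry is not affected.\<close>
  have "(?N *\<^sub>v w) $ a = (if a = a0 then 1 else 0)" if a: "a < m" for a
  proof -
    have "(?N *\<^sub>v w) $ a = (\<Sum>b<m. (if a = a0 \<and> b = b0 then N $$ (a, b) - s + 1 else N $$ (a, b)) * w $ b)"
      using a w by (subst mat_mult_vec_index) auto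
    also have "\<dots> = (\<Sum>b<m. N $$ (a, b) * w $ b + (if b = b0 then (if a = a0 then 1 - s else 0) else 0))"
      using w(2) by (intro sum.cong refl) (auto simp: algebra_simps)
    also have "\<dots> = (\<Sum>b<m. N $$ (a, b) * w $ b) + (if a = a0 then 1 - s else 0)"
      using b0 by (simp add: sum.distrib)
    also have "(\<Sum>b<m. N $$ (a, b) * w $ b) = (N *\<^sub>v w) $ a"
      using N w a by (simp add: scalar_prod_def lessThan_atLeast0)
    finally show ?thesis using Nw[OF a] by simp
  qed
  then have "Determinant.det ?N = 1 * cofactor ?N a0 b0"
    by (intro det_single_entry_column[OF _ w b0]) auto
  moreover have "mat_delete ?N a0 b0 = mat_delete N a0 b0"
    using N by (intro eq_matI) (auto simp: mat_delete_def)
  then have "cofactor ?N a0 b0 = cofactor N a0 b0" by (simp add: cofactor_def)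
  moreover have "Determinant.det N = s * cofactor N a0 b0" by (rule det_single_entry_column[OF N w b0 Nw])
  ultimately show ?thesis by simp
qed

context local_system
begin

lemma ev_prod: "(\<And>i. i \<in> S \<Longrightarrow> f i \<in> A) \<Longrightarrow> ev (prod f S) = (\<Prod>i\<in>S. ev (f i))"
  by (induction S rule: infinite_finite_induct) (auto simp: ev_simps ev_mult sub(10))

lemma ev_det:
  assumes N: "N \<in> carrier_mat m m" and e: "\<And>a b. a < m \<Longrightarrow> b < m \<Longrightarrow> N $$ (a, b) \<in> A"
  shows "Determinant.det N \<in> A" "ev (Determinant.det N) = Determinant.det (map_mat ev N)"
proof -
  have sg: "signof p \<in> A" "ev (signof p) = signof p" for p
    using sub(2) sub(6)[OF sub(2)] by (simp_all add: sign_def ev_simps)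
  have p: "p i < m" if "p permutes {0..<m}" "i < m" for p i using permutes_in_image[OF that(1), of i] that(2) by simp
  have pr: "(\<Prod>i = 0..<m. N $$ (i, p i)) \<in> A" "ev (\<Prod>i = 0..<m. N $$ (i, p i)) = (\<Prod>i = 0..<m. ev (N $$ (i, p i)))"
    if "p permutes {0..<m}" for p
    using e p[OF that] by (auto intro!: sub(10) ev_prod)
  show "Determinant.det N \<in> A" unfolding det_def'[OF N] using sg pr by (intro sub(9) sub(5)) auto
  have "ev (Determinant.det N) = (\<Sum>p\<in>{p. p permutes {0..<m}}. ev (signof p * (\<Prod>i = 0..<m. N $$ (i, p i))))"
    unfolding det_def'[OF N] using sg pr by (intro ev_simps(5) sub(5)) auto
  also have "\<dots> = (\<Sum>p\<in>{p. p permutes {0..<m}}. signof p * (\<Prod>i = 0..<m. map_mat ev N $$ (i, p i)))"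
    using sg pr p N by (intro sum.cong refl) (auto simp: ev_mult intro!: prod.cong)
  finally show "ev (Determinant.det N) = Determinant.det (map_mat ev N)" using N by (simp add: det_def'[of _ m])
qed

text \<open>Cramer's rule over the local ring: the determinant is a unit because its residue is
  nonzero, and the adjugate has entries in \<open>A\<close>.\<close>

lemma solve_linear:
  fixes I0 :: "nat set"
  assumes I0: "finite I0" and H: "\<And>a b. a \<in> I0 \<Longrightarrow> b \<in> I0 \<Longrightarrow> H a b \<in> A" and r: "\<And>a. a \<in> I0 \<Longrightarrow> r a \<in> A"
    and nonsing: "\<forall>w. (\<forall>a\<in>I0. (\<Sum>b\<in>I0. ev (H a b) * w b) = 0) \<longrightarrow> (\<forall>b\<in>I0. w b = 0)"
  shows "\<exists>w. (\<forall>b\<in>I0. w b \<in> A) \<and> (\<forall>a\<in>I0. (\<Sum>b\<in>I0. H a b * w b) = r a)"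
proof -
  define k where "k = card I0"
  define e where "e = pick I0"
  have e: "bij_betw e {..<k} I0" unfolding e_def k_def by (rule bij_betw_pick[OF I0])
  have eI: "e i \<in> I0" if "i < k" for i using e that by (auto simp: bij_betw_def)
  let ?B = "mat k k (\<lambda>(a, b). H (e a) (e b))"
  have B: "?B \<in> carrier_mat k k" by simp
  have "map_mat ev ?B = mat k k (\<lambda>(a, b). ev (H (e a) (e b)))" by (intro eq_matI) auto
  then have d: "Determinant.det ?B \<in> A" "ev (Determinant.det ?B) \<noteq> 0"
    using ev_det[OF B] H eI det_nonzero_iff[OF e e, of "\<lambda>a b. ev (H a b)"] nonsing by auto
  define u where "u = inverse (Determinant.det ?B)"
  have "Determinant.det ?B \<noteq> 0" using d(2) ev_simps(1) by metis
  then have u: "u \<in> A" "u * Determinant.det ?B = 1" using unit[OF d] by (simp_all add: u_def)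
  have adj: "adj_mat ?B $$ (i, j) \<in> A" if "i < k" "j < k" for i j
  proof -
    have "Determinant.det (mat_delete ?B j i) \<in> A"
    proof (rule ev_det(1))
      show "mat_delete ?B j i \<in> carrier_mat (k - 1) (k - 1)" by (rule mat_delete_carrier[OF B])
      fix a b assume ab: "a < k - 1" "b < k - 1"
      have "(if a < j then a else Suc a) < k" "(if b < i then b else Suc b) < k" using ab by auto
      from H[OF eI[OF this(1)] eI[OF this(2)]]
      show "mat_delete ?B j i $$ (a, b) \<in> A" using ab by (simp add: mat_delete_def split: if_splits)
    qed
    then show ?thesis using that sub(7)[OF sub(6)[OF sub(2)], of "j + i"] by (simp add: adj_mat_def cofactor_def sub(5))
  qed
  define w where "w = (\<lambda>b. u * (\<Sum>c<k. adj_mat ?B $$ (inv_into {..<k} e b, c) * r (e c)))"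
  have we: "w (e b) = u * (\<Sum>c<k. adj_mat ?B $$ (b, c) * r (e c))" if "b < k" for b
    using e that by (simp add: w_def bij_betw_inv_into_left)
  have "w b \<in> A" if b: "b \<in> I0" for b
  proof -
    obtain i where "i < k" "b = e i" using e b by (auto simp: bij_betw_def)
    moreover have "u * (\<Sum>c<k. adj_mat ?B $$ (i, c) * r (e c)) \<in> A"
      by (intro sub(5)[OF u(1)] sub(9) sub(5) adj r eI) (use \<open>i < k\<close> in auto)
    ultimately show ?thesis using we by simp
  qed
  moreover have "(\<Sum>b\<in>I0. H a b * w b) = r a" if a: "a \<in> I0" for a
  proof -
    obtain i where i: "i < k" "a = e i" using e a by (auto simp: bij_betw_def)
    have id: "(\<Sum>b<k. H a (e b) * adj_mat ?B $$ (b, c)) = (if i = c then Determinant.det ?B else 0)" if "c < k" for c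
    proof -
      have "(\<Sum>b<k. H a (e b) * adj_mat ?B $$ (b, c)) = (?B * adj_mat ?B) $$ (i, c)"
        using i that adj_mat(1)[OF B] by (simp add: scalar_prod_def lessThan_atLeast0)
      then show ?thesis unfolding adj_mat(2)[OF B] using i that by simp
    qed
    have "(\<Sum>b\<in>I0. H a b * w b) = (\<Sum>b<k. H a (e b) * w (e b))"
      by (rule sum.reindex_bij_betw[OF e, symmetric])
    also have "\<dots> = (\<Sum>b<k. \<Sum>c<k. u * r (e c) * (H a (e b) * adj_mat ?B $$ (b, c)))"
      using we by (intro sum.cong refl) (simp add: sum_distrib_left ac_simps)
    also have "\<dots> = (\<Sum>c<k. u * r (e c) * (\<Sum>b<k. H a (e b) * adj_mat ?B $$ (b, c)))"
      by (subst sum.swap) (simp add: sum_distrib_left)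
    also have "\<dots> = (\<Sum>c<k. if i = c then u * r (e c) * Determinant.det ?B else 0)"
      using id by (intro sum.cong refl) auto
    also have "\<dots> = r a" using i u(2) by (simp add: ac_simps)
    finally show ?thesis .
  qed
  ultimately show ?thesis by blast
qed

end

section \<open>Hessian loci\<close>

abbreviation hess :: "(nat, 'a::comm_ring_1) mpol \<Rightarrow> nat \<Rightarrow> nat \<Rightarrow> (nat, 'a) mpol" where
  "hess f i j \<equiv> partial_deriv i (partial_deriv j f)"

abbreviation hess_minor :: "nat \<Rightarrow> (nat, 'a::field) mpol \<Rightarrow> nat set \<Rightarrow> nat set \<Rightarrow> (nat, 'a) mpol" where
  "hess_minor n f I J \<equiv> Determinant.det (submatrix (hessian n f) I J)"

lemma hess_minor_eq:
  assumes "I \<subseteq> {..n}" "J \<subseteq> {..n}" "card I = m" "card J = m"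
  shows "submatrix (hessian n f) I J = mat m m (\<lambda>(a, b). hess f (pick I a) (pick J b))"
proof -
  have I: "{i. i < dim_row (hessian n f) \<and> i \<in> I} = I" and J: "{j. j < dim_col (hessian n f) \<and> j \<in> J} = J"
    using assms by (auto simp: hessian_def)
  show ?thesis unfolding submatrix_def I J assms(3,4)
  proof (intro eq_matI)
    fix a b assume "a < dim_row (mat m m (\<lambda>(a, b). hess f (pick I a) (pick J b)))"
      "b < dim_col (mat m m (\<lambda>(a, b). hess f (pick I a) (pick J b)))"
    then have ab: "a < m" "b < m" by auto
    then have "pick I a \<le> n" "pick J b \<le> n" using pick_in_set_le[of a I] pick_in_set_le[of b J] assms by auto
    then show "mat m m (\<lambda>(i, j). hessian n f $$ (pick I i, pick J j)) $$ (a, b) =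
      mat m m (\<lambda>(a, b). hess f (pick I a) (pick J b)) $$ (a, b)" using ab by (simp add: hessian_def)
  qed simp_all
qed

lemma hess_minor_rhom:
  assumes "rhom c" "I \<subseteq> {..n}" "J \<subseteq> {..n}" "card I = m" "card J = m"
  shows "c (hess_minor n f I J) = Determinant.det (mat m m (\<lambda>(a, b). c (hess f (pick I a) (pick J b))))"
proof -
  have "map_mat c (mat m m (\<lambda>(a, b). hess f (pick I a) (pick J b))) = mat m m (\<lambda>(a, b). c (hess f (pick I a) (pick J b)))"
    by (intro eq_matI) auto
  then show ?thesis unfolding rhom_det[OF assms(1)] hess_minor_eq[OF assms(2-5)] by simp
qed

lemma hess_minor_polys:
  assumes f: "f \<in> cubic_forms n" and IJ: "I \<subseteq> {..n}" "J \<subseteq> {..n}" "card I = m" "card J = m"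
  shows "hess_minor n f I J \<in> polys {..n}" "homogeneous m (hess_minor n f I J)"
proof -
  let ?N = "mat m m (\<lambda>(a, b). hess f (pick I a) (pick J b))"
  have N: "?N \<in> carrier_mat m m" by simp
  have p: "p i < m" if "p permutes {0..<m}" "i < m" for p i using permutes_in_image[OF that(1), of i] that(2) by simp
  have prod: "(\<Prod>i = 0..<m. ?N $$ (i, p i)) = (\<Prod>i = 0..<m. hess f (pick I i) (pick J (p i)))" if "p permutes {0..<m}" for p
    using p[OF that] by (intro prod.cong) auto
  have "(\<Prod>i = 0..<m. hess f (pick I i) (pick J (p i))) \<in> polys {..n}" for p
    using cubic_formsD(5)[OF f] by (intro polys_closed)
  moreover have h: "homogeneous (\<Sum>i = 0..<m. 1) (\<Prod>i = 0..<m. hess f (pick I i) (pick J (p i)))" for p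
    using cubic_formsD(6)[OF f] by (intro homogeneous_prod)
  moreover have sg: "(signof p :: (nat, 'a) mpol) \<in> polys {..n}" "homogeneous 0 (signof p :: (nat, 'a) mpol)" for p
    by (auto simp: sign_def polys_closed homogeneous_simps)
  moreover have "homogeneous m (signof p * (\<Prod>i = 0..<m. hess f (pick I i) (pick J (p i))))" for p
    using homogeneous_simps(2)[OF sg(2)[of p] h[of p]] by simp
  moreover have "hess_minor n f I J = (\<Sum>p\<in>{p. p permutes {0..<m}}. signof p * (\<Prod>i = 0..<m. hess f (pick I i) (pick J (p i))))"
    unfolding hess_minor_eq[OF IJ] det_def'[OF N] using prod by (intro sum.cong) auto
  ultimately show "hess_minor n f I J \<in> polys {..n}" "homogeneous m (hess_minor n f I J)"
    by (auto intro!: polys_closed(9) polys_closed(5) homogeneous_sum)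
qed

text \<open>\<open>I0\<close> indexes a nonsingular principal block of the Hessian matrix at
  \<open>x\<close> whose rows determine the kernel. Such a set comes from
  \<open>symmetric_rank_basis\<close>, with the rank as its cardinality.\<close>

locale hess_point = proj_point n x p for n :: nat and x :: "nat \<Rightarrow> 'a::field_char_0" and p :: nat +
  fixes f :: "(nat, 'a) mpol" and I0 :: "nat set"
  assumes f: "f \<in> cubic_forms n" and good: "good n ((n + 1) * (n + 1)) f"
    and I0: "I0 \<subseteq> {..n}"
    and nonsing': "\<forall>w. (\<forall>a\<in>I0. (\<Sum>b\<in>I0. peval x (hess f a b) * w b) = 0) \<longrightarrow> (\<forall>b\<in>I0. w b = 0)"
    and kernel': "\<forall>w. (\<forall>a\<in>I0. (\<Sum>b\<le>n. peval x (hess f a b) * w b) = 0) \<longrightarrow> (\<forall>a\<le>n. (\<Sum>b\<le>n. peval x (hess f a b) * w b) = 0)"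
begin

definition H :: "nat \<Rightarrow> nat \<Rightarrow> (nat, 'a) mpol fract" where "H i j = dehom (hess f i j)"

definition h :: "nat \<Rightarrow> nat \<Rightarrow> 'a" where "h i j = ev (H i j)"

lemma finI0: "finite I0"
  using I0 finite_subset by blast

lemma H_stalk: "H i j \<in> stalk"
  unfolding H_def by (rule dehom_stalk[OF cubic_formsD(5)[OF f]])

lemma h_eq: "h i j = peval x (hess f i j) / x p"
  unfolding h_def H_def using ev_dehom[OF cubic_formsD(5,6)[OF f]] by simp

lemma hess_sym: "hess f i j = hess f j i"
  unfolding second_deriv_expand[OF f] tens_sym(1)[of f i j] ..

lemma H_sym: "H i j = H j i"
  unfolding H_def hess_sym[of i j] ..

lemma peval_hess: "peval x (hess f i j) = (\<Sum>l\<le>n. tens f i j l * x l)"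
  unfolding second_deriv_expand[OF f] by (simp add: peval_rhom)

lemma E_H: "v < n \<Longrightarrow> E v (H i j) = const (tens f i j (skip v))"
proof -
  assume v: "v < n"
  have "partial_deriv (skip v) (hess f i j) = (\<Sum>l\<le>n. if skip v = l then Cst (tens f i j l) else 0)"
    unfolding second_deriv_expand[OF f] partial_deriv_sum partial_deriv_mult by (intro sum.cong) auto
  also have "\<dots> = Cst (tens f i j (skip v))" using skip_simps(1)[OF v] by simp
  finally show ?thesis
    unfolding H_def pder_dehom[OF cubic_formsD(5)[OF f] skip_simps(2) skip_simps(1)[OF v]]
    by (simp add: mev_Cst_Vr[OF rhom_const])
qed

lemma h_sum: "(\<Sum>b\<in>B. h a b * w b) = (\<Sum>b\<in>B. peval x (hess f a b) * w b) / x p"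
  by (simp add: h_eq sum_divide_distrib)

lemma nonsing: "\<forall>w. (\<forall>a\<in>I0. (\<Sum>b\<in>I0. h a b * w b) = 0) \<longrightarrow> (\<forall>b\<in>I0. w b = 0)"
  unfolding h_sum using nonsing' xp by simp

lemma kernel: "\<forall>w. (\<forall>a\<in>I0. (\<Sum>b\<le>n. h a b * w b) = 0) \<longrightarrow> (\<forall>a\<le>n. (\<Sum>b\<le>n. h a b * w b) = 0)"
  unfolding h_sum using kernel' xp by simp

section \<open>The Schur complement and its differentials\<close>

definition W :: "nat \<Rightarrow> nat \<Rightarrow> (nat, 'a) mpol fract" where
  "W j = (SOME w. (\<forall>b\<in>I0. w b \<in> stalk) \<and> (\<forall>a\<in>I0. (\<Sum>b\<in>I0. H a b * w b) = H a j))"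

lemma W: "b \<in> I0 \<Longrightarrow> W j b \<in> stalk" "a \<in> I0 \<Longrightarrow> (\<Sum>b\<in>I0. H a b * W j b) = H a j"
proof -
  have "\<exists>w. (\<forall>b\<in>I0. w b \<in> stalk) \<and> (\<forall>a\<in>I0. (\<Sum>b\<in>I0. H a b * w b) = H a j)"
    using nonsing unfolding h_def by (intro solve_linear finI0 H_stalk)
  from someI_ex[OF this] have "(\<forall>b\<in>I0. W j b \<in> stalk) \<and> (\<forall>a\<in>I0. (\<Sum>b\<in>I0. H a b * W j b) = H a j)"
    unfolding W_def[symmetric] .
  then show "b \<in> I0 \<Longrightarrow> W j b \<in> stalk" "a \<in> I0 \<Longrightarrow> (\<Sum>b\<in>I0. H a b * W j b) = H a j" by auto
qed

text \<open>The unit vector at \<open>j\<close>, corrected inside \<open>I0\<close> so that the rows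
  of \<open>H\<close> in \<open>I0\<close> annihilate it.\<close>

definition nv :: "nat \<Rightarrow> nat \<Rightarrow> (nat, 'a) mpol fract" where
  "nv j i = (if i = j then 1 else 0) - (if i \<in> I0 then W j i else 0)"

text \<open>The Schur complement of the block \<open>I0\<close>; the vectors \<open>nv j\<close> specialize to a basis of the kernel.\<close>

definition S :: "nat \<Rightarrow> nat \<Rightarrow> (nat, 'a) mpol fract" where
  "S i j = H i j - (\<Sum>b\<in>I0. H i b * W j b)"

lemma nv_stalk: "nv j i \<in> stalk"
  unfolding nv_def using W(1) sub by auto

lemma S_stalk: "S i j \<in> stalk"
  unfolding S_def using W(1) H_stalk by (intro sub(4) sub(9) sub(5))

lemma H_nv: "j \<le> n \<Longrightarrow> (\<Sum>b\<le>n. H a b * nv j b) = S a j"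
proof -
  assume j: "j \<le> n"
  have "(\<Sum>b\<le>n. H a b * nv j b) = (\<Sum>b\<le>n. if b = j then H a b else 0) - (\<Sum>b\<le>n. if b \<in> I0 then H a b * W j b else 0)"
    unfolding nv_def by (simp add: right_diff_distrib sum_subtractf if_distrib[of "\<lambda>y. H a _ * y"] cong: if_cong)
  also have "(\<Sum>b\<le>n. if b \<in> I0 then H a b * W j b else 0) = (\<Sum>b\<in>I0. H a b * W j b)"
    using I0 by (intro sum.mono_neutral_cong_right) auto
  finally show ?thesis using j by (simp add: S_def)
qed

lemma S_I0: "a \<in> I0 \<Longrightarrow> S a j = 0"
  unfolding S_def using W(2) by simp

lemma nv_S: "i \<le> n \<Longrightarrow> i \<notin> I0 \<Longrightarrow> (\<Sum>a\<le>n. nv i a * S a j) = S i j"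
proof -
  assume i: "i \<le> n" "i \<notin> I0"
  have "(\<Sum>a\<le>n. nv i a * S a j) = (\<Sum>a\<le>n. if a = i then S a j else 0)"
    using i S_I0 by (intro sum.cong refl) (auto simp: nv_def)
  then show ?thesis using i by simp
qed

lemma nv_S_I0: "i \<in> I0 \<Longrightarrow> (\<Sum>a\<le>n. nv i a * S a j) = 0"
  using S_I0 by (intro sum.neutral) (auto simp: nv_def)

lemma S_double: "j \<le> n \<Longrightarrow> (\<Sum>a\<le>n. nv i a * S a j) = (\<Sum>a\<le>n. \<Sum>b\<le>n. nv i a * H a b * nv j b)"
  by (simp flip: H_nv add: sum_distrib_left mult.assoc)

text \<open>Both sides are values of the symmetric bilinear form \<open>H\<close> at
  \<open>nv i\<close> and \<open>nv j\<close>. Outside \<open>I0\<close> this gives symmetry of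
  \<open>S\<close>, and for one index in \<open>I0\<close> it gives the vanishing of the
  corresponding column.\<close>

lemma S_swap:
  assumes "i \<le> n" "j \<le> n"
  shows "(\<Sum>a\<le>n. nv i a * S a j) = (\<Sum>a\<le>n. nv j a * S a i)"
  unfolding S_double[OF assms(1)] S_double[OF assms(2)]
proof -
  have "(\<Sum>a\<le>n. \<Sum>b\<le>n. nv i a * H a b * nv j b) = (\<Sum>b\<le>n. \<Sum>a\<le>n. nv i a * H a b * nv j b)" by (rule sum.swap)
  also have "\<dots> = (\<Sum>b\<le>n. \<Sum>a\<le>n. nv j b * H b a * nv i a)"
  proof (intro sum.cong refl)
    fix a b show "nv i a * H a b * nv j b = nv j b * H b a * nv i a" unfolding H_sym[of a b] by (simp add: ac_simps)
  qed
  finally show "(\<Sum>a\<le>n. \<Sum>b\<le>n. nv i a * H a b * nv j b) = (\<Sum>a\<le>n. \<Sum>b\<le>n. nv j a * H a b * nv i b)" .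
qed

lemma S_sym: "i \<le> n \<Longrightarrow> j \<le> n \<Longrightarrow> i \<notin> I0 \<Longrightarrow> j \<notin> I0 \<Longrightarrow> S i j = S j i"
  using S_swap[of i j] nv_S by simp

lemma S_col_I0: "i \<le> n \<Longrightarrow> j \<in> I0 \<Longrightarrow> S i j = 0"
  using S_I0 S_swap[of i j] nv_S[of i j] nv_S_I0[of j i] I0 by (cases "i \<in> I0") auto

text \<open>\<open>S i j\<close> is the value of the bilinear form \<open>H\<close> at
  \<open>nv i\<close> and \<open>nv j\<close>. The derivatives of these vectors are supported on
  \<open>I0\<close>, where the product of \<open>H\<close> with the other vector vanishes; only the
  derivative of \<open>H\<close> remains.\<close>

lemma derivation_S:
  assumes D: "derivation D" and ij: "i \<le> n" "i \<notin> I0" "j \<le> n" "j \<notin> I0"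
  shows "D (S i j) = (\<Sum>a\<le>n. \<Sum>b\<le>n. nv i a * D (H a b) * nv j b)"
proof -
  have Dnv: "(\<Sum>a\<le>n. D (nv i a) * S a j) = 0" for i j
    using S_I0 by (intro sum.neutral) (auto simp: nv_def derivation_simps[OF D])
  have "D (S i j) = D (\<Sum>a\<le>n. \<Sum>b\<le>n. nv i a * H a b * nv j b)"
    using nv_S[OF ij(1,2), of j] S_double[OF ij(3), of i] by simp
  also have "\<dots> = (\<Sum>a\<le>n. \<Sum>b\<le>n. D (nv i a) * H a b * nv j b) + (\<Sum>a\<le>n. \<Sum>b\<le>n. nv i a * D (H a b) * nv j b)
      + (\<Sum>a\<le>n. \<Sum>b\<le>n. nv i a * H a b * D (nv j b))"
    unfolding derivation_simps(7)[OF D] derivation_simps(2)[OF D] by (simp add: sum.distrib algebra_simps)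
  also have "(\<Sum>a\<le>n. \<Sum>b\<le>n. D (nv i a) * H a b * nv j b) = (\<Sum>a\<le>n. D (nv i a) * S a j)"
    by (simp flip: H_nv[OF ij(3)] add: sum_distrib_left mult.assoc)
  also have "(\<Sum>a\<le>n. \<Sum>b\<le>n. nv i a * H a b * D (nv j b)) = (\<Sum>b\<le>n. D (nv j b) * S b i)"
  proof -
    have "(\<Sum>a\<le>n. \<Sum>b\<le>n. nv i a * H a b * D (nv j b)) = (\<Sum>b\<le>n. \<Sum>a\<le>n. D (nv j b) * (H b a * nv i a))"
    proof (subst sum.swap, intro sum.cong refl)
      fix a b show "nv i a * H a b * D (nv j b) = D (nv j b) * (H b a * nv i a)" unfolding H_sym[of a b] by (simp add: ac_simps)
    qed
    then show ?thesis by (simp flip: H_nv[OF ij(1)] add: sum_distrib_left)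
  qed
  finally show ?thesis unfolding Dnv by simp
qed

definition n0 :: "nat \<Rightarrow> nat \<Rightarrow> 'a" where "n0 j a = ev (nv j a)"

lemma n0_outside: "a \<notin> I0 \<Longrightarrow> n0 j a = (if a = j then 1 else 0)"
  by (simp add: n0_def nv_def ev_simps)

lemma ev_S_sum: "j \<le> n \<Longrightarrow> ev (S a j) = (\<Sum>b\<le>n. h a b * n0 j b)"
proof -
  assume j: "j \<le> n"
  have "ev (S a j) = ev (\<Sum>b\<le>n. H a b * nv j b)" using H_nv[OF j] by simp
  also have "\<dots> = (\<Sum>b\<le>n. ev (H a b * nv j b))" using H_stalk nv_stalk by (intro ev_simps(5) sub(5))
  also have "\<dots> = (\<Sum>b\<le>n. h a b * n0 j b)" by (simp add: ev_mult H_stalk nv_stalk h_def n0_def)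
  finally show ?thesis .
qed

lemma kernel_n0: "j \<le> n \<Longrightarrow> a \<le> n \<Longrightarrow> (\<Sum>b\<le>n. h a b * n0 j b) = 0"
proof -
  assume j: "j \<le> n" "a \<le> n"
  have "\<forall>a\<in>I0. (\<Sum>b\<le>n. h a b * n0 j b) = 0"
    using S_I0 ev_simps(1) by (simp flip: ev_S_sum[OF j(1)])
  then have "\<forall>a\<le>n. (\<Sum>b\<le>n. h a b * n0 j b) = 0" by (rule mp[OF spec[OF kernel]])
  then show ?thesis using j by blast
qed

lemma ev_S: "j \<le> n \<Longrightarrow> a \<le> n \<Longrightarrow> ev (S a j) = 0"
  by (simp add: ev_S_sum kernel_n0)

lemma ev_E_S:
  assumes v: "v < n" and ij: "i \<le> n" "i \<notin> I0" "j \<le> n" "j \<notin> I0"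
  shows "ev (E v (S i j)) = (\<Sum>a\<le>n. \<Sum>b\<le>n. tens f a b (skip v) * n0 i a * n0 j b)"
proof -
  have "ev (E v (S i j)) = ev (\<Sum>a\<le>n. \<Sum>b\<le>n. nv i a * const (tens f a b (skip v)) * nv j b)"
    unfolding derivation_S[OF pder_derivation ij] E_H[OF v] ..
  also have "\<dots> = (\<Sum>a\<le>n. ev (\<Sum>b\<le>n. nv i a * const (tens f a b (skip v)) * nv j b))"
    by (intro ev_simps(5) sub(9) sub(5) nv_stalk const_stalk(1))
  also have "\<dots> = (\<Sum>a\<le>n. \<Sum>b\<le>n. ev (nv i a * const (tens f a b (skip v)) * nv j b))"
    by (intro sum.cong refl ev_simps(5) sub(5) nv_stalk const_stalk(1))
  also have "\<dots> = (\<Sum>a\<le>n. \<Sum>b\<le>n. tens f a b (skip v) * n0 i a * n0 j b)"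
    by (simp add: ev_mult nv_stalk const_stalk sub(5) n0_def ac_simps)
  finally show ?thesis .
qed

text \<open>One representative of each entry of the Schur complement up to symmetry; entries with an
  index in \<open>I0\<close> vanish.\<close>

definition pairs :: "(nat \<times> nat) set" where
  "pairs = {(i, j). i \<le> n \<and> i \<notin> I0 \<and> j \<le> n \<and> j \<notin> I0 \<and> i \<le> j}"

lemma pairs_finite: "finite pairs" "card pairs \<le> (n + 1) * (n + 1)"
proof -
  have s: "pairs \<subseteq> {..n} \<times> {..n}" by (auto simp: pairs_def)
  show "finite pairs" by (rule finite_subset[OF s]) simp
  show "card pairs \<le> (n + 1) * (n + 1)" using card_mono[OF _ s] by simp
qed

text \<open>By \<open>ev_E_S\<close> a linear relation among the differentials is an equation
  \<open>\<Sum>\<^sub>a F(-, y\<^sub>a, z\<^sub>a) = 0\<close> with kernel vectors. Goodness makes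
  the symmetrized tensor vanish, and the coefficients can be read off because outside
  \<open>I0\<close> the vectors \<open>n0 j\<close> are unit vectors.\<close>

lemma S_independent:
  assumes s: "\<And>v. v < n \<Longrightarrow> (\<Sum>q\<in>pairs. s q * ev (E v (S (fst q) (snd q)))) = 0" and q0: "q0 \<in> pairs"
  shows "s q0 = 0"
proof -
  let ?R = "(n + 1) * (n + 1)"
  define m where "m = card pairs"
  obtain e where e: "bij_betw e {..<m} pairs"
    using ex_bij_betw_nat_finite[OF pairs_finite(1)] unfolding m_def lessThan_atLeast0 by blast
  have ep: "e a \<in> pairs" if "a < m" for a using e that by (auto simp: bij_betw_def)
  \<comment> \<open>The relation as a sum of \<open>?R\<close> tensors: the coefficient is absorbed
    in \<open>y\<close>, and summands beyond the number of pairs are zero.\<close>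
  define y where "y = (\<lambda>a i. if a < m then s (e a) * n0 (fst (e a)) i else 0)"
  define z where "z = (\<lambda>a i. if a < m then n0 (snd (e a)) i else 0)"
  have mR: "m \<le> ?R" using pairs_finite(2) by (simp add: m_def)
  have sumR: "(\<Sum>a<?R. F (y a) (z a)) = (\<Sum>q\<in>pairs. F (\<lambda>i. s q * n0 (fst q) i) (n0 (snd q)))"
    if "F (\<lambda>_. 0) (\<lambda>_. 0) = 0" for F :: "(nat \<Rightarrow> 'a) \<Rightarrow> (nat \<Rightarrow> 'a) \<Rightarrow> 'a"
  proof -
    have "(\<Sum>a<?R. F (y a) (z a)) = (\<Sum>a<m. F (\<lambda>i. s (e a) * n0 (fst (e a)) i) (n0 (snd (e a))))"
      using mR that by (intro sum.mono_neutral_cong_right) (auto simp: y_def z_def cong: if_cong)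
    also have "\<dots> = (\<Sum>q\<in>pairs. F (\<lambda>i. s q * n0 (fst q) i) (n0 (snd q)))"
      by (rule sum.reindex_bij_betw[OF e])
    finally show ?thesis .
  qed
  have ker: "(\<Sum>b\<le>n. (\<Sum>l\<le>n. tens f a b l * x l) * n0 j b) = 0" if "a \<le> n" "j \<le> n" for a j
    using kernel_n0[OF that(2,1)] xp unfolding h_eq peval_hess by (simp add: sum_divide_distrib[symmetric])
  have c1: "\<forall>a<?R. \<forall>j\<le>n. (\<Sum>i\<le>n. \<Sum>l\<le>n. tens f i j l * x l * y a i) = 0"
  proof (intro allI impI)
    fix a j assume j: "j \<le> n"
    show "(\<Sum>i\<le>n. \<Sum>l\<le>n. tens f i j l * x l * y a i) = 0"
    proof (cases "a < m")
      case True
      then have "fst (e a) \<le> n" using ep[of a] by (auto simp: pairs_def)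
      have "(\<Sum>i\<le>n. \<Sum>l\<le>n. tens f i j l * x l * y a i) = s (e a) * (\<Sum>b\<le>n. (\<Sum>l\<le>n. tens f j b l * x l) * n0 (fst (e a)) b)"
        using True unfolding y_def by (simp add: sum_distrib_left sum_distrib_right tens_sym(1)[of f j] ac_simps)
      then show ?thesis using ker[OF j \<open>fst (e a) \<le> n\<close>] by simp
    qed (simp add: y_def)
  qed
  have c2: "\<forall>a<?R. \<forall>i\<le>n. (\<Sum>j\<le>n. \<Sum>l\<le>n. tens f i j l * x l * z a j) = 0"
  proof (intro allI impI)
    fix a i assume i: "i \<le> n"
    show "(\<Sum>j\<le>n. \<Sum>l\<le>n. tens f i j l * x l * z a j) = 0"
    proof (cases "a < m")
      case True
      then have "snd (e a) \<le> n" using ep[of a] by (auto simp: pairs_def)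
      then show ?thesis using ker[OF i, of "snd (e a)"] True by (simp add: z_def sum_distrib_right)
    qed (simp add: z_def)
  qed
  define F where "F = (\<lambda>l y' z'. \<Sum>i\<le>n. \<Sum>j\<le>n. tens f i j l * y' i * z' j)"
  have F0: "F l (\<lambda>_. 0) (\<lambda>_. 0) = 0" for l by (simp add: F_def)
  define G where "G = (\<lambda>l. \<Sum>q\<in>pairs. s q * F l (n0 (fst q)) (n0 (snd q)))"
  have sF: "(\<Sum>a<?R. F l (y a) (z a)) = G l" for l
  proof -
    have "(\<Sum>a<?R. F l (y a) (z a)) = (\<Sum>q\<in>pairs. F l (\<lambda>i. s q * n0 (fst q) i) (n0 (snd q)))" by (rule sumR[of "F l", OF F0])
    then show ?thesis unfolding G_def F_def by (simp add: sum_distrib_left ac_simps)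
  qed
  have Gv: "G (skip v) = 0" if "v < n" for v
  proof -
    have "G (skip v) = (\<Sum>q\<in>pairs. s q * ev (E v (S (fst q) (snd q))))"
      unfolding G_def F_def by (intro sum.cong refl) (auto simp: pairs_def ev_E_S[OF that])
    then show ?thesis using s[OF that] by simp
  qed
  \<comment> \<open>The direction \<open>p\<close> is not among the derivations of the chart. Since
    \<open>n0 j\<close> is in the kernel of the Hessian matrix at \<open>x\<close>, the form
    vanishes in the direction \<open>x\<close>, and \<open>x p \<noteq> 0\<close> then yields the
    missing equation.\<close>
  have Fx: "(\<Sum>l\<le>n. x l * F l (n0 i) (n0 j)) = 0" if "i \<le> n" "j \<le> n" for i j
  proof -
    have "(\<Sum>l\<le>n. x l * F l (n0 i) (n0 j)) = (\<Sum>a\<le>n. n0 i a * (\<Sum>b\<le>n. (\<Sum>l\<le>n. tens f a b l * x l) * n0 j b))"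
      unfolding F_def sum_distrib_left sum_distrib_right
      by (subst sum_rotate3) (simp add: ac_simps)
    then show ?thesis using ker[OF _ that(2)] by simp
  qed
  have "(\<Sum>l\<le>n. x l * G l) = (\<Sum>q\<in>pairs. s q * (\<Sum>l\<le>n. x l * F l (n0 (fst q)) (n0 (snd q))))"
    unfolding G_def sum_distrib_left by (subst sum.swap) (simp add: ac_simps)
  also have "\<dots> = 0" using Fx by (intro sum.neutral) (auto simp: pairs_def)
  finally have "(\<Sum>l\<le>n. x l * G l) = 0" .
  moreover have "(\<Sum>l\<le>n. x l * G l) = x p * G p + (\<Sum>l\<in>{..n} - {p}. x l * G l)" using pn by (intro sum.remove) auto
  moreover have "(\<Sum>l\<in>{..n} - {p}. x l * G l) = 0"
  proof (intro sum.neutral ballI)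
    fix l assume "l \<in> {..n} - {p}"
    then obtain v where "v < n" "skip v = l" using skip_surj by auto
    then show "x l * G l = 0" using Gv by auto
  qed
  ultimately have "G p = 0" using xp by simp
  have "G l = 0" if l: "l \<le> n" for l
  proof (cases "l = p")
    case False
    then obtain v where "v < n" "skip v = l" using skip_surj l by blast
    then show ?thesis using Gv by auto
  qed (use \<open>G p = 0\<close> in simp)
  then have c3: "\<forall>l\<le>n. (\<Sum>a<?R. \<Sum>i\<le>n. \<Sum>j\<le>n. tens f i j l * y a i * z a j) = 0"
    using sF unfolding F_def by simp
  have nzx: "\<exists>i\<le>n. x i \<noteq> 0" using pn xp by blast
  obtain i0 j0 where q: "q0 = (i0, j0)" and ij: "i0 \<le> n" "i0 \<notin> I0" "j0 \<le> n" "j0 \<notin> I0" "i0 \<le> j0"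
    using q0 by (auto simp: pairs_def)
  have "(\<Sum>a<?R. y a i0 * z a j0 + y a j0 * z a i0) = 0"
    using good nzx c1 c2 c3 ij unfolding good_def by blast
  moreover have "(\<Sum>a<?R. y a i0 * z a j0 + y a j0 * z a i0) =
      (\<Sum>q\<in>pairs. s q * n0 (fst q) i0 * n0 (snd q) j0 + s q * n0 (fst q) j0 * n0 (snd q) i0)"
    by (rule sumR[of "\<lambda>y z. y i0 * z j0 + y j0 * z i0"]) simp
  \<comment> \<open>Since \<open>i \<le> j\<close> in \<open>pairs\<close>, only the pair
    \<open>q0\<close> contributes; on the diagonal it contributes twice.\<close>
  moreover have "\<dots> = (\<Sum>q\<in>pairs. if q = q0 then s q * (if i0 = j0 then 2 else 1) else 0)"
    using ij by (intro sum.cong refl) (auto simp: n0_outside q pairs_def)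
  ultimately have "s q0 * (if i0 = j0 then 2 else 1) = 0" using q0 pairs_finite(1) by simp
  then show ?thesis by (simp split: if_splits)
qed

text \<open>Bordering the block \<open>I0\<close> by row \<open>i\<close> and column
  \<open>j\<close> gives the Schur entry times a unit. \<open>nv j\<close> is supported on the
  chosen columns and is sent to \<open>S i j\<close> times a unit vector, so
  \<open>det_bordered\<close> applies; it remains to see that the cofactor is nonzero at the
  point.\<close>

lemma bordered_minor:
  assumes ij: "i \<le> n" "i \<notin> I0" "j \<le> n" "j \<notin> I0"
  shows "\<exists>v\<in>stalk. ev v \<noteq> 0 \<and> dehom (hess_minor n f (insert i I0) (insert j I0)) = S i j * v"
proof -
  define m where "m = Suc (card I0)"
  let ?I = "insert i I0" and ?J = "insert j I0"
  have card: "card ?I = m" "card ?J = m" using ij finI0 by (auto simp: m_def)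
  have I: "?I \<subseteq> {..n}" and J: "?J \<subseteq> {..n}" using ij I0 by auto
  have bI: "bij_betw (pick ?I) {..<m} ?I" and bJ: "bij_betw (pick ?J) {..<m} ?J"
    using bij_betw_pick[of ?I] bij_betw_pick[of ?J] finI0 card by auto
  have "i \<in> pick ?I ` {..<m}" "j \<in> pick ?J ` {..<m}" using bij_betw_imp_surj_on[OF bI] bij_betw_imp_surj_on[OF bJ] by auto
  then obtain a0 b0 where a0: "a0 < m" "pick ?I a0 = i" and b0: "b0 < m" "pick ?J b0 = j" by auto
  have pI: "pick ?I a \<in> ?I" if "a < m" for a using bI that by (auto simp: bij_betw_def)
  have pJ: "pick ?J b \<in> ?J" if "b < m" for b using bJ that by (auto simp: bij_betw_def)
  have ai: "pick ?I a = i \<longleftrightarrow> a = a0" if "a < m" for a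
    using bI a0 that by (auto simp: bij_betw_def inj_on_def)
  have bj: "pick ?J b = j \<longleftrightarrow> b = b0" if "b < m" for b
    using bJ b0 that by (auto simp: bij_betw_def inj_on_def)
  let ?N = "mat m m (\<lambda>(a, b). H (pick ?I a) (pick ?J b))"
  have N: "?N \<in> carrier_mat m m" by simp
  define w where "w = vec m (\<lambda>b. nv j (pick ?J b))"
  have w: "w \<in> carrier_vec m" "w $ b0 = 1" using b0 ij by (auto simp: w_def nv_def)
  have onJ: "(\<Sum>b\<in>?J. F b * c b) = (\<Sum>b\<le>n. F b * c b)" if "\<And>b. b \<notin> ?J \<Longrightarrow> c b = 0" for F c :: "nat \<Rightarrow> (nat, 'a) mpol fract"
    using J that by (intro sum.mono_neutral_left) auto
  have Nw: "(?N *\<^sub>v w) $ a = (if a = a0 then S i j else 0)" if a: "a < m" for a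
  proof -
    have "(?N *\<^sub>v w) $ a = (\<Sum>b<m. H (pick ?I a) (pick ?J b) * nv j (pick ?J b))"
      using a by (subst mat_mult_vec_index) (auto simp: w_def)
    also have "\<dots> = (\<Sum>b\<in>?J. H (pick ?I a) b * nv j b)" by (rule sum.reindex_bij_betw[OF bJ])
    also have "\<dots> = (\<Sum>b\<le>n. H (pick ?I a) b * nv j b)" by (rule onJ) (auto simp: nv_def)
    also have "\<dots> = S (pick ?I a) j" by (rule H_nv[OF ij(3)])
    finally show ?thesis using pI[OF a] ai[OF a] S_I0 by auto
  qed
  let ?N' = "mat m m (\<lambda>(a, b). if a = a0 \<and> b = b0 then ?N $$ (a, b) - S i j + 1 else ?N $$ (a, b))"
  have "Determinant.det ?N = S i j * Determinant.det ?N'" by (rule det_bordered[OF N w a0(1) b0(1) Nw])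
  moreover have "dehom (hess_minor n f ?I ?J) = Determinant.det ?N"
    using hess_minor_rhom[OF rhom_mev[OF rhom_const] I J card] by (simp add: H_def)
  moreover have N': "?N' \<in> carrier_mat m m" by simp
  have ent: "?N' $$ (a, b) \<in> stalk" if "a < m" "b < m" for a b
    using that H_stalk S_stalk sub by auto
  \<comment> \<open>At the point \<open>S i j\<close> vanishes, so the perturbed entry specializes
    to \<open>h i j + 1\<close>.\<close>
  define B where "B = (\<lambda>c d. if c = i \<and> d = j then h i j + 1 else h c d)"
  have "map_mat ev ?N' = mat m m (\<lambda>(a, b). B (pick ?I a) (pick ?J b))"
  proof (intro eq_matI)
    fix a b assume "a < dim_row (mat m m (\<lambda>(a, b). B (pick ?I a) (pick ?J b)))" "b < dim_col (mat m m (\<lambda>(a, b). B (pick ?I a) (pick ?J b)))"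
    then have ab: "a < m" "b < m" by auto
    have "ev (H i j - S i j + 1) = h i j + 1"
      using ev_S[OF ij(3,1)] H_stalk S_stalk sub by (simp add: ev_add ev_simps h_def)
    then show "map_mat ev ?N' $$ (a, b) = mat m m (\<lambda>(a, b). B (pick ?I a) (pick ?J b)) $$ (a, b)"
      using ab ai[OF ab(1)] bj[OF ab(2)] a0 b0 by (auto simp: B_def h_def)
  qed simp_all
  then have "ev (Determinant.det ?N') = Determinant.det (mat m m (\<lambda>(a, b). B (pick ?I a) (pick ?J b)))"
    using ev_det(2)[OF N' ent] by simp
  moreover have "\<dots> \<noteq> 0"
    unfolding det_nonzero_iff[OF bI bJ, of B]
  proof (intro allI impI)
    fix w assume w: "\<forall>c\<in>?I. (\<Sum>d\<in>?J. B c d * w d) = 0"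
    \<comment> \<open>Subtracting a multiple of the kernel vector \<open>n0 j\<close> removes the
      coordinate \<open>j\<close> of \<open>w\<close>. What is left is supported on
      \<open>I0\<close>, where the block is nonsingular; the raised entry in row \<open>i\<close>
      then forces \<open>w j = 0\<close>.\<close>
    define u where "u = (\<lambda>d. w d - w j * n0 j d)"
    have nJ: "(\<Sum>d\<in>?J. h c d * n0 j d) = 0" if "c \<le> n" for c
    proof -
      have "(\<Sum>d\<in>?J. h c d * n0 j d) = (\<Sum>d\<le>n. h c d * n0 j d)"
        using J by (intro sum.mono_neutral_left) (auto simp: n0_outside)
      then show ?thesis using kernel_n0[OF ij(3) that] by simp
    qed
    have uj: "u j = 0" using ij by (simp add: u_def n0_outside)
    have "\<forall>c\<in>I0. (\<Sum>d\<in>I0. h c d * u d) = 0"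
    proof
      fix c assume c: "c \<in> I0"
      have "c \<noteq> i" using c ij by auto
      have "(\<Sum>d\<in>I0. h c d * u d) = (\<Sum>d\<in>?J. h c d * u d)" using uj finI0 ij by simp
      also have "\<dots> = (\<Sum>d\<in>?J. B c d * w d) - w j * (\<Sum>d\<in>?J. h c d * n0 j d)"
        unfolding sum_distrib_left sum_subtractf[symmetric] using \<open>c \<noteq> i\<close>
        by (intro sum.cong refl) (simp add: u_def B_def algebra_simps)
      also have "\<dots> = 0" using w c nJ[of c] I0 by auto
      finally show "(\<Sum>d\<in>I0. h c d * u d) = 0" .
    qed
    then have "\<forall>d\<in>I0. u d = 0" by (rule mp[OF spec[OF nonsing]])
    then have wd: "w d = w j * n0 j d" if "d \<in> ?J" for d using that uj by (auto simp: u_def)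
    have "0 = (\<Sum>d\<in>?J. B i d * w d)" using w by simp
    also have "\<dots> = (\<Sum>d\<in>?J. w j * (h i d * n0 j d) + (if d = j then w j else 0))"
    proof (intro sum.cong refl)
      fix d assume d: "d \<in> ?J"
      show "B i d * w d = w j * (h i d * n0 j d) + (if d = j then w j else 0)"
      proof (cases "d = j")
        case True
        then show ?thesis using n0_outside[OF ij(4), of j] by (simp add: B_def distrib_right)
      next
        case False
        then show ?thesis using wd[OF d] by (simp add: B_def)
      qed
    qed
    also have "\<dots> = w j * (\<Sum>d\<in>?J. h i d * n0 j d) + w j"
      using finI0 by (simp only: sum.distrib sum_distrib_left[symmetric] sum.delta finite_insert) simp
    finally have "w j = 0" using nJ[OF ij(1)] by simp
    show "\<forall>d\<in>?J. w d = 0"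
    proof
      fix d assume "d \<in> ?J"
      from wd[OF this] show "w d = 0" unfolding \<open>w j = 0\<close> mult_zero_left .
    qed
  qed
  ultimately show ?thesis using ev_det(1)[OF N' ent] by (intro bexI[of _ "Determinant.det ?N'"]) auto
qed

text \<open>Modulo \<open>P\<close> the Schur complement vanishes, so the matrix becomes a product
  through the \<open>k\<close> indices of \<open>I0\<close>, and its minors of size
  \<open>k + 1\<close> vanish. The factors are padded by a zero column and a zero row to make them
  square.\<close>

lemma minor_in_prime:
  assumes P: "is_prime stalk P" and SP: "\<And>q. q \<in> pairs \<Longrightarrow> S (fst q) (snd q) \<in> P"
    and IJ: "I \<subseteq> {..n}" "J \<subseteq> {..n}" "card I = Suc (card I0)" "card J = Suc (card I0)"
  shows "dehom (hess_minor n f I J) \<in> P"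
proof -
  define k where "k = card I0"
  define m where "m = Suc k"
  note P' = primeD(1)[OF P]
  have SP': "S c d \<in> P" if "c \<le> n" "d \<le> n" for c d
  proof (cases "c \<in> I0 \<or> d \<in> I0")
    case True
    then have "S c d = 0" using S_I0 S_col_I0 that by auto
    then show ?thesis using ideal_closed(1)[OF P'] by simp
  next
    case False
    then have "(c, d) \<in> pairs \<or> (d, c) \<in> pairs" using that by (auto simp: pairs_def)
    then show ?thesis using SP S_sym[of c d] False that by fastforce
  qed
  let ?N = "mat m m (\<lambda>(a, b). H (pick I a) (pick J b))"
  let ?X = "mat m m (\<lambda>(a, b). if b < k then H (pick I a) (pick I0 b) else 0)"
  let ?Y = "mat m m (\<lambda>(a, b). if a < k then W (pick J b) (pick I0 a) else 0)"
  have b0: "bij_betw (pick I0) {..<k} I0" unfolding k_def by (rule bij_betw_pick[OF finI0])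
  have pI: "pick I a \<le> n" if "a < m" for a using pick_in_set_le[of a I] IJ that by (auto simp: m_def k_def)
  have pJ: "pick J a \<le> n" if "a < m" for a using pick_in_set_le[of a J] IJ that by (auto simp: m_def k_def)
  have XY: "(?X * ?Y) $$ (a, b) = (\<Sum>c\<in>I0. H (pick I a) c * W (pick J b) c)" if "a < m" "b < m" for a b
  proof -
    have "(?X * ?Y) $$ (a, b) = (\<Sum>c<m. (if c < k then H (pick I a) (pick I0 c) else 0) * (if c < k then W (pick J b) (pick I0 c) else 0))"
      using that by (simp add: scalar_prod_def lessThan_atLeast0)
    also have "\<dots> = (\<Sum>c<k. H (pick I a) (pick I0 c) * W (pick J b) (pick I0 c))"
      by (intro sum.mono_neutral_cong_right) (auto simp: m_def)
    also have "\<dots> = (\<Sum>c\<in>I0. H (pick I a) c * W (pick J b) c)" by (rule sum.reindex_bij_betw[OF b0])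
    finally show ?thesis .
  qed
  have X: "?X \<in> carrier_mat m m" and Y: "?Y \<in> carrier_mat m m" by simp_all
  have "Determinant.det ?X = (\<Sum>i<m. ?X $$ (i, k) * cofactor ?X i k)"
    by (rule laplace_expansion_column[OF X]) (simp add: m_def)
  also have "\<dots> = 0" by (intro sum.neutral) (auto simp: m_def)
  finally have "Determinant.det (?X * ?Y) = 0" using det_mult[OF X Y] by simp
  moreover have "Determinant.det ?N - Determinant.det (?X * ?Y) \<in> P"
  proof -
    have "?N $$ (a, b) \<in> stalk \<and> (?X * ?Y) $$ (a, b) \<in> stalk \<and> ?N $$ (a, b) - (?X * ?Y) $$ (a, b) \<in> P" if ab: "a < m" "b < m" for a b
    proof -
      have "?N $$ (a, b) - (?X * ?Y) $$ (a, b) = S (pick I a) (pick J b)" unfolding XY[OF ab] using ab by (simp add: S_def)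
      then have "?N $$ (a, b) - (?X * ?Y) $$ (a, b) \<in> P" using SP' pI pJ ab by simp
      moreover have "(?X * ?Y) $$ (a, b) \<in> stalk" unfolding XY[OF ab] using H_stalk W(1) by (intro sub(9) sub(5))
      ultimately show ?thesis using ab H_stalk by simp
    qed
    then show ?thesis by (intro conjunct2[OF conjunct2[OF det_cong_ideal[OF stalk_subring P', of _ m]]]) auto
  qed
  moreover have "dehom (hess_minor n f I J) = Determinant.det ?N"
    using hess_minor_rhom[OF rhom_mev[OF rhom_const] IJ(1,2)] IJ(3,4) by (simp add: H_def m_def k_def)
  ultimately show ?thesis by simp
qed

section \<open>The ideals of minors and regularity of their stalks\<close>

lemma minor_zero:
  assumes IJ: "I \<subseteq> {..n}" "J \<subseteq> {..n}" "card I = m" "card J = m" and m: "card I0 < m"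
  shows "peval x (hess_minor n f I J) = 0"
proof -
  have bJ: "bij_betw (pick J) {..<m} J" using bij_betw_pick[of J] IJ finite_subset by auto
  have "peval x (hess_minor n f I J) = Determinant.det (mat m m (\<lambda>(a, b). peval x (hess f (pick I a) (pick J b))))"
    by (rule hess_minor_rhom[OF rhom_peval IJ])
  also have "\<dots> = 0"
    by (rule minor_vanishes[OF kernel' IJ(2) bJ finI0, of "{}" _ "pick I"]) (use m IJ pick_in_set_le[of _ I] in auto)
  finally show ?thesis .
qed

definition minors :: "nat \<Rightarrow> (nat, 'a) mpol set" where
  "minors k = {hess_minor n f I J | I J. I \<subseteq> {..n} \<and> J \<subseteq> {..n} \<and> card I = k + 1 \<and> card J = k + 1}"

lemma minors_ideal_eq: "hessian_minors_ideal n k f = hom_ideal n (minors k)"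
  by (simp add: hessian_minors_ideal_def minors_def)

lemma minors_polys: "minors k \<subseteq> polys {..n}"
  using hess_minor_polys(1)[OF f] by (auto simp: minors_def)

lemma minors_M:
  assumes "card I0 \<le> k" "g \<in> minors k"
  shows "dehom g \<in> M"
proof -
  obtain I J where IJ: "g = hess_minor n f I J" "I \<subseteq> {..n}" "J \<subseteq> {..n}" "card I = k + 1" "card J = k + 1"
    using assms(2) by (auto simp: minors_def)
  have "ev (dehom g) = peval x g / x p ^ (k + 1)"
    unfolding IJ(1) by (rule ev_dehom[OF hess_minor_polys[OF f IJ(2-5)]])
  then show ?thesis using minor_zero[OF IJ(2-5)] assms(1) dehom_stalk minors_polys assms(2) IJ(1) by (auto simp: M_def)
qed

text \<open>The Schur entries over \<open>pairs\<close> serve as the independent elements of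
  \<open>regularI\<close>: they lie in the ideal because bordered minors are unit multiples of them,
  and a prime containing them contains all minors by \<open>minor_in_prime\<close>.\<close>

lemma regular_stalk:
  assumes k: "card I0 = k"
  shows "regular_local_ring (scheme_stalk n (hessian_minors_ideal n k f) x)"
  unfolding scheme_stalk_def proj_stalk_eq minors_ideal_eq
proof -
  define I where "I = ideal_stalk n (hom_ideal n (minors k)) x"
  define m where "m = card pairs"
  obtain e where e: "bij_betw e {..<m} pairs"
    using ex_bij_betw_nat_finite[OF pairs_finite(1)] unfolding m_def lessThan_atLeast0 by blast
  have ep: "e a \<in> pairs" if "a < m" for a using e that by (auto simp: bij_betw_def)
  have J: "hom_ideal n (minors k) \<subseteq> polys {..n}" using hom_ideal_sub(2)[OF minors_polys] by (simp add: is_ideal_def)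
  have I: "is_ideal stalk I" unfolding I_def by (rule ideal_stalk_ideal[OF J])
  have IM: "I \<subseteq> M" unfolding I_def using k by (intro ideal_stalk_subset minors_polys M_ideal minors_M) auto
  have hI: "S (fst q) (snd q) \<in> I" if "q \<in> pairs" for q
  proof -
    obtain i j where q: "q = (i, j)" and ij: "i \<le> n" "i \<notin> I0" "j \<le> n" "j \<notin> I0" using \<open>q \<in> pairs\<close> by (auto simp: pairs_def)
    obtain v where v: "v \<in> stalk" "ev v \<noteq> 0" "dehom (hess_minor n f (insert i I0) (insert j I0)) = S i j * v"
      using bordered_minor[OF ij] by blast
    have c: "insert i I0 \<subseteq> {..n}" "insert j I0 \<subseteq> {..n}" "card (insert i I0) = k + 1" "card (insert j I0) = k + 1"
      using ij I0 finI0 k by auto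
    then have "hess_minor n f (insert i I0) (insert j I0) \<in> minors k" unfolding minors_def by blast
    then have "S i j * v \<in> I" unfolding I_def v(3)[symmetric]
      by (rule ideal_stalk_mem[OF minors_polys _ hess_minor_polys(2)[OF f c]])
    then have "S i j * v * inverse v \<in> I" using ideal_closed(6)[OF I stalk_inverse[OF v(1,2)]] by blast
    moreover have "v \<noteq> 0" using v(2) ev_simps(1) by auto
    then have "S i j * v * inverse v = S i j" by simp
    ultimately show ?thesis using q by simp
  qed
  show "regular_local_ring (subring_of stalk Quot ideal_stalk n (hom_ideal n (minors k)) x)"
    unfolding I_def[symmetric]
  proof (rule regularI[OF I IM, of m "\<lambda>l. S (fst (e l)) (snd (e l))"])
    show "S (fst (e l)) (snd (e l)) \<in> I" if "l < m" for l using hI[OF ep[OF that]] .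
  next
    fix s :: "nat \<Rightarrow> 'a"
    assume s: "\<And>v. v < n \<Longrightarrow> ev (E v (\<Sum>l<m. const (s l) * S (fst (e l)) (snd (e l)))) = 0"
    define s' where "s' = (\<lambda>q. s (inv_into {..<m} e q))"
    have s'e: "s' (e l) = s l" if "l < m" for l using e that by (simp add: s'_def bij_betw_inv_into_left)
    have "(\<Sum>q\<in>pairs. s' q * ev (E v (S (fst q) (snd q)))) = 0" if v: "v < n" for v
    proof -
      have "E v (\<Sum>l<m. const (s l) * S (fst (e l)) (snd (e l))) = (\<Sum>l<m. const (s l) * E v (S (fst (e l)) (snd (e l))))"
        by (simp add: derivation_simps[OF pder_derivation] pder_const)
      then have "0 = ev (\<Sum>l<m. const (s l) * E v (S (fst (e l)) (snd (e l))))" using s[OF v] by simp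
      also have "\<dots> = (\<Sum>l<m. ev (const (s l) * E v (S (fst (e l)) (snd (e l)))))"
        by (intro ev_simps(5) sub(5) const_stalk(1) pder_stalk S_stalk)
      also have "\<dots> = (\<Sum>l<m. s' (e l) * ev (E v (S (fst (e l)) (snd (e l)))))"
        using s'e by (intro sum.cong refl) (simp add: ev_mult const_stalk pder_stalk S_stalk)
      also have "\<dots> = (\<Sum>q\<in>pairs. s' q * ev (E v (S (fst q) (snd q))))" by (rule sum.reindex_bij_betw[OF e])
      finally show ?thesis by simp
    qed
    then have "s' q = 0" if "q \<in> pairs" for q using S_independent[of s' q] that by blast
    then show "\<forall>l<m. s l = 0" using s'e ep by metis
  next
    fix P assume P: "is_prime stalk P" and SP: "\<And>l. l < m \<Longrightarrow> S (fst (e l)) (snd (e l)) \<in> P"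
    have "S (fst q) (snd q) \<in> P" if "q \<in> pairs" for q
    proof -
      obtain l where "l < m" "q = e l" using e \<open>q \<in> pairs\<close> by (auto simp: bij_betw_def)
      then show ?thesis using SP by simp
    qed
    then show "I \<subseteq> P" unfolding I_def
      using minor_in_prime[OF P] k by (intro ideal_stalk_subset[OF minors_polys primeD(1)[OF P]]) (auto simp: minors_def)
  qed
qed

text \<open>A derivative of a minor is a sum of determinants with one differentiated row each. At
  the point the other rows have rank at most \<open>card I0\<close>, so every summand has rank at
  most \<open>k\<close> and vanishes. Thus all differentials of the ideal are zero at the point,
  while \<open>nz\<close> makes the ideal nonzero.\<close>

lemma not_regular_stalk:
  assumes k: "card I0 < k" and nz: "\<exists>g\<in>minors k. g \<noteq> 0"
  shows "\<not> regular_local_ring (scheme_stalk n (hessian_minors_ideal n k f) x)"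
  unfolding scheme_stalk_def proj_stalk_eq minors_ideal_eq
proof -
  define I where "I = ideal_stalk n (hom_ideal n (minors k)) x"
  have J: "hom_ideal n (minors k) \<subseteq> polys {..n}" using hom_ideal_sub(2)[OF minors_polys] by (simp add: is_ideal_def)
  have I: "is_ideal stalk I" unfolding I_def by (rule ideal_stalk_ideal[OF J])
  have IM: "I \<subseteq> M" unfolding I_def using k by (intro ideal_stalk_subset minors_polys M_ideal minors_M) auto
  obtain g where g: "g \<in> minors k" "g \<noteq> 0" using nz by blast
  obtain I' J' where IJ': "g = hess_minor n f I' J'" "I' \<subseteq> {..n}" "J' \<subseteq> {..n}" "card I' = k + 1" "card J' = k + 1"
    using g(1) by (auto simp: minors_def)
  have hg: "homogeneous (k + 1) g" unfolding IJ'(1) by (rule hess_minor_polys(2)[OF f IJ'(2-5)])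
  have "dehom g \<noteq> 0" unfolding dehom_eq[OF hg] using g(2) Vp_nonzero by (simp add: Zero_fract_def eq_fract)
  moreover have "dehom g \<in> I" unfolding I_def by (rule ideal_stalk_mem[OF minors_polys g(1) hg])
  ultimately have I0': "I \<noteq> {0}" by blast
  define K where "K = {u \<in> M. \<forall>v<n. ev (E v u) = 0}"
  have MA: "u \<in> stalk" "ev u = 0" if "u \<in> M" for u using that by (auto simp: M_def)
  have "is_ideal stalk K"
    unfolding is_ideal_def
  proof (intro conjI ballI)
    show "K \<subseteq> stalk" using MA by (auto simp: K_def)
    show "0 \<in> K" using ideal_closed(1)[OF M_ideal] by (simp add: K_def derivation_simps[OF pder_derivation] ev_simps)
    show "u + v \<in> K" if "u \<in> K" "v \<in> K" for u v
      using that ideal_closed(2)[OF M_ideal, of u v] MA pder_stalk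
      by (auto simp: K_def derivation_simps[OF pder_derivation] ev_add)
    show "a * u \<in> K" if "a \<in> stalk" "u \<in> K" for a u
      using that ideal_closed(3)[OF M_ideal, of a u] MA pder_stalk
      by (auto simp: K_def derivation_simps[OF pder_derivation] ev_add ev_mult sub(5))
  qed
  moreover have "dehom g \<in> K" if g: "g \<in> minors k" for g
  proof -
    obtain I J where IJ: "g = hess_minor n f I J" "I \<subseteq> {..n}" "J \<subseteq> {..n}" "card I = k + 1" "card J = k + 1"
      using g by (auto simp: minors_def)
    let ?N = "mat (k + 1) (k + 1) (\<lambda>(a, b). H (pick I a) (pick J b))"
    have dg: "dehom g = Determinant.det ?N"
      unfolding IJ(1) using hess_minor_rhom[OF rhom_mev[OF rhom_const] IJ(2-5)] by (simp add: H_def)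
    have bJ: "bij_betw (pick J) {..<k + 1} J" using bij_betw_pick[of J] IJ finite_subset by auto
    have "ev (E v (dehom g)) = 0" if v: "v < n" for v
    proof -
      let ?D = "\<lambda>i. mat (k + 1) (k + 1) (\<lambda>(a, b). if a = i then E v (?N $$ (a, b)) else ?N $$ (a, b))"
      have D: "?D i \<in> carrier_mat (k + 1) (k + 1)" for i by simp
      have ent: "?D i $$ (a, b) \<in> stalk" if "a < k + 1" "b < k + 1" for i a b using that H_stalk pder_stalk by auto
      have "ev (Determinant.det (?D i)) = 0" if i: "i < k + 1" for i
      proof -
        have "ev (Determinant.det (?D i)) = Determinant.det (map_mat ev (?D i))" by (rule ev_det(2)[OF D ent])
        also have "map_mat ev (?D i) = mat (k + 1) (k + 1) (\<lambda>(a, b). if a = i then ev (E v (H (pick I a) (pick J b))) else h (pick I a) (pick J b))"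
          by (intro eq_matI) (auto simp: h_def)
        also have "Determinant.det \<dots> = 0"
          by (rule minor_vanishes[OF kernel IJ(3) bJ finI0, of "{i}" _ "pick I"]) (use k IJ pick_in_set_le[of _ I] in auto)
        finally show ?thesis .
      qed
      then have "(\<Sum>i<k + 1. ev (Determinant.det (?D i))) = 0" by simp
      moreover have "ev (\<Sum>i<k + 1. Determinant.det (?D i)) = (\<Sum>i<k + 1. ev (Determinant.det (?D i)))"
        using ev_det(1)[OF D ent] by (intro ev_simps(5))
      moreover have "E v (Determinant.det ?N) = (\<Sum>i<k + 1. Determinant.det (?D i))"
        by (rule derivation_det[OF pder_derivation]) simp
      ultimately show ?thesis unfolding dg by simp
    qed
    then show ?thesis using minors_M[OF _ g] k by (auto simp: K_def)
  qed
  ultimately have "I \<subseteq> K" unfolding I_def by (intro ideal_stalk_subset minors_polys) auto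
  then show "\<not> regular_local_ring (subring_of stalk Quot ideal_stalk n (hom_ideal n (minors k)) x)"
    unfolding I_def[symmetric] by (intro not_regularI I IM I0') (auto simp: K_def)
qed

end

text \<open>The last clause translates between minors and rank: a nonsingular block on
  \<open>I0\<close> contains nonzero minors of every size up to \<open>card I0\<close>.\<close>

lemma hess_point_exists:
  fixes f :: "(nat, 'a::field_char_0) mpol"
  assumes f: "f \<in> cubic_forms n" "good n ((n + 1) * (n + 1)) f" and x: "x \<in> nonzero_vecs {..n}"
  shows "\<exists>p I0. hess_point n x p f I0 \<and> card I0 = vec_space.rank (n + 1) (map_mat (peval x) (hessian n f)) \<and>
    (\<forall>m. (\<forall>I J. I \<subseteq> {..n} \<longrightarrow> J \<subseteq> {..n} \<longrightarrow> card I = m \<longrightarrow> card J = m \<longrightarrow> peval x (hess_minor n f I J) = 0) \<longrightarrow> card I0 < m)"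
proof -
  obtain p where p: "p \<le> n" "x p \<noteq> 0" using x by (fastforce simp: nonzero_vecs_def fun_eq_iff)
  have sym: "peval x (hess f i j) = peval x (hess f j i)" for i j
    unfolding second_deriv_expand[OF f(1)] tens_sym(1)[of f i j] ..
  have M: "mat (n + 1) (n + 1) (\<lambda>(i, j). peval x (hess f i j)) = map_mat (peval x) (hessian n f)"
    by (intro eq_matI) (auto simp: hessian_def)
  obtain I0 where I0: "I0 \<subseteq> {..n}" "card I0 = vec_space.rank (n + 1) (map_mat (peval x) (hessian n f))"
    "\<forall>w. (\<forall>a\<in>I0. (\<Sum>b\<in>I0. peval x (hess f a b) * w b) = 0) \<longrightarrow> (\<forall>b\<in>I0. w b = 0)"
    "\<forall>w. (\<forall>a\<in>I0. (\<Sum>b\<le>n. peval x (hess f a b) * w b) = 0) \<longrightarrow> (\<forall>a\<le>n. (\<Sum>b\<le>n. peval x (hess f a b) * w b) = 0)"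
    using symmetric_rank_basis[of n "\<lambda>i j. peval x (hess f i j)", OF sym] that unfolding M by (elim exE conjE) assumption
  have "hess_point n x p f I0" using x p f I0(1,3,4) by unfold_locales
  moreover have "card I0 < m" if z: "\<forall>I J. I \<subseteq> {..n} \<longrightarrow> J \<subseteq> {..n} \<longrightarrow> card I = m \<longrightarrow> card J = m \<longrightarrow> peval x (hess_minor n f I J) = 0" for m
  proof (rule ccontr)
    assume "\<not> card I0 < m"
    then have "m \<le> card I0" by simp
    from minor_exists[OF finite_subset[OF I0(1) finite_atMost] I0(3) this]
    obtain I J where IJ: "I \<subseteq> I0" "J \<subseteq> I0" "card I = m" "card J = m"
      "Determinant.det (mat m m (\<lambda>(a, b). peval x (hess f (pick I a) (pick J b)))) \<noteq> 0"
      by blast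
    then have "peval x (hess_minor n f I J) \<noteq> 0"
      using hess_minor_rhom[OF rhom_peval, of I n J m x f] I0(1) by auto
    then show False using z IJ I0(1) by blast
  qed
  ultimately show ?thesis using I0(2) by blast
qed

section \<open>The generic cubic\<close>

lemma pt_eqD: "pt x = pt y \<Longrightarrow> \<exists>c. c \<noteq> 0 \<and> x = (\<lambda>i. c * y i)"
proof -
  assume "pt x = pt y"
  moreover have "x \<in> pt x" unfolding pt_def by (intro CollectI exI[of _ 1]) simp
  ultimately have "x \<in> pt y" by simp
  then show ?thesis unfolding pt_def by blast
qed

text \<open>\<open>regularI\<close> for one equation. The derivations of the chart omit the
  direction \<open>p\<close>; if all the others vanished, Euler's identity would make the derivative
  in direction \<open>p\<close> vanish too.\<close>

lemma (in proj_point) hypersurface_regular: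
  assumes f: "f \<in> polys {..n}" "homogeneous (Suc d) f" and zero: "peval x f = 0"
    and j: "j \<le> n" "peval x (partial_deriv j f) \<noteq> 0"
  shows "regular_local_ring (scheme_stalk n (hom_ideal n {f}) x)"
  unfolding scheme_stalk_def proj_stalk_eq
proof (rule regularI[where m = "Suc 0" and h = "\<lambda>_. dehom f"])
  have G: "{f} \<subseteq> polys {..n}" using f by simp
  have "hom_ideal n {f} \<subseteq> polys {..n}" using hom_ideal_sub(2)[OF G] by (simp add: is_ideal_def)
  then show "is_ideal stalk (ideal_stalk n (hom_ideal n {f}) x)" by (rule ideal_stalk_ideal)
  have "dehom f \<in> M" using ev_dehom[OF f] zero dehom_stalk[OF f(1)] by (simp add: M_def)
  then show "ideal_stalk n (hom_ideal n {f}) x \<subseteq> M" by (intro ideal_stalk_subset[OF G M_ideal]) simp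
  show "dehom f \<in> ideal_stalk n (hom_ideal n {f}) x" by (rule ideal_stalk_mem[OF G _ f(2)]) simp
  show "ideal_stalk n (hom_ideal n {f}) x \<subseteq> P" if P: "is_prime stalk P" and "\<And>l. l < Suc 0 \<Longrightarrow> dehom f \<in> P" for P
    using that(2)[of 0] by (intro ideal_stalk_subset[OF G primeD(1)[OF P]]) simp
next
  fix s :: "nat \<Rightarrow> 'a"
  assume s: "\<And>i. i < n \<Longrightarrow> ev (E i (\<Sum>l<Suc 0. const (s l) * dehom f)) = 0"
  have der: "s 0 * peval x (partial_deriv (skip i) f) = 0" if i: "i < n" for i
  proof -
    have pd: "partial_deriv (skip i) f \<in> polys {..n}" "homogeneous d (partial_deriv (skip i) f)"
      by (rule partial_deriv_polys[OF f(1)], rule homogeneous_partial_deriv[OF f(2)])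
    have "E i (\<Sum>l<Suc 0. const (s l) * dehom f) = const (s 0) * dehom (partial_deriv (skip i) f)"
      using pder_dehom[OF f(1) skip_simps(2) skip_simps(1)[OF i]] by (simp add: derivation_simps[OF pder_derivation] pder_const)
    then have "ev (const (s 0) * dehom (partial_deriv (skip i) f)) = 0" using s[OF i] by simp
    then show ?thesis using stalk_add_mult(4)[OF const_stalk(1) dehom_stalk[OF pd(1)]] ev_dehom[OF pd] xp by (simp add: const_stalk(2))
  qed
  have "s 0 = 0"
  proof (rule ccontr)
    assume "s 0 \<noteq> 0"
    then have z: "peval x (partial_deriv l f) = 0" if "l \<le> n" "l \<noteq> p" for l
      using der skip_surj[OF that] by auto
    have "(\<Sum>i\<le>n. x i * peval x (partial_deriv i f)) = 0"
      using arg_cong[OF euler_identity[OF f finite_atMost], of "peval x"] zero by (simp add: peval_rhom)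
    moreover have "(\<Sum>i\<le>n. x i * peval x (partial_deriv i f)) = x p * peval x (partial_deriv p f) + (\<Sum>i\<in>{..n} - {p}. x i * peval x (partial_deriv i f))"
      using pn by (intro sum.remove) auto
    moreover have "(\<Sum>i\<in>{..n} - {p}. x i * peval x (partial_deriv i f)) = 0" using z by (intro sum.neutral) auto
    ultimately have "peval x (partial_deriv p f) = 0" using xp by simp
    then show False using z j by (cases "j = p") auto
  qed
  then show "\<forall>l<Suc 0. s l = 0" by simp
qed

text \<open>At a point with zero gradient, Euler's identity for the first derivatives gives
  \<open>F(x, x, -) = 0\<close>. So \<open>x\<close> is in its own kernel, and
  \<open>y = z = x\<close> violates goodness, the square of a nonzero coordinate being
  nonzero.\<close>

lemma good_gradient:
  fixes f :: "(nat, 'a::field_char_0) mpol"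
  assumes f: "f \<in> cubic_forms n" and good: "good n R f" and R: "0 < R" and x: "x \<in> nonzero_vecs {..n}"
  shows "\<exists>j\<le>n. peval x (partial_deriv j f) \<noteq> 0"
proof (rule ccontr)
  assume "\<not> ?thesis"
  then have z: "peval x (partial_deriv j f) = 0" if "j \<le> n" for j using that by blast
  have quad: "(\<Sum>i\<le>n. \<Sum>l\<le>n. tens f i j l * x l * x i) = 0" if j: "j \<le> n" for j
  proof -
    have "(\<Sum>i\<le>n. x i * peval x (hess f i j)) = 0"
      using arg_cong[OF euler_identity[OF cubic_formsD(3,4)[OF f] finite_atMost], of "peval x" j] z[OF j] by (simp add: peval_rhom)
    then show ?thesis unfolding second_deriv_expand[OF f] by (simp add: peval_rhom sum_distrib_left ac_simps)
  qed
  define y where "y = (\<lambda>a::nat. if a = 0 then x else (\<lambda>_. 0))"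
  have sum0: "(\<Sum>a<R. F (y a)) = F x" if "F (\<lambda>_. 0) = 0" for F :: "(nat \<Rightarrow> 'a) \<Rightarrow> 'a"
  proof -
    have "(\<Sum>a<R. F (y a)) = (\<Sum>a\<in>{0}. F (y a))" using R that by (intro sum.mono_neutral_right) (auto simp: y_def)
    then show ?thesis by (simp add: y_def)
  qed
  obtain i where i: "i \<le> n" "x i \<noteq> 0" using x by (fastforce simp: nonzero_vecs_def fun_eq_iff)
  have c1: "\<forall>a<R. \<forall>j\<le>n. (\<Sum>i\<le>n. \<Sum>l\<le>n. tens f i j l * x l * y a i) = 0"
    using quad by (auto simp: y_def)
  have c2: "\<forall>a<R. \<forall>i\<le>n. (\<Sum>j\<le>n. \<Sum>l\<le>n. tens f i j l * x l * y a j) = 0"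
    using c1 tens_sym(1)[of f] by simp
  have c3: "\<forall>l\<le>n. (\<Sum>a<R. \<Sum>i\<le>n. \<Sum>j\<le>n. tens f i j l * y a i * y a j) = 0"
  proof (intro allI impI)
    fix l assume l: "l \<le> n"
    have "(\<Sum>a<R. \<Sum>i\<le>n. \<Sum>j\<le>n. tens f i j l * y a i * y a j) = (\<Sum>i\<le>n. \<Sum>j\<le>n. tens f i j l * x i * x j)"
      by (rule sum0[of "\<lambda>y. \<Sum>i\<le>n. \<Sum>j\<le>n. tens f i j l * y i * y j"]) simp
    also have "\<dots> = (\<Sum>i\<le>n. \<Sum>j\<le>n. tens f i l j * x j * x i)"
      unfolding tens_sym(2)[of f _ l] by (simp add: ac_simps)
    finally show "(\<Sum>a<R. \<Sum>i\<le>n. \<Sum>j\<le>n. tens f i j l * y a i * y a j) = 0" using quad[OF l] by simp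
  qed
  have "\<forall>i\<le>n. \<forall>j\<le>n. (\<Sum>a<R. y a i * y a j + y a j * y a i) = 0"
    using good i c1 c2 c3 unfolding good_def by blast
  then have "(\<Sum>a<R. y a i * y a i + y a i * y a i) = 0" using i by blast
  moreover have "(\<Sum>a<R. y a i * y a i + y a i * y a i) = x i * x i + x i * x i"
    by (rule sum0[of "\<lambda>y. y i * y i + y i * y i"]) simp
  ultimately show False using i(2) by (simp flip: mult_2)
qed

lemma smooth_of_good:
  fixes f :: "(nat, 'a::field_char_0) mpol"
  assumes f: "f \<in> cubic_forms n" and good: "good n R f" and R: "0 < R"
  shows "sing_locus n (hom_ideal n {f}) = {}"
proof -
  have "regular_local_ring (scheme_stalk n (hom_ideal n {f}) x)"
    if x: "x \<in> nonzero_vecs {..n}" and px: "pt x \<in> proj_zeros {..n} (hom_ideal n {f})" for x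
  proof -
    obtain p where p: "p \<le> n" "x p \<noteq> 0" using x by (fastforce simp: nonzero_vecs_def fun_eq_iff)
    interpret proj_point n x p using x p by unfold_locales
    have "f \<in> hom_ideal n {f}" using hom_ideal_sub(1)[of "{f}"] cubic_formsD(1)[OF f] by simp
    then obtain x' where x': "pt x = pt x'" "peval x' f = 0" using px unfolding proj_zeros_def by blast
    obtain c where "x = (\<lambda>i. c * x' i)" using pt_eqD[OF x'(1)] by blast
    then have "peval x f = 0" using peval_scale[OF cubic_formsD(2)[OF f], of c x'] x'(2) by simp
    moreover obtain j where "j \<le> n" "peval x (partial_deriv j f) \<noteq> 0" using good_gradient[OF f good R x] by blast
    ultimately show ?thesis using cubic_formsD(1,2)[OF f] by (intro hypersurface_regular[of f 2 j]) (simp_all add: numeral_3_eq_3)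
  qed
  then show ?thesis unfolding sing_locus_def by blast
qed

text \<open>At a point where the largest nonvanishing minors are attained, the Schur complement vanishes
  identically, although its entries have independent differentials.\<close>

lemma nonzero_minor_exists:
  fixes f :: "(nat, 'a::field_char_0) mpol"
  assumes f: "f \<in> cubic_forms n" "good n ((n + 1) * (n + 1)) f" and k: "k \<le> n"
  shows "\<exists>I J. I \<subseteq> {..n} \<and> J \<subseteq> {..n} \<and> card I = k + 1 \<and> card J = k + 1 \<and> hess_minor n f I J \<noteq> 0"
proof (rule ccontr)
  assume neg: "\<not> ?thesis"
  define Z where "Z = (\<lambda>m. \<forall>I J. I \<subseteq> {..n} \<longrightarrow> J \<subseteq> {..n} \<longrightarrow> card I = m \<longrightarrow> card J = m \<longrightarrow> hess_minor n f I J = 0)"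
  have empty: "hess_minor n f {} {} = 1" using hess_minor_eq[of "{}" n "{}" 0 f] by (simp add: det_dim_zero)
  have "Z (Suc k)" using neg unfolding Z_def by auto
  moreover have "\<not> Z 0"
  proof
    assume "Z 0"
    then have "hess_minor n f {} {} = 0" unfolding Z_def by simp
    then show False using empty by simp
  qed
  \<comment> \<open>\<open>r\<close> is a size at which some minor is a nonzero polynomial although
    all minors of size \<open>r + 1\<close> vanish identically. A point where the former minor does
    not vanish then has Hessian rank exactly \<open>r\<close>.\<close>
  ultimately obtain r where r: "r < Suc k" "\<not> Z r" "Z (Suc r)" using ex_least_nat_less[of Z "Suc k"] by blast
  obtain I J where IJ: "I \<subseteq> {..n}" "J \<subseteq> {..n}" "card I = r" "card J = r" "hess_minor n f I J \<noteq> 0"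
    using r(2) unfolding Z_def by blast
  have g: "hess_minor n f I J \<in> polys {..n}" "homogeneous r (hess_minor n f I J)" by (rule hess_minor_polys[OF f(1) IJ(1-4)])+
  obtain y0 where y0: "\<forall>i. i \<notin> {..n} \<longrightarrow> y0 i = 0" "peval y0 (hess_minor n f I J) \<noteq> 0"
    using nonzero_value_exists[OF finite_atMost g(1) IJ(5)] by blast
  obtain y where y: "y \<in> nonzero_vecs {..n}" "peval y (hess_minor n f I J) \<noteq> 0"
  proof (cases "y0 = (\<lambda>_. 0)")
    case True
    \<comment> \<open>A homogeneous polynomial that does not vanish at the origin vanishes nowhere,
      by scaling with \<open>0\<close>; any nonzero vector will do.\<close>
    define e where "e = (\<lambda>i::nat. if i = 0 then 1 else (0::'a))"
    have "e \<in> nonzero_vecs {..n}" by (auto simp: nonzero_vecs_def e_def fun_eq_iff)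
    moreover have "peval e (hess_minor n f I J) \<noteq> 0"
      using peval_scale[OF g(2), of 0 e] y0(2) True by auto
    ultimately show ?thesis using that by blast
  next
    case False
    then show ?thesis using that y0 unfolding nonzero_vecs_def by blast
  qed
  obtain p I0 where hp: "hess_point n y p f I0" and small: "\<forall>m. (\<forall>I J. I \<subseteq> {..n} \<longrightarrow> J \<subseteq> {..n} \<longrightarrow> card I = m \<longrightarrow> card J = m \<longrightarrow> peval y (hess_minor n f I J) = 0) \<longrightarrow> card I0 < m"
    using hess_point_exists[OF f y(1)] by blast
  interpret hess_point n y p f I0 by (rule hp)
  have "card I0 < Suc r" using mp[OF spec[OF small, of "Suc r"]] r(3) unfolding Z_def by (simp add: peval_rhom(4))
  moreover have "\<not> card I0 < r" using minor_zero[OF IJ(1-4)] y(2) by blast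
  ultimately have card: "card I0 = r" by simp
  have "{..n} - I0 \<noteq> {}"
  proof
    assume "{..n} - I0 = {}"
    then have "card {..n} \<le> card I0" using finI0 by (intro card_mono) auto
    then show False using card r(1) k by simp
  qed
  then obtain i where i: "i \<le> n" "i \<notin> I0" by auto
  obtain v where v: "ev v \<noteq> 0" "dehom (hess_minor n f (insert i I0) (insert i I0)) = S i i * v"
    using bordered_minor[OF i i] by blast
  have "insert i I0 \<subseteq> {..n}" "card (insert i I0) = Suc r" using i I0 finI0 card by auto
  then have "hess_minor n f (insert i I0) (insert i I0) = 0" using r(3) unfolding Z_def by blast
  then have "S i i * v = 0" using v(2) by simp
  moreover have "v \<noteq> 0" using v(1) ev_simps(1) by auto
  ultimately have S0: "S i i = 0" by simp
  \<comment> \<open>Independence applied to the indicator of the pair \<open>(i, i)\<close>: the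
    relation holds because \<open>S i i\<close> is zero, yet its coefficient is
    \<open>1\<close>.\<close>
  have "(if (i, i) = (i, i) then 1 else (0::'a)) = 0"
  proof (rule S_independent[of "\<lambda>q. if q = (i, i) then 1 else 0"])
    show "(i, i) \<in> pairs" using i by (simp add: pairs_def)
    show "(\<Sum>q\<in>pairs. (if q = (i, i) then 1 else 0) * ev (E v (S (fst q) (snd q)))) = 0" for v
      by (intro sum.neutral ballI) (simp add: S0 derivation_simps[OF pder_derivation] ev_simps)
  qed
  then show False by simp
qed

text \<open>Closed sets of projective space are cut out by homogeneous equations. Restricted to the
  line through \<open>b\<close>, \<open>G\<close> is a polynomial in \<open>s\<close> with
  infinitely many zeros, so every homogeneous component of \<open>G\<close> vanishes at
  \<open>b\<close>.\<close>

lemma homogeneous_component: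
  fixes G :: "('v, 'a::field_char_0) mpol"
  assumes G: "G \<in> polys V" "G \<noteq> 0"
  shows "\<exists>d G'. G' \<in> polys V \<and> homogeneous d G' \<and> G' \<noteq> 0 \<and>
    (\<forall>b. (\<forall>s. s \<noteq> 0 \<longrightarrow> peval (\<lambda>i. s * b i) G = 0) \<longrightarrow> peval b G' = 0)"
proof -
  let ?K = "Poly_Mapping.keys G"
  obtain m0 where m0: "m0 \<in> ?K" using G(2) by (metis all_not_in_conv keys_eq_empty)
  define d where "d = mon_deg m0"
  define G' where "G' = (\<Sum>m\<in>?K. if mon_deg m = d then Poly_Mapping.single m (Poly_Mapping.lookup G m) else 0)"
  have lookup: "Poly_Mapping.lookup G' m = (if mon_deg m = d then Poly_Mapping.lookup G m else 0)" for m
  proof -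
    have "Poly_Mapping.lookup G' m = (\<Sum>m'\<in>?K. if m' = m then (if mon_deg m = d then Poly_Mapping.lookup G m else 0) else 0)"
      unfolding G'_def lookup_sum by (intro sum.cong) (auto simp: lookup_single when_def)
    then show ?thesis by (simp add: in_keys_iff)
  qed
  have "G' \<in> polys V" using G(1) lookup by (auto simp: polys_def in_keys_iff split: if_splits)
  moreover have "homogeneous d G'" using lookup by (auto simp: homogeneous_def in_keys_iff split: if_splits)
  moreover have "G' \<noteq> 0" using lookup[of m0] m0 by (auto simp: d_def in_keys_iff)
  moreover have "peval b G' = 0" if b: "\<forall>s. s \<noteq> 0 \<longrightarrow> peval (\<lambda>i. s * b i) G = 0" for b
  proof -
    define q where "q = (\<Sum>m\<in>?K. Polynomial.monom (Poly_Mapping.lookup G m * mmono b m) (mon_deg m))"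
    have "poly q s = peval (\<lambda>i. s * b i) G" for s
      unfolding q_def peval_eq_mev mev_def mmono_scale poly_sum poly_monom by (simp add: ac_simps)
    then have "UNIV - {0} \<subseteq> {s. poly q s = 0}" using b by auto
    moreover have "infinite (UNIV - {0 :: 'a})" by (simp add: infinite_UNIV_char_0)
    ultimately have "q = 0" using poly_roots_finite finite_subset by blast
    then have "0 = coeff q d" by simp
    also have "\<dots> = (\<Sum>m\<in>?K. if mon_deg m = d then Poly_Mapping.lookup G m * mmono b m else 0)"
      unfolding q_def coeff_sum coeff_monom ..
    also have "\<dots> = peval b G'"
      unfolding G'_def peval_rhom(7) by (intro sum.cong) (auto simp: peval_single peval_rhom(4))
    finally show ?thesis by simp
  qed
  ultimately show ?thesis by blast
qed

lemma cubic_form_of_coeffs: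
  fixes b :: "(nat \<Rightarrow>\<^sub>0 nat) \<Rightarrow> 'a::field"
  assumes "\<And>m. m \<notin> cubic_monomials n \<Longrightarrow> b m = 0"
  shows "\<exists>f\<in>cubic_forms n. Poly_Mapping.lookup f = b"
proof -
  have "{m. b m \<noteq> 0} \<subseteq> cubic_monomials n" using assms by blast
  then have fin: "finite {m. b m \<noteq> 0}" using finite_cubic_monomials finite_subset by blast
  have l: "Poly_Mapping.lookup (Abs_poly_mapping b) = b" using Abs_poly_mapping_inverse[of b] fin by simp
  have "Poly_Mapping.keys (Abs_poly_mapping b) \<subseteq> cubic_monomials n"
    using assms unfolding keys.rep_eq l by blast
  then have "Abs_poly_mapping b \<in> cubic_forms n"
    by (auto simp: cubic_forms_def polys_def homogeneous_def cubic_monomials_def)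
  then show ?thesis using l by blast
qed

lemma cubic_form_coeffs:
  "f \<in> cubic_forms n \<Longrightarrow> m \<notin> cubic_monomials n \<Longrightarrow> Poly_Mapping.lookup f m = 0"
  by (auto simp: cubic_forms_def polys_def homogeneous_def cubic_monomials_def in_keys_iff)

text \<open>Bad solutions for \<open>f\<close> stay solutions when \<open>tens f\<close> is
  multiplied by \<open>s\<close>. Hence badness is constant along the whole line through
  \<open>f\<close>, as \<open>homogeneous_component\<close> requires.\<close>

lemma good_scale:
  fixes f g :: "(nat, 'a::comm_ring_1) mpol"
  assumes g: "Poly_Mapping.lookup g = (\<lambda>m. s * Poly_Mapping.lookup f m)" and good: "good n R g"
  shows "good n R f"
  unfolding good_def
proof (intro allI impI, goal_cases)
  case (1 x y z i j)
  have t: "tens g i j l = s * tens f i j l" for i j l by (simp add: tens_def g ac_simps)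
  have "\<forall>a<R. \<forall>j\<le>n. (\<Sum>i\<le>n. \<Sum>l\<le>n. tens g i j l * x l * y a i) = 0"
    using 1(2) by (simp add: t mult.assoc flip: sum_distrib_left)
  moreover have "\<forall>a<R. \<forall>i\<le>n. (\<Sum>j\<le>n. \<Sum>l\<le>n. tens g i j l * x l * z a j) = 0"
    using 1(3) by (simp add: t mult.assoc flip: sum_distrib_left)
  moreover have "\<forall>l\<le>n. (\<Sum>a<R. \<Sum>i\<le>n. \<Sum>j\<le>n. tens g i j l * y a i * z a j) = 0"
    using 1(4) by (simp add: t mult.assoc flip: sum_distrib_left)
  ultimately show ?case using good 1(1,5,6) unfolding good_def by blast
qed

lemma generic_good_homogeneous:
  "\<exists>d G. G \<in> polys (cubic_monomials n) \<and> homogeneous d G \<and> G \<noteq> 0 \<and>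
     (\<forall>f\<in>cubic_forms n. \<not> good n R (f :: (nat, 'a::field_char_0) mpol) \<longrightarrow> peval (Poly_Mapping.lookup f) G = 0)"
proof -
  obtain G where G: "G \<in> polys (cubic_monomials n)" "G \<noteq> 0"
    "\<forall>f\<in>cubic_forms n. \<not> good n R (f :: (nat, 'a) mpol) \<longrightarrow> peval (Poly_Mapping.lookup f) G = 0"
    using generic_good[of n R, where 'a = 'a] by blast
  obtain d G' where G': "G' \<in> polys (cubic_monomials n)" "homogeneous d G'" "G' \<noteq> 0"
    "\<forall>b. (\<forall>s. s \<noteq> 0 \<longrightarrow> peval (\<lambda>i. s * b i) G = 0) \<longrightarrow> peval b G' = 0"
    using homogeneous_component[OF G(1,2)] by blast
  have "peval (Poly_Mapping.lookup f) G' = 0" if f: "f \<in> cubic_forms n" "\<not> good n R f" for f :: "(nat, 'a) mpol"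
  proof -
    have "peval (\<lambda>m. s * Poly_Mapping.lookup f m) G = 0" for s
    proof -
      obtain g where g: "g \<in> cubic_forms n" "Poly_Mapping.lookup g = (\<lambda>m. s * Poly_Mapping.lookup f m)"
        using cubic_form_of_coeffs[of n "\<lambda>m. s * Poly_Mapping.lookup f m"] cubic_form_coeffs[OF f(1)] by auto
      then have "\<not> good n R g" using good_scale f(2) by blast
      then have "peval (Poly_Mapping.lookup g) G = 0" using G(3) g(1) by blast
      then show ?thesis unfolding g(2) .
    qed
    then show ?thesis using G'(4) by blast
  qed
  then show ?thesis using G'(1-3) by blast
qed

lemma sing_locus_of_good:
  fixes f :: "(nat, 'a::field_char_0) mpol"
  assumes f: "f \<in> cubic_forms n" "good n ((n + 1) * (n + 1)) f" and k: "1 \<le> k" "k \<le> n"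
  shows "sing_locus n (hessian_minors_ideal n k f) = hessian_locus n (k - 1) f"
proof (intro equalityI subsetI)
  fix P assume "P \<in> sing_locus n (hessian_minors_ideal n k f)"
  then obtain x where x: "P = pt x" "x \<in> nonzero_vecs {..n}" "pt x \<in> proj_zeros {..n} (hessian_minors_ideal n k f)"
    "\<not> regular_local_ring (scheme_stalk n (hessian_minors_ideal n k f) x)" unfolding sing_locus_def by blast
  obtain p I0 where hp: "hess_point n x p f I0" and rank: "card I0 = vec_space.rank (n + 1) (map_mat (peval x) (hessian n f))"
    and small: "\<forall>m. (\<forall>I J. I \<subseteq> {..n} \<longrightarrow> J \<subseteq> {..n} \<longrightarrow> card I = m \<longrightarrow> card J = m \<longrightarrow> peval x (hess_minor n f I J) = 0) \<longrightarrow> card I0 < m"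
    using hess_point_exists[OF f x(2)] by blast
  interpret hess_point n x p f I0 by (rule hp)
  \<comment> \<open>Membership in the zero set only provides some representative of the point; the
    minors are homogeneous, so they vanish at \<open>x\<close> as well.\<close>
  obtain x' where x': "pt x = pt x'" "\<forall>g\<in>hessian_minors_ideal n k f. peval x' g = 0" using x(3) unfolding proj_zeros_def by blast
  obtain c where c: "x = (\<lambda>i. c * x' i)" using pt_eqD[OF x'(1)] by blast
  have "peval x (hess_minor n f I J) = 0" if IJ: "I \<subseteq> {..n}" "J \<subseteq> {..n}" "card I = k + 1" "card J = k + 1" for I J
  proof -
    have "hess_minor n f I J \<in> minors k" using IJ unfolding minors_def by blast
    then have "peval x' (hess_minor n f I J) = 0"
      using x'(2) hom_ideal_sub(1)[OF minors_polys] unfolding minors_ideal_eq by blast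
    then show ?thesis using peval_scale[OF hess_minor_polys(2)[OF f(1) IJ], of c x'] c by simp
  qed
  then have "card I0 < k + 1" by (intro mp[OF spec[OF small]]) blast
  moreover have "card I0 \<noteq> k" using regular_stalk x(4) by blast
  ultimately have "card I0 \<le> k - 1" by simp
  then show "P \<in> hessian_locus n (k - 1) f" unfolding hessian_locus_def x(1) rank using x(2) by blast
next
  fix P assume "P \<in> hessian_locus n (k - 1) f"
  then obtain x where x: "P = pt x" "x \<in> nonzero_vecs {..n}"
    "vec_space.rank (n + 1) (map_mat (peval x) (hessian n f)) \<le> k - 1" unfolding hessian_locus_def by blast
  obtain p I0 where hp: "hess_point n x p f I0" and rank: "card I0 = vec_space.rank (n + 1) (map_mat (peval x) (hessian n f))"
    using hess_point_exists[OF f x(2)] by blast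
  interpret hess_point n x p f I0 by (rule hp)
  have c: "card I0 < k" using rank x(3) k(1) by linarith
  have "is_ideal (polys {..n}) {g \<in> polys {..n}. peval x g = 0}"
    by (auto simp: is_ideal_def peval_rhom polys_closed)
  moreover have "minors k \<subseteq> {g \<in> polys {..n}. peval x g = 0}"
  proof
    fix g assume g: "g \<in> minors k"
    then obtain I J where IJ: "g = hess_minor n f I J" "I \<subseteq> {..n}" "J \<subseteq> {..n}" "card I = k + 1" "card J = k + 1"
      unfolding minors_def by blast
    have "peval x g = 0" unfolding IJ(1) using c by (intro minor_zero[OF IJ(2-5)]) simp
    then show "g \<in> {g \<in> polys {..n}. peval x g = 0}" using minors_polys g by blast
  qed
  ultimately have "hom_ideal n (minors k) \<subseteq> {g \<in> polys {..n}. peval x g = 0}" by (rule hom_ideal_sub(3)[OF minors_polys])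
  then have "pt x \<in> proj_zeros {..n} (hessian_minors_ideal n k f)"
    unfolding proj_zeros_def minors_ideal_eq using x(2) by blast
  moreover have "\<exists>g\<in>minors k. g \<noteq> 0" using nonzero_minor_exists[OF f good k(2)] unfolding minors_def by blast
  then have "\<not> regular_local_ring (scheme_stalk n (hessian_minors_ideal n k f) x)" by (rule not_regular_stalk[OF c])
  ultimately show "P \<in> sing_locus n (hessian_minors_ideal n k f)" unfolding sing_locus_def x(1) using x(2) by blast
qed

theorem theoremC:
  fixes n k :: nat
  assumes "n \<ge> 2" and "1 \<le> k" and "k \<le> n"
  shows "\<exists>W :: ((nat \<Rightarrow>\<^sub>0 nat) \<Rightarrow> 'a::{alg_closed_field, field_char_0}) set set.
           zariski_open (cubic_monomials n) W \<and> W \<noteq> {} \<and> W \<subseteq> smooth_cubics n \<and>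
           (\<forall>f \<in> cubic_forms n. form_pt f \<in> W \<longrightarrow>
              hessian_locus n k f - hessian_locus n (k - 1) f \<noteq> {} \<longrightarrow>
              sing_locus n (hessian_minors_ideal n k f) = hessian_locus n (k - 1) f)"
proof -
  let ?V = "cubic_monomials n" and ?R = "(n + 1) * (n + 1)"
  obtain d G where G: "G \<in> polys ?V" "homogeneous d G" "G \<noteq> 0"
    "\<forall>f\<in>cubic_forms n. \<not> good n ?R (f :: (nat, 'a) mpol) \<longrightarrow> peval (Poly_Mapping.lookup f) G = 0"
    using generic_good_homogeneous[of n ?R, where 'a = 'a] by blast
  define W where "W = {pt b | b. b \<in> nonzero_vecs ?V \<and> peval b G \<noteq> 0}"
  \<comment> \<open>\<open>W\<close> is defined through some representative; homogeneity of
    \<open>G\<close> makes the condition hold for every representative.\<close>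
  have W: "peval b G \<noteq> 0" if b: "pt b \<in> W" for b
  proof -
    obtain b' where b': "pt b' = pt b" "peval b' G \<noteq> 0"
      using b unfolding W_def by auto
    obtain c where "b' = (\<lambda>i. c * b i)" using pt_eqD[OF b'(1)] by blast
    then show ?thesis using peval_scale[OF G(2), of c b] b'(2) by auto
  qed
  have "proj_space ?V - W = proj_zeros ?V {G}"
    using W unfolding proj_space_def proj_zeros_def by (auto simp: W_def)
  then have "zariski_closed ?V (proj_space ?V - W)"
    unfolding zariski_closed_def using G(1,2) by (intro exI[of _ "{G}"]) auto
  moreover have "W \<subseteq> proj_space ?V" unfolding W_def proj_space_def by blast
  moreover have "W \<noteq> {}"
  proof -
    obtain b where b: "\<forall>i. i \<notin> ?V \<longrightarrow> b i = 0" "peval b G \<noteq> 0"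
      using nonzero_value_exists[OF finite_cubic_monomials G(1,3)] by blast
    show ?thesis
    proof (cases "b = (\<lambda>_. 0)")
      case True
      \<comment> \<open>If \<open>G\<close> does not vanish at the origin it vanishes nowhere, by
        scaling with \<open>0\<close>; any nonzero coefficient vector then gives a point of
        \<open>W\<close>.\<close>
      define e where "e = (\<lambda>m. if m = mon3 0 0 0 then 1 else (0::'a))"
      have "e \<in> nonzero_vecs ?V" using mon3_cubic[of 0 n 0 0] by (auto simp: nonzero_vecs_def e_def fun_eq_iff)
      moreover have "peval e G \<noteq> 0" using peval_scale[OF G(2), of 0 e] b(2) True by auto
      ultimately show ?thesis unfolding W_def by blast
    next
      case False
      then show ?thesis using b unfolding W_def nonzero_vecs_def by blast
    qed
  qed
  moreover have "W \<subseteq> smooth_cubics n"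
  proof
    fix w assume w: "w \<in> W"
    then obtain b where b: "w = pt b" "b \<in> nonzero_vecs ?V" unfolding W_def by blast
    obtain f where f: "f \<in> cubic_forms n" "Poly_Mapping.lookup f = b"
      using cubic_form_of_coeffs[of n b] b(2) unfolding nonzero_vecs_def by blast
    have "good n ?R f" using G(4) f W[of b] w b(1) by blast
    then have "sing_locus n (hom_ideal n {f}) = {}" by (rule smooth_of_good[OF f(1)]) simp
    moreover have "f \<noteq> 0" using b(2) f(2) by (auto simp: nonzero_vecs_def)
    ultimately show "w \<in> smooth_cubics n" using f unfolding smooth_cubics_def form_pt_def b(1) by blast
  qed
  moreover have "sing_locus n (hessian_minors_ideal n k f) = hessian_locus n (k - 1) f"
    if f: "f \<in> cubic_forms n" "form_pt f \<in> W" for f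
  proof -
    have "good n ?R f" using G(4) f W unfolding form_pt_def by blast
    then show ?thesis by (rule sing_locus_of_good[OF f(1) _ assms(2,3)])
  qed
  ultimately show ?thesis unfolding zariski_open_def by blast
qed

end
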